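(* Let $n\geq2$, $d>0$, let $f:\mathbb{R}^n\to\mathbb{R}$ be $\mathbb{Z}^n$-periodic and Lipschitz continuous, let $V(x)=(0,\dots,0,f(x'))$ for $x=(x',x_{n+1})\in\mathbb{R}^n\times\mathbb{R}$, and let $g\in C(\mathbb{R}^{n+1})$ be uniformly continuous. For $\epsilon\in(0,1]$ let $G_\epsilon\in C(\mathbb{R}^{n+1}\times[0,\infty))$ be the unique viscosity solution of $$\partial_tG_\epsilon+\Big(1-\epsilon d\,\mathrm{div}\frac{DG_\epsilon}{|DG_\epsilon|}\Big)_+|DG_\epsilon|+V\big(\tfrac{x}{\epsilon}\big)\cdot DG_\epsilon=0,\qquad G_\epsilon(x,0)=g(x).$$ Assume that for every $P=(p,p_{n+1})\in\mathbb{R}^{n+1}$ there is a constant $\overline H_+(P)$ such that $\lim_{\lambda\to0}\lambda v_\lambda(x')=-\overline H_+(P)$ for all $x'\in\mathbb{R}^n$, where $v_\lambda$ is the unique $\mathbb{Z}^n$-periodic viscosity solution of $$\lambda v_\lambda+\Big(1-d\,\mathrm{div}\frac{p+Dv_\lambda}{\sqrt{p_{n+1}^2+|p+Dv_\lambda|^2}}\Big)_+\sqrt{p_{n+1}^2+|p+Dv_\lambda|^2}+p_{n+1}f(x')=0\quad\text{in }\mathbb{R}^n.$$ Then $\lim_{\epsilon\to0}G_\epsilon=G$ locally uniformly on $\mathbb{R}^{n+1}\times[0,\infty)$, where $G\in C(\mathbb{R}^{n+1}\times[0,\infty))$ is the unique viscosity solution of $G_t+\overline H_+(DG)=0$ in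 $\mathbb{R}^{n+1}\times(0,\infty)$, $G(x,0)=g(x)$.
   Context: $(a)_+=\max\{a,0\}$. Viscosity solutions of the curvature G-equation are understood in the standard sense for degenerate geometric equations. *)

theory Defs
  imports "HOL-Analysis.Analysis"
begin

definition pos_part :: "real \<Rightarrow> real" where
  "pos_part a = max a 0"

definition symmetric_op :: "('a::real_inner \<Rightarrow>\<^sub>L 'a) \<Rightarrow> bool" where
  "symmetric_op X \<longleftrightarrow> (\<forall>u v. inner (blinfun_apply X u) v = inner u (blinfun_apply X v))"

definition op_trace :: "('a::euclidean_space \<Rightarrow>\<^sub>L 'a) \<Rightarrow> real" where
  "op_trace X = (\<Sum>b\<in>Basis. inner (blinfun_apply X b) b)"

definition zn_periodic :: "(real^'n \<Rightarrow> 'b) \<Rightarrow> bool" where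
  "zn_periodic h \<longleftrightarrow> (\<forall>x k. (\<forall>i. k $ i \<in> \<int>) \<longrightarrow> h (x + k) = h x)"

definition par_superjet :: "('a::euclidean_space \<Rightarrow> real \<Rightarrow> real) \<Rightarrow> 'a \<Rightarrow> real
    \<Rightarrow> (real \<times> 'a \<times> ('a \<Rightarrow>\<^sub>L 'a)) set" where
  "par_superjet u x t = {(a, P, X). symmetric_op X \<and>
     (\<forall>e>0. \<exists>r>0. \<forall>y s. s > 0 \<longrightarrow> dist y x < r \<longrightarrow> \<bar>s - t\<bar> < r \<longrightarrow>
        u y s \<le> u x t + a * (s - t) + inner P (y - x)
               + (1/2) * inner (blinfun_apply X (y - x)) (y - x)
               + e * (\<bar>s - t\<bar> + (norm (y - x))\<^sup>2))}"

definition par_subjet :: "('a::euclidean_space \<Rightarrow> real \<Rightarrow> real) \<Rightarrow> 'a \<Rightarrow> real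
    \<Rightarrow> (real \<times> 'a \<times> ('a \<Rightarrow>\<^sub>L 'a)) set" where
  "par_subjet u x t = {(a, P, X). symmetric_op X \<and>
     (\<forall>e>0. \<exists>r>0. \<forall>y s. s > 0 \<longrightarrow> dist y x < r \<longrightarrow> \<bar>s - t\<bar> < r \<longrightarrow>
        u y s \<ge> u x t + a * (s - t) + inner P (y - x)
               + (1/2) * inner (blinfun_apply X (y - x)) (y - x)
               - e * (\<bar>s - t\<bar> + (norm (y - x))\<^sup>2))}"

text \<open>Viscosity sub/supersolutions of  u_t + F(x, Du, D^2 u) = 0  in R^N x (0,infinity),
  where F(x,P,X) is only defined for gradients P with D P (degenerate geometric
  equations). The conditions are  a + F_*(x,P,X) \<le> 0  resp.  a + F^*(x,P,X) \<ge> 0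
  with F_*, F^* the lower/upper semicontinuous envelopes of F (over D and
  symmetric X), written out literally.\<close>
definition visc_sub_par :: "('a::euclidean_space \<Rightarrow> bool)
    \<Rightarrow> ('a \<Rightarrow> 'a \<Rightarrow> ('a \<Rightarrow>\<^sub>L 'a) \<Rightarrow> real) \<Rightarrow> ('a \<Rightarrow> real \<Rightarrow> real) \<Rightarrow> bool" where
  "visc_sub_par D F u \<longleftrightarrow>
     (\<forall>x t. t > 0 \<longrightarrow> (\<forall>(a, P, X) \<in> par_superjet u x t. \<forall>\<delta>>0. \<forall>r>0.
        \<exists>y Q Y. dist y x < r \<and> dist Q P < r \<and> dist Y X < r \<and> symmetric_op Y \<and> D Q
               \<and> a + F y Q Y < \<delta>))"

definition visc_super_par :: "('a::euclidean_space \<Rightarrow> bool)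
    \<Rightarrow> ('a \<Rightarrow> 'a \<Rightarrow> ('a \<Rightarrow>\<^sub>L 'a) \<Rightarrow> real) \<Rightarrow> ('a \<Rightarrow> real \<Rightarrow> real) \<Rightarrow> bool" where
  "visc_super_par D F u \<longleftrightarrow>
     (\<forall>x t. t > 0 \<longrightarrow> (\<forall>(a, P, X) \<in> par_subjet u x t. \<forall>\<delta>>0. \<forall>r>0.
        \<exists>y Q Y. dist y x < r \<and> dist Q P < r \<and> dist Y X < r \<and> symmetric_op Y \<and> D Q
               \<and> a + F y Q Y > - \<delta>))"

definition par_visc_solution :: "('a::euclidean_space \<Rightarrow> bool)
    \<Rightarrow> ('a \<Rightarrow> 'a \<Rightarrow> ('a \<Rightarrow>\<^sub>L 'a) \<Rightarrow> real) \<Rightarrow> ('a \<Rightarrow> real) \<Rightarrow> ('a \<Rightarrow> real \<Rightarrow> real) \<Rightarrow> bool" where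
  "par_visc_solution D F g u \<longleftrightarrow>
     continuous_on (UNIV \<times> {0..}) (\<lambda>(x, t). u x t) \<and> (\<forall>x. u x 0 = g x) \<and>
     visc_sub_par D F u \<and> visc_super_par D F u"

definition superjet :: "('a::euclidean_space \<Rightarrow> real) \<Rightarrow> 'a \<Rightarrow> ('a \<times> ('a \<Rightarrow>\<^sub>L 'a)) set" where
  "superjet u x = {(P, X). symmetric_op X \<and>
     (\<forall>e>0. \<exists>r>0. \<forall>y. dist y x < r \<longrightarrow>
        u y \<le> u x + inner P (y - x) + (1/2) * inner (blinfun_apply X (y - x)) (y - x)
               + e * (norm (y - x))\<^sup>2)}"

definition subjet :: "('a::euclidean_space \<Rightarrow> real) \<Rightarrow> 'a \<Rightarrow> ('a \<times> ('a \<Rightarrow>\<^sub>L 'a)) set" where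
  "subjet u x = {(P, X). symmetric_op X \<and>
     (\<forall>e>0. \<exists>r>0. \<forall>y. dist y x < r \<longrightarrow>
        u y \<ge> u x + inner P (y - x) + (1/2) * inner (blinfun_apply X (y - x)) (y - x)
               - e * (norm (y - x))\<^sup>2)}"

definition visc_sub_st :: "real \<Rightarrow> ('a::euclidean_space \<Rightarrow> bool)
    \<Rightarrow> ('a \<Rightarrow> 'a \<Rightarrow> ('a \<Rightarrow>\<^sub>L 'a) \<Rightarrow> real) \<Rightarrow> ('a \<Rightarrow> real) \<Rightarrow> bool" where
  "visc_sub_st lam D F u \<longleftrightarrow>
     (\<forall>x. \<forall>(P, X) \<in> superjet u x. \<forall>\<delta>>0. \<forall>r>0.
        \<exists>y Q Y. dist y x < r \<and> dist Q P < r \<and> dist Y X < r \<and> symmetric_op Y \<and> D Q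
               \<and> lam * u x + F y Q Y < \<delta>)"

definition visc_super_st :: "real \<Rightarrow> ('a::euclidean_space \<Rightarrow> bool)
    \<Rightarrow> ('a \<Rightarrow> 'a \<Rightarrow> ('a \<Rightarrow>\<^sub>L 'a) \<Rightarrow> real) \<Rightarrow> ('a \<Rightarrow> real) \<Rightarrow> bool" where
  "visc_super_st lam D F u \<longleftrightarrow>
     (\<forall>x. \<forall>(P, X) \<in> subjet u x. \<forall>\<delta>>0. \<forall>r>0.
        \<exists>y Q Y. dist y x < r \<and> dist Q P < r \<and> dist Y X < r \<and> symmetric_op Y \<and> D Q
               \<and> lam * u x + F y Q Y > - \<delta>)"

definition Vfield :: "(real^'n \<Rightarrow> real) \<Rightarrow> (real^'n) \<times> real \<Rightarrow> (real^'n) \<times> real" where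
  "Vfield f y = (0, f (fst y))"

text \<open>Hamiltonian of the curvature G-equation (defined for P \<noteq> 0):
  (1 - eps d div(DG/|DG|))_+ |DG| + V(x/eps) . DG, with
  div(Dphi/|Dphi|) = tr(D^2phi)/|Dphi| - <D^2phi Dphi, Dphi>/|Dphi|^3.\<close>
definition FG :: "real \<Rightarrow> real \<Rightarrow> (real^'n \<Rightarrow> real)
    \<Rightarrow> (real^'n) \<times> real \<Rightarrow> (real^'n) \<times> real \<Rightarrow> (((real^'n) \<times> real) \<Rightarrow>\<^sub>L ((real^'n) \<times> real)) \<Rightarrow> real" where
  "FG eps d f x P X =
     pos_part (1 - eps * d * (op_trace X / norm P
                               - inner (blinfun_apply X P) P / (norm P) ^ 3)) * norm P
     + inner (Vfield f ((1 / eps) *\<^sub>R x)) P"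

text \<open>Hamiltonian of the cell problem for P = (p, p_{n+1}): with w = p + Dv and
  q = sqrt(p_{n+1}^2 + |w|^2),
  (1 - d div(w/q))_+ q + p_{n+1} f(x'),  div(w/q) = tr(D^2v)/q - <D^2v w, w>/q^3.\<close>
definition Fcell :: "real \<Rightarrow> (real^'n \<Rightarrow> real) \<Rightarrow> (real^'n) \<times> real
    \<Rightarrow> real^'n \<Rightarrow> real^'n \<Rightarrow> ((real^'n) \<Rightarrow>\<^sub>L (real^'n)) \<Rightarrow> real" where
  "Fcell d f P x' Q X =
     (let w = fst P + Q; q = sqrt ((snd P)\<^sup>2 + (norm w)\<^sup>2)
      in pos_part (1 - d * (op_trace X / q - inner (blinfun_apply X w) w / q ^ 3)) * q
         + snd P * f x')"

definition cell_dom :: "(real^'n) \<times> real \<Rightarrow> real^'n \<Rightarrow> bool" where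
  "cell_dom P Q \<longleftrightarrow> (snd P)\<^sup>2 + (norm (fst P + Q))\<^sup>2 \<noteq> 0"

definition cell_solution :: "real \<Rightarrow> (real^'n \<Rightarrow> real) \<Rightarrow> (real^'n) \<times> real \<Rightarrow> real
    \<Rightarrow> (real^'n \<Rightarrow> real) \<Rightarrow> bool" where
  "cell_solution d f P lam v \<longleftrightarrow>
     zn_periodic v \<and> continuous_on UNIV v \<and>
     visc_sub_st lam (cell_dom P) (Fcell d f P) v \<and>
     visc_super_st lam (cell_dom P) (Fcell d f P) v"

end

theory Submission
 imports Defs "HOL-Complex_Analysis.Great_Picard"
begin

text \<open>
  No comparison principle for second-order equations is used. One step of a two-player curvature
  game, T eps h, is a monotone scheme consistent with the G-equation, so its iterates converge to
  the unique viscosity solution for each eps; likewise the discounted game converges to the cell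
  problem. A discrete corrector for the slope P is thus almost an eigenfunction of the game, and
  rotating the players' frames (possible because the cell slope never vanishes when the last
  component of P is nonzero) makes it robust under perturbations by smooth test functions. Testing
  the half-relaxed limits of the game with perturbed test functions yields sub- and supersolutions
  of the effective equation. The effective Hamiltonian is continuous and positively homogeneous, so
  relabelling by arctan makes everything bounded and doubling of variables gives comparison.
\<close>

text \<open>The obstacle is a mismatch of scales. A tangential move has length of order
  \<open>sqrt tau\<close>, whereas one step must be controlled up to errors small against
  \<open>tau\<close>. If a perturbation tilts the gradient by \<open>p\<close>, keeping the old
  frame costs \<open>sqrt tau * norm p\<close>, which is too much. Hence \<open>frame_adjust\<close>
  preserves the tangential components of the gradient exactly and lets only the normal one change,
  along which moves have length \<open>tau\<close>. This needs a gradient bounded away from zero.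
  For a lifted cell function that is free: the lift is affine in the last variable, so the slope at
  a contact point of its inf- or sup-convolution has last component exactly \<open>snd P\<close>
  (\<open>infconv_snd\<close>). The convolution also supplies the one-sided paraboloids that a
  merely Lipschitz function lacks; its price is a drift mismatch of order \<alpha>. When
  \<open>snd P = 0\<close> the shear does not see the slope, the constant
  \<open>- norm P / lam\<close> solves the cell problem, and the corrector is zero. Steps obey
  \<open>h <= eps^2\<close>, so that the rescaled step \<open>h / eps\<close> tends to zero together
  with \<open>eps\<close>.\<close>

section \<open>Reflections, rotations and moving frames\<close>

lemma orthogonal_transformation_refl:
 fixes n :: "'a::euclidean_space"
 assumes "norm n = 1"
 shows "orthogonal_transformation (%x. x - (2 * (n \<bullet> x)) *\<^sub>R n)"
proof -
 have nn: "n \<bullet> n = 1" using assms by (simp add: norm_eq_1)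
 have "linear (%x. x - (2 * (n \<bullet> x)) *\<^sub>R n)"
  by (intro linearI) (simp_all add: inner_add_right algebra_simps)
 moreover have "(x - (2 * (n \<bullet> x)) *\<^sub>R n) \<bullet> (y - (2 * (n \<bullet> y)) *\<^sub>R n) = x \<bullet> y" for x y
  by (simp add: inner_diff_left inner_diff_right nn inner_commute algebra_simps)
 ultimately show ?thesis by (simp add: orthogonal_transformation_def)
qed

lemma refl_diff_bound:
 fixes n m :: "'a::euclidean_space"
 assumes "norm n = 1" "norm m = 1"
 shows "norm ((n \<bullet> x) *\<^sub>R n - (m \<bullet> x) *\<^sub>R m) <= 2 * norm (n - m) * norm x"
proof -
 have "(n \<bullet> x) *\<^sub>R n - (m \<bullet> x) *\<^sub>R m = ((n - m) \<bullet> x) *\<^sub>R n + (m \<bullet> x) *\<^sub>R (n - m)"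
  by (simp add: algebra_simps inner_diff_left)
 also have "norm \<dots> <= \<bar>(n - m) \<bullet> x\<bar> + \<bar>m \<bullet> x\<bar> * norm (n - m)"
  using assms by (metis mult.right_neutral norm_scaleR norm_triangle_ineq)
 also have "\<dots> <= norm (n-m) * norm x + norm x * norm (n - m)"
  using Cauchy_Schwarz_ineq2[of "n-m" x] Cauchy_Schwarz_ineq2[of m x] assms
  by (intro add_mono mult_right_mono) auto
 finally show ?thesis by (simp add: mult.commute)
qed

text \<open>Only the norm of \<open>b\<close> enters the denominator, so the estimate remains useful
  when just one of the two vectors is known to stay away from zero, as with a test gradient and its
  perturbation.\<close>

lemma normalized_diff_bound:
 fixes a b :: "'a::real_normed_vector"
 assumes "a \<noteq> 0" "b \<noteq> 0"
 shows "norm (a /\<^sub>R norm a - b /\<^sub>R norm b) <= 2 * norm (a - b) / norm b"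
proof -
 have "a /\<^sub>R norm a - b /\<^sub>R norm b = (1 / norm b) *\<^sub>R ((a - b) + ((norm b - norm a) / norm a) *\<^sub>R a)"
  using assms by (simp add: algebra_simps diff_divide_distrib inverse_eq_divide)
 also have "norm \<dots> <= (1 / norm b) * (norm (a - b) + \<bar>(norm b - norm a) / norm a\<bar> * norm a)"
  by (simp add: divide_right_mono norm_triangle_le)
 also have "\<bar>(norm b - norm a) / norm a\<bar> * norm a = \<bar>norm b - norm a\<bar>"
  using assms by (simp add: abs_divide)
 also have "\<dots> <= norm (a - b)"
  by (metis norm_minus_commute norm_triangle_ineq3)
 finally show ?thesis using assms by (simp add: divide_right_mono)
qed

text \<open>The rotation is a product of two reflections, so it stays close to the identity when
 the two vectors are close.\<close>
lemma near_identity_rotation: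
 fixes u v :: "'a::euclidean_space"
 assumes uv: "norm u = norm v" and "u \<noteq> 0" and "u + v \<noteq> 0"
 obtains R where "orthogonal_transformation R" "R u = v"
  "!!x. norm (R x - x) <= 4 * norm (u - v) / norm u * norm x"
proof -
 define m where "m = u /\<^sub>R norm u"
 define n where "n = (u + v) /\<^sub>R norm (u + v)"
 define A where "A x = x - (2 * (n \<bullet> x)) *\<^sub>R n" for x
 define B where "B x = x - (2 * (m \<bullet> x)) *\<^sub>R m" for x
 have nm: "norm n = 1" "norm m = 1" using assms(2,3) by (simp_all add: n_def m_def)
 have A: "orthogonal_transformation A" and B: "orthogonal_transformation B"
  unfolding A_def B_def using orthogonal_transformation_refl nm by blast+
 have Bu: "B u = - u"
 proof -
  have u0: "norm u \<noteq> 0" using assms(2) by simp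
  have "m \<bullet> u = norm u" using u0 by (simp add: m_def dot_square_norm power2_eq_square)
  hence "B u = u - (2 * norm u * inverse (norm u)) *\<^sub>R u" by (simp add: B_def m_def)
  also have "2 * norm u * inverse (norm u) = 2" using u0 by (metis mult.assoc right_inverse mult.right_neutral)
  finally show ?thesis by (simp add: scaleR_2)
 qed
 have Au: "A (- u) = v"
 proof -
  have s: "u \<bullet> u = v \<bullet> v" using uv by (simp add: dot_square_norm)
  have "(u + v) \<bullet> (u + v) = 2 * ((u + v) \<bullet> u)"
   by (simp add: s inner_add_left inner_add_right inner_commute)
  hence e: "2 * ((u + v) \<bullet> u) = (norm (u + v))\<^sup>2" by (simp add: dot_square_norm)
  have "2 * (n \<bullet> (- u)) = - norm (u + v)"
   using e assms by (simp add: n_def divide_simps power2_eq_square)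
  hence "A (- u) = - u + norm (u + v) *\<^sub>R ((u + v) /\<^sub>R norm (u + v))"
   by (simp add: A_def n_def)
  also have "\<dots> = v" using assms by simp
  finally show ?thesis .
 qed
 have BB: "B (B x) = x" for x
  using nm(2) by (simp add: B_def inner_diff_right norm_eq_1 algebra_simps)
 have bound: "norm (A (B x) - x) <= 4 * norm (u - v) / norm u * norm x" for x
 proof -
  have "A (B x) - x = A (B x) - B (B x)" by (simp add: BB)
  also have "\<dots> = (-2) *\<^sub>R ((n \<bullet> B x) *\<^sub>R n - (m \<bullet> B x) *\<^sub>R m)"
   by (simp add: A_def B_def algebra_simps)
  also have "norm \<dots> <= 4 * norm (n - m) * norm (B x)"
   unfolding norm_scaleR using refl_diff_bound[OF nm, of "B x"] by (simp add: mult.commute)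
  also have "norm (B x) = norm x" using B orthogonal_transformation_norm by blast
  also have "norm (n - m) <= norm (u - v) / norm u"
  proof -
   have "m = (2 *\<^sub>R u) /\<^sub>R norm (2 *\<^sub>R u)" by (simp add: m_def)
   hence "norm (n - m) <= 2 * norm ((u + v) - 2 *\<^sub>R u) / norm (2 *\<^sub>R u)"
    unfolding n_def using normalized_diff_bound[of "u+v" "2 *\<^sub>R u"] assms by simp
   moreover have "u + v - 2 *\<^sub>R u = v - u" by (simp add: scaleR_2)
   ultimately show ?thesis by (simp add: norm_minus_commute)
  qed
  finally show ?thesis by (simp add: mult_right_mono mult_left_mono)
 qed
 show thesis
  by (rule that[of "%x. A (B x)"])
   (use orthogonal_transformation_compose[OF A B] Bu Au bound in \<open>simp_all add: o_def\<close>)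
qed

text \<open>The two-reflection construction degenerates only for \<open>u = 0\<close> and
  \<open>v = - u\<close>, where the identity and the point reflection serve.\<close>

lemma orthogonal_exists_map:
 fixes u v :: "'a::euclidean_space"
 assumes uv: "norm u = norm v"
 obtains R where "orthogonal_transformation R" "R u = v"
proof (cases "u = 0 \<or> u + v = 0")
 case True
 show thesis
 proof (cases "u = 0")
  case True
  with uv show thesis by (intro that[of "%x. x"]) auto
 next
  case False
  with True have "v = - u" by (simp add: eq_neg_iff_add_eq_0 add.commute)
  thus thesis
   by (intro that[of "%x. - x"]) (simp_all add: orthogonal_transformation_neg)
 qed
next
 case False
 thus thesis using near_identity_rotation[OF uv] that by blast
qed

text \<open>A move has a tangential part of order \<open>sqrt tau\<close> but a normal part of
  exactly \<open>tau\<close>, so replacing the gradient \<open>E a\<close> by \<open>P'\<close> is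
  affordable only if the tangential components stay the same. The vector
  \<open>E (fst a, b)\<close>, with \<open>b\<close> chosen so that its norm is that of
  \<open>P'\<close>, has the tangential components of \<open>E a\<close>; rotating it onto
  \<open>P'\<close> gives \<open>R\<close>. What is left is a multiple \<open>c\<close> of the
  normal component. The bound on \<open>fst a\<close> keeps the normal component of \<open>a\<close>
  large, which makes \<open>b\<close> depend on \<open>norm P'\<close> in a Lipschitz way.\<close>

lemma frame_adjust:
 fixes a P' :: "'a::euclidean_space \<times> real" and E :: "'a \<times> real => 'a \<times> real"
 assumes E: "orthogonal_transformation E"
  and tang: "norm (fst a) <= norm a / 2"
  and close: "norm (P' - E a) <= norm a / 8" and a0: "a \<noteq> 0"
 obtains R c where "orthogonal_transformation R"
  "!!v. P' \<bullet> R (E v) - E a \<bullet> E v = c * snd v" "\<bar>c\<bar> <= 5 * norm (P' - E a)"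
  "!!z. norm (R z - z) <= 32 * norm (P' - E a) / norm a * norm z"
proof -
 define p where "p = norm (P' - E a)"
 have nE: "norm (E v) = norm v" for v :: "'a \<times> real" using E orthogonal_transformation_norm by blast
 have lin: "linear E" using E by (simp only: orthogonal_transformation_def)
 have inE: "E v \<bullet> E w = v \<bullet> w" for v w using E by (simp only: orthogonal_transformation_def)
 have na: "norm a > 0" using a0 by simp
 have p0: "0 <= p" "p <= norm a / 8" using close by (auto simp: p_def)
 have P'1: "norm P' <= norm a + p"
  using norm_triangle_ineq2[of P' "E a"] by (simp add: p_def nE)
 have P'2: "norm P' >= norm a - p"
  using norm_triangle_ineq2[of "E a" P'] by (simp add: p_def nE norm_minus_commute)
 define aT where "aT = fst a"
 define an where "an = snd a"
 have a_eq: "a = (aT, an)" by (simp add: aT_def an_def)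
 have sq: "(norm a)\<^sup>2 = (norm aT)\<^sup>2 + an\<^sup>2"
  by (simp add: a_eq norm_Pair)
 have aT2: "(norm aT)\<^sup>2 <= (norm a)\<^sup>2 / 4"
  using power_mono[OF tang, of 2] by (simp add: aT_def power_divide)
 have an2: "an\<^sup>2 >= (norm a)\<^sup>2 / 4" using sq aT2 zero_le_power2[of "norm a"] by linarith
 hence anb: "\<bar>an\<bar> >= norm a / 2"
  using abs_le_square_iff[of "norm a / 2" an] by (simp add: power_divide)
 have P'sq: "(norm P')\<^sup>2 >= (norm aT)\<^sup>2"
 proof -
  have "norm aT <= norm P'" using tang P'2 p0 na by (simp add: aT_def)
  thus ?thesis by (simp add: power_mono)
 qed
 \<comment> \<open>The sign of \<open>b\<close> is that of \<open>an\<close>, so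
   \<open>b + an\<close> does not cancel and \<open>b - an\<close> is a difference of squares
   divided by at least \<open>norm a / 2\<close>.\<close>
 define b where "b = sgn an * sqrt ((norm P')\<^sup>2 - (norm aT)\<^sup>2)"
 have an0: "an \<noteq> 0" using anb na by auto
 have b2: "b\<^sup>2 = (norm P')\<^sup>2 - (norm aT)\<^sup>2"
  using P'sq an0 by (simp add: b_def power_mult_distrib sgn_if)
 have diff: "\<bar>b - an\<bar> <= 5 * p"
 proof -
  have "\<bar>b - an\<bar> * \<bar>b + an\<bar> = \<bar>b\<^sup>2 - an\<^sup>2\<bar>"
   by (simp add: power2_eq_square algebra_simps flip: abs_mult)
  also have "\<dots> = \<bar>(norm P')\<^sup>2 - (norm a)\<^sup>2\<bar>" by (simp add: b2 sq)
  also have "\<dots> = \<bar>norm P' - norm a\<bar> * (norm P' + norm a)"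
  proof -
   have "(norm P')\<^sup>2 - (norm a)\<^sup>2 = (norm P' - norm a) * (norm P' + norm a)"
    by (simp add: power2_eq_square algebra_simps)
   thus ?thesis by (simp add: abs_mult)
  qed
  also have "\<dots> <= p * (norm a * (17/8))"
   using P'1 P'2 p0 by (intro mult_mono) auto
  finally have 1: "\<bar>b - an\<bar> * \<bar>b + an\<bar> <= p * (norm a * (17/8))" .
  have "\<bar>b + an\<bar> = \<bar>b\<bar> + \<bar>an\<bar>"
   proof -
   have "\<bar>sgn an * q + an\<bar> = \<bar>sgn an * q\<bar> + \<bar>an\<bar>" if "q >= 0" for q
    using an0 that by (cases "an > 0") auto
   thus ?thesis using P'sq by (simp add: b_def)
  qed
  hence 2: "\<bar>b + an\<bar> >= norm a / 2" using anb by linarith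
  have "\<bar>b - an\<bar> * (norm a / 2) <= \<bar>b - an\<bar> * \<bar>b + an\<bar>"
   using 2 by (intro mult_left_mono) auto
  also have "\<dots> <= p * (norm a * (17/8))" by (rule 1)
  also have "\<dots> = (17/4*p) * (norm a / 2)" by simp
  finally have "\<bar>b - an\<bar> * (norm a / 2) <= (17/4*p) * (norm a / 2)" .
  hence "\<bar>b - an\<bar> <= 17/4*p" using na by (simp add: mult_le_cancel_right)
  thus ?thesis using p0 by linarith
 qed
 define Q where "Q = E (aT, b)"
 have nQ: "norm Q = norm P'" by (simp add: Q_def nE norm_Pair b2)
 have QP: "norm (Q - E a) <= 5 * p"
 proof -
  have "Q - E a = E ((aT, b) - a)" by (simp add: Q_def linear_diff[OF lin])
  thus ?thesis using diff by (simp add: nE a_eq norm_Pair)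
 qed
 have QP': "norm (Q - P') <= 6 * p"
  using norm_triangle_ineq4[of "Q - E a" "P' - E a"] QP by (simp add: p_def)
 have Q1: "norm Q >= 7/8 * norm a" using nQ P'2 p0 by linarith
 have Q0: "Q \<noteq> 0" using Q1 na by auto
 have QQ: "Q + P' \<noteq> 0"
 proof
  assume "Q + P' = 0"
  hence "P' = - Q" by (simp add: eq_neg_iff_add_eq_0 add.commute)
  hence "Q - P' = 2 *\<^sub>R Q" by (simp add: scaleR_2)
  hence "norm (Q - P') = 2 * norm Q" by simp
  thus False using QP' Q1 p0 na by linarith
 qed
 obtain R where R: "orthogonal_transformation R" "R Q = P'"
  "!!x. norm (R x - x) <= 4 * norm (Q - P') / norm Q * norm x"
  using near_identity_rotation[OF nQ Q0 QQ] by blast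
 have inR: "R v \<bullet> R w = v \<bullet> w" for v w using R by (simp only: orthogonal_transformation_def)
 have "P' \<bullet> R (E v) - E a \<bullet> E v = (b - an) * snd v" for v
 proof -
  have "P' \<bullet> R (E v) = (aT, b) \<bullet> v" by (simp add: R(2)[symmetric] inR Q_def inE)
  thus ?thesis by (cases v) (simp add: inE a_eq algebra_simps)
 qed
 moreover have "norm (R z - z) <= 32 * p / norm a * norm z" for z
 proof -
  have "4 * norm (Q - P') / norm Q <= 4 * (6 * p) / (7/8 * norm a)"
   using QP' Q1 na p0 by (intro frac_le) auto
  also have "\<dots> <= 32 * p / norm a" using na p0 by (simp add: divide_simps)
  finally show ?thesis using R(3)[of z] by (meson mult_right_mono norm_ge_zero order_trans)
 qed
 ultimately show thesis using that[of R "b - an"] R(1) diff by (simp add: p_def)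
qed

lemma orthogonal_parseval:
 fixes E :: "'a::euclidean_space => 'a"
 assumes E: "orthogonal_transformation E"
 shows "(\<Sum>b\<in>Basis. (u \<bullet> E b) * (w \<bullet> E b)) = u \<bullet> w"
proof -
 have "surj E" using E orthogonal_transformation_surj by blast
 then obtain u' w' where u: "u = E u'" and w: "w = E w'" by (metis surjD)
 have inE: "E v \<bullet> E w = v \<bullet> w" for v w using E by (simp only: orthogonal_transformation_def)
 show ?thesis by (simp add: u w inE euclidean_inner[of u' w'])
qed

text \<open>Expanding each \<open>E b\<close> in the standard basis and exchanging the sums leaves
  an inner product written in the basis \<open>E b\<close>, where Parseval's identity
  applies.\<close>

lemma op_trace_orthogonal:
 fixes E :: "'a::euclidean_space => 'a"
 assumes E: "orthogonal_transformation E"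
 shows "(\<Sum>b\<in>Basis. blinfun_apply X (E b) \<bullet> E b) = op_trace X"
proof -
 define F where "F = inv E"
 have F: "orthogonal_transformation F" unfolding F_def by (rule orthogonal_transformation_inv[OF E])
 have bij: "bij E" using E orthogonal_transformation_bij by blast
 have adj: "u \<bullet> E v = F u \<bullet> v" for u v
 proof -
  have "u \<bullet> E v = E (F u) \<bullet> E v" using bij by (simp add: F_def bij_is_surj surj_f_inv_f)
  also have "\<dots> = F u \<bullet> v" using E by (simp only: orthogonal_transformation_def)
  finally show ?thesis .
 qed
 have inF: "F v \<bullet> F w = v \<bullet> w" for v w using F by (simp only: orthogonal_transformation_def)
 have "blinfun_apply X v \<bullet> w = (\<Sum>c\<in>Basis. (v \<bullet> c) * (blinfun_apply X c \<bullet> w))" for v w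
 proof -
  have "blinfun_apply X (\<Sum>c\<in>Basis. (v \<bullet> c) *\<^sub>R c) \<bullet> w = (\<Sum>c\<in>Basis. (v \<bullet> c) * (blinfun_apply X c \<bullet> w))"
   by (simp only: blinfun.sum_right blinfun.scaleR_right inner_sum_left inner_scaleR_left)
  thus ?thesis by (simp only: euclidean_representation)
 qed
 hence "(\<Sum>b\<in>Basis. blinfun_apply X (E b) \<bullet> E b)
   = (\<Sum>b\<in>Basis. \<Sum>c\<in>Basis. (E b \<bullet> c) * (blinfun_apply X c \<bullet> E b))"
  by (intro sum.cong refl)
 also have "\<dots> = (\<Sum>c\<in>Basis. \<Sum>b\<in>Basis. (c \<bullet> E b) * (blinfun_apply X c \<bullet> E b))"
  by (subst sum.swap) (simp add: inner_commute)
 also have "\<dots> = op_trace X"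
  by (simp only: orthogonal_parseval[OF E] op_trace_def) (simp add: inner_commute)
 finally show ?thesis .
qed

lemma Basis_sum_spacetime:
 fixes \<phi> :: "(real^'n) \<times> real => real"
 shows "(\<Sum>b\<in>Basis. \<phi> b) = (\<Sum>i\<in>UNIV. \<phi> (axis i 1, 0)) + \<phi> (0, 1)"
proof -
 have B: "(Basis :: (real^'n) set) = (%i. axis i 1) ` UNIV"
  by (auto simp: Basis_vec_def)
 have inj: "inj (%i::'n. axis i (1::real))" by (simp add: axis_eq_axis inj_on_def)
 have "(\<Sum>b\<in>Basis. \<phi> b) = (\<Sum>b\<in>(%u. (u, 0)) ` Basis. \<phi> b) + (\<Sum>b\<in>(%v. (0, v)) ` Basis. \<phi> b)"
  unfolding Basis_prod_def by (rule sum.union_disjoint) auto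
 also have "(\<Sum>b\<in>(%u. (u, 0)) ` (Basis :: (real^'n) set). \<phi> b) = (\<Sum>i\<in>UNIV. \<phi> (axis i 1, 0))"
  unfolding B using inj by (simp add: sum.reindex inj_on_def axis_eq_axis image_image)
 finally show ?thesis by simp
qed

text \<open>The trace over the hyperplane orthogonal to the normal \<open>E (0, 1)\<close>. It is
  the curvature term that averaging over the tangential axes of a frame produces.\<close>

lemma op_trace_frame:
 fixes X :: "((real^'n) \<times> real) \<Rightarrow>\<^sub>L ((real^'n) \<times> real)"
  and E :: "(real^'n) \<times> real => (real^'n) \<times> real"
 assumes E: "orthogonal_transformation E"
 shows "(\<Sum>i\<in>UNIV. blinfun_apply X (E (axis i 1, 0)) \<bullet> E (axis i 1, 0))
  = op_trace X - blinfun_apply X (E (0, 1)) \<bullet> E (0, 1)"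
 using op_trace_orthogonal[OF E, of X]
 by (simp add: Basis_sum_spacetime[of "%b. blinfun_apply X (E b) \<bullet> E b"])

lemma quadform_bound: "\<bar>blinfun_apply X u \<bullet> v\<bar> <= norm X * norm u * norm (v :: 'a::euclidean_space)"
 by (meson Cauchy_Schwarz_ineq2 mult_right_mono norm_blinfun norm_ge_zero order_trans)

lemma quadform_diff:
 fixes X :: "'a::euclidean_space \<Rightarrow>\<^sub>L 'a"
 assumes "norm u = 1" "norm v = 1"
 shows "\<bar>blinfun_apply X u \<bullet> u - blinfun_apply X v \<bullet> v\<bar> <= 2 * norm X * norm (u - v)"
proof -
 have "blinfun_apply X u \<bullet> u - blinfun_apply X v \<bullet> v
   = blinfun_apply X (u - v) \<bullet> u + blinfun_apply X v \<bullet> (u - v)"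
  by (simp add: blinfun.diff_right inner_diff_left inner_diff_right)
 thus ?thesis
  using quadform_bound[of X "u - v" u] quadform_bound[of X v "u - v"] assms by simp
qed

section \<open>The one-step game and its monotonicity\<close>

text \<open>The zero map is the option of not moving at all beyond the drift; it produces the
  positive part in the equation. Any other control is a full frame, whose image of
  \<open>(0, 1)\<close> is the direction of the normal step.\<close>

definition controls :: "('a::euclidean_space => 'a) set" where
 "controls = insert (%_. 0) {E. orthogonal_transformation E}"

text \<open>Iterates of the game are not shown to be continuous. Local boundedness is the regularity
  under which the real infimum over controls is meaningful, and it is preserved by every
  step.\<close>

definition locally_bdd :: "('a::real_normed_vector => real) => bool" where
 "locally_bdd u \<longleftrightarrow> (\<forall>R. \<exists>B. \<forall>x. norm x <= R --> \<bar>u x\<bar> <= B)"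

text \<open>Monotonicity and compatibility with added constants in a single inequality, localised to
  a ball of radius \<rho>, so that a test function has to dominate only near the base point.\<close>

definition local_mono :: "(('a::real_normed_vector => real) => 'a => real) => real => bool" where
 "local_mono S \<rho> \<longleftrightarrow> (\<forall>u w c x. locally_bdd u --> locally_bdd w -->
  (\<forall>y. dist y x <= \<rho> --> u y <= w y + c) --> S u x <= S w x + c)"

definition move :: "real => real => 'n => real => (real^'n) \<times> real" where
 "move s h i sig = ((sig * s) *\<^sub>R axis i 1, - h)"

text \<open>The opponent chooses a sign on each tangential axis and the outcomes are averaged over
  the axes. Averaging makes the second-order terms add up to a trace, while the choice of sign
  penalises every frame in which the gradient has a tangential component.\<close>

definition payoff :: "real => real => ((real^'n) \<times> real => real) => (real^'n) \<times> real
  => ((real^'n) \<times> real => (real^'n) \<times> real) => real" where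
 "payoff s h u z E = (\<Sum>i\<in>UNIV. max (u (z + E (move s h i 1))) (u (z + E (move s h i (-1))))) / CARD('n)"

lemma controls_linear: "E \<in> controls ==> linear E"
 by (auto simp: controls_def orthogonal_transformation_def linear_zero)

lemma controls_norm_le: "E \<in> controls ==> norm (E v) <= norm v"
 by (auto simp: controls_def orthogonal_transformation_norm)

lemma norm_move_le:
 assumes "\<bar>sig\<bar> = 1" "s >= 0" "h >= 0"
 shows "norm (move s h i sig) <= s + h"
proof -
 have "norm (move s h i sig) <= norm ((sig * s) *\<^sub>R axis i (1::real)) + norm (-h)"
  unfolding move_def by (rule norm_Pair_le)
 thus ?thesis using assms by (simp add: abs_mult)
qed

lemma controls_norm_move:
 assumes "E \<in> controls" "\<bar>sig\<bar> = 1" "s >= 0" "h >= 0"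
 shows "norm (E (move s h i sig)) <= s + h"
 using controls_norm_le[OF assms(1)] norm_move_le[OF assms(2-4)] order_trans by blast

lemma payoff_mono:
 fixes z z' :: "(real^'n) \<times> real"
 assumes "!!i sig. \<bar>sig\<bar> = 1 ==> u (z + E (move s h i sig)) <= u' (z' + E' (move s h i sig)) + c"
 shows "payoff s h u z E <= payoff s h u' z' E' + c"
proof -
 have "max (u (z + E (move s h i 1))) (u (z + E (move s h i (-1))))
  <= max (u' (z' + E' (move s h i 1))) (u' (z' + E' (move s h i (-1)))) + c" for i
  using assms[of 1 i] assms[of "-1" i] by (auto simp: max_def)
 hence "(\<Sum>i\<in>(UNIV::'n set). max (u (z + E (move s h i 1))) (u (z + E (move s h i (-1)))))
  <= (\<Sum>i\<in>UNIV. max (u' (z' + E' (move s h i 1))) (u' (z' + E' (move s h i (-1)))) + c)"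
  by (intro sum_mono) auto
 thus ?thesis unfolding payoff_def by (simp add: sum.distrib divide_simps mult.commute)
qed

lemma payoff_le:
 fixes z :: "(real^'n) \<times> real"
 assumes "!!i sig. \<bar>sig\<bar> = 1 ==> u (z + E (move s h i sig)) <= b i"
 shows "payoff s h u z E <= (\<Sum>i\<in>UNIV. b i) / CARD('n)"
 unfolding payoff_def by (intro divide_right_mono sum_mono) (use assms in auto)

lemma payoff_ge:
 fixes z :: "(real^'n) \<times> real"
 assumes "!!i. \<exists>sig. \<bar>sig\<bar> = 1 \<and> u (z + E (move s h i sig)) >= b i"
 shows "payoff s h u z E >= (\<Sum>i\<in>UNIV. b i) / CARD('n)"
proof -
 have "b i <= max (u (z + E (move s h i 1))) (u (z + E (move s h i (-1))))" for i
  using assms[of i] by (metis abs_eq_iff' abs_one max.coboundedI1 max.coboundedI2)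
 thus ?thesis unfolding payoff_def by (intro divide_right_mono sum_mono) auto
qed

lemma payoff_ge_const:
 fixes z :: "(real^'n) \<times> real"
 assumes "!!i. \<exists>sig. \<bar>sig\<bar> = 1 \<and> u (z + E (move s h i sig)) >= b"
 shows "payoff s h u z E >= b"
 using payoff_ge[OF assms] by simp

lemma payoff_le_const:
 fixes z :: "(real^'n) \<times> real"
 assumes "!!i sig. \<bar>sig\<bar> = 1 ==> u (z + E (move s h i sig)) <= b"
 shows "payoff s h u z E <= b"
 using payoff_le[of u z E s h "%_. b"] assms by simp

lemma payoff_zero [simp]: "payoff s h u z (%_. 0) = u z"
 by (simp add: payoff_def)

lemma locally_bddE:
 assumes "locally_bdd u"
 obtains B where "B >= 0" "!!x. norm x <= R ==> \<bar>u x\<bar> <= B"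
proof -
 from assms obtain B where "\<forall>x. norm x <= R --> \<bar>u x\<bar> <= B" by (auto simp: locally_bdd_def)
 hence "!!x. norm x <= R ==> \<bar>u x\<bar> <= \<bar>B\<bar>" by force
 with that[of "\<bar>B\<bar>"] show thesis by simp
qed

lemma locally_bdd_continuous:
 fixes u :: "'a::euclidean_space => real"
 assumes "continuous_on UNIV u"
 shows "locally_bdd u"
 unfolding locally_bdd_def
proof
 fix R
 have "compact (u ` cball 0 R)"
  by (intro compact_continuous_image continuous_on_subset[OF assms]) auto
 hence "bounded (u ` cball 0 R)" by (rule compact_imp_bounded)
 then obtain B where "\<forall>x\<in>cball 0 R. \<bar>u x\<bar> <= B" by (auto simp: bounded_iff)
 thus "\<exists>B. \<forall>x. norm x <= R --> \<bar>u x\<bar> <= B" by (metis mem_cball_0)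
qed

lemma locally_bdd_add:
 assumes "locally_bdd u" "locally_bdd w"
 shows "locally_bdd (%x. u x + w x)"
 unfolding locally_bdd_def
proof
 fix R
 obtain A where A: "!!x. norm x <= R ==> \<bar>u x\<bar> <= A" using locally_bddE[OF assms(1)] by metis
 obtain B where B: "!!x. norm x <= R ==> \<bar>w x\<bar> <= B" using locally_bddE[OF assms(2)] by metis
 have "\<bar>u x + w x\<bar> <= A + B" if "norm x <= R" for x using A[OF that] B[OF that] by linarith
 thus "\<exists>B. \<forall>x. norm x <= R --> \<bar>u x + w x\<bar> <= B" by blast
qed

lemma locally_bdd_bounded: "(!!x. \<bar>u x\<bar> <= M) ==> locally_bdd u"
 by (auto simp: locally_bdd_def)

lemma locally_bdd_minus [simp]: "locally_bdd (%x. - u x) \<longleftrightarrow> locally_bdd u"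
 by (simp add: locally_bdd_def)

lemma locally_bdd_const [simp]: "locally_bdd (%x. c)"
 by (rule locally_bdd_bounded[of _ "\<bar>c\<bar>"]) simp

text \<open>Conjugation by the sign exchanges sub- and supersolutions, so that tests from above can
  be reused from below.\<close>

lemma local_mono_minus:
 assumes "local_mono S \<rho>"
 shows "local_mono (%u x. - S (%y. - u y) x) \<rho>"
 unfolding local_mono_def
proof (intro allI impI)
 fix u w :: "'a => real" and c x
 assume "locally_bdd u" "locally_bdd w" and le: "\<forall>y. dist y x <= \<rho> --> u y <= w y + c"
 hence "locally_bdd (%y. - w y)" "locally_bdd (%y. - u y)" by simp_all
 moreover have "\<forall>y. dist y x <= \<rho> --> - w y <= - u y + c"
 proof (intro allI impI)
  fix y assume "dist y x <= \<rho>"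
  hence "u y <= w y + c" using le by blast
  thus "- w y <= - u y + c" by simp
 qed
 ultimately have "S (%y. - w y) x <= S (%y. - u y) x + c"
  using assms unfolding local_mono_def by blast
 thus "- S (%y. - u y) x <= - S (%y. - w y) x + c" by simp
qed

locale shear_game =
 fixes f :: "real^'n => real" and d F L :: real
 assumes d_pos: "d > 0" and f_bound: "!!x. \<bar>f x\<bar> <= F"
  and f_lip: "!!x y. \<bar>f x - f y\<bar> <= L * dist x y"
begin

lemma F_nonneg: "F >= 0" using f_bound[of 0] by linarith

lemma L_nonneg: "L >= 0"
proof -
 have "dist (axis (SOME i. True) 1 :: real^'n) 0 = 1" by simp
 thus ?thesis using f_lip[of "axis (SOME i. True) 1" 0] by simp
qed

text \<open>The square is \<open>2 * n * d * eps * h\<close>, with \<open>n\<close> the number of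
  tangential axes: after the factor \<open>1/2\<close> of the Taylor expansion and the average over
  \<open>n\<close> axes, precisely \<open>h * eps * d\<close> times the tangential trace
  remains.\<close>

definition side :: "real => real => real" where
 "side eps h = sqrt (2 * CARD('n) * d * eps * h)"

definition drift :: "real => real => (real^'n) \<times> real => (real^'n) \<times> real" where
 "drift eps h x = x - h *\<^sub>R Vfield f ((1/eps) *\<^sub>R x)"

definition T :: "real => real => ((real^'n) \<times> real => real) => (real^'n) \<times> real => real" where
 "T eps h u x = (INF E\<in>controls. payoff (side eps h) h u (drift eps h x) E)"

definition reach :: "real => real => real" where
 "reach eps h = h * F + side eps h + h"

lemma side_nonneg: "[|eps >= 0; h >= 0|] ==> side eps h >= 0"
 using d_pos by (simp add: side_def)

lemma side_sq: "[|eps >= 0; h >= 0|] ==> (side eps h)\<^sup>2 = 2 * CARD('n) * d * eps * h"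
 using d_pos by (simp add: side_def)

lemma norm_Vfield: "norm (Vfield f y) <= F"
 using f_bound[of "fst y"] by (simp add: Vfield_def norm_Pair)

lemma Vfield_lip: "norm (Vfield f y - Vfield f z) <= L * norm (fst y - fst z)"
 using f_lip[of "fst y" "fst z"] by (simp add: Vfield_def norm_Pair dist_norm)

lemma dist_drift: "h >= 0 ==> dist (drift eps h x) x <= h * F"
 using norm_Vfield by (simp add: drift_def dist_norm mult_left_mono)

lemma dist_reach:
 assumes "E \<in> controls" "\<bar>sig\<bar> = 1" "eps >= 0" "h >= 0"
 shows "dist (drift eps h x + E (move (side eps h) h i sig)) x <= reach eps h"
proof -
 have "dist (drift eps h x + E (move (side eps h) h i sig)) x
   <= dist (drift eps h x) x + norm (E (move (side eps h) h i sig))"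
  by (metis (no_types, opaque_lifting) add_diff_eq add.commute dist_norm norm_triangle_ineq)
 thus ?thesis
  using dist_drift[of h eps x] controls_norm_move[of E sig "side eps h" h i] side_nonneg assms
  by (simp add: reach_def)
qed

lemma payoff_abs_le:
 assumes "E \<in> controls" "eps >= 0" "h >= 0" "!!y. dist y x <= reach eps h ==> \<bar>u y\<bar> <= B"
 shows "\<bar>payoff (side eps h) h u (drift eps h x) E\<bar> <= B"
proof -
 have *: "\<bar>u (drift eps h x + E (move (side eps h) h i sig))\<bar> <= B" if "\<bar>sig\<bar> = 1" for i sig
  using assms dist_reach that by blast
 have "payoff (side eps h) h u (drift eps h x) E <= B"
  using * by (intro payoff_le_const) (force simp: abs_le_iff)
 moreover have "payoff (side eps h) h u (drift eps h x) E >= - B"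
  using *[of 1] by (intro payoff_ge_const exI[of _ 1] conjI) (auto simp: abs_le_iff minus_le_iff)
 ultimately show ?thesis by linarith
qed

lemma bdd_below_payoff:
 assumes "locally_bdd u" "eps >= 0" "h >= 0"
 shows "bdd_below (payoff (side eps h) h u (drift eps h x) ` controls)"
proof -
 obtain B where B: "!!y. norm y <= norm x + reach eps h ==> \<bar>u y\<bar> <= B"
  using locally_bddE[OF assms(1)] by metis
 have "\<bar>u y\<bar> <= B" if "dist y x <= reach eps h" for y
  using B[of y] that norm_triangle_ineq2[of y x] by (simp add: dist_norm)
 hence "\<bar>payoff (side eps h) h u (drift eps h x) E\<bar> <= B" if "E \<in> controls" for E
  using payoff_abs_le assms that by blast
 thus ?thesis by (intro bdd_belowI2[of _ "-B"]) (force simp: abs_le_iff)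
qed

lemma controls_nonempty: "controls \<noteq> {}" by (auto simp: controls_def)

lemma T_le:
 assumes "locally_bdd u" "eps >= 0" "h >= 0" "E \<in> controls"
 shows "T eps h u x <= payoff (side eps h) h u (drift eps h x) E"
 unfolding T_def by (rule cINF_lower[OF bdd_below_payoff]) (use assms in auto)

lemma T_ge:
 assumes "!!E. E \<in> controls ==> c <= payoff (side eps h) h u (drift eps h x) E"
 shows "c <= T eps h u x"
 unfolding T_def by (rule cINF_greatest[OF controls_nonempty]) (use assms in auto)

lemma T_approx:
 assumes "T eps h u x < c"
 obtains E where "E \<in> controls" "payoff (side eps h) h u (drift eps h x) E < c"
 using assms T_ge[of c eps h u x] by force

lemma T_local_mono:
 assumes "eps >= 0" "h >= 0"
 shows "local_mono (T eps h) (reach eps h)"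
 unfolding local_mono_def
proof (intro allI impI)
 fix u w :: "(real^'n) \<times> real => real" and c x
 assume u: "locally_bdd u" and le: "\<forall>y. dist y x <= reach eps h --> u y <= w y + c"
 have "T eps h u x - c <= T eps h w x"
 proof (rule T_ge)
  fix E :: "(real^'n) \<times> real => (real^'n) \<times> real" assume E: "E \<in> controls"
  have "T eps h u x <= payoff (side eps h) h u (drift eps h x) E" using T_le u assms E by blast
  also have "\<dots> <= payoff (side eps h) h w (drift eps h x) E + c"
   by (rule payoff_mono) (use le dist_reach[OF E] assms in blast)
  finally show "T eps h u x - c <= payoff (side eps h) h w (drift eps h x) E" by simp
 qed
 thus "T eps h u x <= T eps h w x + c" by simp
qed

lemma T_mono:
 assumes "eps >= 0" "h >= 0" "locally_bdd u" "locally_bdd w" "!!y. u y <= w y + c"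
 shows "T eps h u x <= T eps h w x + c"
 using T_local_mono[OF assms(1,2)] assms(3-) unfolding local_mono_def by blast

lemma T_locally_bdd:
 assumes "eps >= 0" "h >= 0" "locally_bdd u"
 shows "locally_bdd (T eps h u)"
 unfolding locally_bdd_def
proof
 fix R
 obtain B where B: "!!y. norm y <= R + reach eps h ==> \<bar>u y\<bar> <= B"
  using locally_bddE[OF assms(3)] by metis
 have "\<bar>T eps h u x\<bar> <= B" if "norm x <= R" for x
 proof -
  have "\<bar>u y\<bar> <= B" if "dist y x <= reach eps h" for y
   using B[of y] that \<open>norm x <= R\<close> norm_triangle_ineq2[of y x] by (simp add: dist_norm)
  hence *: "\<bar>payoff (side eps h) h u (drift eps h x) E\<bar> <= B" if "E \<in> controls" for E
   using payoff_abs_le assms that by blast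
  have "- B <= T eps h u x" using * by (intro T_ge) (force simp: abs_le_iff)
  moreover have "T eps h u x <= B"
   using T_le[OF assms(3,1,2), of "%_. 0" x] *[of "%_. 0"]
   by (simp add: controls_def abs_le_iff) 
  ultimately show ?thesis by linarith
 qed
 thus "\<exists>B. \<forall>x. norm x <= R --> \<bar>T eps h u x\<bar> <= B" by blast
qed

text \<open>Under the blow-up by \<open>eps\<close> the drift scales linearly, and
  \<open>side eps h = eps * side 1 (h / eps)\<close>, so all homogenization estimates can be made
  for the game with \<open>eps = 1\<close> and step \<open>h / eps\<close>.\<close>

lemma T_scale:
 assumes "eps > 0" "h >= 0" "locally_bdd u"
 shows "T eps h u x = eps * T 1 (h / eps) (%y. u (eps *\<^sub>R y) / eps) ((1/eps) *\<^sub>R x)"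
proof -
 have u': "locally_bdd (%y. u (eps *\<^sub>R y) / eps)"
  unfolding locally_bdd_def
 proof
  fix R
  obtain B where B: "!!y. norm y <= eps * R ==> \<bar>u y\<bar> <= B"
   using locally_bddE[OF assms(3)] by metis
  have "\<bar>u (eps *\<^sub>R y) / eps\<bar> <= B / eps" if "norm y <= R" for y
   using B[of "eps *\<^sub>R y"] assms(1) that by (simp add: abs_divide divide_right_mono)
  thus "\<exists>B. \<forall>x. norm x <= R --> \<bar>u (eps *\<^sub>R x) / eps\<bar> <= B" by blast
 qed
 have s: "side eps h = eps * side 1 (h / eps)"
 proof (rule power2_eq_imp_eq)
  show "(side eps h)\<^sup>2 = (eps * side 1 (h / eps))\<^sup>2"
   using assms by (simp add: side_sq power_mult_distrib) (simp add: power2_eq_square)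
 qed (use assms in \<open>simp_all add: side_nonneg\<close>)
 have m: "move (side eps h) h i sig = eps *\<^sub>R move (side 1 (h/eps)) (h/eps) i sig" for i :: 'n and sig
  using assms by (simp add: move_def s)
 have dr: "drift eps h x = eps *\<^sub>R drift 1 (h/eps) ((1/eps) *\<^sub>R x)"
  using assms by (simp add: drift_def scaleR_diff_right)
 have p: "payoff (side eps h) h u (drift eps h x) E
  = eps * payoff (side 1 (h/eps)) (h/eps) (%y. u (eps *\<^sub>R y) / eps) (drift 1 (h/eps) ((1/eps) *\<^sub>R x)) E"
  if "E \<in> controls" for E
 proof -
  have "E (eps *\<^sub>R v) = eps *\<^sub>R E v" for v using controls_linear[OF that] by (rule linear_cmul)
  hence a: "drift eps h x + E (move (side eps h) h i sig)
   = eps *\<^sub>R (drift 1 (h/eps) ((1/eps) *\<^sub>R x) + E (move (side 1 (h/eps)) (h/eps) i sig))" for i sig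
   by (simp add: m dr scaleR_add_right)
  have mx: "max p q = eps * max (p / eps) (q / eps)" for p q :: real
   using assms(1) by (simp add: max_def divide_le_cancel)
  define A where "A i sig = drift 1 (h/eps) ((1/eps) *\<^sub>R x) + E (move (side 1 (h/eps)) (h/eps) i sig)" for i sig
  have "max (u (eps *\<^sub>R A i 1)) (u (eps *\<^sub>R A i (-1)))
   = eps * max (u (eps *\<^sub>R A i 1) / eps) (u (eps *\<^sub>R A i (-1)) / eps)" for i
   by (rule mx)
  hence "(\<Sum>i\<in>UNIV. max (u (eps *\<^sub>R A i 1)) (u (eps *\<^sub>R A i (-1))))
   = eps * (\<Sum>i\<in>UNIV. max (u (eps *\<^sub>R A i 1) / eps) (u (eps *\<^sub>R A i (-1)) / eps))"
   by (simp only: sum_distrib_left)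
  thus ?thesis unfolding payoff_def a A_def[symmetric] by simp
 qed
 have "eps * T 1 (h / eps) (%y. u (eps *\<^sub>R y) / eps) ((1/eps) *\<^sub>R x) <= T eps h u x"
 proof (rule T_ge)
  fix E :: "(real^'n) \<times> real => (real^'n) \<times> real" assume E: "E \<in> controls"
  show "eps * T 1 (h / eps) (%y. u (eps *\<^sub>R y) / eps) ((1/eps) *\<^sub>R x) <= payoff (side eps h) h u (drift eps h x) E"
   unfolding p[OF E] by (rule mult_left_mono[OF T_le[OF u']]) (use assms E in auto)
 qed
 moreover have "T eps h u x / eps <= T 1 (h / eps) (%y. u (eps *\<^sub>R y) / eps) ((1/eps) *\<^sub>R x)"
 proof (rule T_ge)
  fix E :: "(real^'n) \<times> real => (real^'n) \<times> real" assume E: "E \<in> controls"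
  have "T eps h u x <= payoff (side eps h) h u (drift eps h x) E"
   by (rule T_le) (use assms E in auto)
  thus "T eps h u x / eps <= payoff (side 1 (h/eps)) (h/eps) (%y. u (eps *\<^sub>R y) / eps) (drift 1 (h/eps) ((1/eps) *\<^sub>R x)) E"
   unfolding p[OF E] using assms(1) by (simp add: divide_simps mult.commute)
 qed
 ultimately show ?thesis using assms(1) by (simp add: divide_simps mult.commute)
qed

end

section \<open>The curvature Hamiltonian: dependence on Hessian and gradient\<close>

lemma op_trace_shift:
 fixes X :: "'a::euclidean_space \<Rightarrow>\<^sub>L 'a"
 shows "op_trace (X + c *\<^sub>R id_blinfun) = op_trace X + c * DIM('a)"
 by (simp add: op_trace_def blinfun.add_left blinfun.scaleR_left inner_add_left sum.distrib)

text \<open>Pulling the factor \<open>norm Q\<close> into the positive part replaces the singular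
  quotients by a quadratic form on the unit vector \<open>sgn Q\<close>. In this shape the
  Hamiltonian can be compared with the outcome of one frame, whose normal plays the role of
  \<open>sgn Q\<close>.\<close>

lemma FG_alt:
 assumes "Q \<noteq> 0"
 shows "FG eps d f x Q X = max (norm Q - eps * d * (op_trace X - blinfun_apply X (sgn Q) \<bullet> sgn Q)) 0
  + Vfield f ((1/eps) *\<^sub>R x) \<bullet> Q"
proof -
 have n: "norm Q > 0" using assms by simp
 have "blinfun_apply X Q \<bullet> Q = (norm Q)\<^sup>2 * (blinfun_apply X (sgn Q) \<bullet> sgn Q)"
 proof -
  have "blinfun_apply X Q \<bullet> Q = blinfun_apply X (norm Q *\<^sub>R sgn Q) \<bullet> (norm Q *\<^sub>R sgn Q)"
   using n by (simp add: sgn_div_norm)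
  thus ?thesis by (simp add: blinfun.scaleR_right power2_eq_square)
 qed
 hence "blinfun_apply X Q \<bullet> Q / (norm Q)^3 = (blinfun_apply X (sgn Q) \<bullet> sgn Q) / norm Q"
  using n by (simp add: power2_eq_square power3_eq_cube)
 hence "(1 - eps * d * (op_trace X / norm Q - blinfun_apply X Q \<bullet> Q / (norm Q)^3)) * norm Q
  = norm Q - eps * d * (op_trace X - blinfun_apply X (sgn Q) \<bullet> sgn Q)"
  using n by (simp add: field_simps)
 hence "max (1 - eps * d * (op_trace X / norm Q - blinfun_apply X Q \<bullet> Q / (norm Q)^3)) 0 * norm Q
  = max (norm Q - eps * d * (op_trace X - blinfun_apply X (sgn Q) \<bullet> sgn Q)) 0"
  using n by (metis max_mult_distrib_right mult_zero_left less_eq_real_def)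
 thus ?thesis by (simp add: FG_def pos_part_def)
qed

text \<open>The identity has tangential trace \<open>CARD('n)\<close>. These bounds remove the small
  multiples of the identity that strict test functions add to the Hessian.\<close>

lemma FG_shift_ge:
 fixes Q :: "(real^'n) \<times> real"
 assumes "Q \<noteq> 0" "eps >= 0" "d >= 0" "c >= 0"
 shows "FG eps d f x Q X <= FG eps d f x Q (X + c *\<^sub>R id_blinfun) + eps * d * CARD('n) * c"
  and "FG eps d f x Q X >= FG eps d f x Q (X + (- c) *\<^sub>R id_blinfun) - eps * d * CARD('n) * c"
proof -
 have s: "sgn Q \<bullet> sgn Q = 1" using assms by (metis norm_eq_1 norm_sgn)
 have sh: "op_trace (X + k *\<^sub>R id_blinfun) - blinfun_apply (X + k *\<^sub>R id_blinfun) (sgn Q) \<bullet> sgn Q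
  = op_trace X - blinfun_apply X (sgn Q) \<bullet> sgn Q + k * CARD('n)" for k
  unfolding op_trace_shift
  by (simp add: blinfun.add_left blinfun.scaleR_left inner_add_left s algebra_simps)
 show "FG eps d f x Q X <= FG eps d f x Q (X + c *\<^sub>R id_blinfun) + eps * d * CARD('n) * c"
  unfolding FG_alt[OF assms(1)] sh using assms by (simp add: max_def algebra_simps)
 show "FG eps d f x Q X >= FG eps d f x Q (X + (- c) *\<^sub>R id_blinfun) - eps * d * CARD('n) * c"
  unfolding FG_alt[OF assms(1)] sh using assms by (simp add: max_def algebra_simps)
qed

text \<open>The singularity at zero gradient enters only through \<open>1 / norm Q\<close>. In the
  cell problem a gradient with last component \<open>snd P\<close> keeps this factor
  bounded.\<close>

lemma (in shear_game) FG_gradient_lip: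
 fixes P Q :: "(real^'n) \<times> real"
 assumes "P \<noteq> 0" "Q \<noteq> 0" "eps >= 0"
 shows "\<bar>FG eps d f x P X - FG eps d f x Q X\<bar> <= (1 + F + 4 * eps * d * norm X / norm Q) * norm (P - Q)"
proof -
 have X: "\<bar>blinfun_apply X (sgn P) \<bullet> sgn P - blinfun_apply X (sgn Q) \<bullet> sgn Q\<bar> <= 2 * norm X * (2 * norm (P - Q) / norm Q)"
 proof -
  have "norm (sgn P - sgn Q) <= 2 * norm (P - Q) / norm Q"
   using normalized_diff_bound[OF assms(1,2)] by (simp add: sgn_div_norm)
  hence "2 * norm X * norm (sgn P - sgn Q) <= 2 * norm X * (2 * norm (P - Q) / norm Q)"
   by (intro mult_left_mono) auto
  thus ?thesis using quadform_diff[of "sgn P" "sgn Q" X] assms by (simp add: norm_sgn)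
 qed
 have V: "\<bar>Vfield f ((1/eps) *\<^sub>R x) \<bullet> P - Vfield f ((1/eps) *\<^sub>R x) \<bullet> Q\<bar> <= F * norm (P - Q)"
 proof -
  have "\<bar>Vfield f ((1/eps) *\<^sub>R x) \<bullet> (P - Q)\<bar> <= norm (Vfield f ((1/eps) *\<^sub>R x)) * norm (P - Q)"
   by (rule Cauchy_Schwarz_ineq2)
  also have "\<dots> <= F * norm (P - Q)" by (intro mult_right_mono norm_Vfield) auto
  finally show ?thesis by (simp add: inner_diff_right)
 qed
 define t where "t = op_trace X"
 define p where "p = blinfun_apply X (sgn P) \<bullet> sgn P"
 define q where "q = blinfun_apply X (sgn Q) \<bullet> sgn Q"
 have ed: "eps * d >= 0" using assms d_pos by simp
 have "\<bar>max (norm P - eps * d * (t - p)) 0 - max (norm Q - eps * d * (t - q)) 0\<bar>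
  <= \<bar>(norm P - eps * d * (t - p)) - (norm Q - eps * d * (t - q))\<bar>" by (simp add: max_def)
 also have "\<dots> = \<bar>(norm P - norm Q) + eps * d * (p - q)\<bar>" by (simp add: algebra_simps)
 also have "\<dots> <= \<bar>norm P - norm Q\<bar> + \<bar>eps * d * (p - q)\<bar>" by (rule abs_triangle_ineq)
 also have "\<bar>eps * d * (p - q)\<bar> = eps * d * \<bar>p - q\<bar>" by (subst abs_mult, subst (1) abs_of_nonneg[OF ed], rule refl)
 also have "eps * d * \<bar>p - q\<bar> <= eps * d * (2 * norm X * (2 * norm (P - Q) / norm Q))"
  by (rule mult_left_mono) (use X ed in \<open>auto simp: p_def q_def\<close>)
 also have "\<bar>norm P - norm Q\<bar> <= norm (P - Q)" by (rule norm_triangle_ineq3)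
 finally show ?thesis unfolding FG_alt[OF assms(1)] FG_alt[OF assms(2)] using V
  by (simp add: t_def p_def q_def algebra_simps)
qed

section \<open>Consistency of the game with the G-equation\<close>

context shear_game
begin

text \<open>The first summand comes from the mixed tangential-normal second-order term, of order
  \<open>h^(3/2)\<close>, and the second from the purely normal one, of order
  \<open>h^2 <= h^(3/2)\<close>.\<close>

definition remC :: real where
 "remC = sqrt (2 * CARD('n) * d) * (F + 1) + (F + 1)\<^sup>2 / 2"

lemma remC_nonneg: "remC >= 0"
 using F_nonneg d_pos by (simp add: remC_def)

lemma side_le:
 assumes "0 <= eps" "eps <= 1" "0 <= h"
 shows "side eps h <= sqrt (2 * CARD('n) * d) * sqrt h"
proof -
 have "2 * CARD('n) * d * eps * h <= 2 * CARD('n) * d * 1 * h"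
  using assms d_pos by (intro mult_right_mono mult_left_mono) auto
 thus ?thesis by (simp add: side_def flip: real_sqrt_mult)
qed

lemma quad_remainder:
 fixes e b :: "(real^'n) \<times> real"
 assumes "norm e = 1" "norm b <= F + 1" "\<bar>sig\<bar> = 1" "0 <= eps" "eps <= 1" "0 <= h" "h <= 1"
 defines "s \<equiv> side eps h"
 shows "\<bar>blinfun_apply X ((sig * s) *\<^sub>R e - h *\<^sub>R b) \<bullet> ((sig * s) *\<^sub>R e - h *\<^sub>R b) / 2
  - s\<^sup>2 / 2 * (blinfun_apply X e \<bullet> e)\<bar> <= norm X * remC * (h * sqrt h)"
proof -
 have s0: "s >= 0" and s1: "s <= sqrt (2 * CARD('n) * d) * sqrt h"
  using side_nonneg side_le assms by auto
 have sg: "sig * sig = 1" using assms(3) by (metis abs_mult_self_eq mult_1)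
 have "blinfun_apply X ((sig * s) *\<^sub>R e - h *\<^sub>R b) \<bullet> ((sig * s) *\<^sub>R e - h *\<^sub>R b)
  = (sig * s) * (sig * s) * (blinfun_apply X e \<bullet> e) - (sig * s * h) * (blinfun_apply X e \<bullet> b + blinfun_apply X b \<bullet> e)
    + h * h * (blinfun_apply X b \<bullet> b)"
  by (simp add: blinfun.diff_right blinfun.scaleR_right inner_diff_left inner_diff_right algebra_simps)
 also have "(sig * s) * (sig * s) = s\<^sup>2" 
 proof -
  have "(sig * s) * (sig * s) = (sig * sig) * s\<^sup>2" by (simp only: power2_eq_square mult_ac)
  thus ?thesis using sg by simp
 qed
 finally have eq: "blinfun_apply X ((sig * s) *\<^sub>R e - h *\<^sub>R b) \<bullet> ((sig * s) *\<^sub>R e - h *\<^sub>R b) / 2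
  - s\<^sup>2 / 2 * (blinfun_apply X e \<bullet> e) = - (sig * s * h) * (blinfun_apply X e \<bullet> b + blinfun_apply X b \<bullet> e) / 2
    + h * h * (blinfun_apply X b \<bullet> b) / 2" by (simp add: field_simps)
 have K: "norm X >= 0" by simp
 have 1: "\<bar>blinfun_apply X e \<bullet> b + blinfun_apply X b \<bullet> e\<bar> <= 2 * (norm X * (F + 1))"
 proof -
  have "norm X * norm e * norm b <= norm X * (F + 1)" "norm X * norm b * norm e <= norm X * (F + 1)"
   using assms by (simp_all add: mult_left_mono)
  thus ?thesis using quadform_bound[of X e b] quadform_bound[of X b e] by linarith
 qed
 have 2: "\<bar>blinfun_apply X b \<bullet> b\<bar> <= norm X * (F + 1)\<^sup>2"
 proof -
  have "norm X * norm b * norm b <= norm X * (F + 1) * (F + 1)"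
   using assms F_nonneg by (intro mult_mono mult_left_mono) auto
  thus ?thesis using quadform_bound[of X b b] by (simp add: power2_eq_square)
 qed
 have a: "\<bar>- (sig * s * h) * (blinfun_apply X e \<bullet> b + blinfun_apply X b \<bullet> e) / 2\<bar>
  <= (s * h) * (norm X * (F + 1))"
 proof -
  have "\<bar>- (sig * s * h) * (blinfun_apply X e \<bullet> b + blinfun_apply X b \<bullet> e) / 2\<bar>
   = (s * h) * (\<bar>blinfun_apply X e \<bullet> b + blinfun_apply X b \<bullet> e\<bar> / 2)"
   using assms s0 by (simp add: abs_mult)
  also have "\<dots> <= (s * h) * (norm X * (F + 1))"
   using 1 s0 assms by (intro mult_left_mono) auto
  finally show ?thesis .
 qed
 have b: "\<bar>h * h * (blinfun_apply X b \<bullet> b) / 2\<bar> <= (h * h) * (norm X * (F + 1)\<^sup>2 / 2)"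
  using mult_left_mono[OF 2, of "h * h"] assms by (simp add: abs_mult)
 have hh: "h * h <= h * sqrt h"
 proof -
  have "h <= sqrt h" using assms by (metis mult_left_le_one_le real_le_rsqrt power2_eq_square)
  thus ?thesis using assms by (simp add: mult_left_mono)
 qed
 have c: "(s * h) * (norm X * (F + 1)) <= (sqrt (2 * CARD('n) * d) * sqrt h * h) * (norm X * (F + 1))"
  using s1 assms F_nonneg by (intro mult_right_mono) auto
 have e: "(h * h) * (norm X * (F + 1)\<^sup>2 / 2) <= (h * sqrt h) * (norm X * (F + 1)\<^sup>2 / 2)"
  using hh by (intro mult_right_mono) auto
 have "\<bar>blinfun_apply X ((sig * s) *\<^sub>R e - h *\<^sub>R b) \<bullet> ((sig * s) *\<^sub>R e - h *\<^sub>R b) / 2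
  - s\<^sup>2 / 2 * (blinfun_apply X e \<bullet> e)\<bar> <= (sqrt (2 * CARD('n) * d) * sqrt h * h) * (norm X * (F + 1)) + (h * sqrt h) * (norm X * (F + 1)\<^sup>2 / 2)"
  unfolding eq using a b c e by linarith
 also have "\<dots> = norm X * remC * (h * sqrt h)" by (simp add: remC_def algebra_simps)
 finally show ?thesis .
qed

lemma drift_move:
 assumes "linear E"
 shows "drift eps h x + E (move s h i sig)
  = x + ((sig * s) *\<^sub>R E (axis i 1, 0) - h *\<^sub>R (Vfield f ((1/eps) *\<^sub>R x) + E (0, 1)))"
proof -
 have "move s h i sig = (sig * s) *\<^sub>R (axis i 1, 0) - h *\<^sub>R (0, 1)" by (simp add: move_def)
 hence "E (move s h i sig) = (sig * s) *\<^sub>R E (axis i 1, 0) - h *\<^sub>R E (0, 1)"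
  using assms by (simp only: linear_diff linear_cmul)
 thus ?thesis by (simp add: drift_def algebra_simps)
qed

lemma average_trace:
 fixes E :: "(real^'n) \<times> real => (real^'n) \<times> real"
 assumes E: "orthogonal_transformation E" and "eps >= 0" "h >= 0"
 shows "(\<Sum>i\<in>UNIV. a + (side eps h)\<^sup>2 / 2 * (blinfun_apply X (E (axis i 1, 0)) \<bullet> E (axis i 1, 0))) / CARD('n)
  = a + h * (eps * d * (op_trace X - blinfun_apply X (E (0,1)) \<bullet> E (0,1)))"
proof -
 have "(\<Sum>i\<in>(UNIV::'n set). a + (side eps h)\<^sup>2 / 2 * (blinfun_apply X (E (axis i 1, 0)) \<bullet> E (axis i 1, 0)))
  = CARD('n) * a + (CARD('n) * d * eps * h) * (\<Sum>i\<in>(UNIV::'n set). blinfun_apply X (E (axis i 1, 0)) \<bullet> E (axis i 1, 0))"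
  by (simp add: sum.distrib sum_distrib_left side_sq assms algebra_simps)
 thus ?thesis by (simp add: op_trace_frame[OF E] field_simps)
qed

text \<open>Two controls are compared: staying, and the frame with normal \<nu>, for which the
  gradient has no tangential component and the opponent's sign is harmless at first order. The
  smaller outcome is the positive part. The unit vector \<nu> is a parameter because for
  \<open>Q = 0\<close> every direction is admissible.\<close>

lemma T_upper_unit:
 fixes \<nu> Q :: "(real^'n) \<times> real"
 assumes eps: "0 <= eps" "eps <= 1" and h: "0 <= h" "h <= 1" and \<psi>: "locally_bdd \<psi>"
  and exp: "!!\<delta>. \<psi> (x + \<delta>) <= \<psi> x + Q \<bullet> \<delta> + 1/2 * (blinfun_apply X \<delta> \<bullet> \<delta>)"
  and \<nu>: "norm \<nu> = 1" "Q = norm Q *\<^sub>R \<nu>"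
 shows "T eps h \<psi> x <= \<psi> x - h * (max (norm Q - eps * d * (op_trace X - blinfun_apply X \<nu> \<bullet> \<nu>)) 0
  + Vfield f ((1/eps) *\<^sub>R x) \<bullet> Q) + norm X * remC * (h * sqrt h)"
proof -
 define V where "V = Vfield f ((1/eps) *\<^sub>R x)"
 define s where "s = side eps h"
 define r where "r = norm X * remC * (h * sqrt h)"
 have nV: "norm V <= F" using norm_Vfield by (simp add: V_def)
 obtain E where E: "orthogonal_transformation E" "E ((0, 1) :: (real^'n) \<times> real) = \<nu>"
  using orthogonal_exists_map[of "(0,1) :: (real^'n) \<times> real" \<nu>] \<nu>(1) by (auto simp: norm_Pair)
 have lin: "linear E" using E by (simp only: orthogonal_transformation_def)
 have inE: "E v \<bullet> E w = v \<bullet> w" for v w using E by (simp only: orthogonal_transformation_def)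
 have nE: "norm (E v) = norm v" for v using E orthogonal_transformation_norm by blast
 have Ec: "E \<in> controls" using E by (simp add: controls_def)
 have stay: "T eps h \<psi> x <= \<psi> x - h * (V \<bullet> Q) + r"
 proof -
  have "T eps h \<psi> x <= \<psi> (drift eps h x)"
   using T_le[OF \<psi> eps(1) h(1), of "%_. 0" x] by (simp add: controls_def)
  also have "drift eps h x = x + (- h *\<^sub>R V)" by (simp add: drift_def V_def)
  also have "\<psi> \<dots> <= \<psi> x + Q \<bullet> (- h *\<^sub>R V) + 1/2 * (blinfun_apply X (- h *\<^sub>R V) \<bullet> (- h *\<^sub>R V))" by (rule exp)
  also have "1/2 * (blinfun_apply X (- h *\<^sub>R V) \<bullet> (- h *\<^sub>R V)) <= r"
  proof -
   have "blinfun_apply X (- h *\<^sub>R V) \<bullet> (- h *\<^sub>R V) <= h * h * \<bar>blinfun_apply X V \<bullet> V\<bar>"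
   proof -
    have "blinfun_apply X (- h *\<^sub>R V) \<bullet> (- h *\<^sub>R V) = (h * h) * (blinfun_apply X V \<bullet> V)"
     by (simp add: blinfun.minus_right blinfun.scaleR_right)
    also have "\<dots> <= (h * h) * \<bar>blinfun_apply X V \<bullet> V\<bar>" by (intro mult_left_mono) auto
    finally show ?thesis .
   qed
   also have "\<dots> <= h * h * (norm X * (F * F))"
   proof (rule mult_left_mono)
    have "norm X * norm V * norm V <= norm X * F * F" using nV F_nonneg
     by (intro mult_mono mult_left_mono) auto
    thus "\<bar>blinfun_apply X V \<bullet> V\<bar> <= norm X * (F * F)" using quadform_bound[of X V V] by (simp add: mult.assoc)
   qed (use h in auto)
   also have "\<dots> <= (h * sqrt h) * (norm X * (2 * remC))"
   proof (rule mult_mono)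
    have "h <= sqrt h" using h by (metis mult_left_le_one_le real_le_rsqrt power2_eq_square)
    thus "h * h <= h * sqrt h" using h by (simp add: mult_left_mono)
    have "F * F <= (F + 1)\<^sup>2" using F_nonneg by (simp add: power2_eq_square algebra_simps)
    moreover have "0 <= sqrt (2 * CARD('n) * d) * (F + 1)" using F_nonneg d_pos by simp
    ultimately have "F * F <= 2 * remC" by (simp add: remC_def)
    thus "norm X * (F * F) <= norm X * (2 * remC)" by (intro mult_left_mono) auto
   qed (use h in auto)
   finally have "blinfun_apply X (- h *\<^sub>R V) \<bullet> (- h *\<^sub>R V) <= 2 * r" by (simp add: r_def algebra_simps)
   thus ?thesis by linarith
  qed
  finally show ?thesis by (simp add: inner_commute)
 qed
 have go: "T eps h \<psi> x <= \<psi> x - h * (norm Q - eps * d * (op_trace X - blinfun_apply X \<nu> \<bullet> \<nu>) + V \<bullet> Q) + r"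
 proof -
  have "T eps h \<psi> x <= payoff s h \<psi> (drift eps h x) E"
   unfolding s_def using T_le[OF \<psi> eps(1) h(1) Ec] .
  also have "\<dots> <= (\<Sum>i\<in>UNIV. (\<psi> x - h * (norm Q + V \<bullet> Q) + r) + s\<^sup>2 / 2 * (blinfun_apply X (E (axis i 1, 0)) \<bullet> E (axis i 1, 0))) / CARD('n)"
  proof (rule payoff_le)
   fix i :: 'n and sig :: real assume sig: "\<bar>sig\<bar> = 1"
   define e where "e = E (axis i 1, 0)"
   define b where "b = V + \<nu>"
   have ne: "norm e = 1" by (simp add: e_def nE norm_Pair)
   have nb: "norm b <= F + 1" unfolding b_def using norm_triangle_ineq[of V \<nu>] nV \<nu> by simp
   have "\<nu> \<bullet> e = 0" by (simp add: e_def E(2)[symmetric] inE)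
   hence Qe: "Q \<bullet> e = 0" using \<nu> by (metis inner_scaleR_left mult_zero_right)
   have "\<nu> \<bullet> \<nu> = 1" using \<nu> by (simp add: norm_eq_1)
   hence Qn: "Q \<bullet> \<nu> = norm Q" using \<nu> by (metis inner_scaleR_left mult.right_neutral)
   have "\<psi> (drift eps h x + E (move s h i sig)) = \<psi> (x + ((sig * s) *\<^sub>R e - h *\<^sub>R b))"
    unfolding drift_move[OF lin] by (simp add: e_def b_def V_def E(2))
   also have "\<dots> <= \<psi> x + Q \<bullet> ((sig * s) *\<^sub>R e - h *\<^sub>R b) + 1/2 * (blinfun_apply X ((sig * s) *\<^sub>R e - h *\<^sub>R b) \<bullet> ((sig * s) *\<^sub>R e - h *\<^sub>R b))"
    by (rule exp)
   also have "Q \<bullet> ((sig * s) *\<^sub>R e - h *\<^sub>R b) = - h * (norm Q + V \<bullet> Q)"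
    by (simp add: inner_diff_right Qe b_def inner_add_right Qn inner_commute algebra_simps)
   also have "1/2 * (blinfun_apply X ((sig * s) *\<^sub>R e - h *\<^sub>R b) \<bullet> ((sig * s) *\<^sub>R e - h *\<^sub>R b)) <= s\<^sup>2 / 2 * (blinfun_apply X e \<bullet> e) + r"
    using quad_remainder[OF ne nb sig eps h, of X] by (simp add: s_def r_def abs_le_iff)
   finally show "\<psi> (drift eps h x + E (move s h i sig)) <= (\<psi> x - h * (norm Q + V \<bullet> Q) + r) + s\<^sup>2 / 2 * (blinfun_apply X (E (axis i 1, 0)) \<bullet> E (axis i 1, 0))"
    by (simp add: e_def)
  qed
  also have "\<dots> = \<psi> x - h * (norm Q + V \<bullet> Q) + r + h * (eps * d * (op_trace X - blinfun_apply X \<nu> \<bullet> \<nu>))"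
   unfolding s_def average_trace[OF E(1) eps(1) h(1)] E(2) ..
  finally show ?thesis by (simp add: algebra_simps)
 qed
 show ?thesis
  using stay go unfolding V_def[symmetric] r_def[symmetric] by (simp add: max_def)
qed

text \<open>The equation is not defined at zero gradient, and its lower envelope only demands a
  nearby nonzero one. Hence the gradient may be displaced by \<open>kp\<close>, at a cost
  proportional to \<open>kp\<close>.\<close>

lemma T_upper:
 fixes Q :: "(real^'n) \<times> real"
 assumes eps: "0 <= eps" "eps <= 1" and h: "0 <= h" "h <= 1" and \<psi>: "locally_bdd \<psi>"
  and exp: "!!\<delta>. \<psi> (x + \<delta>) <= \<psi> x + Q \<bullet> \<delta> + 1/2 * (blinfun_apply X \<delta> \<bullet> \<delta>)"
  and "kp > 0"
 obtains Q' where "Q' \<noteq> 0" "norm (Q' - Q) <= kp"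
  "T eps h \<psi> x <= \<psi> x - h * FG eps d f x Q' X + norm X * remC * (h * sqrt h) + h * kp * (F + 1)"
proof (cases "Q = 0")
 case False
 have "T eps h \<psi> x <= \<psi> x - h * FG eps d f x Q X + norm X * remC * (h * sqrt h)"
  unfolding FG_alt[OF False]
  by (rule T_upper_unit[OF eps h \<psi> exp]) (use False in \<open>auto simp: norm_sgn sgn_div_norm\<close>)
 moreover have "h * kp * (F + 1) >= 0" using h F_nonneg assms(7) by simp
 ultimately show thesis using that[of Q] False assms(7) by auto
next
 case True
 \<comment> \<open>Any unit vector would do: the displaced gradient
   \<open>kp *\<^sub>R \<nu>\<close> has the same normal \<nu>, so the curvature term is
   unaffected.\<close>
 define \<nu> :: "(real^'n) \<times> real" where "\<nu> = (0, 1)"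
 have \<nu>: "norm \<nu> = 1" by (simp add: \<nu>_def norm_Pair)
 hence \<nu>0: "kp *\<^sub>R \<nu> \<noteq> 0" using assms(7) by auto
 define V where "V = Vfield f ((1/eps) *\<^sub>R x)"
 define m where "m = eps * d * (op_trace X - blinfun_apply X \<nu> \<bullet> \<nu>)"
 have sg: "sgn (kp *\<^sub>R \<nu>) = \<nu>" using assms(7) \<nu> by (simp add: sgn_div_norm)
 have "V \<bullet> \<nu> <= F" using norm_Vfield Cauchy_Schwarz_ineq2[of V \<nu>] \<nu> by (smt (verit) V_def mult_cancel_left1)
 hence "FG eps d f x (kp *\<^sub>R \<nu>) X <= max (0 - m) 0 + kp * (F + 1)"
 proof -
  have "norm (kp *\<^sub>R \<nu>) = kp" using assms(7) \<nu> by simp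
  moreover have "V \<bullet> (kp *\<^sub>R \<nu>) <= kp * F"
   using mult_left_mono[of "V \<bullet> \<nu>" F kp] \<open>V \<bullet> \<nu> <= F\<close> assms(7) by simp
  moreover have "max (kp - m) 0 <= max (0 - m) 0 + kp" using assms(7) by (simp add: max_def)
  moreover have "kp * (F + 1) = kp * F + kp" by (simp add: algebra_simps)
  ultimately show ?thesis
   unfolding FG_alt[OF \<nu>0] sg m_def[symmetric] V_def[symmetric] by linarith
 qed
 hence "h * FG eps d f x (kp *\<^sub>R \<nu>) X <= h * (max (0 - m) 0 + kp * (F + 1))"
  using h by (intro mult_left_mono) auto
 moreover have "T eps h \<psi> x <= \<psi> x - h * (max (0 - m) 0) + norm X * remC * (h * sqrt h)"
  using T_upper_unit[OF eps h \<psi> exp \<nu>] True by (simp add: m_def)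
 ultimately show thesis using that[of "kp *\<^sub>R \<nu>"] \<nu>0 True \<nu> assms(7) by (simp add: algebra_simps)
qed

text \<open>An almost optimal control is analysed. If it stays, the positive part only helps. If the
  gradient is tiny, the gradient is replaced by a small multiple of the frame's own normal.
  Otherwise a frame whose normal deviates from the gradient gains curvature of order
  \<open>h\<close> times the deviation, but the opponent collects \<open>side eps h\<close> times
  the deviation; the hypothesis \<open>small\<close> says that the opponent wins.\<close>

lemma T_lower:
 fixes Q :: "(real^'n) \<times> real"
 assumes eps: "0 <= eps" "eps <= 1" and h: "0 < h" "h <= 1"
  and exp: "!!\<delta>. \<psi> (x + \<delta>) >= \<psi> x + Q \<bullet> \<delta> + 1/2 * (blinfun_apply X \<delta> \<bullet> \<delta>)"
  and kp: "kp > 0" and small: "8 * eps * d * norm X * CARD('n) * h <= kp * side eps h"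
 obtains Q' where "Q' \<noteq> 0" "norm (Q' - Q) <= kp"
  "T eps h \<psi> x >= \<psi> x - h * FG eps d f x Q' X - norm X * remC * (h * sqrt h) - h * kp * (F + 1) - h\<^sup>2"
proof -
 define V where "V = Vfield f ((1/eps) *\<^sub>R x)"
 define s where "s = side eps h"
 define r where "r = norm X * remC * (h * sqrt h)"
 define k where "k = kp * (F + 1)"
 have h0: "0 <= h" using h by simp
 have r0: "r >= 0" using remC_nonneg h by (simp add: r_def)
 have nV: "norm V <= F" using norm_Vfield by (simp add: V_def)
 have s0: "s >= 0" using side_nonneg eps h by (simp add: s_def)
 have "T eps h \<psi> x < T eps h \<psi> x + h\<^sup>2" using h by simp
 then obtain E where Ec: "E \<in> controls" and opt: "payoff s h \<psi> (drift eps h x) E < T eps h \<psi> x + h\<^sup>2"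
  unfolding s_def by (rule T_approx)
 note obt = that
 have suff: thesis if "Q' \<noteq> 0" "norm (Q' - Q) <= kp"
   "payoff s h \<psi> (drift eps h x) E >= \<psi> x - h * g - r" "g <= FG eps d f x Q' X + k" for Q' g
 proof (rule obt[OF that(1,2)])
  have "h * g <= h * (FG eps d f x Q' X + k)" using that h0 by (intro mult_left_mono)
  thus "T eps h \<psi> x >= \<psi> x - h * FG eps d f x Q' X - norm X * remC * (h * sqrt h) - h * kp * (F + 1) - h\<^sup>2"
   using that opt unfolding r_def[symmetric] by (simp add: k_def algebra_simps)
 qed
 show thesis
 proof (cases "orthogonal_transformation E")
  case False
  hence E0: "E = (%_. 0)" using Ec by (auto simp: controls_def)
  define Q' :: "(real^'n) \<times> real" where "Q' = (if Q = 0 then (0, kp) else Q)"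
  have Q': "Q' \<noteq> 0" "norm (Q' - Q) <= kp" using kp by (auto simp: Q'_def norm_Pair zero_prod_def)
  show thesis
  proof (rule suff[OF Q', of "V \<bullet> Q"])
   have "payoff s h \<psi> (drift eps h x) E = \<psi> (x + (- h *\<^sub>R V))" by (simp add: E0 drift_def V_def)
   moreover have "\<psi> (x + (- h *\<^sub>R V)) >= \<psi> x + Q \<bullet> (- h *\<^sub>R V) + 1/2 * (blinfun_apply X (- h *\<^sub>R V) \<bullet> (- h *\<^sub>R V))" by (rule exp)
   moreover have "1/2 * (blinfun_apply X (- h *\<^sub>R V) \<bullet> (- h *\<^sub>R V)) >= - r"
   proof -
    have "h * h * \<bar>blinfun_apply X V \<bullet> V\<bar> <= h * h * (norm X * (F * F))"
    proof (rule mult_left_mono)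
     have "norm X * norm V * norm V <= norm X * F * F" using nV F_nonneg
      by (intro mult_mono mult_left_mono) auto
     thus "\<bar>blinfun_apply X V \<bullet> V\<bar> <= norm X * (F * F)" using quadform_bound[of X V V] by (simp add: mult.assoc)
    qed (use h in auto)
    also have "\<dots> <= (h * sqrt h) * (norm X * (2 * remC))"
    proof (rule mult_mono)
     have "h <= sqrt h" using h by (metis mult_left_le_one_le real_le_rsqrt power2_eq_square less_imp_le)
     thus "h * h <= h * sqrt h" using h by (simp add: mult_left_mono)
     have "F * F <= (F + 1)\<^sup>2" using F_nonneg by (simp add: power2_eq_square algebra_simps)
     moreover have "0 <= sqrt (2 * CARD('n) * d) * (F + 1)" using F_nonneg d_pos by simp
     ultimately have "F * F <= 2 * remC" by (simp add: remC_def)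
     thus "norm X * (F * F) <= norm X * (2 * remC)" by (intro mult_left_mono) auto
    qed (use h in auto)
    finally have 1: "h * h * \<bar>blinfun_apply X V \<bullet> V\<bar> <= 2 * r" by (simp add: r_def algebra_simps)
    have "blinfun_apply X (- h *\<^sub>R V) \<bullet> (- h *\<^sub>R V) = (h * h) * (blinfun_apply X V \<bullet> V)"
     by (simp add: blinfun.minus_right blinfun.scaleR_right)
    moreover have "(h * h) * (blinfun_apply X V \<bullet> V) >= (h * h) * (- \<bar>blinfun_apply X V \<bullet> V\<bar>)"
     by (intro mult_left_mono) auto
    ultimately show ?thesis using 1 by simp
   qed
   moreover have "Q \<bullet> (- h *\<^sub>R V) = - (h * (V \<bullet> Q))" by (simp add: inner_commute)
   ultimately show "payoff s h \<psi> (drift eps h x) E >= \<psi> x - h * (V \<bullet> Q) - r" by linarith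
   have "V \<bullet> Q <= V \<bullet> Q' + k"
   proof (cases "Q = 0")
    case True
    have "- (V \<bullet> Q') <= norm V * norm Q'" using Cauchy_Schwarz_ineq2[of V Q'] by linarith
    also have "\<dots> <= F * kp" using True kp nV F_nonneg by (intro mult_mono) (auto simp: Q'_def norm_Pair)
    also have "\<dots> <= k" using kp by (simp add: k_def algebra_simps)
    finally show ?thesis using True by simp
   next
    case False
    thus ?thesis using kp F_nonneg by (simp add: Q'_def k_def)
   qed
   thus "V \<bullet> Q <= FG eps d f x Q' X + k" unfolding FG_alt[OF Q'(1)] V_def[symmetric] by linarith
  qed
 next
  case E: True
  define \<nu> where "\<nu> = E (0, 1)"
  have lin: "linear E" using E by (simp only: orthogonal_transformation_def)
  have inE: "E v \<bullet> E w = v \<bullet> w" for v w using E by (simp only: orthogonal_transformation_def)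
  have nE: "norm (E v) = norm v" for v using E orthogonal_transformation_norm by blast
  have n\<nu>: "norm \<nu> = 1" by (simp add: \<nu>_def nE norm_Pair)
  define m where "m = eps * d * (op_trace X - blinfun_apply X \<nu> \<bullet> \<nu>)"
  \<comment> \<open>The total tangential gradient in the frame. It measures both the opponent's
    first-order gain and the deviation of the frame's normal from the direction of
    \<open>Q\<close>.\<close>
  define t where "t = (\<Sum>i\<in>(UNIV::'n set). \<bar>Q \<bullet> E (axis i 1, 0)\<bar>)"
  have t0: "t >= 0" by (simp add: t_def sum_nonneg)
  have pay: "payoff s h \<psi> (drift eps h x) E >= \<psi> x - h * (V \<bullet> Q + Q \<bullet> \<nu>) + (s / CARD('n)) * t + h * m - r"
  proof -
   have "(\<Sum>i\<in>(UNIV::'n set). ((\<psi> x - h * (V \<bullet> Q + Q \<bullet> \<nu>) - r) + s\<^sup>2 / 2 * (blinfun_apply X (E (axis i 1, 0)) \<bullet> E (axis i 1, 0)))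
     + s * \<bar>Q \<bullet> E (axis i 1, 0)\<bar>) / CARD('n) <= payoff s h \<psi> (drift eps h x) E"
   proof (rule payoff_ge)
    fix i :: 'n
    define e where "e = E (axis i 1, 0)"
    define b where "b = V + \<nu>"
    define sig :: real where "sig = (if Q \<bullet> e >= 0 then 1 else -1)"
    have sig: "\<bar>sig\<bar> = 1" "sig * (Q \<bullet> e) = \<bar>Q \<bullet> e\<bar>" by (auto simp: sig_def)
    have ne: "norm e = 1" by (simp add: e_def nE norm_Pair)
    have nb: "norm b <= F + 1" unfolding b_def using norm_triangle_ineq[of V \<nu>] nV n\<nu> by simp
    have "\<psi> (drift eps h x + E (move s h i sig)) = \<psi> (x + ((sig * s) *\<^sub>R e - h *\<^sub>R b))"
     unfolding drift_move[OF lin] by (simp add: e_def b_def V_def \<nu>_def)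
    moreover have "\<psi> (x + ((sig * s) *\<^sub>R e - h *\<^sub>R b)) >= \<psi> x + Q \<bullet> ((sig * s) *\<^sub>R e - h *\<^sub>R b) + 1/2 * (blinfun_apply X ((sig * s) *\<^sub>R e - h *\<^sub>R b) \<bullet> ((sig * s) *\<^sub>R e - h *\<^sub>R b))"
     by (rule exp)
    moreover have "Q \<bullet> ((sig * s) *\<^sub>R e - h *\<^sub>R b) = s * \<bar>Q \<bullet> e\<bar> - h * (V \<bullet> Q + Q \<bullet> \<nu>)"
     by (simp add: inner_diff_right b_def inner_add_right inner_commute algebra_simps flip: sig(2))
    moreover have "1/2 * (blinfun_apply X ((sig * s) *\<^sub>R e - h *\<^sub>R b) \<bullet> ((sig * s) *\<^sub>R e - h *\<^sub>R b)) >= s\<^sup>2 / 2 * (blinfun_apply X e \<bullet> e) - r"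
     using quad_remainder[OF ne nb sig(1) eps h0 h(2), of X] by (simp add: s_def r_def abs_le_iff)
    ultimately have "\<psi> (drift eps h x + E (move s h i sig)) >= (\<psi> x - h * (V \<bullet> Q + Q \<bullet> \<nu>) - r) + s\<^sup>2 / 2 * (blinfun_apply X e \<bullet> e) + s * \<bar>Q \<bullet> e\<bar>"
     by simp
    thus "\<exists>sig. \<bar>sig\<bar> = 1 \<and> (\<psi> x - h * (V \<bullet> Q + Q \<bullet> \<nu>) - r) + s\<^sup>2 / 2 * (blinfun_apply X (E (axis i 1, 0)) \<bullet> E (axis i 1, 0))
     + s * \<bar>Q \<bullet> E (axis i 1, 0)\<bar> <= \<psi> (drift eps h x + E (move s h i sig))"
     using sig(1) unfolding e_def by blast
   qed
   thus ?thesis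
    unfolding sum.distrib[of _ "%i. s * \<bar>Q \<bullet> E (axis i 1, 0)\<bar>"] add_divide_distrib
     average_trace[OF E eps(1) h0, folded s_def] sum_distrib_left[symmetric] t_def[symmetric] m_def[symmetric] \<nu>_def[symmetric]
    by (simp add: m_def)
  qed
  show thesis
  proof (cases "norm Q < kp / 2")
   case True
   \<comment> \<open>With this gradient the unit normal is exactly the normal of the chosen frame,
     so the two curvature terms coincide.\<close>
   define Q' where "Q' = (kp / 2) *\<^sub>R \<nu>"
   have nQ': "norm Q' = kp / 2" using kp n\<nu> by (simp add: Q'_def)
   have Q'0: "Q' \<noteq> 0" using nQ' kp by auto
   have sg: "sgn Q' = \<nu>" using kp n\<nu> by (simp add: Q'_def sgn_div_norm)
   have "norm (Q' - Q) <= kp" using norm_triangle_ineq4[of Q' Q] True nQ' by simp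
   thus thesis
   proof (rule suff[OF Q'0])
    have "h * (V \<bullet> Q + Q \<bullet> \<nu> - m) = h * (V \<bullet> Q + Q \<bullet> \<nu>) - h * m" by (simp add: algebra_simps)
    moreover have "(s / CARD('n)) * t >= 0" using s0 t0 by simp
    ultimately show "payoff s h \<psi> (drift eps h x) E >= \<psi> x - h * (V \<bullet> Q + Q \<bullet> \<nu> - m) - r"
     using pay by linarith
    have "V \<bullet> Q <= F * (kp / 2)"
     using Cauchy_Schwarz_ineq2[of V Q] mult_mono[OF nV, of "norm Q" "kp/2"] True F_nonneg by simp
    moreover have "Q \<bullet> \<nu> <= kp / 2" using Cauchy_Schwarz_ineq2[of Q \<nu>] n\<nu> True by simp
    moreover have "- (V \<bullet> Q') <= F * (kp / 2)"
    proof -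
     have "norm V * norm Q' <= F * (kp / 2)" unfolding nQ' using nV kp by (intro mult_right_mono) auto
     thus ?thesis using Cauchy_Schwarz_ineq2[of V Q'] by linarith
    qed
    moreover have "k = F * (kp / 2) + F * (kp / 2) + kp" by (simp add: k_def algebra_simps)
    moreover have "max (kp / 2 - m) 0 >= kp / 2 - m" by simp
    ultimately show "V \<bullet> Q + Q \<bullet> \<nu> - m <= FG eps d f x Q' X + k"
     unfolding FG_alt[OF Q'0] sg V_def[symmetric] m_def[symmetric] nQ' using kp by linarith
   qed
  next
   case False
   hence nQ: "norm Q >= kp / 2" by simp
   hence Q0: "Q \<noteq> 0" using kp by auto
   define x0 where "x0 = blinfun_apply X (sgn Q) \<bullet> sgn Q"
   have tang: "norm (Q - (Q \<bullet> \<nu>) *\<^sub>R \<nu>) <= t"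
   proof -
    have "surj E" using E orthogonal_transformation_surj by blast
    then obtain a where a: "Q = E a" by (metis surjD)
    have "Q \<bullet> \<nu> = snd a" by (cases a) (simp add: a \<nu>_def inE)
    moreover have "E (fst a, 0) = E (a - snd a *\<^sub>R (0, 1))" by (cases a) simp
    ultimately have "Q - (Q \<bullet> \<nu>) *\<^sub>R \<nu> = E (fst a, 0)"
     by (simp only: a \<nu>_def linear_diff[OF lin] linear_cmul[OF lin])
    hence "norm (Q - (Q \<bullet> \<nu>) *\<^sub>R \<nu>) = norm (fst a)" by (simp add: nE norm_Pair)
    also have "\<dots> <= (\<Sum>i\<in>UNIV. \<bar>fst a $ i\<bar>)" by (rule norm_le_l1_cart)
    also have "\<dots> = t" unfolding t_def
    proof (rule sum.cong[OF refl])
     fix i :: 'n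
     have "Q \<bullet> E (axis i 1, 0) = a \<bullet> (axis i 1, 0)" by (simp only: a inE)
     also have "\<dots> = fst a $ i" by (cases a) (simp add: inner_axis)
     finally show "\<bar>fst a $ i\<bar> = \<bar>Q \<bullet> E (axis i 1, 0)\<bar>" by simp
    qed
    finally show ?thesis .
   qed
   have key: "\<bar>blinfun_apply X \<nu> \<bullet> \<nu> - x0\<bar> <= 2 * norm X * (2 * t / norm Q)"
   proof (cases "Q \<bullet> \<nu> = 0")
    case True
    hence "norm Q <= t" using tang by simp
    hence "2 <= 2 * t / norm Q" using Q0 by (simp add: divide_simps)
    moreover have "norm (\<nu> - sgn Q) <= 2" using norm_triangle_ineq4[of \<nu> "sgn Q"] n\<nu> Q0 by (simp add: norm_sgn)
    ultimately have "norm (\<nu> - sgn Q) <= 2 * t / norm Q" by simp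
    hence "2 * norm X * norm (\<nu> - sgn Q) <= 2 * norm X * (2 * t / norm Q)" by (intro mult_left_mono) auto
    thus ?thesis using quadform_diff[of \<nu> "sgn Q" X] n\<nu> Q0 by (simp add: norm_sgn x0_def)
   next
    case nz: False
    \<comment> \<open>The projection of \<open>Q\<close> on the line of \<nu> may point opposite to
      \<nu>; the quadratic form is even, so only the line matters.\<close>
    define u where "u = (Q \<bullet> \<nu>) *\<^sub>R \<nu>"
    have "\<nu> \<noteq> 0" using n\<nu> by auto
    hence u0: "u \<noteq> 0" using nz by (simp add: u_def)
    have "sgn u = sgn (Q \<bullet> \<nu>) *\<^sub>R \<nu>" using n\<nu> by (simp add: u_def sgn_div_norm sgn_if)
    hence xu: "blinfun_apply X (sgn u) \<bullet> sgn u = blinfun_apply X \<nu> \<bullet> \<nu>"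
     using nz by (simp add: blinfun.scaleR_right sgn_if blinfun.minus_right)
    have "norm (sgn u - sgn Q) <= 2 * norm (u - Q) / norm Q"
     using normalized_diff_bound[OF u0 Q0] by (simp add: sgn_div_norm)
    also have "\<dots> <= 2 * t / norm Q" using tang Q0 by (simp add: u_def norm_minus_commute divide_right_mono)
    finally have "2 * norm X * norm (sgn u - sgn Q) <= 2 * norm X * (2 * t / norm Q)" by (intro mult_left_mono) auto
    thus ?thesis using quadform_diff[of "sgn u" "sgn Q" X] u0 Q0 xu by (simp add: norm_sgn x0_def)
   qed
   have "norm (Q - Q) <= kp" using kp by simp
   thus thesis
   proof (rule suff[OF Q0])
    define m0 where "m0 = eps * d * (op_trace X - x0)"
    \<comment> \<open>The constant \<open>8\<close> in \<open>small\<close> originates here: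
      \<open>2\<close> from the quadratic form, \<open>2\<close> from normalising, and
      \<open>2\<close> from \<open>norm Q >= kp / 2\<close>.\<close>
    have "h * (m0 - m) <= (s / CARD('n)) * t"
    proof -
     have "h * (m0 - m) = h * (eps * d) * (blinfun_apply X \<nu> \<bullet> \<nu> - x0)" by (simp add: m0_def m_def algebra_simps)
     also have "\<dots> <= h * (eps * d) * (2 * norm X * (2 * t / norm Q))"
      using key h eps d_pos by (intro mult_left_mono) (auto simp: abs_le_iff)
     also have "\<dots> <= h * (eps * d) * (2 * norm X * (2 * t / (kp / 2)))"
      using h eps d_pos nQ kp t0 by (intro mult_left_mono divide_left_mono mult_pos_pos) auto
     also have "\<dots> = (8 * eps * d * norm X * CARD('n) * h) * (t / (kp * CARD('n)))" using kp by (simp add: field_simps)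
     also have "\<dots> <= (kp * side eps h) * (t / (kp * CARD('n)))"
      using small t0 kp by (intro mult_right_mono) auto
     also have "\<dots> = (s / CARD('n)) * t" using kp by (simp add: s_def field_simps)
     finally show ?thesis .
    qed
    moreover have "h * (V \<bullet> Q + Q \<bullet> \<nu> - m0) = h * (V \<bullet> Q + Q \<bullet> \<nu>) - h * m0"
     "h * (m0 - m) = h * m0 - h * m" by (simp_all add: algebra_simps)
    ultimately show "payoff s h \<psi> (drift eps h x) E >= \<psi> x - h * (V \<bullet> Q + Q \<bullet> \<nu> - m0) - r"
     using pay by linarith
    have "Q \<bullet> \<nu> <= norm Q" using Cauchy_Schwarz_ineq2[of Q \<nu>] n\<nu> by simp
    moreover have "k >= 0" using kp F_nonneg by (simp add: k_def)
    ultimately show "V \<bullet> Q + Q \<bullet> \<nu> - m0 <= FG eps d f x Q X + k"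
     unfolding FG_alt[OF Q0] V_def[symmetric] x0_def[symmetric] m0_def[symmetric] by linarith
   qed
  qed
 qed
qed

end

section \<open>Moduli of continuity and growth of the iterates\<close>

text \<open>A modulus with respect to a distance that charges differences in \<open>x'\<close>
  extra. It is adapted to the shear: identical moves from two points preserve the difference in
  \<open>x'\<close>, and the drift changes the separation only in proportion to that
  difference.\<close>

definition skew_modulus :: "real => real => real => ((real^'n) \<times> real => real) => bool" where
 "skew_modulus kp \<delta> e u \<longleftrightarrow>
  (\<forall>x y. dist x y + kp * norm (fst x - fst y) <= \<delta> --> u x <= u y + e)"

text \<open>The segment is cut into \<open>N + 1\<close> pieces of length at most \<delta>, with
  \<open>N <= dist x y / \<delta>\<close>, and \<open>N <= N^2\<close>. The resulting quadratic
  bound allows uniformly continuous data to be compared with paraboloids, whose evolution is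
  explicit.\<close>

lemma uniformly_continuous_quadratic:
 fixes g :: "'a::real_normed_vector => real"
 assumes \<delta>: "\<delta> > 0" and e: "e >= 0" and g: "!!x y. dist x y <= \<delta> ==> g x <= g y + e"
 shows "g x <= g y + e + e / \<delta>\<^sup>2 * (dist x y)\<^sup>2"
proof -
 define r where "r = dist x y"
 define N where "N = nat \<lfloor>r / \<delta>\<rfloor>"
 have r0: "r >= 0" by (simp add: r_def)
 have N1: "real N <= r / \<delta>" using r0 \<delta> by (simp add: N_def)
 have "r / \<delta> < real (Suc N)" using r0 \<delta> by (simp add: N_def) linarith
 hence N2: "r / real (Suc N) <= \<delta>" using \<delta> by (simp add: field_simps)
 define p where "p k = y + (real k / real (Suc N)) *\<^sub>R (x - y)" for k
 have step: "g (p (Suc k)) <= g (p k) + e" for k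
 proof (rule g)
  have "p (Suc k) - p k = (1 / real (Suc N)) *\<^sub>R (x - y)"
   by (simp add: p_def scaleR_diff_left[symmetric] diff_divide_distrib[symmetric])
  hence "dist (p (Suc k)) (p k) = r / real (Suc N)" by (simp add: dist_norm r_def)
  thus "dist (p (Suc k)) (p k) <= \<delta>" using N2 by simp
 qed
 have "g (p k) <= g y + k * e" for k
 proof (induction k)
  case 0
  show ?case by (simp add: p_def)
 next
  case (Suc k)
  thus ?case using step[of k] by (simp add: algebra_simps)
 qed
 from this[of "Suc N"] have "g x <= g y + (real N + 1) * e" by (simp add: p_def add.commute)
 moreover have "real N * e <= (r / \<delta>)\<^sup>2 * e"
 proof (rule mult_right_mono[OF _ e])
  have "real N <= (real N)\<^sup>2" by (cases N) (simp_all add: power2_eq_square)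
  also have "\<dots> <= (r / \<delta>)\<^sup>2" using N1 by (intro power_mono) auto
  finally show "real N <= (r / \<delta>)\<^sup>2" .
 qed
 ultimately show ?thesis by (simp add: r_def algebra_simps power_divide)
qed

context shear_game
begin

text \<open>The same control is played from both points. The drift separates them by at most
  \<open>h * (L / eps)\<close> times the unchanged difference in \<open>x'\<close>, which the
  enlarged weight pays for; \<delta> and \<open>e\<close> do not deteriorate.\<close>

lemma T_skew_modulus:
 assumes u: "locally_bdd u" "skew_modulus kp \<delta> e u" and "0 < eps" "0 <= h" "kp >= 0"
 shows "skew_modulus (kp + h * (L / eps)) \<delta> e (T eps h u)"
 unfolding skew_modulus_def
proof (intro allI impI)
 fix x y :: "(real^'n) \<times> real"
 assume le: "dist x y + (kp + h * (L / eps)) * norm (fst x - fst y) <= \<delta>"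
 have shift: "u (drift eps h x + v) <= u (drift eps h y + v) + e" for v
 proof -
  define V where "V z = Vfield f ((1/eps) *\<^sub>R z)" for z
  have "norm (V x - V y) <= L * norm (fst ((1/eps) *\<^sub>R x) - fst ((1/eps) *\<^sub>R y))"
   unfolding V_def by (rule Vfield_lip)
  also have "fst ((1/eps) *\<^sub>R x) - fst ((1/eps) *\<^sub>R y) = (1/eps) *\<^sub>R (fst x - fst y)" by (simp add: scaleR_diff_right)
  finally have V: "norm (V x - V y) <= (L / eps) * norm (fst x - fst y)" using assms by simp
  have "dist (drift eps h x + v) (drift eps h y + v) = norm ((x - y) - h *\<^sub>R (V x - V y))"
   by (simp add: dist_norm drift_def V_def algebra_simps)
  also have "\<dots> <= dist x y + h * norm (V x - V y)"
   using norm_triangle_ineq4[of "x - y" "h *\<^sub>R (V x - V y)"] assms by (simp add: dist_norm)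
  also have "\<dots> <= dist x y + h * ((L / eps) * norm (fst x - fst y))"
   using mult_left_mono[OF V assms(4)] by simp
  finally have 1: "dist (drift eps h x + v) (drift eps h y + v) <= dist x y + h * ((L / eps) * norm (fst x - fst y))" .
  have 2: "fst (drift eps h x + v) - fst (drift eps h y + v) = fst x - fst y"
   by (simp add: drift_def Vfield_def)
  have "dist (drift eps h x + v) (drift eps h y + v) + kp * norm (fst (drift eps h x + v) - fst (drift eps h y + v)) <= \<delta>"
   unfolding 2 using 1 le by (simp add: algebra_simps)
  thus ?thesis using u(2) unfolding skew_modulus_def by blast
 qed
 have "T eps h u x - e <= T eps h u y"
 proof (rule T_ge)
  fix E :: "(real^'n) \<times> real => (real^'n) \<times> real" assume E: "E \<in> controls"
  have "T eps h u x <= payoff (side eps h) h u (drift eps h x) E" using T_le u assms E by auto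
  also have "\<dots> <= payoff (side eps h) h u (drift eps h y) E + e"
   by (rule payoff_mono) (rule shift)
  finally show "T eps h u x - e <= payoff (side eps h) h u (drift eps h y) E" by simp
 qed
 thus "T eps h u x <= T eps h u y + e" by simp
qed

definition growthC :: real where
 "growthC = 2 * (F + 1)\<^sup>2 + 2 * CARD('n) * d"

lemma growthC_nonneg: "growthC >= 0"
 using d_pos by (simp add: growthC_def)

lemma sq_drift_bound:
 fixes a b :: "'b::real_normed_vector"
 assumes "norm b <= F + 1" "0 <= h" "h <= 1"
 shows "(norm (a - h *\<^sub>R b))\<^sup>2 <= (1 + h) * (norm a)\<^sup>2 + h * (2 * (F + 1)\<^sup>2)"
proof -
 define A where "A = norm a"
 have "norm (a - h *\<^sub>R b) <= A + h * (F + 1)"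
  using norm_triangle_ineq4[of a "h *\<^sub>R b"] mult_left_mono[OF assms(1), of h] assms(2) by (simp add: A_def)
 hence "(norm (a - h *\<^sub>R b))\<^sup>2 <= (A + h * (F + 1))\<^sup>2" by (intro power_mono) auto
 also have "\<dots> = A\<^sup>2 + h * (2 * A * (F + 1)) + (h * h) * (F + 1)\<^sup>2"
  by (simp add: power2_eq_square algebra_simps)
 also have "\<dots> <= A\<^sup>2 + h * (A\<^sup>2 + (F + 1)\<^sup>2) + h * (F + 1)\<^sup>2"
 proof -
  have "2 * A * (F + 1) <= A\<^sup>2 + (F + 1)\<^sup>2" by (rule sum_squares_bound)
  moreover have "h * h <= h" using assms by (simp add: mult_left_le)
  ultimately show ?thesis using assms by (intro add_mono mult_left_mono mult_right_mono) auto
 qed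
 finally show ?thesis by (simp add: A_def algebra_simps)
qed

text \<open>For the upper bound the minimiser stays put; for the lower bound the opponent steers
  towards the centre. In both cases the squared distance grows by a factor \<open>1 + h\<close> and
  an increment \<open>growthC * h\<close> that does not depend on \<open>eps\<close>, which makes
  the estimates near the initial time uniform in \<open>eps\<close>.\<close>

lemma T_growth:
 assumes "0 <= eps" "eps <= 1" "0 <= h" "h <= 1" "B >= 0"
 shows "T eps h (%y. a + B * (dist y x)\<^sup>2) y <= a + B * ((1 + h) * (dist y x)\<^sup>2 + growthC * h)"
  and "T eps h (%y. a - B * (dist y x)\<^sup>2) y >= a - B * ((1 + h) * (dist y x)\<^sup>2 + growthC * h)"
proof -
 define V where "V = Vfield f ((1/eps) *\<^sub>R y)"
 define s where "s = side eps h"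
 have nV: "norm V <= F" using norm_Vfield by (simp add: V_def)
 have s2: "s\<^sup>2 <= 2 * CARD('n) * d * h"
 proof -
  have "2 * CARD('n) * d * eps * h <= 2 * CARD('n) * d * 1 * h"
   using assms d_pos by (intro mult_right_mono mult_left_mono) auto
  thus ?thesis using assms by (simp add: s_def side_sq)
 qed
 have dn: "0 <= 2 * CARD('n) * d * h" using d_pos assms by simp
 have lb: "locally_bdd (%y. a + B * (dist y x)\<^sup>2)"
  by (intro locally_bdd_continuous continuous_intros)
 have "T eps h (%y. a + B * (dist y x)\<^sup>2) y <= a + B * (dist (drift eps h y) x)\<^sup>2"
  using T_le[OF lb assms(1,3), of "%_. 0" y] by (simp add: controls_def)
 also have "dist (drift eps h y) x = norm ((y - x) - h *\<^sub>R V)" by (simp add: dist_norm drift_def V_def algebra_simps)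
 also have "(norm ((y - x) - h *\<^sub>R V))\<^sup>2 <= (1 + h) * (dist y x)\<^sup>2 + growthC * h"
  using sq_drift_bound[of V h "y - x"] nV assms dn by (simp add: growthC_def dist_norm algebra_simps)
 finally show "T eps h (%y. a + B * (dist y x)\<^sup>2) y <= a + B * ((1 + h) * (dist y x)\<^sup>2 + growthC * h)"
  using assms by (simp add: mult_left_mono)
 show "T eps h (%y. a - B * (dist y x)\<^sup>2) y >= a - B * ((1 + h) * (dist y x)\<^sup>2 + growthC * h)"
 proof (rule T_ge)
  fix E :: "(real^'n) \<times> real => (real^'n) \<times> real" assume E: "E \<in> controls"
  have lin: "linear E" using E by (rule controls_linear)
  show "a - B * ((1 + h) * (dist y x)\<^sup>2 + growthC * h) <= payoff (side eps h) h (%y. a - B * (dist y x)\<^sup>2) (drift eps h y) E"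
  proof (rule payoff_ge_const)
   fix i :: 'n
   define e where "e = E (axis i 1, 0)"
   define b where "b = V + E (0, 1)"
   define p where "p = (y - x) - h *\<^sub>R b"
   have ne: "norm e <= 1" using controls_norm_le[OF E, of "(axis i 1, 0)"] by (simp add: e_def norm_Pair)
   have "norm (E (0, 1)) <= 1" using controls_norm_le[OF E, of "(0, 1)"] by (simp add: norm_Pair)
   hence nb: "norm b <= F + 1" unfolding b_def using norm_triangle_ineq[of V "E (0, 1)"] nV by simp
   \<comment> \<open>The opponent moves towards \<open>x\<close>: the cross term becomes nonpositive
     and only \<open>s^2\<close> is added.\<close>
   define sig :: real where "sig = (if p \<bullet> e <= 0 then 1 else -1)"
   have sig: "\<bar>sig\<bar> = 1" "sig * (p \<bullet> e) <= 0" "sig * sig = 1" by (auto simp: sig_def)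
   have s0: "s >= 0" using side_nonneg assms by (simp add: s_def)
   have "(dist (drift eps h y + E (move s h i sig)) x)\<^sup>2 = (norm (p + (sig * s) *\<^sub>R e))\<^sup>2"
    unfolding drift_move[OF lin] by (simp add: dist_norm p_def e_def b_def V_def algebra_simps)
   also have "\<dots> = (norm p)\<^sup>2 + 2 * s * (sig * (p \<bullet> e)) + (sig * sig) * s\<^sup>2 * (norm e)\<^sup>2"
    by (simp add: power2_norm_eq_inner inner_add_left inner_add_right inner_commute algebra_simps)
     (simp add: power2_eq_square algebra_simps)
   also have "\<dots> <= (norm p)\<^sup>2 + 0 + s\<^sup>2 * 1"
   proof (intro add_mono)
    show "2 * s * (sig * (p \<bullet> e)) <= 0" using s0 sig(2) by (simp add: mult_nonneg_nonpos)
    have "(norm e)\<^sup>2 <= 1" using ne by (simp add: power_le_one)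
    thus "(sig * sig) * s\<^sup>2 * (norm e)\<^sup>2 <= s\<^sup>2 * 1" unfolding sig(3) by (simp add: mult_left_le)
   qed simp
   also have "\<dots> <= (1 + h) * (norm (y - x))\<^sup>2 + h * (2 * (F + 1)\<^sup>2) + 2 * CARD('n) * d * h"
    using sq_drift_bound[OF nb assms(3,4), of "y - x"] s2 by (simp add: p_def)
   also have "\<dots> = (1 + h) * (dist y x)\<^sup>2 + growthC * h" by (simp add: growthC_def dist_norm algebra_simps)
   finally have "B * (dist (drift eps h y + E (move s h i sig)) x)\<^sup>2 <= B * ((1 + h) * (dist y x)\<^sup>2 + growthC * h)"
    using assms(5) by (intro mult_left_mono)
   thus "\<exists>sig. \<bar>sig\<bar> = 1 \<and> a - B * ((1 + h) * (dist y x)\<^sup>2 + growthC * h)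
     <= a - B * (dist (drift eps h y + E (move (side eps h) h i sig)) x)\<^sup>2"
    using sig(1) unfolding s_def by (intro exI[of _ sig]) auto
  qed
 qed
qed

lemma iterate_locally_bdd:
 assumes "0 <= eps" "0 <= h" "locally_bdd u"
 shows "locally_bdd ((T eps h ^^ k) u)"
 by (induction k) (simp_all add: assms T_locally_bdd)

lemma iterate_skew_modulus:
 assumes "locally_bdd u" "skew_modulus 0 \<delta> e u" and "0 < eps" "0 <= h"
 shows "skew_modulus (k * h * (L / eps)) \<delta> e ((T eps h ^^ k) u)"
proof (induction k)
 case (Suc k)
 have "skew_modulus (k * h * (L / eps) + h * (L / eps)) \<delta> e (T eps h ((T eps h ^^ k) u))"
  by (rule T_skew_modulus) (use assms Suc iterate_locally_bdd L_nonneg in auto)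
 thus ?case by (simp add: algebra_simps)
qed (use assms in simp)

lemma iterate_growth:
 assumes eps: "0 <= eps" "eps <= 1" and h: "0 <= h" "h <= 1" and "B >= 0"
  and u: "locally_bdd u" and le: "!!y. \<bar>u y - u x\<bar> <= a + B * (dist y x)\<^sup>2"
 shows "\<bar>(T eps h ^^ k) u x - u x\<bar> <= a + B * (growthC * (k * h) * exp (k * h))"
proof -
 define q where "q k y = (1 + h) ^ k * ((dist y x)\<^sup>2 + growthC * (real k * h))" for k :: nat and y
 have step: "(1 + h) ^ k * ((1 + h) * (dist y x)\<^sup>2 + growthC * h) + (1 + h) ^ k * (growthC * (real k * h)) <= q (Suc k) y" for k y
 proof -
  have a: "(1 + h) ^ k * (growthC * h + growthC * (real k * h)) <= (1 + h) ^ Suc k * (growthC * (real (Suc k) * h))"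
  proof -
   have "(1 + h) ^ k <= (1 + h) ^ Suc k" using h by (intro power_increasing) auto
   hence "(1 + h) ^ k * (growthC * (real (Suc k) * h)) <= (1 + h) ^ Suc k * (growthC * (real (Suc k) * h))"
    using h growthC_nonneg by (intro mult_right_mono) auto
   thus ?thesis by (simp add: algebra_simps)
  qed
  thus ?thesis by (simp add: q_def algebra_simps)
 qed
 have upper: "(T eps h ^^ k) u y <= u x + a + B * q k y" for k y
 proof (induction k arbitrary: y)
  case 0
  thus ?case using le[of y] by (simp add: q_def abs_le_iff)
 next
  case (Suc k)
  define c where "c = a + u x + B * ((1 + h) ^ k * (growthC * (real k * h)))"
  have "(T eps h ^^ Suc k) u y = T eps h ((T eps h ^^ k) u) y" by simp
  also have "\<dots> <= T eps h (%y. c + (B * (1 + h) ^ k) * (dist y x)\<^sup>2) y + 0"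
  proof (rule T_mono[OF eps(1) h(1) iterate_locally_bdd[OF eps(1) h(1) u]])
   show "locally_bdd (%y. c + (B * (1 + h) ^ k) * (dist y x)\<^sup>2)"
    by (intro locally_bdd_continuous continuous_intros)
   show "(T eps h ^^ k) u y <= c + (B * (1 + h) ^ k) * (dist y x)\<^sup>2 + 0" for y
    using Suc[of y] by (simp add: q_def c_def algebra_simps)
  qed
  also have "\<dots> <= c + (B * (1 + h) ^ k) * ((1 + h) * (dist y x)\<^sup>2 + growthC * h)"
   using T_growth(1)[OF eps h, of "B * (1+h)^k" c x y] h assms(5) by simp
  also have "\<dots> = u x + a + B * ((1 + h) ^ k * ((1 + h) * (dist y x)\<^sup>2 + growthC * h) + (1 + h) ^ k * (growthC * (real k * h)))"
   by (simp add: c_def algebra_simps)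
  also have "\<dots> <= u x + a + B * q (Suc k) y" using step[of k y] assms(5) by (intro add_left_mono mult_left_mono)
  finally show ?case .
 qed
 have lower: "(T eps h ^^ k) u y >= u x - a - B * q k y" for k y
 proof (induction k arbitrary: y)
  case 0
  thus ?case using le[of y] by (simp add: q_def abs_le_iff)
 next
  case (Suc k)
  define c where "c = u x - a - B * ((1 + h) ^ k * (growthC * (real k * h)))"
  have "T eps h (%y. c - (B * (1 + h) ^ k) * (dist y x)\<^sup>2) y <= T eps h ((T eps h ^^ k) u) y + 0"
  proof (rule T_mono[OF eps(1) h(1) _ iterate_locally_bdd[OF eps(1) h(1) u]])
   show "locally_bdd (%y. c - (B * (1 + h) ^ k) * (dist y x)\<^sup>2)"
    by (intro locally_bdd_continuous continuous_intros)
   show "c - (B * (1 + h) ^ k) * (dist y x)\<^sup>2 <= (T eps h ^^ k) u y + 0" for y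
    using Suc[of y] by (simp add: q_def c_def algebra_simps)
  qed
  moreover have "c - (B * (1 + h) ^ k) * ((1 + h) * (dist y x)\<^sup>2 + growthC * h) <= T eps h (%y. c - (B * (1 + h) ^ k) * (dist y x)\<^sup>2) y"
   using T_growth(2)[OF eps h, of "B * (1+h)^k" c y x] h assms(5) by simp
  moreover have "c - (B * (1 + h) ^ k) * ((1 + h) * (dist y x)\<^sup>2 + growthC * h)
   = u x - a - B * ((1 + h) ^ k * ((1 + h) * (dist y x)\<^sup>2 + growthC * h) + (1 + h) ^ k * (growthC * (real k * h)))"
   by (simp add: c_def algebra_simps)
  moreover have "B * ((1 + h) ^ k * ((1 + h) * (dist y x)\<^sup>2 + growthC * h) + (1 + h) ^ k * (growthC * (real k * h))) <= B * q (Suc k) y"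
   using step[of k y] assms(5) by (intro mult_left_mono)
  ultimately show ?case by simp
 qed
 have "B * q k x <= B * (growthC * (k * h) * exp (k * h))"
 proof (rule mult_left_mono)
  have "(1 + h) ^ k <= exp h ^ k" using h by (intro power_mono) (auto simp: exp_ge_add_one_self)
  also have "\<dots> = exp (k * h)" by (simp add: exp_of_nat_mult)
  finally have "(1 + h) ^ k * (growthC * (k * h)) <= exp (k * h) * (growthC * (k * h))"
   using h growthC_nonneg by (intro mult_right_mono) auto
  thus "q k x <= growthC * (k * h) * exp (k * h)" by (simp add: q_def mult.commute)
 qed (use assms in auto)
 thus ?thesis using upper[of k x] lower[of k x] by (simp add: abs_le_iff)
qed

text \<open>For \<open>t <= 0\<close> the number of steps is \<open>nat\<close> of a nonpositive
  integer, hence zero, and the flow is the datum itself. It is thus defined for all real times, and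
  limits at \<open>t = 0\<close> need no boundary treatment.\<close>

definition flow :: "real => real => ((real^'n) \<times> real => real) => (real^'n) \<times> real => real => real" where
 "flow eps h g x t = (T eps h ^^ nat \<lfloor>t / h\<rfloor>) g x"

lemma flow_step:
 assumes "h > 0" "t >= h"
 shows "flow eps h g x t = T eps h (%y. flow eps h g y (t - h)) x"
proof -
 have "(t - h) / h = t / h - 1" using assms by (simp add: field_simps)
 hence "\<lfloor>t / h\<rfloor> = \<lfloor>(t - h) / h\<rfloor> + 1" by linarith
 moreover have "\<lfloor>(t - h) / h\<rfloor> >= 0" using assms by simp
 ultimately have "nat \<lfloor>t / h\<rfloor> = Suc (nat \<lfloor>(t - h) / h\<rfloor>)" by linarith
 thus ?thesis by (simp add: flow_def)
qed

lemma flow_nonpos: "h > 0 ==> t <= 0 ==> flow eps h g x t = g x"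
proof -
 assume "h > 0" "t <= 0"
 hence "t / h <= 0" by (simp add: divide_nonpos_pos)
 hence "nat \<lfloor>t / h\<rfloor> = 0" by linarith
 thus ?thesis by (simp add: flow_def)
qed

lemma nat_floor_step:
 fixes h t :: real
 assumes h: "h > 0"
 shows "real (nat \<lfloor>t / h\<rfloor>) * h <= max t 0"
proof -
 have "real (nat \<lfloor>t / h\<rfloor>) <= max t 0 / h"
 proof (cases "t >= 0")
  case True
  thus ?thesis using h by simp
 next
  case False
  hence "t / h <= 0" using h by (simp add: divide_nonpos_pos)
  hence "nat \<lfloor>t / h\<rfloor> = 0" by linarith
  thus ?thesis using h by simp
 qed
 thus ?thesis using h by (simp add: field_simps)
qed

end

section \<open>Testing monotone schemes with perturbed test functions\<close>

text \<open>The \<open>2 * e\<close> terms make the contact of the test function with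
  \<open>ubar\<close> strict. Near-maximum points of \<open>u j\<close> minus the test function
  therefore converge to the contact point even if the test function carries an oscillating
  perturbation \<open>W j\<close> of vanishing size, later a scaled corrector. The source
  \<open>c\<close> carries the zero-order term of the discounted problem. As \<open>S j\<close> acts
  in space only, the time part of the test function reduces to the number \<open>a\<close>, up to
  \<open>2 * e\<close>.\<close>

lemma discrete_test_sub:
 fixes u :: "nat => 'a::euclidean_space => real => real"
 assumes S: "!!j. local_mono (S j) (\<rho> j)" and \<rho>: "\<rho> \<longlonglongrightarrow> 0"
  and h: "!!j. h j > 0" "h \<longlonglongrightarrow> 0"
  and bd: "!!j R. \<exists>B. \<forall>x t. norm x <= R --> 0 <= t --> t <= R --> \<bar>u j x t\<bar> <= B"
  and step: "!!j x t. t >= h j ==> u j x t <= S j (%y. u j y (t - h j)) x + h j * c j x"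
  and upper: "!!x t e. t > 0 ==> e > 0 ==>
   \<exists>r>0. \<exists>J. \<forall>j\<ge>J. \<forall>y s. dist y x < r --> \<bar>s - t\<bar> < r --> u j y s < ubar x t + e"
  and attained: "!!e r J. e > 0 ==> r > 0 ==>
   \<exists>j\<ge>J. \<exists>y s. dist y x0 < r \<and> \<bar>s - t0\<bar> < r \<and> u j y s > ubar x0 t0 - e"
  and jet: "(a, P, X) \<in> par_superjet ubar x0 t0" and t0: "t0 > 0" and e: "e > 0"
  and W: "!!j y. \<bar>W j y\<bar> <= kp j" "kp \<longlonglongrightarrow> 0" and r: "r > 0"
 defines "\<psi> \<equiv> %j y. P \<bullet> (y - x0) + 1/2 * (blinfun_apply X (y - x0) \<bullet> (y - x0)) + 2 * e * (norm (y - x0))\<^sup>2 + W j y"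
 shows "\<exists>j\<ge>J. \<exists>y. dist y x0 < r \<and> \<psi> j y + h j * (a - 2 * e) - (h j)\<^sup>2 <= S j (\<psi> j) y + h j * c j y"
proof -
 \<comment> \<open>The absolute value in time matches the error term of parabolic jets. Over one
   step it changes by at most \<open>h j\<close>, which is the loss \<open>2 * e\<close> in the
   conclusion.\<close>
 define \<phi>0 where "\<phi>0 y s = a * (s - t0) + 2 * e * \<bar>s - t0\<bar> + P \<bullet> (y - x0)
  + 1/2 * (blinfun_apply X (y - x0) \<bullet> (y - x0)) + 2 * e * (norm (y - x0))\<^sup>2" for y and s :: real
 define \<phi> where "\<phi> j y s = \<phi>0 y s + W j y" for j y and s :: real
 have \<phi>\<psi>: "\<phi> j y s = a * (s - t0) + 2 * e * \<bar>s - t0\<bar> + \<psi> j y" for j y s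
  by (simp add: \<phi>_def \<phi>0_def \<psi>_def)
 have \<phi>0_cont: "continuous_on UNIV (%z. \<phi>0 (fst z) (snd z))"
  unfolding \<phi>0_def by (intro continuous_intros)
 obtain r1 where r1: "r1 > 0" and jet': "!!y s. s > 0 ==> dist y x0 < r1 ==> \<bar>s - t0\<bar> < r1 ==>
  ubar y s <= ubar x0 t0 + \<phi>0 y s - e * (\<bar>s - t0\<bar> + (norm (y - x0))\<^sup>2)"
 proof -
  from jet e obtain r1 where "r1 > 0" and
  *: "\<forall>y s. s > 0 --> dist y x0 < r1 --> \<bar>s - t0\<bar> < r1 -->
    ubar y s <= ubar x0 t0 + a * (s - t0) + P \<bullet> (y - x0)
       + (1/2) * (blinfun_apply X (y - x0) \<bullet> (y - x0)) + e * (\<bar>s - t0\<bar> + (norm (y - x0))\<^sup>2)"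
   unfolding par_superjet_def by blast
  show thesis
  proof (rule that[OF \<open>r1 > 0\<close>])
   fix y :: 'a and s :: real assume "s > 0" "dist y x0 < r1" "\<bar>s - t0\<bar> < r1"
   hence "ubar y s <= ubar x0 t0 + a * (s - t0) + P \<bullet> (y - x0)
       + (1/2) * (blinfun_apply X (y - x0) \<bullet> (y - x0)) + e * (\<bar>s - t0\<bar> + (norm (y - x0))\<^sup>2)"
    using * by blast
   thus "ubar y s <= ubar x0 t0 + \<phi>0 y s - e * (\<bar>s - t0\<bar> + (norm (y - x0))\<^sup>2)"
    by (simp add: \<phi>0_def algebra_simps)
  qed
 qed
 define r2 where "r2 = min (r1/2) (min (r/2) (t0/2))"
 have r2: "r2 > 0" "r2 < r1" "r2 < r" "r2 < t0" using r1 r t0 by (auto simp: r2_def min_def)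
 define K where "K = cball x0 r2 \<times> cball t0 r2"
 have Kc: "compact K" unfolding K_def by (intro compact_Times) auto
 define D where "D j z = u j (fst z) (snd z) - \<phi> j (fst z) (snd z)" for j z
 have Kpos: "snd z > 0" "dist (fst z) x0 <= r2" "\<bar>snd z - t0\<bar> <= r2" if "z \<in> K" for z
  using that r2 by (auto simp: K_def dist_real_def dist_commute abs_le_iff)
 have lb\<psi>: "locally_bdd (\<psi> j)" for j
 proof -
  have "locally_bdd (%y. P \<bullet> (y - x0) + 1/2 * (blinfun_apply X (y - x0) \<bullet> (y - x0)) + 2 * e * (norm (y - x0))\<^sup>2)"
   by (intro locally_bdd_continuous continuous_intros)
  from locally_bdd_add[OF this locally_bdd_bounded[of "W j" "kp j"]] W show ?thesis by (simp add: \<psi>_def)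
 qed
 have Dbdd: "bdd_above (D j ` K)" for j
 proof -
  define R where "R = norm x0 + r2 + t0"
  obtain B where B: "!!x t. norm x <= R ==> 0 <= t ==> t <= R ==> \<bar>u j x t\<bar> <= B" using bd by blast
  have "bounded ((%z. \<phi>0 (fst z) (snd z)) ` K)"
   by (intro compact_imp_bounded compact_continuous_image continuous_on_subset[OF \<phi>0_cont] Kc) auto
  then obtain C where C: "!!z. z \<in> K ==> \<bar>\<phi>0 (fst z) (snd z)\<bar> <= C" by (auto simp: bounded_iff)
  have "D j z <= B + C + kp j" if "z \<in> K" for z
  proof -
   have "norm (fst z) <= R" using norm_triangle_ineq2[of "fst z" x0] Kpos[OF that] t0 by (simp add: R_def dist_norm)
   moreover have "snd z <= R" using Kpos(3)[OF that] norm_ge_zero[of x0] unfolding R_def by linarith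
   ultimately have "\<bar>u j (fst z) (snd z)\<bar> <= B" using B Kpos[OF that] by simp
   thus ?thesis using C[OF that] W(1)[of j "fst z"] by (simp add: D_def \<phi>_def abs_le_iff)
  qed
  thus ?thesis by (intro bdd_aboveI2) auto
 qed
 have Kne: "K \<noteq> {}" using r2 by (auto simp: K_def)
 \<comment> \<open>\<open>u j\<close> and \<open>W j\<close> are only bounded, so a maximum need not
   exist. The slack \<open>h^2\<close> is negligible after division by the step.\<close>
 have near_max: "\<exists>z\<in>K. \<forall>z'\<in>K. D j z' <= D j z + (h j)\<^sup>2" for j
 proof -
  have "Sup (D j ` K) - (h j)\<^sup>2 < Sup (D j ` K)" using h(1)[of j] by simp
  hence "\<exists>v\<in>D j ` K. Sup (D j ` K) - (h j)\<^sup>2 < v"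
   by (subst (asm) less_cSup_iff) (use Kne Dbdd in auto)
  then obtain z where z: "z \<in> K" "Sup (D j ` K) - (h j)\<^sup>2 < D j z" by blast
  hence "D j z' <= D j z + (h j)\<^sup>2" if "z' \<in> K" for z'
   using cSup_upper[OF _ Dbdd, of "D j z'" j] that by fastforce
  thus ?thesis using z by blast
 qed
 define zm where "zm j = (SOME z. z \<in> K \<and> (\<forall>z'\<in>K. D j z' <= D j z + (h j)\<^sup>2))" for j
 have zm: "zm j \<in> K" "!!z'. z' \<in> K ==> D j z' <= D j (zm j) + (h j)\<^sup>2" for j
  using someI_ex[OF near_max[of j, unfolded Bex_def]] unfolding zm_def[symmetric] by auto
 have "\<exists>j\<ge>max J m. \<exists>y s. dist y x0 < min (inverse (Suc m)) r2 \<and> \<bar>s - t0\<bar> < min (inverse (Suc m)) r2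
  \<and> u j y s > ubar x0 t0 - inverse (Suc m)" for m
  by (rule attained) (use r2 in auto)
 then obtain jm ym sm where jm: "!!m. jm m >= max J m"
  and ym: "!!m. dist (ym m) x0 < min (inverse (Suc m)) r2" "!!m. \<bar>sm m - t0\<bar> < min (inverse (Suc m)) r2"
  and um: "!!m. u (jm m) (ym m) (sm m) > ubar x0 t0 - inverse (Suc m)"
  by metis
 have jm_lim: "filterlim jm at_top sequentially"
  using jm by (intro filterlim_at_top_mono[OF filterlim_ident]) auto
 have lim_jm: "(%m. q (jm m)) \<longlonglongrightarrow> 0" if "q \<longlonglongrightarrow> 0" for q :: "nat => real"
  using filterlim_compose[OF that jm_lim] .
 have inv_lim: "(%m. inverse (real (Suc m))) \<longlonglongrightarrow> 0" by (rule LIMSEQ_inverse_real_of_nat)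
 have "\<forall>m. zm (jm m) \<in> K" using zm(1) by blast
 then obtain l \<alpha> where l: "l \<in> K" and \<alpha>: "strict_mono \<alpha>" and lim: "((%m. zm (jm m)) \<circ> \<alpha>) \<longlonglongrightarrow> l"
  using Kc unfolding compact_eq_seq_compact_metric by (metis seq_compactE)
 have sub_lim: "(%m. q (\<alpha> m)) \<longlonglongrightarrow> c" if "q \<longlonglongrightarrow> c" for q :: "nat => real" and c
  using LIMSEQ_subseq_LIMSEQ[OF that \<alpha>] by (simp add: o_def)
 have ym_lim: "ym \<longlonglongrightarrow> x0"
 proof (rule iffD2[OF tendsto_dist_iff], rule Lim_null_comparison[OF _ inv_lim], rule always_eventually, rule allI)
  show "norm (dist (ym m) x0) <= inverse (real (Suc m))" for m using ym(1)[of m] by (simp only: min_less_iff_conj less_imp_le real_norm_def abs_of_nonneg zero_le_dist)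
 qed
 have sm_lim: "sm \<longlonglongrightarrow> t0"
 proof (rule iffD2[OF tendsto_dist_iff], rule Lim_null_comparison[OF _ inv_lim], rule always_eventually, rule allI)
  show "norm (dist (sm m) t0) <= inverse (real (Suc m))" for m using ym(2)[of m] by (simp only: min_less_iff_conj less_imp_le real_norm_def abs_of_nonneg zero_le_dist dist_real_def abs_abs)
 qed
 have \<phi>0_0: "\<phi>0 x0 t0 = 0" by (simp add: \<phi>0_def)
 have \<phi>0m: "(%m. \<phi>0 (ym m) (sm m)) \<longlonglongrightarrow> 0"
 proof -
  have "(%m. (ym m, sm m)) \<longlonglongrightarrow> (x0, t0)" using ym_lim sm_lim by (intro tendsto_Pair)
  from continuous_on_tendsto_compose[OF \<phi>0_cont this] show ?thesis by (simp add: \<phi>0_0)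
 qed
 \<comment> \<open>At any other limit point the jet inequality leaves a gap \<gamma>, while the
   points \<open>(ym, sm)\<close>, at which \<open>u j\<close> nearly attains
   \<open>ubar x0 t0\<close>, show that the near-maxima are bounded below by a null
   sequence.\<close>
 have l0: "l = (x0, t0)"
 proof (rule ccontr)
  assume ne: "l \<noteq> (x0, t0)"
  define \<gamma> where "\<gamma> = e * (\<bar>snd l - t0\<bar> + (norm (fst l - x0))\<^sup>2)"
  have \<gamma>: "\<gamma> > 0"
  proof -
   have "\<bar>snd l - t0\<bar> > 0 \<or> (norm (fst l - x0))\<^sup>2 > 0" using ne by (cases l) auto
   hence "\<bar>snd l - t0\<bar> + (norm (fst l - x0))\<^sup>2 > 0" by (smt (verit) zero_le_power2)
   thus ?thesis using e by (simp add: \<gamma>_def)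
  qed
  have ul: "ubar (fst l) (snd l) <= ubar x0 t0 + \<phi>0 (fst l) (snd l) - \<gamma>"
   unfolding \<gamma>_def by (rule jet') (use Kpos[OF l] r2 in auto)
  obtain r3 J3 where r3: "r3 > 0" and J3: "!!j y s. j >= J3 ==> dist y (fst l) < r3 ==> \<bar>s - snd l\<bar> < r3 ==> u j y s < ubar (fst l) (snd l) + \<gamma>/4"
   using upper[of "snd l" "\<gamma>/4" "fst l"] Kpos[OF l] \<gamma> by (metis zero_less_divide_iff zero_less_numeral)
  define Z where "Z m = zm (jm (\<alpha> m))" for m
  have Zl: "Z \<longlonglongrightarrow> l"
  proof -
   have "Z = (%m. zm (jm m)) \<circ> \<alpha>" by (rule ext) (simp add: Z_def)
   thus ?thesis using lim by simp
  qed
  have \<phi>Z: "(%m. \<phi>0 (fst (Z m)) (snd (Z m))) \<longlonglongrightarrow> \<phi>0 (fst l) (snd l)"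
   using continuous_on_tendsto_compose[OF \<phi>0_cont Zl] by simp
  have ev1: "\<forall>\<^sub>F m in sequentially. dist (Z m) l < r3" using Zl r3 by (rule tendstoD)
  have ev2: "\<forall>\<^sub>F m in sequentially. jm (\<alpha> m) >= J3"
   using filterlim_compose[OF jm_lim filterlim_subseq[OF \<alpha>]] by (simp add: filterlim_at_top)
  define \<eta> where "\<eta> m = inverse (real (Suc (\<alpha> m))) + \<phi>0 (ym (\<alpha> m)) (sm (\<alpha> m)) + 2 * kp (jm (\<alpha> m)) + (h (jm (\<alpha> m)))\<^sup>2" for m
  have \<eta>: "\<eta> \<longlonglongrightarrow> 0"
  proof -
   have "\<eta> \<longlonglongrightarrow> 0 + 0 + 2 * 0 + 0\<^sup>2" unfolding \<eta>_def
    by (intro tendsto_intros sub_lim[OF inv_lim] sub_lim[OF \<phi>0m] sub_lim[OF lim_jm[OF W(2)]] sub_lim[OF lim_jm[OF h(2)]])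
   thus ?thesis by simp
  qed
  have "\<forall>\<^sub>F m in sequentially. \<bar>\<phi>0 (fst (Z m)) (snd (Z m)) - \<phi>0 (fst l) (snd l)\<bar> < \<gamma>/4"
   using tendstoD[OF \<phi>Z, of "\<gamma>/4"] \<gamma> by (simp add: dist_real_def)
  moreover have "\<forall>\<^sub>F m in sequentially. \<bar>\<eta> m\<bar> < \<gamma>/4"
   using tendstoD[OF \<eta>, of "\<gamma>/4"] \<gamma> by (simp add: dist_real_def)
  ultimately have "\<forall>\<^sub>F m in sequentially. False"
   using ev1 ev2
  proof eventually_elim
   case (elim m)
   define j where "j = jm (\<alpha> m)"
   have "dist (fst (Z m)) (fst l) < r3" "\<bar>snd (Z m) - snd l\<bar> < r3"
    using elim(3) dist_fst_le[of "Z m" l] dist_snd_le[of "Z m" l] by (auto simp: dist_real_def)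
   hence 1: "u j (fst (Z m)) (snd (Z m)) < ubar (fst l) (snd l) + \<gamma>/4"
    using J3 elim(4) by (simp add: j_def)
   have mem: "(ym (\<alpha> m), sm (\<alpha> m)) \<in> K"
    using ym(1)[of "\<alpha> m"] ym(2)[of "\<alpha> m"] by (simp add: K_def dist_commute dist_real_def abs_minus_commute)
   have 2: "D j (ym (\<alpha> m), sm (\<alpha> m)) <= D j (Z m) + (h j)\<^sup>2" unfolding Z_def j_def by (rule zm(2)[OF mem])
   have 3: "D j (ym (\<alpha> m), sm (\<alpha> m)) > ubar x0 t0 - inverse (Suc (\<alpha> m)) - \<phi>0 (ym (\<alpha> m)) (sm (\<alpha> m)) - kp j"
    using um[of "\<alpha> m"] W(1)[of j "ym (\<alpha> m)"] by (simp add: D_def \<phi>_def j_def abs_le_iff)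
   have 4: "D j (Z m) <= u j (fst (Z m)) (snd (Z m)) - \<phi>0 (fst (Z m)) (snd (Z m)) + kp j"
    using W(1)[of j "fst (Z m)"] by (simp add: D_def \<phi>_def abs_le_iff)
   have "\<eta> m = inverse (real (Suc (\<alpha> m))) + \<phi>0 (ym (\<alpha> m)) (sm (\<alpha> m)) + 2 * kp j + (h j)\<^sup>2" by (simp add: \<eta>_def j_def)
   with 1 2 3 4 elim(1,2) ul \<gamma> show False by linarith
  qed
  thus False by simp
 qed
 have lim0: "(%m. zm (jm (\<alpha> m))) \<longlonglongrightarrow> (x0, t0)" using lim l0 by (simp add: o_def)
 have "\<forall>\<^sub>F m in sequentially. dist (zm (jm (\<alpha> m))) (x0, t0) < r2/2"
  by (rule tendstoD[OF lim0]) (use r2 in auto)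
 moreover have "\<forall>\<^sub>F m in sequentially. \<bar>\<rho> (jm (\<alpha> m))\<bar> < r2/2"
  using tendstoD[OF sub_lim[OF lim_jm[OF \<rho>]], of "r2/2"] r2 by (simp add: dist_real_def)
 moreover have "\<forall>\<^sub>F m in sequentially. \<bar>h (jm (\<alpha> m))\<bar> < r2/2"
  using tendstoD[OF sub_lim[OF lim_jm[OF h(2)]], of "r2/2"] r2 by (simp add: dist_real_def)
 ultimately have "\<forall>\<^sub>F m in sequentially. dist (zm (jm (\<alpha> m))) (x0, t0) < r2/2 \<and> \<bar>\<rho> (jm (\<alpha> m))\<bar> < r2/2 \<and> \<bar>h (jm (\<alpha> m))\<bar> < r2/2"
  by eventually_elim auto
 then obtain m where m: "dist (zm (jm (\<alpha> m))) (x0, t0) < r2/2" "\<bar>\<rho> (jm (\<alpha> m))\<bar> < r2/2" "\<bar>h (jm (\<alpha> m))\<bar> < r2/2"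
  using eventually_happens'[OF sequentially_bot] by blast
 define j where "j = jm (\<alpha> m)"
 define y where "y = fst (zm j)"
 define s where "s = snd (zm j)"
 have yx: "dist y x0 < r2/2" using m(1) dist_fst_le[of "zm j" "(x0, t0)"] by (simp add: y_def j_def)
 have st: "\<bar>s - t0\<bar> < r2/2" using m(1) dist_snd_le[of "zm j" "(x0, t0)"] by (simp add: s_def j_def dist_real_def)
 have hj: "0 < h j" "h j < r2/2" using h(1)[of j] m(3) by (auto simp: j_def)
 have sh: "s >= h j" using st hj r2 by linarith
 \<comment> \<open>\<open>M\<close> bounds \<open>u j\<close> minus the test function on all of
   \<open>K\<close>, in particular at the earlier time \<open>s - h j\<close>; monotonicity of
   \<open>S j\<close> transports the bound to time \<open>s\<close>.\<close>
 define M where "M = D j (zm j) + (h j)\<^sup>2"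
 define k where "k = M + (a * (s - h j - t0) + 2 * e * \<bar>s - h j - t0\<bar>)"
 have lbu: "locally_bdd (%y. u j y (s - h j))"
  unfolding locally_bdd_def
 proof
  fix R
  obtain B where B: "!!x t. norm x <= max R s ==> 0 <= t ==> t <= max R s ==> \<bar>u j x t\<bar> <= B" using bd by blast
  have "\<bar>u j x (s - h j)\<bar> <= B" if "norm x <= R" for x
   by (rule B) (use that sh hj in auto)
  thus "\<exists>B. \<forall>x. norm x <= R --> \<bar>u j x (s - h j)\<bar> <= B" by blast
 qed
 have "S j (%y. u j y (s - h j)) y <= S j (\<psi> j) y + k"
 proof -
  have "u j z (s - h j) <= \<psi> j z + k" if "dist z y <= \<rho> j" for z
  proof -
   have "dist z x0 <= r2" using that yx m(2) dist_triangle[of z x0 y] by (simp add: j_def)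
   moreover have "\<bar>s - h j - t0\<bar> <= r2" using st hj by linarith
   ultimately have "(z, s - h j) \<in> K" by (simp add: K_def dist_commute dist_real_def abs_minus_commute)
   from zm(2)[OF this, of j] have "u j z (s - h j) - \<phi> j z (s - h j) <= M" by (simp add: D_def M_def)
   thus ?thesis by (simp add: \<phi>\<psi> k_def)
  qed
  thus ?thesis using S[of j] lbu lb\<psi>[of j] unfolding local_mono_def by blast
 qed
 with step[OF sh, of y] have 1: "u j y s <= S j (\<psi> j) y + k + h j * c j y" by simp
 have 2: "u j y s = M - (h j)\<^sup>2 + \<phi> j y s" by (simp add: M_def D_def y_def s_def)
 have "2 * e * \<bar>s - t0\<bar> - 2 * e * \<bar>s - h j - t0\<bar> >= - (2 * e * h j)"
 proof -
  have "2 * e * (\<bar>s - h j - t0\<bar> - \<bar>s - t0\<bar>) <= 2 * e * h j" using e hj by (intro mult_left_mono) auto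
  thus ?thesis by (simp add: algebra_simps)
 qed
 hence "\<psi> j y + h j * (a - 2 * e) - (h j)\<^sup>2 <= S j (\<psi> j) y + h j * c j y"
  using 1 2 unfolding k_def \<phi>\<psi> by (simp add: algebra_simps)
 moreover have "j >= J" using jm[of "\<alpha> m"] by (simp add: j_def)
 moreover have "dist y x0 < r" using yx r2 by simp
 ultimately show ?thesis by blast
qed

lemma par_subjet_minus:
 "(a, P, X) \<in> par_subjet u x t \<longleftrightarrow> (- a, - P, - X) \<in> par_superjet (%y s. - u y s) x t"
proof -
 have 1: "symmetric_op (- X) \<longleftrightarrow> symmetric_op X"
  by (simp add: symmetric_op_def blinfun.minus_left)
 have 2: "- u y s <= - u x t + - a * (s - t) + (- P) \<bullet> (y - x) + 1/2 * (blinfun_apply (- X) (y - x) \<bullet> (y - x))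
   + e * (\<bar>s - t\<bar> + (norm (y - x))\<^sup>2) \<longleftrightarrow>
   u y s >= u x t + a * (s - t) + P \<bullet> (y - x) + 1/2 * (blinfun_apply X (y - x) \<bullet> (y - x))
   - e * (\<bar>s - t\<bar> + (norm (y - x))\<^sup>2)" for y s e
  by (simp add: blinfun.minus_left) linarith
 show ?thesis unfolding par_subjet_def par_superjet_def mem_Collect_eq split 1 2 ..
qed

text \<open>The previous test applied to \<open>- u\<close>, with \<open>S\<close> conjugated by the
  sign.\<close>

lemma discrete_test_super:
 fixes u :: "nat => 'a::euclidean_space => real => real"
 assumes S: "!!j. local_mono (S j) (\<rho> j)" and \<rho>: "\<rho> \<longlonglongrightarrow> 0"
  and h: "!!j. h j > 0" "h \<longlonglongrightarrow> 0"
  and bd: "!!j R. \<exists>B. \<forall>x t. norm x <= R --> 0 <= t --> t <= R --> \<bar>u j x t\<bar> <= B"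
  and step: "!!j x t. t >= h j ==> u j x t >= S j (%y. u j y (t - h j)) x - h j * c j x"
  and lower: "!!x t e. t > 0 ==> e > 0 ==>
   \<exists>r>0. \<exists>J. \<forall>j\<ge>J. \<forall>y s. dist y x < r --> \<bar>s - t\<bar> < r --> u j y s > ubar x t - e"
  and attained: "!!e r J. e > 0 ==> r > 0 ==>
   \<exists>j\<ge>J. \<exists>y s. dist y x0 < r \<and> \<bar>s - t0\<bar> < r \<and> u j y s < ubar x0 t0 + e"
  and jet: "(a, P, X) \<in> par_subjet ubar x0 t0" and t0: "t0 > 0" and e: "e > 0"
  and W: "!!j y. \<bar>W j y\<bar> <= kp j" "kp \<longlonglongrightarrow> 0" and r: "r > 0"
 defines "\<psi> \<equiv> %j y. P \<bullet> (y - x0) + 1/2 * (blinfun_apply X (y - x0) \<bullet> (y - x0)) - 2 * e * (norm (y - x0))\<^sup>2 + W j y"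
 shows "\<exists>j\<ge>J. \<exists>y. dist y x0 < r \<and> \<psi> j y + h j * (a + 2 * e) + (h j)\<^sup>2 >= S j (\<psi> j) y - h j * c j y"
proof -
 define S' where "S' j u x = - S j (%y. - u y) x" for j u x
 have "\<exists>j\<ge>J. \<exists>y. dist y x0 < r \<and>
  ((- P) \<bullet> (y - x0) + 1/2 * (blinfun_apply (- X) (y - x0) \<bullet> (y - x0)) + 2 * e * (norm (y - x0))\<^sup>2 + (- W j y))
   + h j * (- a - 2 * e) - (h j)\<^sup>2
  <= S' j (%y. (- P) \<bullet> (y - x0) + 1/2 * (blinfun_apply (- X) (y - x0) \<bullet> (y - x0)) + 2 * e * (norm (y - x0))\<^sup>2 + (- W j y)) y
   + h j * c j y"
 proof (rule discrete_test_sub[where u = "%j x t. - u j x t" and ubar = "%x t. - ubar x t" and \<rho> = \<rho> and kp = kp and ?t0.0 = t0])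
  show "local_mono (S' j) (\<rho> j)" for j unfolding S'_def by (rule local_mono_minus[OF S])
  show "\<exists>B. \<forall>x t. norm x <= R --> 0 <= t --> t <= R --> \<bar>- u j x t\<bar> <= B" for j R using bd by simp
  show "- u j x t <= S' j (%y. - u j y (t - h j)) x + h j * c j x" if "t >= h j" for j x t
   using step[OF that, of x] by (simp add: S'_def)
  show "\<exists>r>0. \<exists>J. \<forall>j\<ge>J. \<forall>y s. dist y x < r --> \<bar>s - t\<bar> < r --> - u j y s < - ubar x t + e" if te: "t > 0" "e > 0" for x t e
  proof -
   obtain r J where "r > 0" and J: "!!j y s. j >= J ==> dist y x < r ==> \<bar>s - t\<bar> < r ==> u j y s > ubar x t - e"
    using lower[OF te, of x] by blast
   have "- u j y s < - ubar x t + e" if "j >= J" "dist y x < r" "\<bar>s - t\<bar> < r" for j y s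
    using J[OF that] by simp
   thus ?thesis using \<open>r > 0\<close> by blast
  qed
  show "\<exists>j\<ge>J. \<exists>y s. dist y x0 < r \<and> \<bar>s - t0\<bar> < r \<and> - ubar x0 t0 - e < - u j y s" if er: "e > 0" "r > 0" for e r J
  proof -
   obtain j y s where "j >= J" "dist y x0 < r" "\<bar>s - t0\<bar> < r" "u j y s < ubar x0 t0 + e"
    using attained[OF er, of J] by blast
   thus ?thesis by (intro exI[of _ j] conjI exI[of _ y] exI[of _ s]) auto
  qed
  show "(- a, - P, - X) \<in> par_superjet (%x t. - ubar x t) x0 t0" using jet by (simp add: par_subjet_minus)
  show "\<bar>- W j y\<bar> <= kp j" for j y using W by simp
 qed (use \<rho> h t0 e W r in auto)
 then obtain j y where j: "j >= J" "dist y x0 < r" and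
  ineq: "((- P) \<bullet> (y - x0) + 1/2 * (blinfun_apply (- X) (y - x0) \<bullet> (y - x0)) + 2 * e * (norm (y - x0))\<^sup>2 + (- W j y))
   + h j * (- a - 2 * e) - (h j)\<^sup>2
  <= S' j (%y. (- P) \<bullet> (y - x0) + 1/2 * (blinfun_apply (- X) (y - x0) \<bullet> (y - x0)) + 2 * e * (norm (y - x0))\<^sup>2 + (- W j y)) y
   + h j * c j y" by blast
 have neg: "(- P) \<bullet> (y - x0) + 1/2 * (blinfun_apply (- X) (y - x0) \<bullet> (y - x0)) + 2 * e * (norm (y - x0))\<^sup>2 + (- W j y) = - \<psi> j y" for y
  by (simp add: \<psi>_def blinfun.minus_left)
 show ?thesis using j ineq unfolding neg S'_def
  by (intro exI[of _ j] conjI exI[of _ y]) (auto simp: algebra_simps)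
qed

text \<open>The flows are piecewise constant in time, so equicontinuity holds only for late indices,
  with a radius independent of the index. A diagonal subsequence on a countable dense set is Cauchy
  everywhere. The convergence obtained is continuous convergence, the form that the tests above
  consume.\<close>

lemma asymptotic_Arzela_Ascoli:
 fixes u :: "nat => 'b::euclidean_space => real"
 assumes bd: "!!z. \<exists>B. \<forall>j. \<bar>u j z\<bar> <= B"
  and eq: "!!z e. e > 0 ==> \<exists>r>0. \<exists>J. \<forall>j\<ge>J. \<forall>y. dist y z < r --> \<bar>u j y - u j z\<bar> <= e"
 obtains k l where "strict_mono (k :: nat => nat)"
  "!!z e. e > 0 ==> \<exists>r>0. \<exists>J. \<forall>j\<ge>J. \<forall>y. dist y z < r --> \<bar>u (k j) y - l z\<bar> < e"
  "continuous_on UNIV l"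
proof -
 obtain D :: "'b set" where D: "countable D" "!!X. open X ==> X \<noteq> {} ==> \<exists>y\<in>D. y \<in> X"
  using countable_dense_setE by blast
 obtain B where B: "!!z j. \<bar>u j z\<bar> <= B z" using bd by metis
 \<comment> \<open>Dividing by a pointwise bound yields functions bounded by \<open>1\<close>, as
   the diagonal extraction demands.\<close>
 define C where "C z = \<bar>B z\<bar> + 1" for z
 have C: "C z > 0" "\<bar>u j z\<bar> <= C z" for z j using B[where j=j and z=z] by (auto simp: C_def)
 obtain k where k: "strict_mono (k :: nat => nat)" "!!z. z \<in> D ==> \<exists>l. (%j. u (k j) z / C z) \<longlonglongrightarrow> l"
 proof (rule function_convergent_subsequence[OF D(1), of "%j z. u j z / C z" 1])
  fix j z
  have "\<bar>u j z\<bar> / C z <= 1" using C(2)[where j=j and z=z] C(1)[of z] by simp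
  thus "norm (u j z / C z) <= 1" using C(1)[of z] by (simp add: abs_divide)
 qed blast
 have kD: "\<exists>l. (%j. u (k j) z) \<longlonglongrightarrow> l" if z: "z \<in> D" for z
 proof -
  obtain l where "(%j. u (k j) z / C z) \<longlonglongrightarrow> l" using k(2)[OF z] by blast
  hence "(%j. C z * (u (k j) z / C z)) \<longlonglongrightarrow> C z * l" by (rule tendsto_mult_left)
  moreover have "C z * (u (k j) z / C z) = u (k j) z" for j using C(1)[of z] by simp
  ultimately show ?thesis by auto
 qed
 have k_ge: "k j >= j" for j using k(1) by (rule strict_mono_imp_increasing)
 have conv: "\<exists>l. (%j. u (k j) z) \<longlonglongrightarrow> l" for z
 proof -
  have "Cauchy (%j. u (k j) z)"
   unfolding Cauchy_def
  proof (intro allI impI)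
   fix e :: real assume e: "e > 0"
   obtain r J where r: "r > 0" and J: "!!j y. j >= J ==> dist y z < r ==> \<bar>u j y - u j z\<bar> <= e/4"
    using eq[of "e/4" z] e by (metis zero_less_divide_iff zero_less_numeral)
   obtain y where y: "y \<in> D" "dist y z < r"
    using D(2)[of "ball z r"] r by (auto simp: dist_commute)
   have "Cauchy (%j. u (k j) y)" using kD[OF y(1)] LIMSEQ_imp_Cauchy by blast
   then obtain M where M: "!!m n. m >= M ==> n >= M ==> dist (u (k m) y) (u (k n) y) < e/4"
    using e unfolding Cauchy_def by (metis zero_less_divide_iff zero_less_numeral)
   have "dist (u (k m) z) (u (k n) z) < e" if "m >= max M J" "n >= max M J" for m n
   proof -
    have "k m >= J" "k n >= J" using that k_ge[of m] k_ge[of n] by auto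
    hence "\<bar>u (k m) y - u (k m) z\<bar> <= e/4" "\<bar>u (k n) y - u (k n) z\<bar> <= e/4" using J y(2) by auto
    moreover have "\<bar>u (k m) y - u (k n) y\<bar> < e/4" using M[of m n] that by (simp add: dist_real_def)
    ultimately show ?thesis using e unfolding dist_real_def by linarith
   qed
   thus "\<exists>M. \<forall>m\<ge>M. \<forall>n\<ge>M. dist (u (k m) z) (u (k n) z) < e" by blast
  qed
  thus ?thesis unfolding Cauchy_convergent_iff convergent_def .
 qed
 define l where "l z = lim (%j. u (k j) z)" for z
 have l: "(%j. u (k j) z) \<longlonglongrightarrow> l z" for z
  using conv[of z] unfolding l_def convergent_def[symmetric] convergent_LIMSEQ_iff .
 have ccv: "\<exists>r>0. \<exists>J. \<forall>j\<ge>J. \<forall>y. dist y z < r --> \<bar>u (k j) y - l z\<bar> < e" if e: "e > 0" for z e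
 proof -
  obtain r J where r: "r > 0" and J: "!!j y. j >= J ==> dist y z < r ==> \<bar>u j y - u j z\<bar> <= e/2"
   using eq[of "e/2" z] e by (metis zero_less_divide_iff zero_less_numeral)
  obtain M where M: "!!j. j >= M ==> dist (u (k j) z) (l z) < e/2"
   using l[of z] e unfolding LIMSEQ_def by (metis zero_less_divide_iff zero_less_numeral)
  have "\<bar>u (k j) y - l z\<bar> < e" if "j >= max M J" "dist y z < r" for j y
  proof -
   have "k j >= J" using that k_ge[of j] by auto
   hence "\<bar>u (k j) y - u (k j) z\<bar> <= e/2" using J that(2) by blast
   moreover have "\<bar>u (k j) z - l z\<bar> < e/2" using M[of j] that by (simp add: dist_real_def)
   ultimately show ?thesis by linarith
  qed
  thus ?thesis using r by blast
 qed
 have "continuous_on UNIV l"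
  unfolding continuous_on_iff
 proof (intro ballI allI impI)
  fix z :: 'b and e :: real assume e: "e > 0"
  obtain r J where r: "r > 0" and J: "!!j y. j >= J ==> dist y z < r ==> \<bar>u (k j) y - l z\<bar> < e/2"
   using ccv[of "e/2" z] e by (metis zero_less_divide_iff zero_less_numeral)
  have "dist (l y) (l z) < e" if "dist y z < r" for y
  proof -
   have "(%j. dist (u (k j) y) (l z)) \<longlonglongrightarrow> dist (l y) (l z)"
    by (intro tendsto_intros l)
   hence "dist (l y) (l z) <= e/2"
    by (rule LIMSEQ_le_const2) (use J that in \<open>force simp: dist_real_def\<close>)
   thus ?thesis using e by simp
  qed
  thus "\<exists>d>0. \<forall>x'\<in>UNIV. dist x' z < d --> dist (l x') (l z) < e" using r by blast
 qed
 thus thesis using that k(1) ccv by blast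
qed

lemma quadratic_expansion:
 fixes X :: "'a::euclidean_space \<Rightarrow>\<^sub>L 'a" and P x0 :: 'a and c :: real
 assumes "symmetric_op X"
 defines "\<psi> \<equiv> %y. P \<bullet> (y - x0) + 1/2 * (blinfun_apply X (y - x0) \<bullet> (y - x0)) + c * (norm (y - x0))\<^sup>2"
 shows "\<psi> (y + \<delta>) = \<psi> y + (P + blinfun_apply X (y - x0) + (2 * c) *\<^sub>R (y - x0)) \<bullet> \<delta>
  + 1/2 * (blinfun_apply (X + (2 * c) *\<^sub>R id_blinfun) \<delta> \<bullet> \<delta>)"
proof -
 define z where "z = y - x0"
 have z: "y + \<delta> - x0 = z + \<delta>" by (simp add: z_def)
 have s: "z \<bullet> blinfun_apply X \<delta> = \<delta> \<bullet> blinfun_apply X z"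
  using assms(1) by (metis inner_commute symmetric_op_def)
 show ?thesis unfolding \<psi>_def z z_def[symmetric]
  by (simp add: power2_norm_eq_inner inner_add_left inner_add_right blinfun.add_left blinfun.add_right
    blinfun.scaleR_left inner_commute s algebra_simps)
qed

lemma norm_id_blinfun_le: "norm (id_blinfun :: 'a::real_normed_vector \<Rightarrow>\<^sub>L 'a) <= 1"
 by (rule norm_blinfun_bound) auto

lemma norm_blinfun_shift: "norm (X + c *\<^sub>R (id_blinfun :: 'a::real_normed_vector \<Rightarrow>\<^sub>L 'a)) <= norm X + \<bar>c\<bar>"
proof -
 have "norm (c *\<^sub>R (id_blinfun :: 'a \<Rightarrow>\<^sub>L 'a)) <= \<bar>c\<bar>"
  using mult_left_mono[OF norm_id_blinfun_le, of "\<bar>c\<bar>"] by simp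
 thus ?thesis using norm_triangle_ineq[of X "c *\<^sub>R id_blinfun"] by linarith
qed

section \<open>Convergence of the game to the G-equation for fixed eps\<close>

context shear_game
begin

text \<open>The tested inequality meets the upper expansion of \<open>T\<close>, which is exact for
  a quadratic test function. The gradient may move by \<open>kp\<close> to avoid zero, and the shift
  of the Hessian by \<open>4 * e\<close> times the identity is traded for a multiple of
  \<open>e\<close>.\<close>

lemma test_consistency_sub:
 fixes X :: "((real^'n) \<times> real) \<Rightarrow>\<^sub>L ((real^'n) \<times> real)" and P x0 y :: "(real^'n) \<times> real" and a c :: real
 assumes eps: "0 <= eps" "eps <= 1" and h: "0 < h" "h <= 1" and X: "symmetric_op X" and e: "e >= 0" and kp: "kp > 0"
 defines "\<psi> \<equiv> %y. P \<bullet> (y - x0) + 1/2 * (blinfun_apply X (y - x0) \<bullet> (y - x0)) + 2 * e * (norm (y - x0))\<^sup>2"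
 assumes ineq: "\<psi> y + h * (a - 2 * e) - h\<^sup>2 <= T eps h \<psi> y + h * c"
 shows "\<exists>Q'. Q' \<noteq> 0 \<and> norm (Q' - (P + blinfun_apply X (y - x0) + (4 * e) *\<^sub>R (y - x0))) <= kp \<and>
  a + FG eps d f y Q' X <= c + (2 + 4 * d * CARD('n)) * e + h + (norm X + 4 * e) * remC * sqrt h + kp * (F + 1)"
proof -
 define Q where "Q = P + blinfun_apply X (y - x0) + (4 * e) *\<^sub>R (y - x0)"
 define Y where "Y = X + (4 * e) *\<^sub>R id_blinfun"
 have lb: "locally_bdd \<psi>" unfolding \<psi>_def by (intro locally_bdd_continuous continuous_intros)
 have exp: "\<psi> (y + \<delta>) = \<psi> y + Q \<bullet> \<delta> + 1/2 * (blinfun_apply Y \<delta> \<bullet> \<delta>)" for \<delta>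
  using quadratic_expansion[OF X, of P y \<delta> x0 "2 * e"] by (simp add: \<psi>_def Q_def Y_def)
 have h0: "0 <= h" using h by simp
 obtain Q' where Q': "Q' \<noteq> 0" "norm (Q' - Q) <= kp"
  "T eps h \<psi> y <= \<psi> y - h * FG eps d f y Q' Y + norm Y * remC * (h * sqrt h) + h * kp * (F + 1)"
  by (rule T_upper[OF eps h0 h(2) lb _ kp, of y Q Y]) (simp add: exp)
 have "h * (a - 2 * e - h) <= h * (c - FG eps d f y Q' Y + norm Y * remC * sqrt h + kp * (F + 1))"
  using ineq Q'(3) by (simp add: algebra_simps power2_eq_square)
 hence 1: "a - 2 * e - h <= c - FG eps d f y Q' Y + norm Y * remC * sqrt h + kp * (F + 1)" using h by simp
 have "norm Y <= norm X + 4 * e" using norm_blinfun_shift[of X "4 * e"] e by (simp add: Y_def)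
 hence 2: "norm Y * remC * sqrt h <= (norm X + 4 * e) * remC * sqrt h"
  using remC_nonneg h by (intro mult_right_mono) auto
 have 3: "FG eps d f y Q' X <= FG eps d f y Q' Y + eps * d * CARD('n) * (4 * e)"
  using FG_shift_ge(1)[OF Q'(1) eps(1), of d "4 * e"] d_pos e by (simp add: Y_def)
 have 4: "eps * (d * CARD('n) * (4 * e)) <= 1 * (d * CARD('n) * (4 * e))"
  using eps d_pos e by (intro mult_right_mono) auto
 have "a + FG eps d f y Q' X <= c + (2 + 4 * d * CARD('n)) * e + h + (norm X + 4 * e) * remC * sqrt h + kp * (F + 1)"
  using 1 2 3 4 by (simp add: algebra_simps)
 thus ?thesis using Q' unfolding Q_def by blast
qed

lemma test_consistency_super:
 fixes X :: "((real^'n) \<times> real) \<Rightarrow>\<^sub>L ((real^'n) \<times> real)" and P x0 y :: "(real^'n) \<times> real" and a c :: real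
 assumes eps: "0 <= eps" "eps <= 1" and h: "0 < h" "h <= 1" and X: "symmetric_op X" and e: "e >= 0" and kp: "kp > 0"
  and small: "8 * eps * d * (norm X + 4 * e) * CARD('n) * h <= kp * side eps h"
 defines "\<psi> \<equiv> %y. P \<bullet> (y - x0) + 1/2 * (blinfun_apply X (y - x0) \<bullet> (y - x0)) - 2 * e * (norm (y - x0))\<^sup>2"
 assumes ineq: "\<psi> y + h * (a + 2 * e) + h\<^sup>2 >= T eps h \<psi> y - h * c"
 shows "\<exists>Q'. Q' \<noteq> 0 \<and> norm (Q' - (P + blinfun_apply X (y - x0) - (4 * e) *\<^sub>R (y - x0))) <= kp \<and>
  a + FG eps d f y Q' X >= - (c + (2 + 4 * d * CARD('n)) * e + 2 * h + (norm X + 4 * e) * remC * sqrt h + kp * (F + 1))"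
proof -
 define Q where "Q = P + blinfun_apply X (y - x0) - (4 * e) *\<^sub>R (y - x0)"
 define Y where "Y = X + (- (4 * e)) *\<^sub>R id_blinfun"
 have exp: "\<psi> (y + \<delta>) = \<psi> y + Q \<bullet> \<delta> + 1/2 * (blinfun_apply Y \<delta> \<bullet> \<delta>)" for \<delta>
  using quadratic_expansion[OF X, of P y \<delta> x0 "- 2 * e"] by (simp add: \<psi>_def Q_def Y_def)
 have nY: "norm Y <= norm X + 4 * e" using norm_blinfun_shift[of X "- (4 * e)"] e by (simp add: Y_def)
 have h0: "0 <= h" using h by simp
 have small': "8 * eps * d * norm Y * CARD('n) * h <= kp * side eps h"
 proof -
  have "8 * eps * d * norm Y * CARD('n) * h <= 8 * eps * d * (norm X + 4 * e) * CARD('n) * h"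
   using nY eps d_pos h by (intro mult_right_mono mult_left_mono) auto
  thus ?thesis using small by linarith
 qed
 obtain Q' where Q': "Q' \<noteq> 0" "norm (Q' - Q) <= kp"
  "T eps h \<psi> y >= \<psi> y - h * FG eps d f y Q' Y - norm Y * remC * (h * sqrt h) - h * kp * (F + 1) - h\<^sup>2"
  by (rule T_lower[OF eps h _ kp small', of \<psi> y Q]) (simp add: exp)
 have "h * (a + 2 * e + h) >= h * (- c - FG eps d f y Q' Y - norm Y * remC * sqrt h - kp * (F + 1) - h)"
  using ineq Q'(3) by (simp add: algebra_simps power2_eq_square)
 hence 1: "a + 2 * e + h >= - c - FG eps d f y Q' Y - norm Y * remC * sqrt h - kp * (F + 1) - h" using h by simp
 have 2: "norm Y * remC * sqrt h <= (norm X + 4 * e) * remC * sqrt h"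
  using nY remC_nonneg h by (intro mult_right_mono) auto
 have 3: "FG eps d f y Q' X >= FG eps d f y Q' Y - eps * d * CARD('n) * (4 * e)"
  using FG_shift_ge(2)[OF Q'(1) eps(1), of d "4 * e"] d_pos e by (simp add: Y_def)
 have 4: "eps * (d * CARD('n) * (4 * e)) <= 1 * (d * CARD('n) * (4 * e))"
  using eps d_pos e by (intro mult_right_mono) auto
 have "a + FG eps d f y Q' X >= - (c + (2 + 4 * d * CARD('n)) * e + 2 * h + (norm X + 4 * e) * remC * sqrt h + kp * (F + 1))"
  using 1 2 3 4 by (simp add: algebra_simps)
 thus ?thesis using Q' unfolding Q_def by blast
qed

lemma iterate_near:
 assumes eps: "0 <= eps" "eps <= 1" and h: "0 <= h" "h <= 1" and u: "locally_bdd u"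
  and \<delta>: "\<delta> > 0" and e: "e >= 0" and mod: "!!x y. dist x y <= \<delta> ==> u x <= u y + e" and k: "k * h <= tau"
 shows "\<bar>(T eps h ^^ k) u x - u x\<bar> <= e + e / \<delta>\<^sup>2 * (growthC * tau * exp tau)"
proof -
 have "\<bar>u y - u x\<bar> <= e + e / \<delta>\<^sup>2 * (dist y x)\<^sup>2" for y
 proof -
  have "u y <= u x + e + e / \<delta>\<^sup>2 * (dist y x)\<^sup>2" "u x <= u y + e + e / \<delta>\<^sup>2 * (dist x y)\<^sup>2"
   by (rule uniformly_continuous_quadratic[OF \<delta> e mod], assumption)+
  thus ?thesis by (simp add: abs_le_iff dist_commute)
 qed
 hence "\<bar>(T eps h ^^ k) u x - u x\<bar> <= e + e / \<delta>\<^sup>2 * (growthC * (k * h) * exp (k * h))"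
  by (intro iterate_growth[OF eps h _ u]) (use e in auto)
 also have "\<dots> <= e + e / \<delta>\<^sup>2 * (growthC * tau * exp tau)"
 proof -
  have "0 <= k * h" using h by simp
  hence "0 <= tau" using k by linarith
  thus ?thesis
   using k growthC_nonneg h e by (intro add_left_mono mult_left_mono mult_mono) auto
 qed
 finally show ?thesis .
qed

lemma flow_near_initial:
 assumes "0 <= eps" "eps <= 1" and "0 < h" "h <= 1" and "locally_bdd g"
  and "\<delta> > 0" and "e >= 0" and "!!x y. dist x y <= \<delta> ==> g x <= g y + e" and "t <= tau" "0 <= tau"
 shows "\<bar>flow eps h g x t - g x\<bar> <= e + e / \<delta>\<^sup>2 * (growthC * tau * exp tau)"
 unfolding flow_def
 by (rule iterate_near) (use assms nat_floor_step[of h t] in auto)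

lemma flow_modulus:
 assumes eps: "0 < eps" and h: "0 < h" and g: "locally_bdd g"
  and mod: "!!x y. dist x y <= \<delta> ==> g x <= g y + e" and t: "t <= T0" "0 <= T0"
  and le: "dist x y * (1 + T0 * (L / eps)) <= \<delta>"
 shows "flow eps h g x t <= flow eps h g y t + e"
proof -
 define k where "k = nat \<lfloor>t / h\<rfloor>"
 have kh: "k * h <= T0" using nat_floor_step[of h t] h t by (simp add: k_def)
 have "skew_modulus 0 \<delta> e g" using mod by (simp add: skew_modulus_def)
 hence sk: "skew_modulus (k * h * (L / eps)) \<delta> e ((T eps h ^^ k) g)"
  using iterate_skew_modulus g eps h by simp
 have "norm (fst x - fst y) <= dist x y" by (metis dist_fst_le dist_norm)
 moreover have "k * h * (L / eps) <= T0 * (L / eps)" using kh L_nonneg eps by (intro mult_right_mono) auto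
 ultimately have "k * h * (L / eps) * norm (fst x - fst y) <= T0 * (L / eps) * dist x y"
  using t L_nonneg eps by (intro mult_mono[of "k * h * (L / eps)"]) simp_all
 hence "dist x y + k * h * (L / eps) * norm (fst x - fst y) <= \<delta>" using le by (simp add: algebra_simps)
 thus ?thesis using sk unfolding flow_def k_def[symmetric] skew_modulus_def by blast
qed

lemma floor_diff_step:
 fixes s t h :: real
 assumes "h > 0" "s <= t"
 shows "nat \<lfloor>s / h\<rfloor> <= nat \<lfloor>t / h\<rfloor>"
  "real (nat \<lfloor>t / h\<rfloor> - nat \<lfloor>s / h\<rfloor>) * h <= t - s + h"
proof -
 have sh: "s / h <= t / h" using assms by (simp add: divide_right_mono)
 thus le: "nat \<lfloor>s / h\<rfloor> <= nat \<lfloor>t / h\<rfloor>" by (intro nat_mono floor_mono)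
 have fl: "\<lfloor>s / h\<rfloor> <= \<lfloor>t / h\<rfloor>" using sh by (rule floor_mono)
 have "int (nat \<lfloor>t / h\<rfloor> - nat \<lfloor>s / h\<rfloor>) <= \<lfloor>t / h\<rfloor> - \<lfloor>s / h\<rfloor>" using fl by linarith
 hence "real (nat \<lfloor>t / h\<rfloor> - nat \<lfloor>s / h\<rfloor>) <= real_of_int (\<lfloor>t / h\<rfloor> - \<lfloor>s / h\<rfloor>)"
  by (metis of_int_le_iff of_int_of_nat_eq)
 also have "\<dots> <= (t - s + h) / h"
 proof -
  have "(t - s + h) / h = t / h - s / h + 1" using assms by (simp add: field_simps)
  thus ?thesis by linarith
 qed
 finally show "real (nat \<lfloor>t / h\<rfloor> - nat \<lfloor>s / h\<rfloor>) * h <= t - s + h" using assms by (simp add: field_simps)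
qed

text \<open>In space, the skewed modulus of \<open>g\<close> survives up to the time
  \<open>T0\<close>. In time, the iterate at the earlier time has this same space modulus, hence
  lies between paraboloids and moves little during the remaining steps. The radius may depend on
  \<open>eps\<close>, which is fixed.\<close>

lemma flow_equicontinuous:
 assumes eps: "0 < eps" "eps <= 1" and g: "uniformly_continuous_on UNIV g" and e: "e > 0"
 obtains r where "r > 0" "r <= 1" "!!h y s. 0 < h ==> h < r ==> dist y x < r ==> \<bar>s - t\<bar> < r ==>
  \<bar>flow eps h g y s - flow eps h g x t\<bar> <= e"
proof -
 define e' where "e' = e / 3"
 have e': "e' > 0" using e by (simp add: e'_def)
 obtain \<delta>0 where \<delta>0: "\<delta>0 > 0" "!!x y. dist x y < \<delta>0 ==> dist (g x) (g y) < e'"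
  using g e' unfolding uniformly_continuous_on_def by (metis UNIV_I dist_commute)
 define \<delta> where "\<delta> = \<delta>0 / 2"
 have \<delta>: "\<delta> > 0" using \<delta>0 by (simp add: \<delta>_def)
 have mod: "g x <= g y + e'" if "dist x y <= \<delta>" for x y
  using \<delta>0(2)[of x y] that \<delta>0(1) by (simp add: \<delta>_def dist_real_def)
 have lb: "locally_bdd g" using g by (intro locally_bdd_continuous uniformly_continuous_imp_continuous)
 define T0 where "T0 = max t 0 + 1"
 define K where "K = 1 + T0 * (L / eps)"
 have T0: "T0 >= 0" by (simp add: T0_def)
 have K: "K >= 1" using T0 L_nonneg eps by (simp add: K_def)
 define \<delta>' where "\<delta>' = \<delta> / K"
 have \<delta>': "\<delta>' > 0" using \<delta> K by (simp add: \<delta>'_def)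
 define C where "C = e' / \<delta>'\<^sup>2 * (growthC * 2 * exp 2)"
 have C: "C >= 0" using e' growthC_nonneg by (simp add: C_def)
 define r where "r = min (min 1 \<delta>') (e' / (C + 1))"
 have r: "r > 0" "r <= 1" "r <= \<delta>'" "C * r <= e'"
 proof -
  show "r > 0" using \<delta>' e' C by (simp add: r_def)
  show "r <= 1" "r <= \<delta>'" by (simp_all add: r_def)
  have "C * r <= C * (e' / (C + 1))" using C by (intro mult_left_mono) (auto simp: r_def)
  also have "\<dots> <= e'" using C e' by (simp add: field_simps)
  finally show "C * r <= e'" .
 qed
 show thesis
 proof (rule that[OF r(1,2)])
  fix h y s assume h: "0 < h" "h < r" and y: "dist y x < r" and s: "\<bar>s - t\<bar> < r"
  have fm: "flow eps h g a s' <= flow eps h g b s' + e'" if "s' <= T0" "dist a b <= \<delta>'" for a b s'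
  proof (rule flow_modulus[OF eps(1) h(1) lb mod that(1) T0])
   show "dist a b * (1 + T0 * (L / eps)) <= \<delta>"
    unfolding K_def[symmetric] using that(2) K by (simp add: \<delta>'_def field_simps)
  qed
  have time: "\<bar>flow eps h g x b - flow eps h g x a\<bar> <= e' + e'" if ab: "a <= b" "b - a < r" "a <= T0" for a b
  proof -
   define k where "k = nat \<lfloor>a / h\<rfloor>"
   define m where "m = nat \<lfloor>b / h\<rfloor> - k"
   have m: "nat \<lfloor>b / h\<rfloor> = m + k" "real m * h <= 2 * r"
    using floor_diff_step[OF h(1) ab(1)] ab h unfolding m_def k_def by auto
   have "\<bar>(T eps h ^^ m) ((T eps h ^^ k) g) x - (T eps h ^^ k) g x\<bar> <= e' + e' / \<delta>'\<^sup>2 * (growthC * (2 * r) * exp (2 * r))"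
   proof (rule iterate_near)
    show "locally_bdd ((T eps h ^^ k) g)" using iterate_locally_bdd lb eps h by simp
    show "(T eps h ^^ k) g p <= (T eps h ^^ k) g q + e'" if "dist p q <= \<delta>'" for p q
     using fm[OF ab(3) that] by (simp add: flow_def k_def)
   qed (use eps h r m \<delta>' e' in auto)
   also have "e' / \<delta>'\<^sup>2 * (growthC * (2 * r) * exp (2 * r)) <= e' / \<delta>'\<^sup>2 * (growthC * (2 * r) * exp 2)"
    using r e' growthC_nonneg by (intro mult_left_mono) auto
   also have "\<dots> = C * r" by (simp add: C_def)
   finally show ?thesis using r(4) by (simp add: flow_def m(1) k_def funpow_add)
  qed
  have "\<bar>flow eps h g x s - flow eps h g x t\<bar> <= e' + e'"
  proof (cases "s <= t")
   case True
   thus ?thesis using time[of s t] s by (simp add: T0_def abs_minus_commute)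
  next
   case False
   thus ?thesis using time[of t s] s by (simp add: T0_def)
  qed
  moreover have "\<bar>flow eps h g y s - flow eps h g x s\<bar> <= e'"
  proof -
   have "s <= T0" using s r(2) unfolding T0_def by linarith
   moreover have "dist y x <= \<delta>'" "dist x y <= \<delta>'" using y r by (simp_all add: dist_commute)
   ultimately have "flow eps h g y s <= flow eps h g x s + e'" "flow eps h g x s <= flow eps h g y s + e'"
    using fm by blast+
   thus ?thesis by linarith
  qed
  moreover have "e = e' + e' + e'" by (simp add: e'_def)
  ultimately show "\<bar>flow eps h g y s - flow eps h g x t\<bar> <= e" by linarith
 qed
qed

end

lemma small_sqrt:
 fixes A c :: real
 assumes "A >= 0" "c > 0"
 obtains tau0 where "tau0 > 0" "tau0 <= 1" "!!tau. 0 <= tau ==> tau < tau0 ==> A * sqrt tau <= c"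
proof -
 define tau0 where "tau0 = min 1 ((c / (A + 1))\<^sup>2)"
 define q where "q = c / (A + 1)"
 have p: "q > 0" using assms by (simp add: q_def)
 show thesis
 proof (rule that[of tau0])
  show "tau0 > 0" "tau0 <= 1" using p by (auto simp: tau0_def q_def[symmetric])
  fix tau assume "0 <= tau" "tau < tau0"
  hence "sqrt tau <= sqrt (q\<^sup>2)" by (intro real_sqrt_le_mono) (simp add: tau0_def q_def)
  hence "sqrt tau <= q" using p by simp
  hence "A * sqrt tau <= A * q" using assms by (intro mult_left_mono) auto
  also have "\<dots> <= c" using assms by (simp add: q_def field_simps)
  finally show "A * sqrt tau <= c" .
 qed
qed

lemma small_factor:
 fixes B c :: real
 assumes "B >= 0" "c > 0"
 obtains e where "e > 0" "e <= 1" "B * e <= c"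
proof (rule that[of "min 1 (c / (B + 1))"])
 show "min 1 (c / (B + 1)) > 0" "min 1 (c / (B + 1)) <= 1" using assms by auto
 have "B * min 1 (c / (B + 1)) <= B * (c / (B + 1))" using assms by (intro mult_left_mono) auto
 also have "\<dots> <= c" using assms by (simp add: field_simps)
 finally show "B * min 1 (c / (B + 1)) <= c" .
qed

lemma le_sqrt_self: "0 <= x ==> x <= 1 ==> x <= sqrt x"
 by (metis mult_left_le_one_le real_le_rsqrt power2_eq_square)

context shear_game
begin

text \<open>The first inequality bounds the step-dependent consistency errors. The second is the
  smallness hypothesis of \<open>T_lower\<close> for \<open>kp = \<theta> / (F + 1)\<close>, a
  choice that makes the displacement error \<open>kp * (F + 1)\<close> equal to \<theta>.\<close>

definition small_error :: "real => real => real => real => real => bool" where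
 "small_error eps N e \<theta> h \<longleftrightarrow> 2 * h + (N + 4 * e) * remC * sqrt h <= \<theta> \<and>
  8 * eps * d * (N + 4 * e) * CARD('n) * h <= \<theta> / (F + 1) * side eps h"

lemma small_error_ex:
 assumes "0 < eps" "N >= 0" "e >= 0" "\<theta> > 0"
 obtains h0 where "h0 > 0" "h0 <= 1" "!!h. 0 < h ==> h < h0 ==> small_error eps N e \<theta> h"
proof -
 define A1 where "A1 = 2 + (N + 4 * e) * remC"
 have A1: "A1 >= 0" using assms remC_nonneg by (simp add: A1_def)
 obtain h1 where h1: "h1 > 0" "h1 <= 1" "!!tau. 0 <= tau ==> tau < h1 ==> A1 * sqrt tau <= \<theta>"
  using small_sqrt[OF A1 assms(4)] by blast
 define A2 where "A2 = 8 * eps * d * (N + 4 * e) * CARD('n)"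
 have A2: "A2 >= 0" using assms d_pos by (simp add: A2_def)
 define c where "c = \<theta> / (F + 1) * sqrt (2 * CARD('n) * d * eps)"
 have c: "c > 0" using assms d_pos F_nonneg by (simp add: c_def)
 obtain h2 where h2: "h2 > 0" "!!tau. 0 <= tau ==> tau < h2 ==> A2 * sqrt tau <= c"
  using small_sqrt[OF A2 c] by blast
 show thesis
 proof (rule that[of "min h1 h2"])
  fix h :: real assume h: "0 < h" "h < min h1 h2"
  have "h <= sqrt h" using h h1 by (intro le_sqrt_self) auto
  hence "2 * h + (N + 4 * e) * remC * sqrt h <= A1 * sqrt h" by (simp add: A1_def algebra_simps)
  also have "\<dots> <= \<theta>" using h1(3)[of h] h by simp
  finally have 1: "2 * h + (N + 4 * e) * remC * sqrt h <= \<theta>" .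
  have "A2 * h = A2 * sqrt h * sqrt h" using h by (simp add: mult.assoc)
  also have "\<dots> <= c * sqrt h" using h2(2)[of h] h by (intro mult_right_mono) auto
  also have "\<dots> = \<theta> / (F + 1) * side eps h" by (simp add: c_def side_def real_sqrt_mult)
  finally show "small_error eps N e \<theta> h" using 1 by (simp add: small_error_def A2_def)
 qed (use h1 h2 in auto)
qed

lemma reach_tendsto:
 assumes "h \<longlonglongrightarrow> 0"
 shows "(%j. reach eps (h j)) \<longlonglongrightarrow> 0"
proof -
 have "(%j. h j * F + sqrt (2 * CARD('n) * d * eps * h j) + h j) \<longlonglongrightarrow> 0 * F + sqrt (2 * CARD('n) * d * eps * 0) + 0"
  by (intro tendsto_intros assms)
 thus ?thesis by (simp add: reach_def side_def)
qed

lemma flow_bounded_uniformly: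
 assumes g: "uniformly_continuous_on UNIV g"
 shows "\<exists>B. \<forall>eps h x t. 0 < eps --> eps <= 1 --> 0 < h --> h <= 1 --> norm x <= R --> t <= R --> \<bar>flow eps h g x t\<bar> <= B"
proof -
 have lb: "locally_bdd g" using g by (intro locally_bdd_continuous uniformly_continuous_imp_continuous)
 obtain B where B: "!!x. norm x <= R ==> \<bar>g x\<bar> <= B" using locally_bddE[OF lb] by metis
 obtain \<delta> where \<delta>: "\<delta> > 0" "!!x y. dist x y < \<delta> ==> dist (g x) (g y) < 1"
  using g unfolding uniformly_continuous_on_def by (metis UNIV_I dist_commute zero_less_one)
 have mod: "g x <= g y + 1" if "dist x y <= \<delta> / 2" for x y
  using \<delta>(2)[of x y] that \<delta>(1) by (simp add: dist_real_def abs_less_iff)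
 have "\<bar>flow eps h g x t\<bar> <= B + (1 + 1 / (\<delta> / 2)\<^sup>2 * (growthC * max R 0 * exp (max R 0)))"
  if "0 < eps" "eps <= 1" "0 < h" "h <= 1" "norm x <= R" "t <= R" for eps h x t
 proof -
  have "\<bar>flow eps h g x t - g x\<bar> <= 1 + 1 / (\<delta> / 2)\<^sup>2 * (growthC * max R 0 * exp (max R 0))"
   by (rule flow_near_initial[OF _ that(2-4) lb _ _ mod]) (use that \<delta> in auto)
  thus ?thesis using B[OF that(5)] by linarith
 qed
 thus ?thesis by blast
qed

lemma flow_bounded:
 assumes "0 < eps" "eps <= 1" "uniformly_continuous_on UNIV g"
 shows "\<exists>B. \<forall>x t h. norm x <= R --> t <= R --> 0 < h --> h <= 1 --> \<bar>flow eps h g x t\<bar> <= B"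
 using flow_bounded_uniformly[OF assms(3), of R] assms(1,2) by blast

text \<open>Monotonicity and consistency together, in the manner of convergence proofs for monotone
  schemes. There is no oscillation to correct at fixed \<open>eps\<close>, so the tests run with
  \<open>W = 0\<close>.\<close>

lemma flow_limit:
 assumes eps: "0 < eps" "eps <= 1" and g: "uniformly_continuous_on UNIV g"
  and h: "!!j. 0 < h j" "!!j. h j <= 1" "h \<longlonglongrightarrow> 0"
  and ccv: "!!x t e. e > 0 ==> \<exists>r>0. \<exists>J. \<forall>j\<ge>J. \<forall>y s. dist y x < r --> \<bar>s - t\<bar> < r -->
    \<bar>flow eps (h j) g y s - l x t\<bar> < e"
 shows "visc_sub_par (%P. P \<noteq> 0) (FG eps d f) l" and "visc_super_par (%P. P \<noteq> 0) (FG eps d f) l"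
proof -
 have eps0: "0 <= eps" using eps by simp
 have mono: "local_mono (T eps (h j)) (reach eps (h j))" for j
  using T_local_mono eps h(1)[of j] by simp
 have bd: "\<exists>B. \<forall>x t. norm x <= R --> 0 <= t --> t <= R --> \<bar>flow eps (h j) g x t\<bar> <= B" for j R
  using flow_bounded[OF eps g, of R] h by blast
 have step: "flow eps (h j) g x t = T eps (h j) (%y. flow eps (h j) g y (t - h j)) x" if "t >= h j" for j x t
  by (rule flow_step[OF h(1) that])
 have up: "\<exists>r>0. \<exists>J. \<forall>j\<ge>J. \<forall>y s. dist y x < r --> \<bar>s - t\<bar> < r --> flow eps (h j) g y s < l x t + e"
  and lo: "\<exists>r>0. \<exists>J. \<forall>j\<ge>J. \<forall>y s. dist y x < r --> \<bar>s - t\<bar> < r --> flow eps (h j) g y s > l x t - e"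
  if e: "e > 0" for x t e
 proof -
  obtain r J where rJ: "r > 0" "!!j y s. j >= J ==> dist y x < r ==> \<bar>s - t\<bar> < r ==> \<bar>flow eps (h j) g y s - l x t\<bar> < e"
   using ccv[OF e, of x t] by blast
  have "flow eps (h j) g y s < l x t + e" "flow eps (h j) g y s > l x t - e" if "j >= J" "dist y x < r" "\<bar>s - t\<bar> < r" for j y s
   using rJ(2)[OF that] by linarith+
  thus "\<exists>r>0. \<exists>J. \<forall>j\<ge>J. \<forall>y s. dist y x < r --> \<bar>s - t\<bar> < r --> flow eps (h j) g y s < l x t + e"
   "\<exists>r>0. \<exists>J. \<forall>j\<ge>J. \<forall>y s. dist y x < r --> \<bar>s - t\<bar> < r --> flow eps (h j) g y s > l x t - e"
   using rJ(1) by blast+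
 qed
 have at: "\<exists>j\<ge>J. \<exists>y s. dist y x < r \<and> \<bar>s - t\<bar> < r \<and> \<bar>flow eps (h j) g y s - l x t\<bar> < e" if e: "e > 0" and r: "r > 0" for x t e r J
 proof -
  obtain r' J' where rJ: "r' > 0" "!!j y s. j >= J' ==> dist y x < r' ==> \<bar>s - t\<bar> < r' ==> \<bar>flow eps (h j) g y s - l x t\<bar> < e"
   using ccv[OF e, of x t] by blast
  have "\<bar>flow eps (h (max J J')) g x t - l x t\<bar> < e" using rJ by simp
  thus ?thesis using r by (intro exI[of _ "max J J'"] conjI exI[of _ x] exI[of _ t]) auto
 qed
 show "visc_sub_par (%P. P \<noteq> 0) (FG eps d f) l"
  unfolding visc_sub_par_def
 proof (intro allI impI ballI, clarify)
  fix x0 :: "(real^'n) \<times> real" and t0 a and P :: "(real^'n) \<times> real" and X and \<delta> r :: real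
  assume t0: "t0 > 0" and jet: "(a, P, X) \<in> par_superjet l x0 t0" and \<delta>: "\<delta> > 0" and r: "r > 0"
  have X: "symmetric_op X" using jet by (simp add: par_superjet_def)
  obtain e where e: "e > 0" "e <= 1" "(2 + 4 * d * CARD('n)) * e <= \<delta> / 4"
   using small_factor[of "2 + 4 * d * CARD('n)" "\<delta> / 4"] d_pos \<delta> by auto
  \<comment> \<open>The same number keeps \<open>kp\<close> small as an error in the equation,
    through \<open>kp * (F + 1)\<close>, and as a displacement of the gradient.\<close>
  define \<theta> where "\<theta> = min (\<delta> / 4) (r * (F + 1) / 3)"
  have \<theta>: "\<theta> > 0" "\<theta> <= \<delta> / 4" using \<delta> r F_nonneg by (auto simp: \<theta>_def)
  define kp where "kp = \<theta> / (F + 1)"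
  have kp: "kp > 0" "kp <= r / 3" "kp * (F + 1) <= \<delta> / 4"
  proof -
   show "kp > 0" using \<theta> F_nonneg by (simp add: kp_def)
   have "\<theta> <= r / 3 * (F + 1)" by (simp add: \<theta>_def)
   thus "kp <= r / 3" using F_nonneg by (simp add: kp_def pos_divide_le_eq)
   show "kp * (F + 1) <= \<delta> / 4" using \<theta> F_nonneg by (simp add: kp_def)
  qed
  have nX: "norm X + 4 > 0" by (simp add: add_nonneg_pos)
  obtain r0 where r0: "r0 > 0" "r0 <= 1" "(norm X + 4) * r0 <= r / 3"
   using small_factor[of "norm X + 4" "r / 3"] nX r by auto
  define r' where "r' = min r r0"
  have "(norm X + 4) * r' <= (norm X + 4) * r0" using nX by (intro mult_left_mono) (auto simp: r'_def)
  hence r': "r' > 0" "r' <= r" "(norm X + 4) * r' <= r / 3" using r r0 by (auto simp: r'_def)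
  obtain h0 where h0: "h0 > 0" "h0 <= 1" "!!h. 0 < h ==> h < h0 ==> small_error eps (norm X) e (\<delta>/4) h"
   using small_error_ex[OF eps(1), of "norm X" e "\<delta>/4"] e \<delta> by auto
  obtain J where J: "!!j. j >= J ==> h j < h0"
   using order_tendstoD(2)[OF h(3) h0(1)] by (auto simp: eventually_sequentially)
  have "\<exists>j\<ge>J. \<exists>y. dist y x0 < r' \<and>
   (P \<bullet> (y - x0) + 1/2 * (blinfun_apply X (y - x0) \<bullet> (y - x0)) + 2 * e * (norm (y - x0))\<^sup>2 + 0) + h j * (a - 2 * e) - (h j)\<^sup>2
    <= T eps (h j) (%y. P \<bullet> (y - x0) + 1/2 * (blinfun_apply X (y - x0) \<bullet> (y - x0)) + 2 * e * (norm (y - x0))\<^sup>2 + 0) y + h j * 0"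
  proof (rule discrete_test_sub[where u = "%j. flow eps (h j) g" and ubar = l and \<rho> = "%j. reach eps (h j)" and kp = "%_. 0" and ?t0.0 = t0 and r = r'])
   show "\<exists>j\<ge>J. \<exists>y s. dist y x0 < r \<and> \<bar>s - t0\<bar> < r \<and> l x0 t0 - e < flow eps (h j) g y s" if er: "e > 0" "r > 0" for e r J
   proof -
    obtain j y s where "j >= J" "dist y x0 < r" "\<bar>s - t0\<bar> < r" "\<bar>flow eps (h j) g y s - l x0 t0\<bar> < e"
     using at[OF er, of J] by blast
    thus ?thesis by (intro exI[of _ j] conjI exI[of _ y] exI[of _ s]) auto
   qed
  qed (use mono reach_tendsto[OF h(3)] h bd step up jet t0 e r' in auto)
  then obtain j y where j: "j >= J" and y: "dist y x0 < r'" and ineq: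
   "(P \<bullet> (y - x0) + 1/2 * (blinfun_apply X (y - x0) \<bullet> (y - x0)) + 2 * e * (norm (y - x0))\<^sup>2) + h j * (a - 2 * e) - (h j)\<^sup>2
    <= T eps (h j) (%y. P \<bullet> (y - x0) + 1/2 * (blinfun_apply X (y - x0) \<bullet> (y - x0)) + 2 * e * (norm (y - x0))\<^sup>2) y + h j * 0"
   by auto
  have se: "small_error eps (norm X) e (\<delta>/4) (h j)" using h0(3) h(1) J[OF j] by blast
  obtain Q' where Q': "Q' \<noteq> 0" "norm (Q' - (P + blinfun_apply X (y - x0) + (4 * e) *\<^sub>R (y - x0))) <= kp"
   "a + FG eps d f y Q' X <= 0 + (2 + 4 * d * CARD('n)) * e + h j + (norm X + 4 * e) * remC * sqrt (h j) + kp * (F + 1)"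
   using test_consistency_sub[OF eps0 eps(2) h(1)[of j] h(2)[of j] X _ kp(1) ineq] e by auto
  have "dist Q' P < r"
  proof -
   have "norm (blinfun_apply X (y - x0) + (4 * e) *\<^sub>R (y - x0)) <= norm X * norm (y - x0) + 4 * norm (y - x0)"
    using norm_triangle_le[OF add_mono[OF norm_blinfun[of X "y - x0"], of "norm ((4 * e) *\<^sub>R (y - x0))" "4 * norm (y - x0)"]] e
    by (simp add: mult_right_mono)
   also have "\<dots> <= (norm X + 4) * r'" using y nX mult_left_mono[of "norm (y - x0)" r' "norm X + 4"]
    by (simp add: dist_norm algebra_simps)
   finally have "norm (blinfun_apply X (y - x0) + (4 * e) *\<^sub>R (y - x0)) <= r / 3" using r'(3) by linarith
   moreover have "norm (Q' - P) <= norm (Q' - (P + blinfun_apply X (y - x0) + (4 * e) *\<^sub>R (y - x0))) + norm (blinfun_apply X (y - x0) + (4 * e) *\<^sub>R (y - x0))"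
    using norm_triangle_ineq[of "Q' - (P + blinfun_apply X (y - x0) + (4 * e) *\<^sub>R (y - x0))" "blinfun_apply X (y - x0) + (4 * e) *\<^sub>R (y - x0)"]
    by (simp add: algebra_simps)
   ultimately show ?thesis using Q'(2) kp(2) r by (simp add: dist_norm)
  qed
  moreover have "a + FG eps d f y Q' X < \<delta>"
   using Q'(3) se e(3) kp(3) h(1)[of j] \<delta> unfolding small_error_def by linarith
  moreover have "dist y x0 < r" using y r' by simp
  ultimately show "\<exists>y Q Y. dist y x0 < r \<and> dist Q P < r \<and> dist Y X < r \<and> symmetric_op Y \<and> Q \<noteq> 0 \<and> a + FG eps d f y Q Y < \<delta>"
   using Q'(1) X r by (intro exI[of _ y] exI[of _ Q'] exI[of _ X]) auto
 qed
 show "visc_super_par (%P. P \<noteq> 0) (FG eps d f) l"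
  unfolding visc_super_par_def
 proof (intro allI impI ballI, clarify)
  fix x0 :: "(real^'n) \<times> real" and t0 a and P :: "(real^'n) \<times> real" and X and \<delta> r :: real
  assume t0: "t0 > 0" and jet: "(a, P, X) \<in> par_subjet l x0 t0" and \<delta>: "\<delta> > 0" and r: "r > 0"
  have X: "symmetric_op X" using jet by (simp add: par_subjet_def)
  obtain e where e: "e > 0" "e <= 1" "(2 + 4 * d * CARD('n)) * e <= \<delta> / 4"
   using small_factor[of "2 + 4 * d * CARD('n)" "\<delta> / 4"] d_pos \<delta> by auto
  define \<theta> where "\<theta> = min (\<delta> / 4) (r * (F + 1) / 3)"
  have \<theta>: "\<theta> > 0" "\<theta> <= \<delta> / 4" using \<delta> r F_nonneg by (auto simp: \<theta>_def)
  define kp where "kp = \<theta> / (F + 1)"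
  have kp: "kp > 0" "kp <= r / 3" "kp * (F + 1) <= \<delta> / 4"
  proof -
   show "kp > 0" using \<theta> F_nonneg by (simp add: kp_def)
   have "\<theta> <= r / 3 * (F + 1)" by (simp add: \<theta>_def)
   thus "kp <= r / 3" using F_nonneg by (simp add: kp_def pos_divide_le_eq)
   show "kp * (F + 1) <= \<delta> / 4" using \<theta> F_nonneg by (simp add: kp_def)
  qed
  have nX: "norm X + 4 > 0" by (simp add: add_nonneg_pos)
  obtain r0 where r0: "r0 > 0" "r0 <= 1" "(norm X + 4) * r0 <= r / 3"
   using small_factor[of "norm X + 4" "r / 3"] nX r by auto
  define r' where "r' = min r r0"
  have "(norm X + 4) * r' <= (norm X + 4) * r0" using nX by (intro mult_left_mono) (auto simp: r'_def)
  hence r': "r' > 0" "r' <= r" "(norm X + 4) * r' <= r / 3" using r r0 by (auto simp: r'_def)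
  obtain h0 where h0: "h0 > 0" "h0 <= 1" "!!h. 0 < h ==> h < h0 ==> small_error eps (norm X) e \<theta> h"
   using small_error_ex[OF eps(1), of "norm X" e \<theta>] e \<theta> by auto
  obtain J where J: "!!j. j >= J ==> h j < h0"
   using order_tendstoD(2)[OF h(3) h0(1)] by (auto simp: eventually_sequentially)
  have "\<exists>j\<ge>J. \<exists>y. dist y x0 < r' \<and>
   (P \<bullet> (y - x0) + 1/2 * (blinfun_apply X (y - x0) \<bullet> (y - x0)) - 2 * e * (norm (y - x0))\<^sup>2 + 0) + h j * (a + 2 * e) + (h j)\<^sup>2
    >= T eps (h j) (%y. P \<bullet> (y - x0) + 1/2 * (blinfun_apply X (y - x0) \<bullet> (y - x0)) - 2 * e * (norm (y - x0))\<^sup>2 + 0) y - h j * 0"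
  proof (rule discrete_test_super[where u = "%j. flow eps (h j) g" and ubar = l and \<rho> = "%j. reach eps (h j)" and kp = "%_. 0" and ?t0.0 = t0 and r = r'])
   show "\<exists>j\<ge>J. \<exists>y s. dist y x0 < r \<and> \<bar>s - t0\<bar> < r \<and> flow eps (h j) g y s < l x0 t0 + e" if er: "e > 0" "r > 0" for e r J
   proof -
    obtain j y s where "j >= J" "dist y x0 < r" "\<bar>s - t0\<bar> < r" "\<bar>flow eps (h j) g y s - l x0 t0\<bar> < e"
     using at[OF er, of J] by blast
    thus ?thesis by (intro exI[of _ j] conjI exI[of _ y] exI[of _ s]) auto
   qed
  qed (use mono reach_tendsto[OF h(3)] h bd step lo jet t0 e r' in auto)
  then obtain j y where j: "j >= J" and y: "dist y x0 < r'" and ineq: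
   "(P \<bullet> (y - x0) + 1/2 * (blinfun_apply X (y - x0) \<bullet> (y - x0)) - 2 * e * (norm (y - x0))\<^sup>2) + h j * (a + 2 * e) + (h j)\<^sup>2
    >= T eps (h j) (%y. P \<bullet> (y - x0) + 1/2 * (blinfun_apply X (y - x0) \<bullet> (y - x0)) - 2 * e * (norm (y - x0))\<^sup>2) y - h j * 0"
   by auto
  have se: "small_error eps (norm X) e \<theta> (h j)" using h0(3) h(1) J[OF j] by blast
  have sm: "8 * eps * d * (norm X + 4 * e) * CARD('n) * h j <= kp * side eps (h j)"
   using se by (simp add: small_error_def kp_def)
  obtain Q' where Q': "Q' \<noteq> 0" "norm (Q' - (P + blinfun_apply X (y - x0) - (4 * e) *\<^sub>R (y - x0))) <= kp"
   "a + FG eps d f y Q' X >= - (0 + (2 + 4 * d * CARD('n)) * e + 2 * h j + (norm X + 4 * e) * remC * sqrt (h j) + kp * (F + 1))"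
   using test_consistency_super[OF eps0 eps(2) h(1)[of j] h(2)[of j] X _ kp(1) sm ineq] e by auto
  have "dist Q' P < r"
  proof -
   have "norm (blinfun_apply X (y - x0) - (4 * e) *\<^sub>R (y - x0)) <= norm (blinfun_apply X (y - x0)) + norm ((4 * e) *\<^sub>R (y - x0))"
    by (rule norm_triangle_ineq4)
   also have "\<dots> <= norm X * norm (y - x0) + 4 * norm (y - x0)"
    using norm_blinfun[of X "y - x0"] e by (intro add_mono) (auto simp: mult_right_mono)
   also have "\<dots> <= (norm X + 4) * r'" using y nX mult_left_mono[of "norm (y - x0)" r' "norm X + 4"]
    by (simp add: dist_norm algebra_simps)
   finally have "norm (blinfun_apply X (y - x0) - (4 * e) *\<^sub>R (y - x0)) <= r / 3" using r'(3) by linarith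
   moreover have "norm (Q' - P) <= norm (Q' - (P + blinfun_apply X (y - x0) - (4 * e) *\<^sub>R (y - x0))) + norm (blinfun_apply X (y - x0) - (4 * e) *\<^sub>R (y - x0))"
    using norm_triangle_ineq[of "Q' - (P + blinfun_apply X (y - x0) - (4 * e) *\<^sub>R (y - x0))" "blinfun_apply X (y - x0) - (4 * e) *\<^sub>R (y - x0)"]
    by (simp add: algebra_simps)
   ultimately show ?thesis using Q'(2) kp(2) r by (simp add: dist_norm)
  qed
  moreover have "a + FG eps d f y Q' X > - \<delta>"
   using Q'(3) se e(3) kp(3) \<theta>(2) h(1)[of j] \<delta> unfolding small_error_def by linarith
  moreover have "dist y x0 < r" using y r' by simp
  ultimately show "\<exists>y Q Y. dist y x0 < r \<and> dist Q P < r \<and> dist Y X < r \<and> symmetric_op Y \<and> Q \<noteq> 0 \<and> a + FG eps d f y Q Y > - \<delta>"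
   using Q'(1) X r by (intro exI[of _ y] exI[of _ Q'] exI[of _ X]) auto
 qed
qed

end

text \<open>A failing sequence accumulates at some \<open>z\<close>, where late \<open>u j\<close>
  are close to \<open>l z\<close>. The value \<open>l y\<close> at a failing point is compared with
  \<open>l z\<close> through one common late index, so continuity of \<open>l\<close> comes out of
  the argument.\<close>

lemma continuous_convergence_uniform:
 fixes u :: "nat => 'b::metric_space => real"
 assumes ccv: "!!z e. e > 0 ==> \<exists>r>0. \<exists>J. \<forall>j\<ge>J. \<forall>y. dist y z < r --> \<bar>u j y - l z\<bar> < e"
  and K: "compact K" and e: "e > 0"
 shows "\<exists>J. \<forall>j\<ge>J. \<forall>z\<in>K. \<bar>u j z - l z\<bar> < e"
proof (rule ccontr)
 assume "\<not> ?thesis"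
 hence "\<forall>m. \<exists>j\<ge>m. \<exists>z\<in>K. \<not> \<bar>u j z - l z\<bar> < e" by blast
 then obtain jm zm where jm: "!!m. jm m >= m" and zm: "!!m. zm m \<in> K" and bad: "!!m. \<not> \<bar>u (jm m) (zm m) - l (zm m)\<bar> < e"
  by metis
 obtain z \<alpha> where z: "z \<in> K" and \<alpha>: "strict_mono \<alpha>" and lim: "(zm \<circ> \<alpha>) \<longlonglongrightarrow> z"
  using K zm unfolding compact_eq_seq_compact_metric by (metis seq_compactE)
 obtain r J where r: "r > 0" and J: "!!j y. j >= J ==> dist y z < r ==> \<bar>u j y - l z\<bar> < e / 3"
  using ccv[of "e / 3" z] e by (metis zero_less_divide_iff zero_less_numeral)
 obtain M where M: "!!m. m >= M ==> dist (zm (\<alpha> m)) z < r"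
  using lim r unfolding lim_sequentially o_def by blast
 define m where "m = max M J"
 define y where "y = zm (\<alpha> m)"
 have y: "dist y z < r" using M[of m] by (simp add: m_def y_def)
 obtain r' J' where r': "r' > 0" and J': "!!j y'. j >= J' ==> dist y' y < r' ==> \<bar>u j y' - l y\<bar> < e / 3"
  using ccv[of "e / 3" y] e by (metis zero_less_divide_iff zero_less_numeral)
 have "\<bar>u (max J J') y - l y\<bar> < e / 3" using J'[of "max J J'" y] r' by simp
 moreover have "\<bar>u (max J J') y - l z\<bar> < e / 3" using J[of "max J J'" y] y by simp
 moreover have "jm (\<alpha> m) >= J" using jm[of "\<alpha> m"] strict_mono_imp_increasing[OF \<alpha>, of m] by (simp add: m_def)
 hence "\<bar>u (jm (\<alpha> m)) y - l z\<bar> < e / 3" using J y by blast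
 ultimately have "\<bar>u (jm (\<alpha> m)) y - l y\<bar> < e" by linarith
 thus False using bad[of "\<alpha> m"] by (simp add: y_def)
qed

text \<open>The function \<open>P . x + v x'\<close> of all \<open>n + 1\<close> variables. The
  shear depends on \<open>x'\<close> only, so the game preserves functions of this shape, and the
  cell problem is the equation with \<open>eps = 1\<close> restricted to them.\<close>

definition lift :: "(real^'n) \<times> real => (real^'n => real) => (real^'n) \<times> real => real" where
 "lift P v x = P \<bullet> x + v (fst x)"

lemma locally_bdd_lift:
 assumes "!!x y. v x <= v y + Lam * dist x y"
 shows "locally_bdd (lift P v)"
proof -
 have "\<bar>v x - v y\<bar> <= \<bar>Lam\<bar> * dist x y" for x y
 proof -
  have "Lam * dist x y <= \<bar>Lam\<bar> * dist x y" by (simp add: mult_right_mono)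
  thus ?thesis using assms[of x y] assms[of y x] by (simp add: dist_commute)
 qed
 hence "\<bar>Lam\<bar>-lipschitz_on UNIV v" by (auto simp: lipschitz_on_def dist_real_def)
 hence v: "continuous_on UNIV v" by (rule lipschitz_on_continuous_on)
 have "continuous_on UNIV (%x. v (fst x))"
  by (rule continuous_on_compose2[OF v]) (auto intro: continuous_intros)
 hence "continuous_on UNIV (lift P v)" unfolding lift_def by (intro continuous_intros)
 thus ?thesis by (rule locally_bdd_continuous)
qed

context shear_game
begin

lemma flow_subsequence_solution:
 assumes eps: "0 < eps" "eps <= 1" and g: "uniformly_continuous_on UNIV g"
  and h: "!!j. 0 < h j" "!!j. h j <= 1" "h \<longlonglongrightarrow> 0"
 obtains k l where "strict_mono (k :: nat => nat)"
  "!!z e. e > 0 ==> \<exists>r>0. \<exists>J. \<forall>j\<ge>J. \<forall>y. dist y z < r --> \<bar>flow eps (h (k j)) g (fst y) (snd y) - l (fst z) (snd z)\<bar> < e"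
  "par_visc_solution (%P. P \<noteq> 0) (FG eps d f) g l"
proof -
 define u where "u j z = flow eps (h j) g (fst z) (snd z)" for j and z :: "((real^'n) \<times> real) \<times> real"
 have bd: "\<exists>B. \<forall>j. \<bar>u j z\<bar> <= B" for z
 proof -
  obtain B where "!!x t h. norm x <= max (norm (fst z)) (snd z) ==> t <= max (norm (fst z)) (snd z) ==> 0 < h ==> h <= 1 ==> \<bar>flow eps h g x t\<bar> <= B"
   using flow_bounded[OF eps g] by blast
  hence "\<bar>u j z\<bar> <= B" for j using h by (simp add: u_def)
  thus ?thesis by blast
 qed
 have eq: "\<exists>r>0. \<exists>J. \<forall>j\<ge>J. \<forall>y. dist y z < r --> \<bar>u j y - u j z\<bar> <= e" if e: "e > 0" for z e
 proof -
  obtain r where r: "r > 0" "!!h y s. 0 < h ==> h < r ==> dist y (fst z) < r ==> \<bar>s - snd z\<bar> < r ==>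
   \<bar>flow eps h g y s - flow eps h g (fst z) (snd z)\<bar> <= e"
   using flow_equicontinuous[OF eps g e, of "fst z" "snd z"] by metis
  obtain J where J: "!!j. j >= J ==> h j < r"
   using order_tendstoD(2)[OF h(3) r(1)] by (auto simp: eventually_sequentially)
  have "\<bar>u j y - u j z\<bar> <= e" if "j >= J" "dist y z < r" for j y
   unfolding u_def using that dist_fst_le[of y z] dist_snd_le[of y z]
   by (intro r(2) h(1) J) (auto simp: dist_real_def)
  thus ?thesis using r(1) by blast
 qed
 obtain k l where k: "strict_mono (k :: nat => nat)"
  and ccv: "!!z e. e > 0 ==> \<exists>r>0. \<exists>J. \<forall>j\<ge>J. \<forall>y. dist y z < r --> \<bar>u (k j) y - l z\<bar> < e"
  and l: "continuous_on UNIV l"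
  using asymptotic_Arzela_Ascoli[of u, OF bd eq] by metis
 define l' where "l' x t = l (x, t)" for x t
 have hk: "(%j. h (k j)) \<longlonglongrightarrow> 0" using LIMSEQ_subseq_LIMSEQ[OF h(3) k] by (simp add: o_def)
 have ccv': "\<exists>r>0. \<exists>J. \<forall>j\<ge>J. \<forall>y s. dist y x < r --> \<bar>s - t\<bar> < r --> \<bar>flow eps (h (k j)) g y s - l' x t\<bar> < e" if e: "e > 0" for x t e
 proof -
  obtain r J where r: "r > 0" "!!j y. j >= J ==> dist y (x, t) < r ==> \<bar>u (k j) y - l (x, t)\<bar> < e" using ccv[OF e] by blast
  have "\<bar>flow eps (h (k j)) g y s - l' x t\<bar> < e" if "j >= J" "dist y x < r/2" "\<bar>s - t\<bar> < r/2" for j y s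
  proof -
   have "dist (y, s) (x, t) <= dist y x + dist s t"
    using sqrt_sum_squares_le_sum_abs[of "dist y x" "dist s t"] by (simp add: dist_Pair_Pair)
   hence "dist (y, s) (x, t) < r" using that by (simp add: dist_real_def)
   from r(2)[OF that(1) this] show ?thesis by (simp add: u_def l'_def)
  qed
  thus ?thesis using r(1) by (intro exI[of _ "r/2"] conjI exI[of _ J] allI impI) simp_all
 qed
 have init: "l' x 0 = g x" for x
 proof (rule ccontr)
  assume "l' x 0 \<noteq> g x"
  hence "\<bar>g x - l' x 0\<bar> > 0" by simp
  from ccv'[OF this, of x 0] obtain r J where "r > 0" "!!j y s. j >= J ==> dist y x < r ==> \<bar>s - 0\<bar> < r ==> \<bar>flow eps (h (k j)) g y s - l' x 0\<bar> < \<bar>g x - l' x 0\<bar>" by blast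
  hence "\<bar>flow eps (h (k J)) g x 0 - l' x 0\<bar> < \<bar>g x - l' x 0\<bar>" by simp
  thus False using flow_nonpos[OF h(1), of 0] by simp
 qed
 have "par_visc_solution (%P. P \<noteq> 0) (FG eps d f) g l'"
  unfolding par_visc_solution_def
 proof (intro conjI allI)
  have "(%(x, t). l' x t) = l" by (auto simp: l'_def)
  thus "continuous_on (UNIV \<times> {0..}) (%(x, t). l' x t)" using l continuous_on_subset by auto
  show "l' x 0 = g x" for x by (rule init)
  show "visc_sub_par (%P. P \<noteq> 0) (FG eps d f) l'" "visc_super_par (%P. P \<noteq> 0) (FG eps d f) l'"
   using flow_limit[OF eps g, of "%j. h (k j)" l'] h hk ccv' by auto
 qed
 moreover have "\<exists>r>0. \<exists>J. \<forall>j\<ge>J. \<forall>y. dist y z < r --> \<bar>flow eps (h (k j)) g (fst y) (snd y) - l' (fst z) (snd z)\<bar> < e" if "e > 0" for z e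
  using ccv[OF that, of z] by (simp add: u_def l'_def)
 ultimately show thesis using that k by blast
qed

text \<open>Uniqueness identifies every subsequential limit of the flow with \<open>G\<close>, so
  steps below any threshold reach a prescribed accuracy on bounded sets. The claim is existence of
  one such step; a rate of convergence is never produced.\<close>

lemma flow_approximates:
 assumes eps: "0 < eps" "eps <= 1" and g: "uniformly_continuous_on UNIV g"
  and uniq: "!!H. par_visc_solution (%P. P \<noteq> 0) (FG eps d f) g H ==> (!!x t. t >= 0 ==> H x t = G x t)"
  and "h0 > 0" "\<eta> > 0"
 shows "\<exists>h. 0 < h \<and> h < h0 \<and> (\<forall>x t. norm x <= R --> 0 <= t --> t <= R --> \<bar>flow eps h g x t - G x t\<bar> < \<eta>)"
proof -
 define h where "h j = min h0 1 / 2 * inverse (real (Suc j))" for j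
 have inv: "0 < inverse (real (Suc j))" "inverse (real (Suc j)) <= 1" for j by (auto simp: inverse_le_1_iff)
 have m: "min h0 1 > 0" using assms by simp
 have h1: "0 < h j" for j unfolding h_def using m inv(1)[of j] by (intro mult_pos_pos) auto
 have "h j <= min h0 1 / 2 * 1" for j unfolding h_def using m inv(2)[of j] by (intro mult_left_mono) auto
 hence h2: "h j <= min h0 1 / 2" for j by simp
 have h3: "h \<longlonglongrightarrow> 0" unfolding h_def using tendsto_mult_left[OF LIMSEQ_inverse_real_of_nat, of "min h0 1 / 2"] by simp
 have h4: "h j <= 1" "h j < h0" for j using h2[of j] m by (auto simp: min_def split: if_splits)
 obtain k l where k: "strict_mono (k :: nat => nat)"
  and ccv: "!!z e. e > 0 ==> \<exists>r>0. \<exists>J. \<forall>j\<ge>J. \<forall>y. dist y z < r --> \<bar>flow eps (h (k j)) g (fst y) (snd y) - l (fst z) (snd z)\<bar> < e"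
  and sol: "par_visc_solution (%P. P \<noteq> 0) (FG eps d f) g l"
  using flow_subsequence_solution[OF eps g h1 h4(1) h3] by metis
 have K: "compact (cball (0 :: (real^'n) \<times> real) R \<times> {0..R})" by (intro compact_Times) auto
 obtain J where J: "!!j z. j >= J ==> z \<in> cball (0 :: (real^'n) \<times> real) R \<times> {0..R} ==> \<bar>flow eps (h (k j)) g (fst z) (snd z) - l (fst z) (snd z)\<bar> < \<eta>"
  using continuous_convergence_uniform[of "%j z. flow eps (h (k j)) g (fst z) (snd z)" "%z. l (fst z) (snd z)", OF ccv K assms(6)] by blast
 have "\<bar>flow eps (h (k J)) g x t - G x t\<bar> < \<eta>" if "norm x <= R" "0 <= t" "t <= R" for x t
  using J[of J "(x, t)"] that uniq[OF sol, of t x] by simp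
 thus ?thesis using h1 h4(2) by blast
qed

section \<open>Lifted functions and the discounted discrete cell problem\<close>

text \<open>Serves both for lattice translations in \<open>x'\<close>, under which \<open>f\<close>
  is periodic, and for translations in the last variable, on which the drift does not
  depend.\<close>

lemma T_shift:
 assumes "locally_bdd u" "eps >= 0" "h >= 0" and V: "!!x. Vfield f ((1/eps) *\<^sub>R (x + z)) = Vfield f ((1/eps) *\<^sub>R x)"
  and u: "!!y. u (y + z) = u y + c"
 shows "T eps h u (x + z) = T eps h u x + c"
proof -
 have dr: "drift eps h (x + z) = drift eps h x + z" using V by (simp add: drift_def)
 have pt: "u (drift eps h (x + z) + m) = u (drift eps h x + m) + c" for m
 proof -
  have "drift eps h (x + z) + m = (drift eps h x + m) + z" by (simp add: dr)
  thus ?thesis by (simp only: u)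
 qed
 have "T eps h u (x + z) - c <= T eps h u x"
 proof (rule T_ge)
  fix E :: "(real^'n) \<times> real => (real^'n) \<times> real" assume E: "E \<in> controls"
  have "T eps h u (x + z) <= payoff (side eps h) h u (drift eps h (x + z)) E" using T_le assms E by blast
  also have "\<dots> <= payoff (side eps h) h u (drift eps h x) E + c" by (rule payoff_mono) (simp add: pt)
  finally show "T eps h u (x + z) - c <= payoff (side eps h) h u (drift eps h x) E" by simp
 qed
 moreover have "T eps h u x + c <= T eps h u (x + z)"
 proof (rule T_ge)
  fix E :: "(real^'n) \<times> real => (real^'n) \<times> real" assume E: "E \<in> controls"
  have "T eps h u x <= payoff (side eps h) h u (drift eps h x) E" using T_le assms E by blast
  also have "\<dots> <= payoff (side eps h) h u (drift eps h (x + z)) E + (- c)" by (rule payoff_mono) (simp add: pt)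
  finally show "T eps h u x + c <= payoff (side eps h) h u (drift eps h (x + z)) E" by simp
 qed
 ultimately show ?thesis by simp
qed

text \<open>On affine functions there is no second-order term and the expansion is exact: tangential
  moves never help the minimiser, as the opponent picks their sign, and the best normal points along
  \<open>P\<close>.\<close>

lemma T_linear:
 assumes "0 <= eps" "eps <= 1" "0 <= h" "h <= 1"
 shows "T eps h (%x. P \<bullet> x + c) x = P \<bullet> x + c - h * (norm P + Vfield f ((1/eps) *\<^sub>R x) \<bullet> P)"
proof (rule antisym)
 have lb: "locally_bdd (%x. P \<bullet> x + c)" by (intro locally_bdd_continuous continuous_intros)
 define \<nu> where "\<nu> = (if P = 0 then (0, 1) else sgn P)"
 have \<nu>: "norm \<nu> = 1" "P = norm P *\<^sub>R \<nu>" by (auto simp: \<nu>_def norm_sgn norm_Pair sgn_div_norm zero_prod_def)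
 show "T eps h (%x. P \<bullet> x + c) x <= P \<bullet> x + c - h * (norm P + Vfield f ((1/eps) *\<^sub>R x) \<bullet> P)"
  using T_upper_unit[OF assms lb _ \<nu>, of x 0] by (simp add: inner_add_right op_trace_def)
 define V where "V = Vfield f ((1/eps) *\<^sub>R x)"
 show "P \<bullet> x + c - h * (norm P + Vfield f ((1/eps) *\<^sub>R x) \<bullet> P) <= T eps h (%x. P \<bullet> x + c) x"
 proof (rule T_ge)
  fix E :: "(real^'n) \<times> real => (real^'n) \<times> real" assume E: "E \<in> controls"
  show "P \<bullet> x + c - h * (norm P + Vfield f ((1/eps) *\<^sub>R x) \<bullet> P) <= payoff (side eps h) h (%x. P \<bullet> x + c) (drift eps h x) E"
  proof (rule payoff_ge_const)
   fix i :: 'n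
   define e where "e = E (axis i 1, 0)"
   define sig :: real where "sig = (if P \<bullet> e >= 0 then 1 else -1)"
   have sig: "\<bar>sig\<bar> = 1" "sig * (P \<bullet> e) >= 0" by (auto simp: sig_def)
   have "norm (E (0, 1)) <= 1" using controls_norm_le[OF E, of "(0, 1)"] by (simp add: norm_Pair)
   hence "P \<bullet> E (0, 1) <= norm P"
    using norm_cauchy_schwarz[of P "E (0,1)"] mult_left_le[of "norm (E (0,1))" "norm P"] by simp
   hence 1: "h * (P \<bullet> E (0, 1)) <= h * norm P" using assms by (intro mult_left_mono)
   have 2: "0 <= side eps h * (sig * (P \<bullet> e))" using side_nonneg assms sig by simp
   have "P \<bullet> (drift eps h x + E (move (side eps h) h i sig)) = P \<bullet> x + side eps h * (sig * (P \<bullet> e)) - h * (V \<bullet> P + P \<bullet> E (0, 1))"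
    unfolding drift_move[OF controls_linear[OF E]]
    by (simp add: inner_add_right inner_diff_right e_def V_def inner_commute algebra_simps)
   thus "\<exists>sig. \<bar>sig\<bar> = 1 \<and> P \<bullet> x + c - h * (norm P + Vfield f ((1/eps) *\<^sub>R x) \<bullet> P)
     <= P \<bullet> (drift eps h x + E (move (side eps h) h i sig)) + c"
    using 1 2 sig(1) unfolding V_def[symmetric] by (intro exI[of _ sig]) (simp add: algebra_simps)
  qed
 qed
qed

definition cell_step :: "real => (real^'n) \<times> real => (real^'n => real) => real^'n => real" where
 "cell_step tau P v x = T 1 tau (lift P v) (x, 0) - fst P \<bullet> x"

lemma T_lift:
 assumes "locally_bdd (lift P v)" "tau >= 0"
 shows "T 1 tau (lift P v) x = P \<bullet> x + cell_step tau P v (fst x)"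
proof -
 obtain x' a where x: "x = (x', a)" by (cases x)
 have "T 1 tau (lift P v) ((x', 0) + (0, a)) = T 1 tau (lift P v) (x', 0) + snd P * a"
  by (rule T_shift) (use assms in \<open>auto simp: lift_def Vfield_def inner_prod_def inner_add_right algebra_simps\<close>)
 thus ?thesis by (simp add: x cell_step_def inner_prod_def)
qed

end

text \<open>The Hessian of \<open>v (fst x)\<close> as a function of all variables.\<close>

definition embed_op :: "((real^'n) \<Rightarrow>\<^sub>L (real^'n)) => ((real^'n) \<times> real) \<Rightarrow>\<^sub>L ((real^'n) \<times> real)" where
 "embed_op X = Blinfun (%z. (blinfun_apply X (fst z), 0))"

lemma embed_op_apply [simp]: "blinfun_apply (embed_op X) z = (blinfun_apply X (fst z), 0)"
proof -
 have "bounded_linear (%z :: (real^'a) \<times> real. (blinfun_apply X (fst z), 0 :: real))"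
  by (intro bounded_linear_Pair bounded_linear_compose[OF blinfun.bounded_linear_right bounded_linear_fst] bounded_linear_zero)
 from bounded_linear_Blinfun_apply[OF this] show ?thesis by (simp add: embed_op_def)
qed

lemma op_trace_embed: "op_trace (embed_op X) = op_trace X"
proof -
 have B: "(Basis :: (real^'n) set) = (%i. axis i 1) ` UNIV" by (auto simp: Basis_vec_def)
 have "op_trace X = (\<Sum>i\<in>UNIV. blinfun_apply X (axis i 1) \<bullet> axis i 1)"
  unfolding op_trace_def B by (subst sum.reindex) (auto simp: inj_on_def axis_eq_axis)
 moreover have "op_trace (embed_op X) = (\<Sum>i\<in>UNIV. blinfun_apply X (axis i 1) \<bullet> axis i 1)"
  unfolding op_trace_def Basis_sum_spacetime by simp
 ultimately show ?thesis by simp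
qed

lemma symmetric_embed: "symmetric_op X ==> symmetric_op (embed_op X)"
 by (auto simp: symmetric_op_def)

text \<open>The cell operator is the operator of the G-equation at a gradient with last component
  \<open>snd P\<close>, so every consistency estimate carries over without a second
  computation.\<close>

lemma FG_embed: "FG 1 d f x (fst P + Q, snd P) (embed_op X) = Fcell d f P (fst x) Q X"
 by (simp add: FG_def Fcell_def Let_def op_trace_embed norm_Pair add.commute Vfield_def mult.commute)

text \<open>Viewed as constant in time, the lift turns a stationary jet into a parabolic one with
  zero time slope, and the parabolic test becomes available for the cell problem.\<close>

lemma superjet_lift:
 assumes "(Q, X) \<in> superjet v x0"
 shows "(0, P + (Q, 0), embed_op X) \<in> par_superjet (%x t. lift P v x) (x0, 0) t0"
proof -
 have sym: "symmetric_op X" and jet: "!!e. e > 0 ==> \<exists>r>0. \<forall>y. dist y x0 < r -->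
    v y <= v x0 + Q \<bullet> (y - x0) + (1/2) * (blinfun_apply X (y - x0) \<bullet> (y - x0)) + e * (norm (y - x0))\<^sup>2"
  using assms unfolding superjet_def by auto
 have "\<exists>r>0. \<forall>y s. s > 0 --> dist y (x0, 0) < r --> \<bar>s - t0\<bar> < r -->
    lift P v y <= lift P v (x0, 0) + 0 * (s - t0) + (P + (Q, 0)) \<bullet> (y - (x0, 0))
       + (1/2) * (blinfun_apply (embed_op X) (y - (x0, 0)) \<bullet> (y - (x0, 0)))
       + e * (\<bar>s - t0\<bar> + (norm (y - (x0, 0)))\<^sup>2)" if e: "e > 0" for e
 proof -
  obtain r where r: "r > 0" and le: "!!y. dist y x0 < r ==>
    v y <= v x0 + Q \<bullet> (y - x0) + (1/2) * (blinfun_apply X (y - x0) \<bullet> (y - x0)) + e * (norm (y - x0))\<^sup>2"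
   using jet[OF e] by blast
  have "lift P v y <= lift P v (x0, 0) + 0 * (s - t0) + (P + (Q, 0)) \<bullet> (y - (x0, 0))
       + (1/2) * (blinfun_apply (embed_op X) (y - (x0, 0)) \<bullet> (y - (x0, 0)))
       + e * (\<bar>s - t0\<bar> + (norm (y - (x0, 0)))\<^sup>2)" if y: "dist y (x0, 0) < r" for y :: "(real^'a) \<times> real" and s
  proof -
   obtain y' a where yy: "y = (y', a)" by (cases y)
   have "dist y' x0 < r" using y dist_fst_le[of y "(x0, 0)"] by (simp add: yy)
   note le' = le[OF this]
   have "norm (y' - x0) <= norm (y - (x0, 0))" using dist_fst_le[of y "(x0, 0)"] by (simp add: yy dist_norm)
   hence "(norm (y' - x0))\<^sup>2 <= (norm (y - (x0, 0)))\<^sup>2" by (intro power_mono) auto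
   hence "(norm (y' - x0))\<^sup>2 <= \<bar>s - t0\<bar> + (norm (y - (x0, 0)))\<^sup>2" using abs_ge_zero[of "s - t0"] by linarith
   hence "e * (norm (y' - x0))\<^sup>2 <= e * (\<bar>s - t0\<bar> + (norm (y - (x0, 0)))\<^sup>2)" using e by (intro mult_left_mono) auto
   thus ?thesis using le' by (cases P) (simp add: lift_def yy inner_diff_right inner_add_left)
  qed
  thus ?thesis using r by blast
 qed
 thus ?thesis using symmetric_embed[OF sym] unfolding par_superjet_def by auto
qed

lemma subjet_minus: "(Q, X) \<in> subjet v x \<longleftrightarrow> (- Q, - X) \<in> superjet (%y. - v y) x"
proof -
 have 1: "symmetric_op (- X) \<longleftrightarrow> symmetric_op X"
  by (simp add: symmetric_op_def blinfun.minus_left)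
 have 2: "- v y <= - v x + (- Q) \<bullet> (y - x) + 1/2 * (blinfun_apply (- X) (y - x) \<bullet> (y - x))
   + e * (norm (y - x))\<^sup>2 \<longleftrightarrow>
   v y >= v x + Q \<bullet> (y - x) + 1/2 * (blinfun_apply X (y - x) \<bullet> (y - x))
   - e * (norm (y - x))\<^sup>2" for y e
  by (simp add: blinfun.minus_left) linarith
 show ?thesis unfolding subjet_def superjet_def mem_Collect_eq split 1 2 ..
qed

lemma embed_op_minus: "embed_op (- X) = - embed_op X"
 by (rule blinfun_eqI) (simp add: blinfun.minus_left)

lemma subjet_lift:
 assumes "(Q, X) \<in> subjet v x0"
 shows "(0, P + (Q, 0), embed_op X) \<in> par_subjet (%x t. lift P v x) (x0, 0) t0"
proof -
 have "(0, - P + (- Q, 0), embed_op (- X)) \<in> par_superjet (%x t. lift (- P) (%y. - v y) x) (x0, 0) t0"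
  by (rule superjet_lift) (use assms subjet_minus in blast)
 moreover have "- P + (- Q, 0) = - (P + (Q, 0))" by simp
 moreover have "(%x t. lift (- P) (%y. - v y) x) = (%(x :: (real^'a) \<times> real) (t :: real). - lift P v x)" by (simp add: lift_def fun_eq_iff)
 ultimately show ?thesis by (simp add: par_subjet_minus embed_op_minus)
qed

context shear_game
begin

lemma cell_step_mono:
 assumes "locally_bdd (lift P v)" "locally_bdd (lift P w)" "tau >= 0" "!!x. v x <= w x + c"
 shows "cell_step tau P v x <= cell_step tau P w x + c"
 using T_mono[OF _ assms(3) assms(1,2), of 1 c "(x, 0)"] assms(4) by (simp add: cell_step_def lift_def)

lemma cell_step_const:
 assumes "0 <= tau" "tau <= 1"
 shows "cell_step tau P (%_. c) x = c - tau * (norm P + snd P * f x)"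
 using T_linear[of 1 tau P c "(x, 0)"] assms
 by (simp add: cell_step_def lift_def[abs_def] inner_prod_def Vfield_def mult.commute)

text \<open>Equal moves from two points keep their difference in \<open>x'\<close>. The drifts
  differ only in the last variable, where the lift is affine with slope \<open>snd P\<close>; this
  is the only source of growth.\<close>

lemma cell_step_lipschitz:
 assumes v: "!!x y. v x <= v y + Lam * dist x y" and "tau >= 0"
 shows "cell_step tau P v x <= cell_step tau P v y + (Lam + tau * (\<bar>snd P\<bar> * L)) * dist x y"
proof -
 have lb: "locally_bdd (lift P v)" using v by (rule locally_bdd_lift)
 define c where "c = fst P \<bullet> x - fst P \<bullet> y + (Lam + tau * (\<bar>snd P\<bar> * L)) * dist x y"
 have "T 1 tau (lift P v) (x, 0) - c <= T 1 tau (lift P v) (y, 0)"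
 proof (rule T_ge)
  fix E :: "(real^'n) \<times> real => (real^'n) \<times> real" assume E: "E \<in> controls"
  have pt: "lift P v (drift 1 tau (x, 0) + m) <= lift P v (drift 1 tau (y, 0) + m) + c" for m :: "(real^'n) \<times> real"
  proof -
   obtain m1 m2 where m: "m = (m1, m2)" by (cases m)
   have "v (x + m1) <= v (y + m1) + Lam * dist x y" using v[of "x + m1" "y + m1"] by simp
   moreover have "\<bar>snd P * (tau * (f y - f x))\<bar> <= tau * (\<bar>snd P\<bar> * L) * dist x y"
   proof -
    have "\<bar>snd P * (tau * (f y - f x))\<bar> = tau * \<bar>snd P\<bar> * \<bar>f x - f y\<bar>"
     using assms by (simp add: abs_mult abs_minus_commute)
    also have "\<dots> <= tau * \<bar>snd P\<bar> * (L * dist x y)" using assms f_lip by (intro mult_left_mono) auto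
    finally show ?thesis by (simp add: mult.assoc)
   qed
   ultimately show ?thesis
    by (simp add: lift_def m drift_def Vfield_def inner_prod_def inner_add_right c_def algebra_simps abs_le_iff)
  qed
  have "T 1 tau (lift P v) (x, 0) <= payoff (side 1 tau) tau (lift P v) (drift 1 tau (x, 0)) E" using T_le lb assms E by simp
  also have "\<dots> <= payoff (side 1 tau) tau (lift P v) (drift 1 tau (y, 0)) E + c" by (rule payoff_mono) (rule pt)
  finally show "T 1 tau (lift P v) (x, 0) - c <= payoff (side 1 tau) tau (lift P v) (drift 1 tau (y, 0)) E" by simp
 qed
 thus ?thesis by (simp add: cell_step_def c_def)
qed

lemma cell_step_periodic:
 assumes "zn_periodic f" "zn_periodic v" "locally_bdd (lift P v)" "tau >= 0"
 shows "zn_periodic (cell_step tau P v)"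
 unfolding zn_periodic_def
proof (intro allI impI)
 fix x k :: "real^'n" assume k: "\<forall>i. k $ i \<in> \<int>"
 have "T 1 tau (lift P v) ((x, 0) + (k, 0)) = T 1 tau (lift P v) (x, 0) + fst P \<bullet> k"
  by (rule T_shift) (use assms k in \<open>auto simp: lift_def Vfield_def zn_periodic_def inner_prod_def inner_add_right\<close>)
 thus "cell_step tau P v (x + k) = cell_step tau P v x" by (simp add: cell_step_def inner_add_right)
qed

text \<open>Implicit stepping leads to \<open>cell_step v = (1 + lam * tau) * v\<close>, a
  fixed-point problem with contraction factor \<open>1 / D\<close>. Constants are explicit barriers,
  and the Lipschitz constant \<open>abs (snd P) * L / lam\<close> is invariant because division by
  \<open>D\<close> compensates its growth. A late iterate with residual \<open>tau^2\<close>
  suffices, so no fixed point is constructed.\<close>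

lemma discrete_cell:
 assumes per: "zn_periodic f" and lam: "lam > 0" and tau: "0 < tau" "tau <= 1"
 shows "\<exists>v. zn_periodic v \<and> (\<forall>x y. v x <= v y + (\<bar>snd P\<bar> * L / lam) * dist x y) \<and>
  (\<forall>x. \<bar>v x + norm P / lam\<bar> <= \<bar>snd P\<bar> * F / lam) \<and>
  (\<forall>x. \<bar>T 1 tau (lift P v) x - (lift P v x + tau * lam * v (fst x))\<bar> <= tau\<^sup>2)"
proof -
 define Lam where "Lam = \<bar>snd P\<bar> * L / lam"
 define b where "b = \<bar>snd P\<bar> * F / lam"
 \<comment> \<open>\<open>c0\<close> is the discounted solution in the absence of shear, and
   \<open>b\<close> the deviation that \<open>abs (f x) <= F\<close> can cause.\<close>
 define c0 where "c0 = - norm P / lam"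
 define D where "D = 1 + lam * tau"
 have D: "D > 1" using lam tau by (simp add: D_def)
 have b: "b >= 0" using lam F_nonneg by (simp add: b_def)
 define w where "w k = ((%v x. cell_step tau P v x / D) ^^ k) (%_. c0)" for k
 have w0: "w 0 = (%_. c0)" and wS: "w (Suc k) = (%x. cell_step tau P (w k) x / D)" for k
  by (simp_all add: w_def)
 have tau0: "tau >= 0" using tau by simp
 have lip: "w k x <= w k y + Lam * dist x y" for k x y
 proof (induction k arbitrary: x y)
  case 0
  thus ?case using lam L_nonneg by (simp add: w0 Lam_def)
 next
  case (Suc k)
  have "cell_step tau P (w k) x <= cell_step tau P (w k) y + (Lam + tau * (\<bar>snd P\<bar> * L)) * dist x y"
   by (rule cell_step_lipschitz[OF Suc tau0])
  also have "Lam + tau * (\<bar>snd P\<bar> * L) = Lam * D" using lam by (simp add: Lam_def D_def field_simps)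
  finally show ?case using D by (simp add: wS field_simps)
 qed
 have lb: "locally_bdd (lift P (w k))" for k using lip by (rule locally_bdd_lift)
 have cl: "locally_bdd (lift P (%_. c))" for c by (rule locally_bdd_lift[of _ 0]) simp
 have pr: "zn_periodic (w k)" for k
 proof (induction k)
  case 0
  thus ?case by (simp add: w0 zn_periodic_def)
 next
  case (Suc k)
  from cell_step_periodic[OF per Suc lb tau0] show ?case by (simp add: wS zn_periodic_def)
 qed
 have bd: "\<bar>w k x - c0\<bar> <= b" for k x
 proof (induction k arbitrary: x)
  case 0
  thus ?case using b by (simp add: w0)
 next
  case (Suc k)
  have 1: "lam * (c0 + b) = - norm P + \<bar>snd P\<bar> * F" "lam * (c0 - b) = - norm P - \<bar>snd P\<bar> * F"
   using lam by (simp_all add: c0_def b_def field_simps)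
  have pf: "\<bar>snd P * f x\<bar> <= \<bar>snd P\<bar> * F" by (simp add: abs_mult f_bound mult_left_mono)
  have "cell_step tau P (w k) x <= cell_step tau P (%_. c0 + b) x + 0"
   by (rule cell_step_mono[OF lb cl tau0]) (use Suc in \<open>simp add: abs_le_iff algebra_simps\<close>)
  also have "\<dots> = c0 + b - tau * (norm P + snd P * f x)" using cell_step_const tau by simp
  also have "\<dots> <= c0 + b + tau * (lam * (c0 + b))"
  proof -
   have "- (norm P + snd P * f x) <= lam * (c0 + b)" using pf unfolding 1 by (simp add: abs_le_iff)
   hence "tau * (- (norm P + snd P * f x)) <= tau * (lam * (c0 + b))" using tau0 by (intro mult_left_mono)
   thus ?thesis by (simp only: mult_minus_right)
  qed
  also have "\<dots> = D * (c0 + b)" by (simp add: D_def algebra_simps)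
  finally have up: "w (Suc k) x <= c0 + b" using D by (simp add: wS field_simps)
  have "D * (c0 - b) = c0 - b + tau * (lam * (c0 - b))" by (simp add: D_def algebra_simps)
  also have "\<dots> <= c0 - b - tau * (norm P + snd P * f x)"
  proof -
   have "lam * (c0 - b) <= - (norm P + snd P * f x)" using pf unfolding 1 by (simp add: abs_le_iff)
   hence "tau * (lam * (c0 - b)) <= tau * (- (norm P + snd P * f x))" using tau0 by (intro mult_left_mono)
   thus ?thesis by (simp only: mult_minus_right)
  qed
  also have "\<dots> = cell_step tau P (%_. c0 - b) x" using cell_step_const tau by simp
  also have "\<dots> <= cell_step tau P (w k) x + 0"
   by (rule cell_step_mono[OF cl lb tau0]) (use Suc in \<open>simp add: abs_le_iff algebra_simps\<close>)
  finally have "c0 - b <= w (Suc k) x" using D by (simp add: wS field_simps)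
  with up show ?case by (simp add: abs_le_iff)
 qed
 have contr: "\<bar>w (Suc k) x - w k x\<bar> <= 2 * b / D ^ k" for k x
 proof (induction k arbitrary: x)
  case 0
  have "\<bar>w 1 x - c0\<bar> <= b" using bd[of 1 x] .
  thus ?case using b by (simp add: w0)
 next
  case (Suc k)
  have "cell_step tau P (w (Suc k)) x <= cell_step tau P (w k) x + 2 * b / D ^ k"
   by (rule cell_step_mono[OF lb lb tau0]) (use Suc in \<open>simp add: abs_le_iff algebra_simps\<close>)
  moreover have "cell_step tau P (w k) x <= cell_step tau P (w (Suc k)) x + 2 * b / D ^ k"
   by (rule cell_step_mono[OF lb lb tau0]) (use Suc in \<open>simp add: abs_le_iff algebra_simps\<close>)
  ultimately have "\<bar>cell_step tau P (w (Suc k)) x - cell_step tau P (w k) x\<bar> <= 2 * b / D ^ k" by linarith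
  hence "\<bar>cell_step tau P (w (Suc k)) x - cell_step tau P (w k) x\<bar> / D <= 2 * b / D ^ k / D"
   using D by (intro divide_right_mono) auto
  hence "\<bar>(cell_step tau P (w (Suc k)) x - cell_step tau P (w k) x) / D\<bar> <= 2 * b / D ^ k / D"
   using D by (simp add: abs_divide)
  thus ?case by (simp add: wS[of "Suc k"] wS[of k] diff_divide_distrib mult.commute)
 qed
 have "(%k. D * (2 * b) * (1 / D) ^ k) \<longlonglongrightarrow> D * (2 * b) * 0"
  using D by (intro tendsto_mult_left LIMSEQ_realpow_zero) auto
 hence "\<forall>\<^sub>F k in sequentially. D * (2 * b) * (1 / D) ^ k < tau\<^sup>2"
  by (rule order_tendstoD) (use tau in auto)
 then obtain k where k: "D * (2 * b) * (1 / D) ^ k < tau\<^sup>2" by (meson eventually_happens' sequentially_bot)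
 have "\<bar>T 1 tau (lift P (w k)) x - (lift P (w k) x + tau * lam * w k (fst x))\<bar> <= tau\<^sup>2" for x
 proof -
  have "T 1 tau (lift P (w k)) x - (lift P (w k) x + tau * lam * w k (fst x)) = cell_step tau P (w k) (fst x) - D * w k (fst x)"
   unfolding T_lift[OF lb tau0] by (simp add: lift_def D_def algebra_simps)
  also have "\<dots> = D * (w (Suc k) (fst x) - w k (fst x))" using D by (simp add: wS algebra_simps)
  finally have "\<bar>T 1 tau (lift P (w k)) x - (lift P (w k) x + tau * lam * w k (fst x))\<bar> = D * \<bar>w (Suc k) (fst x) - w k (fst x)\<bar>"
   using D by (simp add: abs_mult)
  also have "\<dots> <= D * (2 * b / D ^ k)" using contr D by (intro mult_left_mono) auto
  also have "\<dots> = D * (2 * b) * (1 / D) ^ k" by (simp add: power_divide)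
  finally show ?thesis using k by simp
 qed
 moreover have "\<bar>w k x + norm P / lam\<bar> <= b" for x using bd[of k x] by (simp add: c0_def)
 ultimately show ?thesis using pr[of k] lip[of k] unfolding Lam_def b_def by blast
qed

end

section \<open>Limits of the discounted game and the flat cell problem\<close>

context shear_game
begin

text \<open>The approximants are treated as time-independent solutions of a scheme with source
  \<open>- lam * w j\<close>, tested at the dummy time \<open>1\<close> without perturbation. A
  nonzero \<open>snd P\<close> keeps the gradients of the lift away from the singularity.\<close>

lemma cell_limit:
 assumes lam: "lam > 0" and P: "snd P \<noteq> 0"
  and tau: "!!j. 0 < tau j" "!!j. tau j <= 1" "tau \<longlonglongrightarrow> 0"
  and lip: "!!j x y. w j x <= w j y + Lam * dist x y"
  and eq: "!!j x. \<bar>T 1 (tau j) (lift P (w j)) x - (lift P (w j) x + tau j * lam * w j (fst x))\<bar> <= (tau j)\<^sup>2"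
  and ccv: "!!x e. e > 0 ==> \<exists>r>0. \<exists>J. \<forall>j\<ge>J. \<forall>y. dist y x < r --> \<bar>w j y - v x\<bar> < e"
 shows "visc_sub_st lam (cell_dom P) (Fcell d f P) v" and "visc_super_st lam (cell_dom P) (Fcell d f P) v"
proof -
 have mono: "local_mono (T 1 (tau j)) (reach 1 (tau j))" for j
  using T_local_mono tau(1)[of j] by simp
 have lb: "locally_bdd (lift P (w j))" for j using lip by (rule locally_bdd_lift)
 have bd: "\<exists>B. \<forall>x t. norm x <= R --> 0 <= t --> t <= R --> \<bar>lift P (w j) x\<bar> <= B" for j and R :: real
  using lb[of j] unfolding locally_bdd_def by blast
 have st1: "lift P (w j) x <= T 1 (tau j) (%y. lift P (w j) y) x + tau j * (- lam * w j (fst x) + tau j)" for j x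
  using eq[of j x] by (simp add: abs_le_iff power2_eq_square algebra_simps)
 have st2: "lift P (w j) x >= T 1 (tau j) (%y. lift P (w j) y) x - tau j * (lam * w j (fst x) + tau j)" for j x
  using eq[of j x] by (simp add: abs_le_iff power2_eq_square algebra_simps)
 have up: "\<exists>r>0. \<exists>J. \<forall>j\<ge>J. \<forall>y s. dist y x < r --> \<bar>s - t\<bar> < r --> \<bar>lift P (w j) y - lift P v x\<bar> < e"
  if e: "e > 0" for x e and t :: real
 proof -
  obtain r J where rJ: "r > 0" "!!j y. j >= J ==> dist y (fst x) < r ==> \<bar>w j y - v (fst x)\<bar> < e/2"
   using ccv[of "e/2" "fst x"] e by (metis zero_less_divide_iff zero_less_numeral)
  obtain r2 where r2: "r2 > 0" "norm P * r2 <= e/2"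
   using small_factor[of "norm P" "e/2"] e by (metis norm_ge_zero zero_less_divide_iff zero_less_numeral)
  have "\<bar>lift P (w j) y - lift P v x\<bar> < e" if "j >= J" "dist y x < min r r2" for j y
  proof -
   have "dist (fst y) (fst x) < r" using that dist_fst_le[of y x] by simp
   hence 1: "\<bar>w j (fst y) - v (fst x)\<bar> < e/2" using rJ that by blast
   have "\<bar>P \<bullet> (y - x)\<bar> <= norm P * norm (y - x)" by (rule Cauchy_Schwarz_ineq2)
   also have "\<dots> <= norm P * r2" using that by (intro mult_left_mono) (auto simp: dist_norm)
   finally have "\<bar>P \<bullet> y - P \<bullet> x\<bar> <= e/2" using r2 by (simp add: inner_diff_right)
   thus ?thesis using 1 unfolding lift_def by linarith
  qed
  thus ?thesis using rJ(1) r2(1) by (intro exI[of _ "min r r2"] conjI exI[of _ J]) auto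
 qed
 have at: "\<exists>j\<ge>J. \<exists>y s. dist y x < r \<and> \<bar>s - t\<bar> < r \<and> \<bar>lift P (w j) y - lift P v x\<bar> < e"
  if e: "e > 0" "r > 0" for x e r J and t :: real
 proof -
  obtain r' J' where r': "r' > 0" "!!j y s. j >= J' ==> dist y x < r' ==> \<bar>s - t\<bar> < r' ==> \<bar>lift P (w j) y - lift P v x\<bar> < e"
   using up[OF e(1), of x t] by blast
  have "\<bar>lift P (w (max J J')) x - lift P v x\<bar> < e" using r'(1) by (intro r'(2)[of _ x t]) auto
  thus ?thesis using e by (intro exI[of _ "max J J'"] conjI exI[of _ x] exI[of _ t]) auto
 qed
 \<comment> \<open>\<open>C\<close> will be the Lipschitz constant of the operator in the gradient
   and \<open>N\<close> the norm of the Hessian; all radii are fixed before the index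
   \<open>J\<close>.\<close>
 have parameters: "\<exists>e r' kp J. e > 0 \<and> e <= 1 \<and> r' > 0 \<and> r' <= r \<and> kp > 0 \<and>
   (2 + 4 * d * CARD('n)) * e <= \<delta> / 8 \<and> kp * (F + 1) <= \<delta> / 8 \<and> kp + (N + 4) * r' <= r / 2 \<and>
   C * (kp + 4 * r') <= \<delta> / 8 \<and>
   (\<forall>j\<ge>J. small_error 1 N e (kp * (F + 1)) (tau j) \<and> tau j <= \<delta> / 8 \<and>
    (\<forall>y. dist y x0 < r' --> \<bar>lam * v x0 - lam * w j y\<bar> < \<delta> / 8))"
  if \<delta>: "\<delta> > 0" "r > 0" and N: "N >= 0" "C >= 0" for \<delta> r N C x0
 proof -
  obtain e where e: "e > 0" "e <= 1" "(2 + 4 * d * CARD('n)) * e <= \<delta> / 8"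
   using small_factor[of "2 + 4 * d * CARD('n)" "\<delta> / 8"] d_pos \<delta> by auto
  define m where "m = min (r / 4) (\<delta> / 16)"
  have m: "m > 0" "m <= r / 4" "m <= \<delta> / 16" using \<delta> by (auto simp: m_def)
  obtain kp where kp: "kp > 0" "kp <= 1" "((F + 1) + C + 1) * kp <= m"
   using small_factor[of "(F + 1) + C + 1" m] m F_nonneg N by auto
  have ex: "((F + 1) + C + 1) * kp = kp * (F + 1) + C * kp + kp" by (simp add: algebra_simps)
  have ks: "kp * (F + 1) >= 0" "C * kp >= 0" using kp F_nonneg N by simp_all
  obtain r1 where r1: "r1 > 0" "r1 <= 1" "((N + 4) + 4 * C) * r1 <= m"
   using small_factor[of "(N + 4) + 4 * C" m] m N by auto
  obtain r3 J3 where r3: "r3 > 0" "!!j y. j >= J3 ==> dist y x0 < r3 ==> \<bar>w j y - v x0\<bar> < \<delta> / 8 / lam"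
   using ccv[of "\<delta> / 8 / lam" x0] \<delta> lam by auto
  define r' where "r' = min r (min r1 r3)"
  have r': "r' > 0" "r' <= r" "r' <= r1" "r' <= r3" using \<delta> r1 r3 by (auto simp: r'_def)
  have "((N + 4) + 4 * C) * r' <= ((N + 4) + 4 * C) * r1" using r' N by (intro mult_left_mono) auto
  moreover have "((N + 4) + 4 * C) * r' = (N + 4) * r' + C * (4 * r')" by (simp add: algebra_simps)
  moreover have "(N + 4) * r' >= 0" "C * (4 * r') >= 0" using r' N by simp_all
  ultimately have rr: "(N + 4) * r' <= m" "C * (4 * r') <= m" using r1 by linarith+
  obtain h0 where h0: "h0 > 0" "h0 <= 1" "!!h. 0 < h ==> h < h0 ==> small_error 1 N e (kp * (F + 1)) h"
   using small_error_ex[of 1 N e "kp * (F + 1)"] e kp N F_nonneg by auto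
  have hd: "min h0 (\<delta> / 8) > 0" using h0 \<delta> by simp
  obtain J1 where J1: "!!j. j >= J1 ==> tau j < min h0 (\<delta> / 8)"
   using order_tendstoD(2)[OF tau(3) hd] unfolding eventually_sequentially by blast
  have fin: "small_error 1 N e (kp * (F + 1)) (tau j) \<and> tau j <= \<delta> / 8 \<and>
    (\<forall>y. dist y x0 < r' --> \<bar>lam * v x0 - lam * w j y\<bar> < \<delta> / 8)" if j: "j >= max J1 J3" for j
  proof (intro conjI allI impI)
   show "small_error 1 N e (kp * (F + 1)) (tau j)" "tau j <= \<delta> / 8" using h0 J1[of j] tau(1)[of j] j by auto
   fix y assume "dist y x0 < r'"
   hence "\<bar>w j y - v x0\<bar> < \<delta> / 8 / lam" using r3(2)[of j y] r' j by simp
   hence "lam * \<bar>w j y - v x0\<bar> < \<delta> / 8" using lam by (simp add: field_simps)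
   moreover have "\<bar>lam * v x0 - lam * w j y\<bar> = lam * \<bar>w j y - v x0\<bar>"
    using lam by (simp add: abs_mult abs_minus_commute flip: right_diff_distrib)
   ultimately show "\<bar>lam * v x0 - lam * w j y\<bar> < \<delta> / 8" by simp
  qed
  define A1 where "A1 = kp * (F + 1)"
  define A2 where "A2 = C * kp"
  define A3 where "A3 = (N + 4) * r'"
  define A4 where "A4 = C * (4 * r')"
  have km: "A1 + A2 + kp <= m" using kp(3) unfolding ex A1_def A2_def .
  note nn = ks[folded A1_def A2_def] rr[folded A3_def A4_def] m kp(1)
  have b1: "kp * (F + 1) <= \<delta> / 8" unfolding A1_def[symmetric] using km nn by linarith
  have b2: "kp + (N + 4) * r' <= r / 2" unfolding A3_def[symmetric] using km nn by linarith
  have "C * (kp + 4 * r') = A2 + A4" by (simp add: A2_def A4_def algebra_simps)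
  hence b3: "C * (kp + 4 * r') <= \<delta> / 8" using km nn by linarith
  show ?thesis
  proof (rule exI[of _ e], rule exI[of _ r'], rule exI[of _ kp], rule exI[of _ "max J1 J3"], intro conjI)
   show "kp * (F + 1) <= \<delta> / 8" "kp + (N + 4) * r' <= r / 2" "C * (kp + 4 * r') <= \<delta> / 8" by (rule b1 b2 b3)+
   show "\<forall>j\<ge>max J1 J3. small_error 1 N e (kp * (F + 1)) (tau j) \<and> tau j <= \<delta> / 8 \<and>
    (\<forall>y. dist y x0 < r' --> \<bar>lam * v x0 - lam * w j y\<bar> < \<delta> / 8)" using fin by blast
  qed (use e kp r' in auto)
 qed
 \<comment> \<open>The game test yields a gradient \<open>Q'\<close> in \<open>n + 1\<close>
   variables, but the cell operator admits only the last component \<open>snd P\<close>. Resetting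
   that component changes the gradient by at most \<open>kp + 4 * r'\<close>, since the embedded
   Hessian contributes nothing to it, and the Lipschitz bound in the gradient does the rest.\<close>
 have transfer: "dist (fst Q' - fst P) Q < r \<and> cell_dom P (fst Q' - fst P) \<and>
   \<bar>Fcell d f P (fst y) (fst Q' - fst P) X - FG 1 d f y Q' (embed_op X)\<bar>
    <= (1 + F + 4 * d * norm (embed_op X) / \<bar>snd P\<bar>) * (kp + 4 * r')"
  if Q': "Q' \<noteq> 0" "norm (Q' - (P + (Q, 0) + blinfun_apply (embed_op X) (y - (x0, 0)) + c *\<^sub>R (y - (x0, 0)))) <= kp"
   and y: "dist y (x0, 0) < r'" and c: "\<bar>c\<bar> <= 4" and small: "kp + (norm (embed_op X) + 4) * r' <= r / 2" and r: "r > 0"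
  for Q' Q X y x0 c kp r r'
 proof -
  define X' where "X' = embed_op X"
  define z where "z = y - (x0, 0)"
  have nz: "norm z <= r'" using y by (simp add: z_def dist_norm)
  define Q1 where "Q1 = (fst Q', snd P)"
  have Q1: "Q1 \<noteq> 0" using P by (simp add: Q1_def zero_prod_def)
  have cz: "norm (c *\<^sub>R z) <= 4 * r'" using mult_mono[OF c nz] by simp
  define A where "A = P + (Q, 0)"
  define B where "B = blinfun_apply X' z + c *\<^sub>R z"
  have nB: "norm B <= norm X' * r' + 4 * r'"
   unfolding B_def using norm_triangle_le[OF add_mono[OF order_trans[OF norm_blinfun[of X' z] mult_left_mono[OF nz norm_ge_zero]] cz]] .
  have nQ: "norm (Q' - (A + B)) <= kp"
   using Q'(2) unfolding A_def B_def X'_def z_def by (simp only: add.assoc)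
  have "norm (Q' - A) <= norm (Q' - (A + B)) + norm B" using norm_triangle_ineq[of "Q' - (A + B)" B] by simp
  hence n1: "norm (Q' - (P + (Q, 0))) <= kp + (norm X' * r' + 4 * r')" using nB nQ unfolding A_def by linarith
  have "dist (fst Q' - fst P) Q = norm (fst (Q' - (P + (Q, 0))))" by (simp add: dist_norm algebra_simps)
  also have "\<dots> <= norm (Q' - (P + (Q, 0)))" using dist_fst_le[of "Q' - (P + (Q, 0))" 0] by simp
  also have "\<dots> < r" using n1 small r by (simp add: X'_def algebra_simps)
  finally have a: "dist (fst Q' - fst P) Q < r" .
  have b: "cell_dom P (fst Q' - fst P)"
   using P by (simp add: cell_dom_def)
  have "\<bar>snd Q' - snd P\<bar> <= kp + 4 * r'"
  proof -
   have "snd Q' - snd P = snd (Q' - (A + B)) + snd (c *\<^sub>R z)"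
    by (simp add: A_def B_def X'_def)
   moreover have "\<bar>snd (Q' - (A + B))\<bar> <= kp"
    using dist_snd_le[of "Q' - (A + B)" 0] nQ by (simp del: snd_diff)
   moreover have "\<bar>snd (c *\<^sub>R z)\<bar> <= 4 * r'" using dist_snd_le[of "c *\<^sub>R z" 0] cz by simp
   ultimately show ?thesis by linarith
  qed
  moreover have "norm (Q' - Q1) = \<bar>snd Q' - snd P\<bar>" by (cases Q') (simp add: Q1_def norm_Pair)
  ultimately have dQ: "norm (Q' - Q1) <= kp + 4 * r'" by simp
  have nQ1: "norm Q1 >= \<bar>snd P\<bar>" using dist_snd_le[of Q1 0] by (simp add: Q1_def)
  have "FG 1 d f y Q1 X' = Fcell d f P (fst y) (fst Q' - fst P) X"
   using FG_embed[of d f y P "fst Q' - fst P" X] by (simp add: Q1_def X'_def)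
  moreover have "\<bar>FG 1 d f y Q' X' - FG 1 d f y Q1 X'\<bar> <= (1 + F + 4 * 1 * d * norm X' / norm Q1) * norm (Q' - Q1)"
   by (rule FG_gradient_lip[OF Q'(1) Q1]) simp
  moreover have "(1 + F + 4 * 1 * d * norm X' / norm Q1) * norm (Q' - Q1) <= (1 + F + 4 * d * norm X' / \<bar>snd P\<bar>) * (kp + 4 * r')"
  proof (rule mult_mono[OF _ dQ])
   have "4 * d * norm X' / norm Q1 <= 4 * d * norm X' / \<bar>snd P\<bar>"
    using nQ1 P d_pos by (intro divide_left_mono) (auto intro!: mult_pos_pos simp: Q1)
   thus "1 + F + 4 * 1 * d * norm X' / norm Q1 <= 1 + F + 4 * d * norm X' / \<bar>snd P\<bar>" by simp
   show "0 <= 1 + F + 4 * d * norm X' / \<bar>snd P\<bar>" using F_nonneg d_pos by simp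
  qed simp
  ultimately show ?thesis using a b unfolding X'_def by (simp add: abs_minus_commute)
 qed
 show "visc_sub_st lam (cell_dom P) (Fcell d f P) v"
  unfolding visc_sub_st_def
 proof (intro allI impI ballI, clarify)
  fix x0 Q :: "real^'n" and X and \<delta> r :: real
  assume jet: "(Q, X) \<in> superjet v x0" and \<delta>: "\<delta> > 0" and r: "r > 0"
  have X: "symmetric_op X" using jet by (simp add: superjet_def)
  define C where "C = 1 + F + 4 * d * norm (embed_op X) / \<bar>snd P\<bar>"
  have C: "C >= 0" using F_nonneg d_pos by (simp add: C_def)
  obtain e r' kp J where e: "e > 0" "e <= 1" "(2 + 4 * d * CARD('n)) * e <= \<delta> / 8" and r': "r' > 0" "r' <= r" and kp: "kp > 0" "kp * (F + 1) <= \<delta> / 8"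
   "kp + (norm (embed_op X) + 4) * r' <= r / 2" "C * (kp + 4 * r') <= \<delta> / 8"
   and J: "!!j. j >= J ==> small_error 1 (norm (embed_op X)) e (kp * (F + 1)) (tau j)" "!!j. j >= J ==> tau j <= \<delta> / 8"
   "!!j y. j >= J ==> dist y x0 < r' ==> \<bar>lam * v x0 - lam * w j y\<bar> < \<delta> / 8"
   using parameters[OF \<delta> r norm_ge_zero C, of "embed_op X" x0] by blast
  have "\<exists>j\<ge>J. \<exists>y. dist y (x0, 0) < r' \<and>
   ((P + (Q, 0)) \<bullet> (y - (x0, 0)) + 1/2 * (blinfun_apply (embed_op X) (y - (x0, 0)) \<bullet> (y - (x0, 0))) + 2 * e * (norm (y - (x0, 0)))\<^sup>2 + 0) + tau j * (0 - 2 * e) - (tau j)\<^sup>2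
    <= T 1 (tau j) (%y. (P + (Q, 0)) \<bullet> (y - (x0, 0)) + 1/2 * (blinfun_apply (embed_op X) (y - (x0, 0)) \<bullet> (y - (x0, 0))) + 2 * e * (norm (y - (x0, 0)))\<^sup>2 + 0) y
     + tau j * (- lam * w j (fst y) + tau j)"
  proof (rule discrete_test_sub[where u = "%j x t. lift P (w j) x" and ubar = "%x t. lift P v x" and \<rho> = "%j. reach 1 (tau j)" and kp = "%_. 0" and ?t0.0 = 1 and r = r'])
   show "\<exists>r>0. \<exists>J. \<forall>j\<ge>J. \<forall>y s. dist y x < r --> \<bar>s - t\<bar> < r --> lift P (w j) y < lift P v x + e" if e: "e > 0" for x t e
   proof -
    obtain r J where "r > 0" and rJ: "!!j y s. j >= J ==> dist y x < r ==> \<bar>s - t\<bar> < r ==> \<bar>lift P (w j) y - lift P v x\<bar> < e"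
     using up[OF e, of x t] by blast
    have "lift P (w j) y < lift P v x + e" if "j >= J" "dist y x < r" "\<bar>s - t\<bar> < r" for j y s
     using rJ[OF that] by linarith
    thus ?thesis using \<open>r > 0\<close> by blast
   qed
   show "\<exists>j\<ge>J. \<exists>y s. dist y (x0, 0) < r \<and> \<bar>s - 1\<bar> < r \<and> lift P v (x0, 0) - e < lift P (w j) y" if er: "e > 0" "r > 0" for e r J
   proof -
    obtain j y s where "j >= J" "dist y (x0, 0) < r" "\<bar>s - 1\<bar> < r" "\<bar>lift P (w j) y - lift P v (x0, 0)\<bar> < e"
     using at[OF er, of J] by blast
    thus ?thesis by (intro exI[of _ j] conjI exI[of _ y] exI[of _ s]) auto
   qed
  qed (use mono reach_tendsto[OF tau(3)] tau bd st1 superjet_lift[OF jet, of P 1] e r' in auto)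
  then obtain j y where j: "j >= J" and y: "dist y (x0, 0) < r'" and ineq:
   "((P + (Q, 0)) \<bullet> (y - (x0, 0)) + 1/2 * (blinfun_apply (embed_op X) (y - (x0, 0)) \<bullet> (y - (x0, 0))) + 2 * e * (norm (y - (x0, 0)))\<^sup>2) + tau j * (0 - 2 * e) - (tau j)\<^sup>2
    <= T 1 (tau j) (%y. (P + (Q, 0)) \<bullet> (y - (x0, 0)) + 1/2 * (blinfun_apply (embed_op X) (y - (x0, 0)) \<bullet> (y - (x0, 0))) + 2 * e * (norm (y - (x0, 0)))\<^sup>2) y
     + tau j * (- lam * w j (fst y) + tau j)"
   by auto
  obtain Q' where Q': "Q' \<noteq> 0" "norm (Q' - (P + (Q, 0) + blinfun_apply (embed_op X) (y - (x0, 0)) + (4 * e) *\<^sub>R (y - (x0, 0)))) <= kp"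
   and FQ: "0 + FG 1 d f y Q' (embed_op X) <= (- lam * w j (fst y) + tau j) + (2 + 4 * d * CARD('n)) * e + tau j + (norm (embed_op X) + 4 * e) * remC * sqrt (tau j) + kp * (F + 1)"
   using test_consistency_sub[OF _ _ tau(1)[of j] tau(2)[of j] symmetric_embed[OF X] _ kp(1) ineq] e by auto
  have tr: "dist (fst Q' - fst P) Q < r \<and> cell_dom P (fst Q' - fst P) \<and>
   \<bar>Fcell d f P (fst y) (fst Q' - fst P) X - FG 1 d f y Q' (embed_op X)\<bar> <= C * (kp + 4 * r')"
   unfolding C_def by (rule transfer[OF Q' y _ kp(3) r]) (use e in auto)
  have dy: "dist (fst y) x0 < r'" using y dist_fst_le[of y "(x0, 0)"] by simp
  have "lam * v x0 + Fcell d f P (fst y) (fst Q' - fst P) X < \<delta>"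
   using tr kp(2,4) FQ e(3) J(1)[OF j] J(2)[OF j] J(3)[OF j dy] tau(1)[of j] \<delta> unfolding small_error_def abs_le_iff abs_less_iff by linarith
  moreover have "dist (fst y) x0 < r" using dy r' by simp
  ultimately show "\<exists>y Q' Y. dist y x0 < r \<and> dist Q' Q < r \<and> dist Y X < r \<and> symmetric_op Y \<and> cell_dom P Q' \<and> lam * v x0 + Fcell d f P y Q' Y < \<delta>"
   using tr X r by (intro exI[of _ "fst y"] exI[of _ "fst Q' - fst P"] exI[of _ X]) auto
 qed
 show "visc_super_st lam (cell_dom P) (Fcell d f P) v"
  unfolding visc_super_st_def
 proof (intro allI impI ballI, clarify)
  fix x0 Q :: "real^'n" and X and \<delta> r :: real
  assume jet: "(Q, X) \<in> subjet v x0" and \<delta>: "\<delta> > 0" and r: "r > 0"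
  have X: "symmetric_op X" using jet by (simp add: subjet_def)
  define C where "C = 1 + F + 4 * d * norm (embed_op X) / \<bar>snd P\<bar>"
  have C: "C >= 0" using F_nonneg d_pos by (simp add: C_def)
  obtain e r' kp J where e: "e > 0" "e <= 1" "(2 + 4 * d * CARD('n)) * e <= \<delta> / 8" and r': "r' > 0" "r' <= r" and kp: "kp > 0" "kp * (F + 1) <= \<delta> / 8"
   "kp + (norm (embed_op X) + 4) * r' <= r / 2" "C * (kp + 4 * r') <= \<delta> / 8"
   and J: "!!j. j >= J ==> small_error 1 (norm (embed_op X)) e (kp * (F + 1)) (tau j)" "!!j. j >= J ==> tau j <= \<delta> / 8"
   "!!j y. j >= J ==> dist y x0 < r' ==> \<bar>lam * v x0 - lam * w j y\<bar> < \<delta> / 8"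
   using parameters[OF \<delta> r norm_ge_zero C, of "embed_op X" x0] by blast
  have "\<exists>j\<ge>J. \<exists>y. dist y (x0, 0) < r' \<and>
   ((P + (Q, 0)) \<bullet> (y - (x0, 0)) + 1/2 * (blinfun_apply (embed_op X) (y - (x0, 0)) \<bullet> (y - (x0, 0))) - 2 * e * (norm (y - (x0, 0)))\<^sup>2 + 0) + tau j * (0 + 2 * e) + (tau j)\<^sup>2
    >= T 1 (tau j) (%y. (P + (Q, 0)) \<bullet> (y - (x0, 0)) + 1/2 * (blinfun_apply (embed_op X) (y - (x0, 0)) \<bullet> (y - (x0, 0))) - 2 * e * (norm (y - (x0, 0)))\<^sup>2 + 0) y
     - tau j * (lam * w j (fst y) + tau j)"
  proof (rule discrete_test_super[where u = "%j x t. lift P (w j) x" and ubar = "%x t. lift P v x" and \<rho> = "%j. reach 1 (tau j)" and kp = "%_. 0" and ?t0.0 = 1 and r = r'])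
   show "\<exists>r>0. \<exists>J. \<forall>j\<ge>J. \<forall>y s. dist y x < r --> \<bar>s - t\<bar> < r --> lift P (w j) y > lift P v x - e" if e: "e > 0" for x t e
   proof -
    obtain r J where "r > 0" and rJ: "!!j y s. j >= J ==> dist y x < r ==> \<bar>s - t\<bar> < r ==> \<bar>lift P (w j) y - lift P v x\<bar> < e"
     using up[OF e, of x t] by blast
    have "lift P (w j) y > lift P v x - e" if "j >= J" "dist y x < r" "\<bar>s - t\<bar> < r" for j y s
     using rJ[OF that] by linarith
    thus ?thesis using \<open>r > 0\<close> by blast
   qed
   show "\<exists>j\<ge>J. \<exists>y s. dist y (x0, 0) < r \<and> \<bar>s - 1\<bar> < r \<and> lift P (w j) y < lift P v (x0, 0) + e" if er: "e > 0" "r > 0" for e r J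
   proof -
    obtain j y s where "j >= J" "dist y (x0, 0) < r" "\<bar>s - 1\<bar> < r" "\<bar>lift P (w j) y - lift P v (x0, 0)\<bar> < e"
     using at[OF er, of J] by blast
    thus ?thesis by (intro exI[of _ j] conjI exI[of _ y] exI[of _ s]) auto
   qed
  qed (use mono reach_tendsto[OF tau(3)] tau bd st2 subjet_lift[OF jet, of P 1] e r' in auto)
  then obtain j y where j: "j >= J" and y: "dist y (x0, 0) < r'" and ineq:
   "((P + (Q, 0)) \<bullet> (y - (x0, 0)) + 1/2 * (blinfun_apply (embed_op X) (y - (x0, 0)) \<bullet> (y - (x0, 0))) - 2 * e * (norm (y - (x0, 0)))\<^sup>2) + tau j * (0 + 2 * e) + (tau j)\<^sup>2
    >= T 1 (tau j) (%y. (P + (Q, 0)) \<bullet> (y - (x0, 0)) + 1/2 * (blinfun_apply (embed_op X) (y - (x0, 0)) \<bullet> (y - (x0, 0))) - 2 * e * (norm (y - (x0, 0)))\<^sup>2) y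
     - tau j * (lam * w j (fst y) + tau j)"
   by auto
  have sm: "8 * 1 * d * (norm (embed_op X) + 4 * e) * CARD('n) * tau j <= kp * side 1 (tau j)"
   using J(1)[OF j] F_nonneg by (simp add: small_error_def)
  obtain Q' where Q': "Q' \<noteq> 0" "norm (Q' - (P + (Q, 0) + blinfun_apply (embed_op X) (y - (x0, 0)) - (4 * e) *\<^sub>R (y - (x0, 0)))) <= kp"
   and FQ: "0 + FG 1 d f y Q' (embed_op X) >= - ((lam * w j (fst y) + tau j) + (2 + 4 * d * CARD('n)) * e + 2 * tau j + (norm (embed_op X) + 4 * e) * remC * sqrt (tau j) + kp * (F + 1))"
   using test_consistency_super[OF _ _ tau(1)[of j] tau(2)[of j] symmetric_embed[OF X] _ kp(1) sm ineq] e by auto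
  have Q2: "norm (Q' - (P + (Q, 0) + blinfun_apply (embed_op X) (y - (x0, 0)) + (- (4 * e)) *\<^sub>R (y - (x0, 0)))) <= kp"
   using Q'(2) by simp
  have tr: "dist (fst Q' - fst P) Q < r \<and> cell_dom P (fst Q' - fst P) \<and>
   \<bar>Fcell d f P (fst y) (fst Q' - fst P) X - FG 1 d f y Q' (embed_op X)\<bar> <= C * (kp + 4 * r')"
   unfolding C_def by (rule transfer[OF Q'(1) Q2 y _ kp(3) r]) (use e in auto)
  have dy: "dist (fst y) x0 < r'" using y dist_fst_le[of y "(x0, 0)"] by simp
  have "lam * v x0 + Fcell d f P (fst y) (fst Q' - fst P) X > - \<delta>"
   using tr kp(2,4) FQ e(3) J(1)[OF j] J(2)[OF j] J(3)[OF j dy] tau(1)[of j] \<delta> unfolding small_error_def abs_le_iff abs_less_iff by linarith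
  moreover have "dist (fst y) x0 < r" using dy r' by simp
  ultimately show "\<exists>y Q' Y. dist y x0 < r \<and> dist Q' Q < r \<and> dist Y X < r \<and> symmetric_op Y \<and> cell_dom P Q' \<and> lam * v x0 + Fcell d f P y Q' Y > - \<delta>"
   using tr X r by (intro exI[of _ "fst y"] exI[of _ "fst Q' - fst P"] exI[of _ X]) auto
 qed
qed

end

lemma superjet_const:
 fixes x :: "'a::euclidean_space"
 assumes "(Q, X) \<in> superjet (%_. c) x"
 shows "Q = 0" and "blinfun_apply X u \<bullet> u >= 0"
proof -
 have jet: "\<exists>r>0. \<forall>z. norm z < r --> 0 <= Q \<bullet> z + 1/2 * (blinfun_apply X z \<bullet> z) + e * (norm z)\<^sup>2" if e: "e > 0" for e
 proof -
  have "\<exists>r>0. \<forall>y. dist y x < r --> c <= c + Q \<bullet> (y - x) + 1/2 * (blinfun_apply X (y - x) \<bullet> (y - x)) + e * (norm (y - x))\<^sup>2"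
   using assms e unfolding superjet_def by blast
  then obtain r where r: "r > 0" "!!y. dist y x < r ==> c <= c + Q \<bullet> (y - x) + 1/2 * (blinfun_apply X (y - x) \<bullet> (y - x)) + e * (norm (y - x))\<^sup>2"
   by blast
  have "0 <= Q \<bullet> z + 1/2 * (blinfun_apply X z \<bullet> z) + e * (norm z)\<^sup>2" if "norm z < r" for z
   using r(2)[of "x + z"] that by (simp add: dist_norm)
  thus ?thesis using r(1) by blast
 qed
 show Q0: "Q = 0"
 proof (rule ccontr)
  assume Q: "Q \<noteq> 0"
  obtain r where r: "r > 0" "!!z. norm z < r ==> 0 <= Q \<bullet> z + 1/2 * (blinfun_apply X z \<bullet> z) + 1 * (norm z)\<^sup>2"
   using jet[of 1] by auto
  define B where "B = norm X / 2 + 1"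
  have B: "B >= 1" by (simp add: B_def)
  obtain t where t: "t > 0" "t <= 1" "(B + norm Q) * t <= min (1/2) (r/2)"
   using small_factor[of "B + norm Q" "min (1/2) (r/2)"] B r by auto
  have ex: "(B + norm Q) * t = B * t + norm Q * t" by (simp add: algebra_simps)
  have ps: "B * t >= 0" "norm Q * t >= 0" using B t by simp_all
  have "norm (- t *\<^sub>R Q) < r" using t(1,3) ex ps r by (simp add: mult.commute)
  from r(2)[OF this] have 1: "0 <= Q \<bullet> (- t *\<^sub>R Q) + 1/2 * (blinfun_apply X (- t *\<^sub>R Q) \<bullet> (- t *\<^sub>R Q)) + (norm (- t *\<^sub>R Q))\<^sup>2" by simp
  have "blinfun_apply X (- t *\<^sub>R Q) \<bullet> (- t *\<^sub>R Q) <= norm X * norm (- t *\<^sub>R Q) * norm (- t *\<^sub>R Q)"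
   using quadform_bound[of X "- t *\<^sub>R Q" "- t *\<^sub>R Q"] by linarith
  also have "\<dots> = norm X * (t * norm Q)\<^sup>2" using t by (simp add: power2_eq_square)
  finally have 2: "1/2 * (blinfun_apply X (- t *\<^sub>R Q) \<bullet> (- t *\<^sub>R Q)) <= norm X / 2 * (t * norm Q)\<^sup>2" by simp
  have 3: "(norm (- t *\<^sub>R Q))\<^sup>2 = (t * norm Q)\<^sup>2" using t by simp
  have 4: "Q \<bullet> (- t *\<^sub>R Q) = - t * (norm Q)\<^sup>2" by (simp add: power2_norm_eq_inner)
  have "0 <= - t * (norm Q)\<^sup>2 + B * (t * norm Q)\<^sup>2" using 1 2 unfolding 3 4 by (simp add: B_def algebra_simps)
  also have "\<dots> = t * (norm Q)\<^sup>2 * (B * t - 1)" by (simp add: power2_eq_square algebra_simps)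
  also have "\<dots> < 0"
  proof -
   have "B * t - 1 < 0" using t(3) ex ps by linarith
   moreover have "t * (norm Q)\<^sup>2 > 0" using t Q by simp
   ultimately show ?thesis by (rule mult_pos_neg[rotated])
  qed
  finally show False by simp
 qed
 show "blinfun_apply X u \<bullet> u >= 0"
 proof (rule ccontr)
  assume neg: "\<not> ?thesis"
  hence u: "u \<noteq> 0" by auto
  \<comment> \<open>With this \<open>e\<close> the penalty cancels half of the negative second-order
    term, leaving a strictly negative quarter of the quadratic form.\<close>
  define e where "e = - (blinfun_apply X u \<bullet> u) / (4 * (norm u)\<^sup>2)"
  have e: "e > 0" using neg u by (simp add: e_def divide_neg_pos)
  obtain r where r: "r > 0" "!!z. norm z < r ==> 0 <= Q \<bullet> z + 1/2 * (blinfun_apply X z \<bullet> z) + e * (norm z)\<^sup>2"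
   using jet[OF e] by auto
  obtain t where t: "t > 0" "norm u * t <= r/2" using small_factor[of "norm u" "r/2"] r by auto
  have "norm (t *\<^sub>R u) < r" using t r by (simp add: mult.commute)
  from r(2)[OF this] have "0 <= 1/2 * (blinfun_apply X (t *\<^sub>R u) \<bullet> (t *\<^sub>R u)) + e * (norm (t *\<^sub>R u))\<^sup>2" by (simp add: Q0)
  also have "\<dots> = t\<^sup>2 * (1/2 * (blinfun_apply X u \<bullet> u) + e * (norm u)\<^sup>2)"
   by (simp add: blinfun.scaleR_right power_mult_distrib power2_eq_square algebra_simps)
  also have "e * (norm u)\<^sup>2 = - (blinfun_apply X u \<bullet> u) / 4" using u by (simp add: e_def)
  finally have "0 <= t\<^sup>2 * (1/4 * (blinfun_apply X u \<bullet> u))" by (simp add: algebra_simps)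
  thus False using neg t by (simp add: zero_le_mult_iff)
 qed
qed

text \<open>With \<open>snd P = 0\<close> the shear drops out, and the jets of a constant have zero
  gradient and semidefinite Hessian. Written in a frame, the curvature term is a sum of values of
  the Hessian's quadratic form, so its sign is known. For \<open>P = 0\<close> the operator is
  singular at the jet itself and the envelopes are reached through nearby nonzero gradients.\<close>

lemma cell_constant:
 fixes f :: "real^'n => real"
 assumes lam: "lam > 0" and P: "snd P = 0" and d: "d > 0"
 shows "cell_solution d f P lam (%_. - norm P / lam)"
proof -
 have nP: "norm P = norm (fst P)" using P by (cases P) (simp add: norm_Pair)
 have bounds: "(\<forall>u. blinfun_apply X u \<bullet> u >= 0) --> Fcell d f P y Q X <= norm (fst P + Q)"
  "(\<forall>u. blinfun_apply X u \<bullet> u <= 0) --> Fcell d f P y Q X >= norm (fst P + Q)"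
  if w: "fst P + Q \<noteq> 0" for X :: "(real^'n) \<Rightarrow>\<^sub>L (real^'n)" and y Q
 proof -
  define W where "W = (fst P + Q, 0 :: real)"
  have W: "W \<noteq> 0" using w by (simp add: W_def zero_prod_def)
  have nW: "norm W = norm (fst P + Q)" by (simp add: W_def norm_Pair)
  obtain E where E: "orthogonal_transformation E" "E ((0, 1) :: (real^'n) \<times> real) = sgn W"
   using orthogonal_exists_map[of "(0,1) :: (real^'n) \<times> real" "sgn W"] W by (auto simp: norm_Pair norm_sgn)
  define t where "t = op_trace (embed_op X) - blinfun_apply (embed_op X) (sgn W) \<bullet> sgn W"
  have t: "t = (\<Sum>i\<in>UNIV. blinfun_apply X (fst (E (axis i 1, 0))) \<bullet> fst (E (axis i 1, 0)))"
   unfolding t_def using op_trace_frame[OF E(1), of "embed_op X"] by (simp add: E(2) inner_prod_def)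
  have "Fcell d f P y Q X = FG 1 d f (y, 0) W (embed_op X)"
   using FG_embed[of d f "(y, 0)" P Q X] P by (simp add: W_def)
  also have "\<dots> = max (norm (fst P + Q) - d * t) 0"
   unfolding FG_alt[OF W] t_def[symmetric] nW by (simp add: Vfield_def W_def)
  finally have eq: "Fcell d f P y Q X = max (norm (fst P + Q) - d * t) 0" .
  show "(\<forall>u. blinfun_apply X u \<bullet> u >= 0) --> Fcell d f P y Q X <= norm (fst P + Q)"
  proof
   assume "\<forall>u. blinfun_apply X u \<bullet> u >= 0"
   hence "t >= 0" unfolding t by (intro sum_nonneg) auto
   hence "d * t >= 0" using d by simp
   thus "Fcell d f P y Q X <= norm (fst P + Q)" unfolding eq by simp
  qed
  show "(\<forall>u. blinfun_apply X u \<bullet> u <= 0) --> Fcell d f P y Q X >= norm (fst P + Q)"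
  proof
   assume "\<forall>u. blinfun_apply X u \<bullet> u <= 0"
   hence "t <= 0" unfolding t by (intro sum_nonpos) auto
   hence "d * t <= 0" using d by (simp add: mult_nonneg_nonpos)
   thus "Fcell d f P y Q X >= norm (fst P + Q)" unfolding eq by simp
  qed
 qed
 \<comment> \<open>A small correction that leaves the singular gradient; it is nontrivial only for
   \<open>fst P = 0\<close>.\<close>
 have choose: "\<exists>Q. norm Q < \<eta> \<and> fst P + Q \<noteq> 0" if "\<eta> > 0" for \<eta>
 proof (cases "fst P = 0")
  case True
  thus ?thesis using that
   by (intro exI[of _ "(\<eta>/2) *\<^sub>R axis (SOME i. True) 1"]) (simp add: axis_eq_0_iff)
 next
  case False
  thus ?thesis using that by (intro exI[of _ 0]) simp
 qed
 show ?thesis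
  unfolding cell_solution_def
 proof (intro conjI)
  show "zn_periodic (%_ :: real^'n. - norm P / lam)" by (simp add: zn_periodic_def)
  show "continuous_on UNIV (%_ :: real^'n. - norm P / lam)" by simp
  show "visc_sub_st lam (cell_dom P) (Fcell d f P) (%_. - norm P / lam)"
   unfolding visc_sub_st_def
  proof (intro allI ballI impI, clarify)
   fix x Q :: "real^'n" and X and \<delta> r :: real
   assume jet: "(Q, X) \<in> superjet (%_. - norm P / lam) x" and dr: "\<delta> > 0" "r > 0"
   have Q: "Q = 0" and X: "\<forall>u. blinfun_apply X u \<bullet> u >= 0" using superjet_const[OF jet] by auto
   have sX: "symmetric_op X" using jet by (simp add: superjet_def)
   obtain Q' where Q': "norm Q' < min r \<delta>" "fst P + Q' \<noteq> 0" using choose[of "min r \<delta>"] dr by auto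
   have "Fcell d f P x Q' X <= norm P + norm Q'"
    using bounds(1)[OF Q'(2), of X x] X norm_triangle_ineq[of "fst P" Q'] nP by simp
   hence "lam * (- norm P / lam) + Fcell d f P x Q' X < \<delta>" using Q'(1) lam by simp
   thus "\<exists>y Q' Y. dist y x < r \<and> dist Q' Q < r \<and> dist Y X < r \<and> symmetric_op Y \<and> cell_dom P Q' \<and> lam * (- norm P / lam) + Fcell d f P y Q' Y < \<delta>"
    using Q' sX dr Q by (intro exI[of _ x] exI[of _ Q'] exI[of _ X]) (auto simp: cell_dom_def P)
  qed
  show "visc_super_st lam (cell_dom P) (Fcell d f P) (%_. - norm P / lam)"
   unfolding visc_super_st_def
  proof (intro allI ballI impI, clarify)
   fix x Q :: "real^'n" and X and \<delta> r :: real
   assume jet: "(Q, X) \<in> subjet (%_. - norm P / lam) x" and dr: "\<delta> > 0" "r > 0"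
   have jet': "(- Q, - X) \<in> superjet (%_. - (- norm P / lam)) x" by (rule iffD1[OF subjet_minus jet])
   have Q: "Q = 0" and X: "\<forall>u. blinfun_apply X u \<bullet> u <= 0"
    using superjet_const[OF jet'] by (auto simp: blinfun.minus_left)
   have sX: "symmetric_op X" using jet by (simp add: subjet_def)
   obtain Q' where Q': "norm Q' < min r \<delta>" "fst P + Q' \<noteq> 0" using choose[of "min r \<delta>"] dr by auto
   have "Fcell d f P x Q' X >= norm P - norm Q'"
    using bounds(2)[OF Q'(2), of X x] X norm_triangle_ineq2[of "fst P" "- Q'"] nP by simp
   hence "lam * (- norm P / lam) + Fcell d f P x Q' X > - \<delta>" using Q'(1) lam by simp
   thus "\<exists>y Q' Y. dist y x < r \<and> dist Q' Q < r \<and> dist Y X < r \<and> symmetric_op Y \<and> cell_dom P Q' \<and> lam * (- norm P / lam) + Fcell d f P y Q' Y > - \<delta>"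
    using Q' sX dr Q by (intro exI[of _ x] exI[of _ Q'] exI[of _ X]) (auto simp: cell_dom_def P)
  qed
 qed
qed

section \<open>Approximate eigenfunctions from the vanishing discount\<close>

lemma periodic_reduce:
 fixes x :: "real^'n"
 obtains k y where "\<forall>i. k $ i \<in> \<int>" "x = y + k" "y \<in> cbox 0 (\<chi> i. 1)"
proof
 show "\<forall>i. (\<chi> i. of_int \<lfloor>x $ i\<rfloor>) $ i \<in> \<int>" by simp
 show "x = (\<chi> i. frac (x $ i)) + (\<chi> i. of_int \<lfloor>x $ i\<rfloor>)"
  by (simp add: vec_eq_iff frac_def)
 show "(\<chi> i. frac (x $ i)) \<in> cbox 0 (\<chi> i. 1)"
  by (auto simp: mem_box_cart frac_ge_0 less_imp_le frac_lt_1)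
qed

text \<open>An additive eigenfunction of the game up to \<eta> per unit time. \<open>Lam\<close> and
  \<open>M\<close> are parameters so that they can be held fixed while \<open>tau\<close> tends to
  zero.\<close>

definition approx_cell :: "(((real^'n) \<times> real => real) => (real^'n) \<times> real => real)
  => (real^'n) \<times> real => real => real => real => real => real => (real^'n => real) => bool" where
 "approx_cell S P H tau \<eta> Lam M v \<longleftrightarrow> (\<forall>x y. v x <= v y + Lam * dist x y) \<and> (\<forall>x. \<bar>v x\<bar> <= M) \<and>
  (\<forall>x. \<bar>S (lift P v) x - (lift P v x - tau * H)\<bar> <= \<eta> * tau)"

context shear_game
begin

text \<open>Compactness and uniqueness: counterexamples with \<open>tau\<close> tending to zero
  would have a convergent subsequence, whose limit is a solution of the cell problem and hence
  \<open>v\<close>. Periodicity upgrades convergence on the unit cell to the whole space. The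
  threshold \<open>tau1\<close> is common to all admissible \<open>w\<close>.\<close>

lemma discrete_cell_converges:
 assumes per: "zn_periodic f" and lam: "lam > 0" and P: "snd P \<noteq> 0"
  and uniq: "!!w. cell_solution d f P lam w ==> w = v" and \<eta>: "\<eta> > 0"
 shows "\<exists>tau1>0. \<forall>tau w. 0 < tau --> tau < tau1 --> tau <= 1 --> zn_periodic w --> (\<forall>x y. w x <= w y + Lam * dist x y) -->
  (\<forall>x. \<bar>w x\<bar> <= M) -->
  (\<forall>x. \<bar>T 1 tau (lift P w) x - (lift P w x + tau * lam * w (fst x))\<bar> <= tau\<^sup>2) --> (\<forall>x. \<bar>w x - v x\<bar> < \<eta>)"
proof (rule ccontr)
 assume neg: "\<not> ?thesis"
 define good where "good tau w \<longleftrightarrow> 0 < tau \<and> tau <= 1 \<and> zn_periodic w \<and> (\<forall>x y. w x <= w y + Lam * dist x y) \<and>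
  (\<forall>x. \<bar>w x\<bar> <= M) \<and> (\<forall>x. \<bar>T 1 tau (lift P w) x - (lift P w x + tau * lam * w (fst x))\<bar> <= tau\<^sup>2) \<and> \<not> (\<forall>x. \<bar>w x - v x\<bar> < \<eta>)" for tau w
 have "\<exists>tau w. good tau w \<and> tau < inverse (real (Suc j))" for j
 proof -
  have "inverse (real (Suc j)) > 0" by simp
  thus ?thesis using neg unfolding good_def by blast
 qed
 then obtain tau w where good: "!!j. good (tau j) (w j)" and tauj: "!!j. tau j < inverse (real (Suc j))" by metis
 have tau: "0 < tau j" "tau j <= 1" for j using good[of j] by (auto simp: good_def)
 have tau0: "tau \<longlonglongrightarrow> 0"
 proof (rule Lim_null_comparison[OF _ LIMSEQ_inverse_real_of_nat], rule always_eventually, rule allI)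
  show "norm (tau j) <= inverse (real (Suc j))" for j using tau(1)[of j] tauj[of j] by simp
 qed
 have lip: "w j x <= w j y + Lam * dist x y" for j x y using good[of j] unfolding good_def by blast
 have bd: "\<exists>B. \<forall>j. \<bar>w j z\<bar> <= B" for z using good unfolding good_def by blast
 have eq: "\<exists>r>0. \<exists>J. \<forall>j\<ge>J. \<forall>y. dist y z < r --> \<bar>w j y - w j z\<bar> <= e" if e: "e > 0" for z e
 proof -
  obtain r where r: "r > 0" "\<bar>Lam\<bar> * r <= e" using small_factor[of "\<bar>Lam\<bar>" e] e by auto
  have "\<bar>w j y - w j z\<bar> <= e" if "dist y z < r" for j y
  proof -
   have "Lam * dist y z <= \<bar>Lam\<bar> * r" using that by (intro mult_mono) auto
   thus ?thesis using lip[of j y z] lip[of j z y] r(2) by (simp add: dist_commute)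
  qed
  thus ?thesis using r(1) by blast
 qed
 obtain k l where k: "strict_mono (k :: nat => nat)"
  and ccv: "!!z e. e > 0 ==> \<exists>r>0. \<exists>J. \<forall>j\<ge>J. \<forall>y. dist y z < r --> \<bar>w (k j) y - l z\<bar> < e"
  and l: "continuous_on UNIV l"
  using asymptotic_Arzela_Ascoli[of w, OF bd eq] by metis
 have tauk: "(%j. tau (k j)) \<longlonglongrightarrow> 0" using LIMSEQ_subseq_LIMSEQ[OF tau0 k] by (simp add: o_def)
 have eqk: "\<bar>T 1 (tau (k j)) (lift P (w (k j))) x - (lift P (w (k j)) x + tau (k j) * lam * w (k j) (fst x))\<bar> <= (tau (k j))\<^sup>2" for j x
  using good[of "k j"] unfolding good_def by blast
 have lim: "(%j. w (k j) x) \<longlonglongrightarrow> l x" for x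
  unfolding LIMSEQ_def
 proof (intro allI impI)
  fix e :: real assume "e > 0"
  then obtain r J where "r > 0" "!!j y. j >= J ==> dist y x < r ==> \<bar>w (k j) y - l x\<bar> < e" using ccv by blast
  thus "\<exists>no. \<forall>n\<ge>no. dist (w (k n) x) (l x) < e" by (intro exI[of _ J]) (simp add: dist_real_def)
 qed
 have perl: "zn_periodic l"
  unfolding zn_periodic_def
 proof (intro allI impI)
  fix x m :: "real^'n" assume m: "\<forall>i. m $ i \<in> \<int>"
  have "w (k j) (x + m) = w (k j) x" for j using good[of "k j"] m unfolding good_def zn_periodic_def by blast
  thus "l (x + m) = l x" using lim[of "x + m"] lim[of x] LIMSEQ_unique by simp
 qed
 have "cell_solution d f P lam l"
  unfolding cell_solution_def
  using perl l cell_limit[OF lam P, of "%j. tau (k j)" "%j. w (k j)" Lam l] tau tauk lip eqk ccv by auto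
 hence lv: "l = v" by (rule uniq)
 have K: "compact (cbox (0 :: real^'n) (\<chi> i. 1))" by simp
 obtain J where J: "!!j z. j >= J ==> z \<in> cbox (0 :: real^'n) (\<chi> i. 1) ==> \<bar>w (k j) z - l z\<bar> < \<eta>"
  using continuous_convergence_uniform[of "%j. w (k j)" l, OF ccv K \<eta>] by blast
 have "\<bar>w (k J) x - v x\<bar> < \<eta>" for x
 proof -
  obtain m y where m: "\<forall>i. m $ i \<in> \<int>" "x = y + m" and y: "y \<in> cbox 0 (\<chi> i. 1)" by (rule periodic_reduce)
  have "w (k J) x = w (k J) y" "l x = l y" using good[of "k J"] perl m unfolding good_def zn_periodic_def by auto
  thus ?thesis using J[of J y] y by (simp add: lv)
 qed
 thus False using good[of "k J"] unfolding good_def by blast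
qed

text \<open>Only a pointwise limit of \<open>lam * v lam\<close> is given, whereas an eigenfunction
  needs it uniformly in \<open>x\<close>. Once \<open>lam\<close> is fixed by that uniform limit,
  \<open>tau\<close> is the only small parameter, and the bounds \<open>A / lam\<close> and
  \<open>Mb lam\<close> no longer change.\<close>

lemma approx_cell_exists:
 assumes per: "zn_periodic f" and P: "snd P \<noteq> 0"
  and sol: "!!lam. lam > 0 ==> cell_solution d f P lam (v lam)"
  and uniq: "!!lam w. lam > 0 ==> cell_solution d f P lam w ==> w = v lam"
  and lim: "!!x. ((%lam. lam * v lam x) \<longlongrightarrow> - H) (at_right 0)" and \<eta>: "\<eta> > 0"
 shows "\<exists>Lam M tau1. Lam >= 0 \<and> tau1 > 0 \<and> (\<forall>tau. 0 < tau --> tau < tau1 --> (\<exists>w. approx_cell (T 1 tau) P H tau \<eta> Lam M w))"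
proof -
 define A where "A = \<bar>snd P\<bar> * L"
 have A: "A >= 0" using L_nonneg by (simp add: A_def)
 define Mb where "Mb lam = norm P / lam + \<bar>snd P\<bar> * F / lam" for lam
 have disc: "\<exists>w. zn_periodic w \<and> (\<forall>x y. w x <= w y + (A / lam) * dist x y) \<and> (\<forall>x. \<bar>w x\<bar> <= Mb lam) \<and>
  (\<forall>x. \<bar>T 1 tau (lift P w) x - (lift P w x + tau * lam * w (fst x))\<bar> <= tau\<^sup>2)" if lt: "lam > 0" "0 < tau" "tau <= 1" for lam tau
 proof -
  obtain w where w: "zn_periodic w" "\<forall>x y. w x <= w y + (A / lam) * dist x y" "\<forall>x. \<bar>w x + norm P / lam\<bar> <= \<bar>snd P\<bar> * F / lam"
   "\<forall>x. \<bar>T 1 tau (lift P w) x - (lift P w x + tau * lam * w (fst x))\<bar> <= tau\<^sup>2"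
   using discrete_cell[OF per lt, of P] unfolding A_def by blast
  have "\<bar>w x\<bar> <= Mb lam" for x
  proof -
   have "norm P / lam >= 0" using lt by simp
   thus ?thesis using w(3)[rule_format, of x] unfolding Mb_def by linarith
  qed
  thus ?thesis using w by blast
 qed
 \<comment> \<open>The Lipschitz constant \<open>A\<close> of \<open>lam * v lam\<close> does not
   depend on \<open>lam\<close>. It is inherited from the discrete approximants, for which it was
   explicit.\<close>
 have vlip: "lam * v lam x <= lam * v lam y + A * dist x y" if lam: "lam > 0" for lam x y
 proof (rule field_le_epsilon)
  fix e :: real assume e: "e > 0"
  have "e / 2 / lam > 0" using e lam by simp
  from discrete_cell_converges[OF per lam P uniq[OF lam] this, of "A / lam" "Mb lam"]
  obtain tau1 where tau1: "tau1 > 0" and c: "!!tau w. 0 < tau ==> tau < tau1 ==> tau <= 1 ==> zn_periodic w ==> (\<forall>x y. w x <= w y + A / lam * dist x y) ==>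
   (\<forall>x. \<bar>w x\<bar> <= Mb lam) ==> (\<forall>x. \<bar>T 1 tau (lift P w) x - (lift P w x + tau * lam * w (fst x))\<bar> <= tau\<^sup>2) ==> (\<forall>x. \<bar>w x - v lam x\<bar> < e / 2 / lam)"
   by blast
  define tau where "tau = min 1 tau1 / 2"
  have tau: "0 < tau" "tau < tau1" "tau <= 1" using tau1 by (auto simp: tau_def min_def)
  obtain w where w: "zn_periodic w" "\<forall>x y. w x <= w y + (A / lam) * dist x y" "\<forall>x. \<bar>w x\<bar> <= Mb lam"
   "\<forall>x. \<bar>T 1 tau (lift P w) x - (lift P w x + tau * lam * w (fst x))\<bar> <= tau\<^sup>2"
   using disc[OF lam tau(1,3)] by blast
  have cl: "\<bar>w z - v lam z\<bar> < e / 2 / lam" for z using c[OF tau w] by blast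
  have "v lam x <= v lam y + A / lam * dist x y + (e / 2 / lam + e / 2 / lam)"
   using cl[of x] cl[of y] w(2)[rule_format, of x y] by linarith
  hence "lam * v lam x <= lam * (v lam y + A / lam * dist x y + (e / 2 / lam + e / 2 / lam))"
   using lam by (intro mult_left_mono) auto
  also have "\<dots> = lam * v lam y + A * dist x y + e" using lam by (simp add: algebra_simps)
  finally show "lam * v lam x <= lam * v lam y + A * dist x y + e" .
 qed
 \<comment> \<open>The common Lipschitz constant reduces uniform convergence on the unit cell to
   convergence at the finitely many points of a net.\<close>
 have "\<exists>lam>0. \<forall>x. \<bar>lam * v lam x + H\<bar> <= \<eta> / 3"
 proof -
  obtain \<rho> where \<rho>: "\<rho> > 0" "A * \<rho> <= \<eta> / 6" using small_factor[OF A, of "\<eta> / 6"] \<eta> by auto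
  have K: "compact (cbox (0 :: real^'n) (\<chi> i. 1))" by simp
  obtain Z where Z: "finite Z" "cbox (0 :: real^'n) (\<chi> i. 1) \<subseteq> (\<Union>z\<in>Z. ball z \<rho>)"
  proof (rule compactE_image[OF K, of "cbox (0 :: real^'n) (\<chi> i. 1)" "%z. ball z \<rho>"])
   show "cbox (0 :: real^'n) (\<chi> i. 1) \<subseteq> (\<Union>z\<in>cbox (0 :: real^'n) (\<chi> i. 1). ball z \<rho>)" using \<rho>(1) by force
  qed auto
  have "\<forall>\<^sub>F lam in at_right 0. \<bar>lam * v lam z + H\<bar> < \<eta> / 6" for z
   using tendstoD[OF lim[of z], of "\<eta> / 6"] \<eta> by (simp add: dist_real_def)
  hence "\<forall>\<^sub>F lam in at_right 0. \<forall>z\<in>Z. \<bar>lam * v lam z + H\<bar> < \<eta> / 6"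
   using Z(1) by (simp add: eventually_ball_finite)
  moreover have "\<forall>\<^sub>F lam in at_right 0. lam > (0 :: real)" by (simp add: eventually_at_right_less)
  ultimately have "\<forall>\<^sub>F lam in at_right 0. lam > (0 :: real) \<and> (\<forall>z\<in>Z. \<bar>lam * v lam z + H\<bar> < \<eta> / 6)"
   by eventually_elim auto
  then obtain lam where lam: "lam > 0" "!!z. z \<in> Z ==> \<bar>lam * v lam z + H\<bar> < \<eta> / 6"
   using eventually_happens'[OF trivial_limit_at_right_real] by blast
  have "\<bar>lam * v lam x + H\<bar> <= \<eta> / 3" for x
  proof -
   obtain m y where m: "\<forall>i. m $ i \<in> \<int>" "x = y + m" and y: "y \<in> cbox 0 (\<chi> i. 1)" by (rule periodic_reduce)
   have vx: "v lam x = v lam y" using sol[OF lam(1)] m unfolding cell_solution_def zn_periodic_def by auto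
   obtain z where z: "z \<in> Z" "dist z y < \<rho>" using Z(2) y by auto
   have "A * dist z y <= A * \<rho>" using z A by (intro mult_left_mono) auto
   hence "\<bar>lam * v lam y - lam * v lam z\<bar> <= \<eta> / 6"
    using vlip[OF lam(1), of y z] vlip[OF lam(1), of z y] \<rho>(2) unfolding dist_commute[of y z] by linarith
   thus ?thesis using lam(2)[OF z(1)] unfolding vx by linarith
  qed
  thus ?thesis using lam(1) by blast
 qed
 then obtain lam where lam: "lam > 0" "!!x. \<bar>lam * v lam x + H\<bar> <= \<eta> / 3" by blast
 have "\<eta> / 3 / lam > 0" using \<eta> lam by simp
 from discrete_cell_converges[OF per lam(1) P uniq[OF lam(1)] this, of "A / lam" "Mb lam"]
 obtain tau1 where tau1: "tau1 > 0" and c: "!!tau w. 0 < tau ==> tau < tau1 ==> tau <= 1 ==> zn_periodic w ==> (\<forall>x y. w x <= w y + A / lam * dist x y) ==>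
   (\<forall>x. \<bar>w x\<bar> <= Mb lam) ==> (\<forall>x. \<bar>T 1 tau (lift P w) x - (lift P w x + tau * lam * w (fst x))\<bar> <= tau\<^sup>2) ==> (\<forall>x. \<bar>w x - v lam x\<bar> < \<eta> / 3 / lam)"
  by blast
 \<comment> \<open>A third of \<eta> each for \<open>lam * v lam + H\<close>, for
   \<open>w - v lam\<close>, and for the residual \<open>tau^2 <= tau * \<eta> / 3\<close>.\<close>
 define tau2 where "tau2 = min tau1 (min 1 (\<eta> / 3))"
 have tau2: "tau2 > 0" using tau1 \<eta> by (simp add: tau2_def)
 have "\<exists>w. approx_cell (T 1 tau) P H tau \<eta> (A / lam) (Mb lam) w" if tau: "0 < tau" "tau < tau2" for tau
 proof -
  have tau': "0 < tau" "tau < tau1" "tau <= 1" "tau <= \<eta> / 3" using tau by (auto simp: tau2_def)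
  obtain w where w: "zn_periodic w" "\<forall>x y. w x <= w y + (A / lam) * dist x y" "\<forall>x. \<bar>w x\<bar> <= Mb lam"
   "\<forall>x. \<bar>T 1 tau (lift P w) x - (lift P w x + tau * lam * w (fst x))\<bar> <= tau\<^sup>2"
   using disc[OF lam(1) tau'(1,3)] by blast
  have "\<bar>T 1 tau (lift P w) x - (lift P w x - tau * H)\<bar> <= \<eta> * tau" for x
  proof -
   have "\<bar>w (fst x) - v lam (fst x)\<bar> < \<eta> / 3 / lam" using c[OF tau'(1,2,3) w] by blast
   hence "lam * \<bar>w (fst x) - v lam (fst x)\<bar> <= \<eta> / 3" using lam(1) by (simp add: field_simps)
   hence "\<bar>lam * w (fst x) - lam * v lam (fst x)\<bar> <= \<eta> / 3"
    using lam(1) by (simp add: abs_mult flip: right_diff_distrib)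
   hence "\<bar>lam * w (fst x) + H\<bar> <= 2 * \<eta> / 3" using lam(2)[of "fst x"] by linarith
   hence "tau * \<bar>lam * w (fst x) + H\<bar> <= tau * (2 * \<eta> / 3)" using tau' by (intro mult_left_mono) auto
   hence 1: "\<bar>tau * lam * w (fst x) + tau * H\<bar> <= tau * (2 * \<eta> / 3)"
    using tau' by (simp add: abs_mult mult.assoc flip: distrib_left)
   have 2: "tau\<^sup>2 <= tau * (\<eta> / 3)" unfolding power2_eq_square using tau' by (intro mult_left_mono) auto
   have 3: "tau * (2 * \<eta> / 3) + tau * (\<eta> / 3) = \<eta> * tau" by (simp add: field_simps)
   show ?thesis using 1 2 3 w(4)[rule_format, of x] by linarith
  qed
  thus ?thesis using w unfolding approx_cell_def by blast
 qed
 moreover have "A / lam >= 0" using A lam by simp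
 ultimately show ?thesis using tau2 by blast
qed

end

section \<open>Inf-convolutions and the transfer of one game step\<close>

definition infconv :: "real => ('a::euclidean_space => real) => 'a => real" where
 "infconv \<alpha> w x = (INF y. w y + (dist x y)\<^sup>2 / (2 * \<alpha>))"

text \<open>The lower bound is Young's inequality for \<open>Lam * dist x y\<close>. Beyond the
  radius \<open>2 * \<alpha> * Lam\<close> the quadratic exceeds any decrease that the Lipschitz
  bound permits, so the infimum is attained inside a compact ball.\<close>

lemma infconv_facts:
 fixes w :: "'a::euclidean_space => real"
 assumes w: "!!x y. w x <= w y + Lam * dist x y" and \<alpha>: "\<alpha> > 0" and Lam: "Lam >= 0"
 shows "infconv \<alpha> w x <= w z + (dist x z)\<^sup>2 / (2 * \<alpha>)"
  and "infconv \<alpha> w x <= w x" and "infconv \<alpha> w x >= w x - \<alpha> * Lam\<^sup>2 / 2"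
  and "\<exists>y. infconv \<alpha> w x = w y + (dist x y)\<^sup>2 / (2 * \<alpha>) \<and> dist x y <= 2 * \<alpha> * Lam"
proof -
 have low: "w x - \<alpha> * Lam\<^sup>2 / 2 <= w y + (dist x y)\<^sup>2 / (2 * \<alpha>)" for y
 proof -
  have "Lam * dist x y <= (dist x y)\<^sup>2 / (2 * \<alpha>) + \<alpha> * Lam\<^sup>2 / 2"
  proof -
   have "0 <= (dist x y - \<alpha> * Lam)\<^sup>2 / (2 * \<alpha>)" using \<alpha> by simp
   also have "\<dots> = (dist x y)\<^sup>2 / (2 * \<alpha>) + \<alpha> * Lam\<^sup>2 / 2 - Lam * dist x y"
    using \<alpha> by (simp add: power2_eq_square field_simps)
   finally show ?thesis by simp
  qed
  thus ?thesis using w[of x y] by linarith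
 qed
 have bdd: "bdd_below (range (%y. w y + (dist x y)\<^sup>2 / (2 * \<alpha>)))"
  using low by (intro bdd_belowI2) auto
 show le: "infconv \<alpha> w x <= w z + (dist x z)\<^sup>2 / (2 * \<alpha>)" for z
  unfolding infconv_def by (rule cINF_lower[OF bdd]) simp
 show "infconv \<alpha> w x <= w x" using le[of x] by simp
 show "infconv \<alpha> w x >= w x - \<alpha> * Lam\<^sup>2 / 2"
  unfolding infconv_def by (rule cINF_greatest) (use low in auto)
 have "\<bar>w a - w b\<bar> <= Lam * dist a b" for a b using w[of a b] w[of b a] by (simp add: dist_commute)
 hence "Lam-lipschitz_on UNIV w" using Lam by (auto simp: lipschitz_on_def dist_real_def)
 hence wc: "continuous_on UNIV w" by (rule lipschitz_on_continuous_on)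
 have nn: "0 <= 2 * \<alpha> * Lam" using \<alpha> Lam by simp
 have cont: "continuous_on (cball x (2 * \<alpha> * Lam)) (%y. w y + (dist x y)\<^sup>2 / (2 * \<alpha>))"
  using \<alpha> by (intro continuous_intros continuous_on_subset[OF wc]) auto
 have "cball x (2 * \<alpha> * Lam) \<noteq> {}" using nn by simp
 from continuous_attains_inf[OF compact_cball this cont] obtain y where y: "y \<in> cball x (2 * \<alpha> * Lam)"
  and min: "!!z. z \<in> cball x (2 * \<alpha> * Lam) ==> w y + (dist x y)\<^sup>2 / (2 * \<alpha>) <= w z + (dist x z)\<^sup>2 / (2 * \<alpha>)"
  by blast
 have "w y + (dist x y)\<^sup>2 / (2 * \<alpha>) <= w z + (dist x z)\<^sup>2 / (2 * \<alpha>)" for z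
 proof (cases "z \<in> cball x (2 * \<alpha> * Lam)")
  case True
  thus ?thesis by (rule min)
 next
  case False
  hence far: "2 * \<alpha> * Lam <= dist x z" by simp
  have "Lam * dist x z <= (dist x z)\<^sup>2 / (2 * \<alpha>)"
   using mult_right_mono[OF far, of "dist x z"] \<alpha> by (simp add: power2_eq_square field_simps)
  hence "w x <= w z + (dist x z)\<^sup>2 / (2 * \<alpha>)" using w[of x z] by linarith
  moreover have "w y + (dist x y)\<^sup>2 / (2 * \<alpha>) <= w x" using min[of x] nn by simp
  ultimately show ?thesis by linarith
 qed
 hence "w y + (dist x y)\<^sup>2 / (2 * \<alpha>) <= infconv \<alpha> w x" unfolding infconv_def by (intro cINF_greatest) auto
 thus "\<exists>y. infconv \<alpha> w x = w y + (dist x y)\<^sup>2 / (2 * \<alpha>) \<and> dist x y <= 2 * \<alpha> * Lam"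
  using le[of y] y by (intro exI[of _ y]) auto
qed

text \<open>Along the last axis \<open>w\<close> is affine with slope \<pi>, so minimality in that
  direction is a quadratic problem in one variable and its stationarity condition is the claim. This
  is what bounds the slope in the frame argument away from zero.\<close>

lemma infconv_snd:
 fixes w :: "'a::euclidean_space \<times> real => real"
 assumes le: "!!z. w y + (dist x y)\<^sup>2 / (2 * \<alpha>) <= w z + (dist x z)\<^sup>2 / (2 * \<alpha>)" and \<alpha>: "\<alpha> > 0"
  and inv: "!!z c. w (z + (0, c)) = w z + c * \<pi>"
 shows "snd ((1/\<alpha>) *\<^sub>R (x - y)) = \<pi>"
proof -
 define q where "q = snd (x - y)"
 define b where "b = \<pi> - q / \<alpha>"
 have sq: "(dist x (y + (0, c)))\<^sup>2 = (dist x y)\<^sup>2 - 2 * q * c + c\<^sup>2" for c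
 proof -
  have "dist x (y + (0, c)) = norm ((x - y) - (0, c))" by (simp add: dist_norm algebra_simps)
  moreover have "(norm ((x - y) - (0, c)))\<^sup>2 = (norm (x - y))\<^sup>2 - 2 * ((x - y) \<bullet> (0, c)) + (norm (0 :: 'a, c))\<^sup>2"
   unfolding power2_norm_eq_inner inner_diff_left[of "x - y"] inner_diff_right[of _ "x - y"] by (simp add: inner_commute)
  moreover have "(x - y) \<bullet> (0, c) = q * c" by (simp add: q_def inner_prod_def)
  ultimately show ?thesis by (simp add: dist_norm norm_Pair)
 qed
 \<comment> \<open>The minimiser of the resulting quadratic in \<open>c\<close>; a nonzero
   \<open>b\<close> would make its value negative.\<close>
 define c where "c = - (\<alpha> * b)"
 have "0 <= c * \<pi> + (- 2 * q * c + c\<^sup>2) / (2 * \<alpha>)"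
  using le[of "y + (0, c)"] unfolding inv sq by (simp add: diff_divide_distrib add_divide_distrib)
 also have "\<dots> = c * b + c\<^sup>2 / (2 * \<alpha>)" using \<alpha> by (simp add: b_def field_simps)
 also have "\<dots> = - (\<alpha> * b\<^sup>2 / 2)" using \<alpha> by (simp add: c_def power2_eq_square)
 finally have "b\<^sup>2 <= 0" using \<alpha> by (simp add: mult_le_0_iff)
 hence "b = 0" by simp
 thus ?thesis by (simp add: b_def q_def)
qed

context shear_game
begin

text \<open>The point reached by the move \<open>m\<close> from \<open>y\<close> is inserted as a
  competitor in the infimum at the point reached by \<open>m'\<close> from \<open>x\<close>. Apart
  from the first-order mismatch \<open>c1\<close>, the \<alpha> term is due to the drifts, which
  differ by at most \<open>L * (2 * \<alpha> * Lam)\<close>, the \<rho> term to the perturbation,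
  and \<open>c2^2 / \<alpha>\<close> to unequal moves inside the quadratic penalty.\<close>

lemma infconv_step:
 fixes w \<psi> :: "(real^'n) \<times> real => real"
 assumes w: "!!x y. w x <= w y + Lam * dist x y" and \<alpha>: "0 < \<alpha>" "\<alpha> <= 1" and Lam: "Lam >= 0" and tau: "0 <= tau" "tau <= 1"
  and y: "infconv \<alpha> w x = w y + (dist x y)\<^sup>2 / (2 * \<alpha>)" "dist x y <= 2 * \<alpha> * Lam"
  and \<psi>: "!!\<delta>. norm \<delta> <= 1 ==> \<psi> (x + \<delta>) <= \<psi> x + p \<bullet> \<delta> + \<rho> * (norm \<delta>)\<^sup>2"
  and p: "norm p <= \<rho>"
  and first: "((1/\<alpha>) *\<^sub>R (x - y) + p) \<bullet> m' - ((1/\<alpha>) *\<^sub>R (x - y)) \<bullet> m <= c1"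
  and m: "norm (m' - m) <= c2" and m': "norm (m' - tau *\<^sub>R Vfield f (1 *\<^sub>R x)) <= B" "B <= 1"
 shows "infconv \<alpha> w (drift 1 tau x + m') + \<psi> (drift 1 tau x + m') <= w (drift 1 tau y + m) + (infconv \<alpha> w x - w y) + \<psi> x
  + c1 + tau * (\<alpha> * (4 * L * Lam\<^sup>2 + 4 * L\<^sup>2 * Lam\<^sup>2)) + \<rho> * (tau * F + B\<^sup>2) + c2\<^sup>2 / \<alpha>"
proof -
 define P where "P = (1/\<alpha>) *\<^sub>R (x - y)"
 define Vx where "Vx = Vfield f (1 *\<^sub>R x)"
 define Vy where "Vy = Vfield f (1 *\<^sub>R y)"
 have xy: "x - y = \<alpha> *\<^sub>R P" using \<alpha> by (simp add: P_def)
 have nxy: "norm (x - y) <= 2 * \<alpha> * Lam" using y(2) by (simp add: dist_norm)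
 have nP: "norm P <= 2 * Lam"
 proof -
  have "\<alpha> * norm P <= \<alpha> * (2 * Lam)" using nxy \<alpha> unfolding xy by (simp add: algebra_simps)
  thus ?thesis using \<alpha> by (simp add: mult_le_cancel_left)
 qed
 have V: "norm (Vx - Vy) <= L * (2 * \<alpha> * Lam)"
 proof -
  have "norm (Vx - Vy) <= L * norm (fst (1 *\<^sub>R x) - fst (1 *\<^sub>R y))" unfolding Vx_def Vy_def by (rule Vfield_lip)
  also have "\<dots> <= L * norm (x - y)" using dist_fst_le[of x y] L_nonneg by (intro mult_left_mono) (auto simp: dist_norm)
  also have "\<dots> <= L * (2 * \<alpha> * Lam)" using nxy L_nonneg by (intro mult_left_mono)
  finally show ?thesis .
 qed
 define D where "D = (m' - m) - tau *\<^sub>R (Vx - Vy)"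
 have zz: "drift 1 tau x + m' - (drift 1 tau y + m) = \<alpha> *\<^sub>R P + D"
  using xy by (simp add: drift_def D_def Vx_def Vy_def algebra_simps)
 have "infconv \<alpha> w (drift 1 tau x + m') <= w (drift 1 tau y + m) + (dist (drift 1 tau x + m') (drift 1 tau y + m))\<^sup>2 / (2 * \<alpha>)"
  by (rule infconv_facts(1)[OF w \<alpha>(1) Lam])
 also have "(dist (drift 1 tau x + m') (drift 1 tau y + m))\<^sup>2 = (norm (x - y))\<^sup>2 + 2 * \<alpha> * (P \<bullet> D) + (norm D)\<^sup>2"
  unfolding dist_norm zz xy power2_norm_eq_inner
  by (simp add: inner_add_left inner_add_right inner_commute algebra_simps)
 also have "((norm (x - y))\<^sup>2 + 2 * \<alpha> * (P \<bullet> D) + (norm D)\<^sup>2) / (2 * \<alpha>) = (dist x y)\<^sup>2 / (2 * \<alpha>) + P \<bullet> D + (norm D)\<^sup>2 / (2 * \<alpha>)"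
  using \<alpha> by (simp add: dist_norm field_simps)
 finally have 1: "infconv \<alpha> w (drift 1 tau x + m') <= w (drift 1 tau y + m) + (infconv \<alpha> w x - w y) + P \<bullet> D + (norm D)\<^sup>2 / (2 * \<alpha>)"
  using y(1) by linarith
 have dx: "drift 1 tau x + m' = x + (m' - tau *\<^sub>R Vx)" by (simp add: drift_def Vx_def)
 have 2: "\<psi> (drift 1 tau x + m') <= \<psi> x + p \<bullet> (m' - tau *\<^sub>R Vx) + \<rho> * (norm (m' - tau *\<^sub>R Vx))\<^sup>2"
  unfolding dx by (rule \<psi>) (use m' in \<open>simp add: Vx_def\<close>)
 have \<rho>: "\<rho> >= 0" using p norm_ge_zero order_trans by blast
 have 3: "\<rho> * (norm (m' - tau *\<^sub>R Vx))\<^sup>2 <= \<rho> * B\<^sup>2"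
  using m'(1) \<rho> unfolding Vx_def by (intro mult_left_mono power_mono) auto
 have 4: "P \<bullet> D + p \<bullet> (m' - tau *\<^sub>R Vx) <= c1 + tau * (\<alpha> * (4 * L * Lam\<^sup>2)) + \<rho> * (tau * F)"
 proof -
  have "P \<bullet> D + p \<bullet> (m' - tau *\<^sub>R Vx) = ((P + p) \<bullet> m' - P \<bullet> m) + tau * (- (P \<bullet> (Vx - Vy))) + tau * (- (p \<bullet> Vx))"
   by (simp add: D_def inner_diff_right inner_add_left algebra_simps)
  moreover have "(P + p) \<bullet> m' - P \<bullet> m <= c1" using first by (simp add: P_def)
  moreover have "tau * (- (P \<bullet> (Vx - Vy))) <= tau * (\<alpha> * (4 * L * Lam\<^sup>2))"
  proof (rule mult_left_mono[OF _ tau(1)])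
   have "- (P \<bullet> (Vx - Vy)) <= norm P * norm (Vx - Vy)" using Cauchy_Schwarz_ineq2[of P "Vx - Vy"] by linarith
   also have "\<dots> <= (2 * Lam) * (L * (2 * \<alpha> * Lam))" using nP V Lam by (intro mult_mono) auto
   finally show "- (P \<bullet> (Vx - Vy)) <= \<alpha> * (4 * L * Lam\<^sup>2)" by (simp add: power2_eq_square algebra_simps)
  qed
  moreover have "tau * (- (p \<bullet> Vx)) <= tau * (\<rho> * F)"
  proof (rule mult_left_mono[OF _ tau(1)])
   have "- (p \<bullet> Vx) <= norm p * norm Vx" using Cauchy_Schwarz_ineq2[of p Vx] by linarith
   also have "\<dots> <= \<rho> * F" using p norm_Vfield \<rho> unfolding Vx_def by (intro mult_mono) auto
   finally show "- (p \<bullet> Vx) <= \<rho> * F" .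
  qed
  ultimately show ?thesis by (simp add: mult.left_commute mult.assoc)
 qed
 have 5: "(norm D)\<^sup>2 / (2 * \<alpha>) <= c2\<^sup>2 / \<alpha> + tau * (\<alpha> * (4 * L\<^sup>2 * Lam\<^sup>2))"
 proof -
  have "norm D <= c2 + tau * (L * (2 * \<alpha> * Lam))"
  proof -
   have "norm (tau *\<^sub>R (Vx - Vy)) <= tau * (L * (2 * \<alpha> * Lam))" using V tau by (simp add: mult_left_mono)
   thus ?thesis using norm_triangle_ineq4[of "m' - m" "tau *\<^sub>R (Vx - Vy)"] m unfolding D_def by linarith
  qed
  hence "(norm D)\<^sup>2 <= (c2 + tau * (L * (2 * \<alpha> * Lam)))\<^sup>2" by (intro power_mono) auto
  also have "\<dots> <= 2 * c2\<^sup>2 + 2 * (tau * (L * (2 * \<alpha> * Lam)))\<^sup>2"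
   using sum_squares_bound[of c2 "tau * (L * (2 * \<alpha> * Lam))"] by (simp add: power2_eq_square algebra_simps)
  finally have "(norm D)\<^sup>2 / (2 * \<alpha>) <= (2 * c2\<^sup>2 + 2 * (tau * (L * (2 * \<alpha> * Lam)))\<^sup>2) / (2 * \<alpha>)" using \<alpha> by (intro divide_right_mono) auto
  also have "\<dots> = c2\<^sup>2 / \<alpha> + (tau * tau) * (\<alpha> * (4 * L\<^sup>2 * Lam\<^sup>2))"
   using \<alpha> by (simp add: power2_eq_square field_simps)
  also have "\<dots> <= c2\<^sup>2 / \<alpha> + tau * (\<alpha> * (4 * L\<^sup>2 * Lam\<^sup>2))"
  proof -
   have "tau * tau <= tau" using tau by (simp add: mult_left_le)
   thus ?thesis using \<alpha> by (intro add_left_mono mult_right_mono) auto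
  qed
  finally show ?thesis .
 qed
 have "tau * (\<alpha> * (4 * L * Lam\<^sup>2)) + tau * (\<alpha> * (4 * L\<^sup>2 * Lam\<^sup>2)) = tau * (\<alpha> * (4 * L * Lam\<^sup>2 + 4 * L\<^sup>2 * Lam\<^sup>2))"
  "\<rho> * (tau * F) + \<rho> * B\<^sup>2 = \<rho> * (tau * F + B\<^sup>2)" by (simp_all add: algebra_simps)
 thus ?thesis using 1 2 3 4 5 by linarith
qed

definition cell_value :: "(real^'n) \<times> real => real => bool" where
 "cell_value P H \<longleftrightarrow> (\<forall>\<eta>>0. \<exists>Lam M tau1. Lam >= 0 \<and> tau1 > 0 \<and>
  (\<forall>tau. 0 < tau --> tau < tau1 --> (\<exists>w. approx_cell (T 1 tau) P H tau \<eta> Lam M w)))"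

text \<open>\<psi> has to satisfy only a one-sided expansion at the point \<open>x\<close> where the
  step is evaluated, with small slope and small curvature; blown-up smooth test functions do so near
  their contact point. \<open>W\<close> may depend on \<open>tau\<close>, while its bound and the
  tolerance \<rho> may not.\<close>

definition super_corrector :: "(real^'n) \<times> real => real => bool" where
 "super_corrector P H \<longleftrightarrow> (\<forall>\<eta>>0. \<exists>\<rho>>0. \<exists>M tau0. tau0 > 0 \<and> (\<forall>tau. 0 < tau --> tau < tau0 -->
  (\<exists>W. (\<forall>x. \<bar>W x\<bar> <= M) \<and> (\<forall>\<psi> x p. locally_bdd \<psi> --> norm p <= \<rho> -->
    (\<forall>\<delta>. norm \<delta> <= 1 --> \<psi> (x + \<delta>) <= \<psi> x + p \<bullet> \<delta> + \<rho> * (norm \<delta>)\<^sup>2) -->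
    T 1 tau (%y. P \<bullet> y + W y + \<psi> y) x <= P \<bullet> x + W x + \<psi> x - tau * (H - \<eta>)))))"

definition sub_corrector :: "(real^'n) \<times> real => real => bool" where
 "sub_corrector P H \<longleftrightarrow> (\<forall>\<eta>>0. \<exists>\<rho>>0. \<exists>M tau0. tau0 > 0 \<and> (\<forall>tau. 0 < tau --> tau < tau0 -->
  (\<exists>W. (\<forall>x. \<bar>W x\<bar> <= M) \<and> (\<forall>\<psi> x p. locally_bdd \<psi> --> norm p <= \<rho> -->
    (\<forall>\<delta>. norm \<delta> <= 1 --> \<psi> (x + \<delta>) >= \<psi> x + p \<bullet> \<delta> - \<rho> * (norm \<delta>)\<^sup>2) -->
    T 1 tau (%y. P \<bullet> y + W y + \<psi> y) x >= P \<bullet> x + W x + \<psi> x - tau * (H + \<eta>)))))"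

lemma lift_lipschitz:
 assumes "!!x y. v x <= v y + Lam * dist x y" "Lam >= 0"
 shows "lift P v x <= lift P v y + (norm P + Lam) * dist x y"
proof -
 have "P \<bullet> (x - y) <= norm P * dist x y" by (simp add: dist_norm norm_cauchy_schwarz)
 moreover have "Lam * dist (fst x) (fst y) <= Lam * dist x y" using dist_fst_le[of x y] assms(2) by (intro mult_left_mono)
 ultimately show ?thesis using assms(1)[of "fst x" "fst y"] by (simp add: lift_def inner_diff_right algebra_simps)
qed

lemma lift_shift: "lift P v (z + (0, c)) = lift P v z + c * snd P"
 by (simp add: lift_def inner_prod_def algebra_simps)

text \<open>One move, drift included, has length at most \<open>stepC * sqrt tau\<close> as long as
  \<open>tau <= 1\<close>.\<close>

definition stepC :: real where "stepC = F + 1 + sqrt (2 * CARD('n) * d)"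

lemma stepC_ge: "stepC >= 1" using F_nonneg d_pos by (simp add: stepC_def)

lemma move_bounds:
 assumes E: "E \<in> controls" and sig: "\<bar>sig\<bar> = 1" and tau: "0 <= tau" "tau <= 1"
 shows "norm (E (move (side 1 tau) tau i sig)) <= stepC * sqrt tau"
  and "norm (E (move (side 1 tau) tau i sig) - tau *\<^sub>R Vfield f z) <= stepC * sqrt tau"
proof -
 have t: "tau <= sqrt tau" using tau by (rule le_sqrt_self)
 have a: "norm (E (move (side 1 tau) tau i sig)) <= side 1 tau + tau"
  by (rule controls_norm_move[OF E sig]) (use tau side_nonneg in auto)
 have s: "side 1 tau <= sqrt (2 * CARD('n) * d) * sqrt tau" using side_le tau by simp
 have e: "stepC * sqrt tau = F * sqrt tau + sqrt tau + sqrt (2 * CARD('n) * d) * sqrt tau" by (simp add: stepC_def algebra_simps)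
 have f: "F * tau <= F * sqrt tau" using t F_nonneg by (intro mult_left_mono)
 have f0: "0 <= F * tau" using F_nonneg tau by simp
 show "norm (E (move (side 1 tau) tau i sig)) <= stepC * sqrt tau" using a s t f f0 unfolding e by linarith
 have "norm (tau *\<^sub>R Vfield f z) <= F * tau" using mult_left_mono[OF norm_Vfield[of z] tau(1)] tau by (simp add: mult.commute)
 thus "norm (E (move (side 1 tau) tau i sig) - tau *\<^sub>R Vfield f z) <= stepC * sqrt tau"
  using norm_triangle_ineq4[of "E (move (side 1 tau) tau i sig)" "tau *\<^sub>R Vfield f z"] a s t f unfolding e by linarith
qed

text \<open>The opponent collects the tangential part of the gradient with weight
  \<open>sqrt tau\<close>, against errors of order \<open>tau\<close>. Consequently a nearly optimal
  frame has its normal almost parallel to the gradient, which is how the tangency hypothesis of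
  \<open>frame_adjust\<close> gets verified.\<close>

lemma payoff_lower_quadratic:
 assumes E: "orthogonal_transformation E" and tau: "0 <= tau" "tau <= 1" and small: "stepC * sqrt tau <= 1"
  and u: "!!\<delta>. norm \<delta> <= 1 ==> u (y + \<delta>) >= u y + Q \<bullet> \<delta> - A * (norm \<delta>)\<^sup>2" and A: "A >= 0" and Q: "norm Q <= N"
  and a: "Q = E a"
 shows "payoff (side 1 tau) tau u (drift 1 tau y) E >= u y + sqrt tau * (sqrt (2 * CARD('n) * d) / CARD('n) * norm (fst a))
  - tau * (N * (F + 1) + A * stepC\<^sup>2)"
proof -
 define s where "s = side 1 tau"
 have s: "s = sqrt (2 * CARD('n) * d) * sqrt tau" by (simp add: s_def side_def real_sqrt_mult)
 have s0: "s >= 0" using side_nonneg tau by (simp add: s_def)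
 have Ec: "E \<in> controls" using E by (simp add: controls_def)
 have lin: "linear E" using E by (simp only: orthogonal_transformation_def)
 have inE: "E v \<bullet> E w = v \<bullet> w" for v w using E by (simp only: orthogonal_transformation_def)
 have nE: "norm (E v) = norm v" for v using E orthogonal_transformation_norm by blast
 have comp: "Q \<bullet> E (axis i 1, 0) = fst a $ i" for i
 proof -
  have "Q \<bullet> E (axis i 1, 0) = a \<bullet> (axis i 1, 0)" by (simp only: a inE)
  thus ?thesis by (cases a) (simp add: inner_axis)
 qed
 have "(\<Sum>i\<in>(UNIV::'n set). (u y - tau * (N * (F + 1) + A * stepC\<^sup>2)) + s * \<bar>fst a $ i\<bar>) / CARD('n) <= payoff s tau u (drift 1 tau y) E"
 proof (rule payoff_ge)
  fix i :: 'n
  define V where "V = Vfield f ((1/1) *\<^sub>R y)"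
  define e where "e = E (axis i 1, 0)"
  define sig :: real where "sig = (if Q \<bullet> e >= 0 then 1 else -1)"
  have sig: "\<bar>sig\<bar> = 1" "sig * (Q \<bullet> e) = \<bar>fst a $ i\<bar>" using comp[of i] by (auto simp: sig_def e_def)
  define \<delta> where "\<delta> = (sig * s) *\<^sub>R e - tau *\<^sub>R (V + E (0, 1))"
  have pt: "drift 1 tau y + E (move s tau i sig) = y + \<delta>"
   unfolding drift_move[OF lin] by (simp add: \<delta>_def e_def V_def)
  have "\<delta> = E (move s tau i sig) - tau *\<^sub>R Vfield f y" using pt by (simp add: drift_def algebra_simps)
  hence n\<delta>: "norm \<delta> <= stepC * sqrt tau" using move_bounds(2)[OF Ec sig(1) tau] by (simp add: s_def)
  hence "(norm \<delta>)\<^sup>2 <= (stepC * sqrt tau)\<^sup>2" by (intro power_mono) auto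
  hence "A * (norm \<delta>)\<^sup>2 <= A * (stepC\<^sup>2 * tau)" using A tau by (intro mult_left_mono) (auto simp: power_mult_distrib)
  moreover have "Q \<bullet> \<delta> = s * (sig * (Q \<bullet> e)) - tau * (Q \<bullet> (V + E (0, 1)))"
   by (simp add: \<delta>_def inner_diff_right algebra_simps)
  moreover have "tau * (Q \<bullet> (V + E (0, 1))) <= tau * (N * (F + 1))"
  proof (rule mult_left_mono[OF _ tau(1)])
   have "norm (V + E (0, 1)) <= F + 1"
    using norm_triangle_ineq[of V "E (0,1)"] norm_Vfield[of "(1/1) *\<^sub>R y"] by (simp add: V_def nE norm_Pair)
   hence "norm Q * norm (V + E (0, 1)) <= N * (F + 1)" using Q by (intro mult_mono) (auto intro: order_trans[OF norm_ge_zero Q])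
   thus "Q \<bullet> (V + E (0, 1)) <= N * (F + 1)" using norm_cauchy_schwarz[of Q "V + E (0, 1)"] by linarith
  qed
  moreover have "u (y + \<delta>) >= u y + Q \<bullet> \<delta> - A * (norm \<delta>)\<^sup>2" by (rule u) (use n\<delta> small in simp)
  ultimately have "u (y + \<delta>) >= (u y - tau * (N * (F + 1) + A * stepC\<^sup>2)) + s * \<bar>fst a $ i\<bar>"
   unfolding sig(2) by (simp add: algebra_simps)
  thus "\<exists>sig. \<bar>sig\<bar> = 1 \<and> (u y - tau * (N * (F + 1) + A * stepC\<^sup>2)) + s * \<bar>fst a $ i\<bar> <= u (drift 1 tau y + E (move s tau i sig))"
   using sig(1) pt by (intro exI[of _ sig]) simp
 qed
 moreover have "(\<Sum>i\<in>(UNIV::'n set). (u y - tau * (N * (F + 1) + A * stepC\<^sup>2)) + s * \<bar>fst a $ i\<bar>) / CARD('n)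
  = (u y - tau * (N * (F + 1) + A * stepC\<^sup>2)) + (s / CARD('n)) * (\<Sum>i\<in>UNIV. \<bar>fst a $ i\<bar>)"
  by (simp add: sum.distrib sum_distrib_left[symmetric] add_divide_distrib)
 moreover have "(s / CARD('n)) * norm (fst a) <= (s / CARD('n)) * (\<Sum>i\<in>UNIV. \<bar>fst a $ i\<bar>)"
  using s0 by (intro mult_left_mono norm_le_l1_cart) auto
 ultimately show ?thesis unfolding s_def[symmetric] s by (simp add: algebra_simps)
qed

end

lemma norm_diff_square:
 fixes a b :: "'a::real_inner"
 shows "(norm (a - b))\<^sup>2 = (norm a)\<^sup>2 - 2 * (a \<bullet> b) + (norm b)\<^sup>2"
 by (simp add: power2_norm_eq_inner inner_diff_left inner_diff_right inner_commute)

section \<open>Robust correctors for flat and tilted slopes\<close>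

context shear_game
begin

text \<open>\<open>P\<close> is orthogonal to the shear, so the zero corrector works: the frame
  whose normal points along the perturbed gradient \<open>Q\<close> yields \<open>norm Q\<close>,
  within \<rho> of \<open>norm P\<close>.\<close>

lemma super_corrector_flat:
 assumes "snd P = 0"
 shows "super_corrector P (norm P)"
 unfolding super_corrector_def
proof (intro allI impI)
 fix \<eta> :: real assume \<eta>: "\<eta> > 0"
 define C where "C = 1 + F + stepC\<^sup>2"
 have C: "C >= 0" using F_nonneg by (simp add: C_def)
 obtain \<rho> where \<rho>: "\<rho> > 0" "C * \<rho> <= \<eta>" using small_factor[OF C \<eta>] by blast
 obtain tau0 where tau0: "tau0 > 0" "tau0 <= 1" "!!tau. 0 <= tau ==> tau < tau0 ==> stepC * sqrt tau <= 1"
  using small_sqrt[of stepC 1] stepC_ge by auto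
 have main: "T 1 tau (%y. P \<bullet> y + 0 + \<psi> y) x <= P \<bullet> x + 0 + \<psi> x - tau * (norm P - \<eta>)"
  if tau: "0 < tau" "tau < tau0" and lb: "locally_bdd \<psi>" and p: "norm p <= \<rho>"
   and \<psi>: "\<forall>\<delta>. norm \<delta> <= 1 --> \<psi> (x + \<delta>) <= \<psi> x + p \<bullet> \<delta> + \<rho> * (norm \<delta>)\<^sup>2" for tau \<psi> x p
 proof -
  have tau1: "0 <= tau" "tau <= 1" using tau tau0 by auto
  have lbu: "locally_bdd (%y. P \<bullet> y + 0 + \<psi> y)"
   using locally_bdd_add[OF locally_bdd_continuous lb, of "%y. P \<bullet> y"] by (simp add: continuous_intros)
  define Q where "Q = P + p"
  define V where "V = Vfield f (1 *\<^sub>R x)"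
  define \<nu> where "\<nu> = (if Q = 0 then (0, 1) else sgn Q)"
  have \<nu>: "norm \<nu> = 1" "Q = norm Q *\<^sub>R \<nu>" by (auto simp: \<nu>_def norm_sgn norm_Pair sgn_div_norm zero_prod_def)
  obtain E where E: "orthogonal_transformation E" "E ((0, 1) :: (real^'n) \<times> real) = \<nu>"
   using orthogonal_exists_map[of "(0,1) :: (real^'n) \<times> real" \<nu>] \<nu>(1) by (auto simp: norm_Pair)
  have Ec: "E \<in> controls" using E by (simp add: controls_def)
  have lin: "linear E" using E by (simp only: orthogonal_transformation_def)
  have inE: "E v \<bullet> E w = v \<bullet> w" for v w using E by (simp only: orthogonal_transformation_def)
  have "T 1 tau (%y. P \<bullet> y + 0 + \<psi> y) x <= payoff (side 1 tau) tau (%y. P \<bullet> y + 0 + \<psi> y) (drift 1 tau x) E"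
   using T_le[OF lbu _ tau1(1) Ec] by simp
  also have "\<dots> <= P \<bullet> x + \<psi> x - tau * (norm P - \<eta>)"
  proof (rule payoff_le_const)
   fix i :: 'n and sig :: real assume sig: "\<bar>sig\<bar> = 1"
   define m where "m = E (move (side 1 tau) tau i sig)"
   define \<delta> where "\<delta> = m - tau *\<^sub>R V"
   have pt: "drift 1 tau x + m = x + \<delta>" by (simp add: drift_def \<delta>_def V_def)
   have n\<delta>: "norm \<delta> <= stepC * sqrt tau" unfolding \<delta>_def m_def V_def by (rule move_bounds(2)[OF Ec sig tau1])
   hence "norm \<delta> <= 1" using tau0(3)[OF tau1(1) tau(2)] by linarith
   hence 1: "\<psi> (x + \<delta>) <= \<psi> x + p \<bullet> \<delta> + \<rho> * (norm \<delta>)\<^sup>2" using \<psi> by blast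
   have "(norm \<delta>)\<^sup>2 <= (stepC * sqrt tau)\<^sup>2" using n\<delta> by (intro power_mono) auto
   hence 2: "\<rho> * (norm \<delta>)\<^sup>2 <= \<rho> * (stepC\<^sup>2 * tau)" using \<rho> tau1 by (intro mult_left_mono) (auto simp: power_mult_distrib)
   have Qm: "Q \<bullet> m = - tau * norm Q"
   proof -
    have "\<nu> \<bullet> m = (0, 1) \<bullet> move (side 1 tau) tau i sig" unfolding m_def E(2)[symmetric] by (rule inE)
    hence "\<nu> \<bullet> m = - tau" by (simp add: move_def)
    thus ?thesis using \<nu>(2) by (metis inner_scaleR_left mult.commute)
   qed
   have PV: "P \<bullet> V = 0" using assms by (simp add: V_def Vfield_def inner_prod_def)
   have 3: "P \<bullet> \<delta> + p \<bullet> \<delta> = - tau * norm Q - tau * (p \<bullet> V)"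
    using Qm PV unfolding \<delta>_def Q_def by (simp add: inner_diff_right inner_add_left algebra_simps)
   have 4: "norm Q >= norm P - \<rho>" using norm_triangle_ineq2[of P "- p"] p by (simp add: Q_def)
   have 5: "- (p \<bullet> V) <= \<rho> * F"
   proof -
    have "- (p \<bullet> V) <= norm p * norm V" using Cauchy_Schwarz_ineq2[of p V] by linarith
    also have "\<dots> <= \<rho> * F" using p norm_Vfield \<rho> unfolding V_def by (intro mult_mono) auto
    finally show ?thesis .
   qed
   have "tau * (- norm Q - p \<bullet> V + \<rho> * stepC\<^sup>2) <= tau * (- norm P + C * \<rho>)"
    using 4 5 tau1 by (intro mult_left_mono) (auto simp: C_def algebra_simps)
   also have "\<dots> <= tau * (- norm P + \<eta>)" using \<rho> tau1 by (intro mult_left_mono) auto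
   finally have 6: "tau * (- norm Q - p \<bullet> V + \<rho> * stepC\<^sup>2) <= tau * (- norm P + \<eta>)" .
   show "P \<bullet> (drift 1 tau x + E (move (side 1 tau) tau i sig)) + 0 + \<psi> (drift 1 tau x + E (move (side 1 tau) tau i sig)) <= P \<bullet> x + \<psi> x - tau * (norm P - \<eta>)"
    unfolding m_def[symmetric] pt using 1 2 3 6 by (simp add: inner_add_right algebra_simps)
  qed
  finally show ?thesis by simp
 qed
 show "\<exists>\<rho>>0. \<exists>M tau0. tau0 > 0 \<and> (\<forall>tau. 0 < tau --> tau < tau0 -->
  (\<exists>W. (\<forall>x. \<bar>W x\<bar> <= M) \<and> (\<forall>\<psi> x p. locally_bdd \<psi> --> norm p <= \<rho> -->
    (\<forall>\<delta>. norm \<delta> <= 1 --> \<psi> (x + \<delta>) <= \<psi> x + p \<bullet> \<delta> + \<rho> * (norm \<delta>)\<^sup>2) -->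
    T 1 tau (%y. P \<bullet> y + W y + \<psi> y) x <= P \<bullet> x + W x + \<psi> x - tau * (norm P - \<eta>))))"
 proof (rule exI[of _ \<rho>], intro conjI \<rho>(1), rule exI[of _ 0], rule exI[of _ tau0], intro conjI tau0(1) allI impI)
  fix tau :: real assume "0 < tau" "tau < tau0"
  thus "\<exists>W. (\<forall>x. \<bar>W x\<bar> <= 0) \<and> (\<forall>\<psi> x p. locally_bdd \<psi> --> norm p <= \<rho> -->
    (\<forall>\<delta>. norm \<delta> <= 1 --> \<psi> (x + \<delta>) <= \<psi> x + p \<bullet> \<delta> + \<rho> * (norm \<delta>)\<^sup>2) -->
    T 1 tau (%y. P \<bullet> y + W y + \<psi> y) x <= P \<bullet> x + W x + \<psi> x - tau * (norm P - \<eta>))"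
   using main by (intro exI[of _ "%_. 0"] conjI allI impI) (simp, blast)
 qed
qed

text \<open>No control can gain more than \<open>norm Q\<close> from its normal step, and the
  opponent's sign makes the tangential contribution nonnegative.\<close>

lemma sub_corrector_flat:
 assumes "snd P = 0"
 shows "sub_corrector P (norm P)"
 unfolding sub_corrector_def
proof (intro allI impI)
 fix \<eta> :: real assume \<eta>: "\<eta> > 0"
 define C where "C = 1 + F + stepC\<^sup>2"
 have C: "C >= 0" using F_nonneg by (simp add: C_def)
 obtain \<rho> where \<rho>: "\<rho> > 0" "C * \<rho> <= \<eta>" using small_factor[OF C \<eta>] by blast
 obtain tau0 where tau0: "tau0 > 0" "tau0 <= 1" "!!tau. 0 <= tau ==> tau < tau0 ==> stepC * sqrt tau <= 1"
  using small_sqrt[of stepC 1] stepC_ge by auto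
 have main: "T 1 tau (%y. P \<bullet> y + 0 + \<psi> y) x >= P \<bullet> x + 0 + \<psi> x - tau * (norm P + \<eta>)"
  if tau: "0 < tau" "tau < tau0" and p: "norm p <= \<rho>"
   and \<psi>: "\<forall>\<delta>. norm \<delta> <= 1 --> \<psi> (x + \<delta>) >= \<psi> x + p \<bullet> \<delta> - \<rho> * (norm \<delta>)\<^sup>2" for tau \<psi> x p
 proof (rule T_ge)
  fix E :: "(real^'n) \<times> real => (real^'n) \<times> real" assume Ec: "E \<in> controls"
  have tau1: "0 <= tau" "tau <= 1" using tau tau0 by auto
  define V where "V = Vfield f (1 *\<^sub>R x)"
  define Q where "Q = P + p"
  have "payoff (side 1 tau) tau (%y. P \<bullet> y + 0 + \<psi> y) (drift 1 tau x) E >= P \<bullet> x + \<psi> x - tau * (norm P + \<eta>)"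
  proof (rule payoff_ge_const)
   fix i :: 'n
   define e where "e = E (axis i 1, 0)"
   define sig :: real where "sig = (if Q \<bullet> e >= 0 then 1 else -1)"
   have sig: "\<bar>sig\<bar> = 1" "sig * (Q \<bullet> e) >= 0" by (auto simp: sig_def)
   define m where "m = E (move (side 1 tau) tau i sig)"
   define \<delta> where "\<delta> = m - tau *\<^sub>R V"
   have pt: "drift 1 tau x + m = x + \<delta>" by (simp add: drift_def \<delta>_def V_def)
   have n\<delta>: "norm \<delta> <= stepC * sqrt tau" unfolding \<delta>_def m_def V_def by (rule move_bounds(2)[OF Ec sig(1) tau1])
   hence "norm \<delta> <= 1" using tau0(3)[OF tau1(1) tau(2)] by linarith
   hence 1: "\<psi> (x + \<delta>) >= \<psi> x + p \<bullet> \<delta> - \<rho> * (norm \<delta>)\<^sup>2" using \<psi> by blast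
   have "(norm \<delta>)\<^sup>2 <= (stepC * sqrt tau)\<^sup>2" using n\<delta> by (intro power_mono) auto
   hence 2: "\<rho> * (norm \<delta>)\<^sup>2 <= \<rho> * (stepC\<^sup>2 * tau)" using \<rho> tau1 by (intro mult_left_mono) (auto simp: power_mult_distrib)
   have "drift 1 tau x + m = x + ((sig * side 1 tau) *\<^sub>R e - tau *\<^sub>R (V + E (0, 1)))"
    unfolding m_def drift_move[OF controls_linear[OF Ec]] by (simp add: e_def V_def)
   hence \<delta>e: "\<delta> = (sig * side 1 tau) *\<^sub>R e - tau *\<^sub>R (V + E (0, 1))" using pt by simp
   have PV: "P \<bullet> V = 0" using assms by (simp add: V_def Vfield_def inner_prod_def)
   have "side 1 tau * (sig * (Q \<bullet> e)) >= 0" using side_nonneg tau1 sig by simp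
   moreover have "Q \<bullet> \<delta> = side 1 tau * (sig * (Q \<bullet> e)) - tau * (p \<bullet> V + Q \<bullet> E (0, 1))"
    using PV unfolding \<delta>e Q_def by (simp add: inner_diff_right inner_add_left inner_add_right algebra_simps)
   moreover have "tau * (p \<bullet> V + Q \<bullet> E (0, 1)) <= tau * (\<rho> * F + (norm P + \<rho>))"
   proof (rule mult_left_mono[OF _ tau1(1)])
    have "p \<bullet> V <= norm p * norm V" by (rule norm_cauchy_schwarz)
    also have "\<dots> <= \<rho> * F" using p norm_Vfield \<rho> unfolding V_def by (intro mult_mono) auto
    finally have a: "p \<bullet> V <= \<rho> * F" .
    have "norm (E (0, 1)) <= 1" using controls_norm_le[OF Ec, of "(0, 1)"] by (simp add: norm_Pair)
    hence "Q \<bullet> E (0, 1) <= norm Q"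
     using norm_cauchy_schwarz[of Q "E (0,1)"] mult_left_le[of "norm (E (0,1))" "norm Q"] by simp
    moreover have "norm Q <= norm P + \<rho>" using norm_triangle_ineq[of P p] p by (simp add: Q_def)
    ultimately show "p \<bullet> V + Q \<bullet> E (0, 1) <= \<rho> * F + (norm P + \<rho>)" using a by linarith
   qed
   ultimately have 3: "P \<bullet> \<delta> + p \<bullet> \<delta> >= - (tau * (\<rho> * F + (norm P + \<rho>)))" by (simp add: Q_def inner_add_left)
   have "tau * (\<rho> * F + (norm P + \<rho>) + \<rho> * stepC\<^sup>2) = tau * (norm P + C * \<rho>)" by (simp add: C_def algebra_simps)
   also have "\<dots> <= tau * (norm P + \<eta>)" using \<rho> tau1 by (intro mult_left_mono) auto
   finally have 6: "tau * (\<rho> * F + (norm P + \<rho>) + \<rho> * stepC\<^sup>2) <= tau * (norm P + \<eta>)" .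
   have "P \<bullet> (drift 1 tau x + m) + 0 + \<psi> (drift 1 tau x + m) >= P \<bullet> x + \<psi> x - tau * (norm P + \<eta>)"
    unfolding pt using 1 2 3 6 by (simp add: inner_add_right algebra_simps)
   thus "\<exists>sig. \<bar>sig\<bar> = 1 \<and> P \<bullet> x + \<psi> x - tau * (norm P + \<eta>) \<le>
     P \<bullet> (drift 1 tau x + E (move (side 1 tau) tau i sig)) + 0 + \<psi> (drift 1 tau x + E (move (side 1 tau) tau i sig))"
    using sig(1) unfolding m_def by blast
  qed
  thus "P \<bullet> x + 0 + \<psi> x - tau * (norm P + \<eta>) <= payoff (side 1 tau) tau (%y. P \<bullet> y + 0 + \<psi> y) (drift 1 tau x) E" by simp
 qed
 show "\<exists>\<rho>>0. \<exists>M tau0. tau0 > 0 \<and> (\<forall>tau. 0 < tau --> tau < tau0 -->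
  (\<exists>W. (\<forall>x. \<bar>W x\<bar> <= M) \<and> (\<forall>\<psi> x p. locally_bdd \<psi> --> norm p <= \<rho> -->
    (\<forall>\<delta>. norm \<delta> <= 1 --> \<psi> (x + \<delta>) >= \<psi> x + p \<bullet> \<delta> - \<rho> * (norm \<delta>)\<^sup>2) -->
    T 1 tau (%y. P \<bullet> y + W y + \<psi> y) x >= P \<bullet> x + W x + \<psi> x - tau * (norm P + \<eta>))))"
 proof (rule exI[of _ \<rho>], intro conjI \<rho>(1), rule exI[of _ 0], rule exI[of _ tau0], intro conjI tau0(1) allI impI)
  fix tau :: real assume "0 < tau" "tau < tau0"
  thus "\<exists>W. (\<forall>x. \<bar>W x\<bar> <= 0) \<and> (\<forall>\<psi> x p. locally_bdd \<psi> --> norm p <= \<rho> -->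
    (\<forall>\<delta>. norm \<delta> <= 1 --> \<psi> (x + \<delta>) >= \<psi> x + p \<bullet> \<delta> - \<rho> * (norm \<delta>)\<^sup>2) -->
    T 1 tau (%y. P \<bullet> y + W y + \<psi> y) x >= P \<bullet> x + W x + \<psi> x - tau * (norm P + \<eta>))"
   using main by (intro exI[of _ "%_. 0"] conjI allI impI) (simp, blast)
 qed
qed

text \<open>\<alpha> is fixed before \<rho>, since the term divided by \<alpha> must be made small
  by \<rho>. The coefficients are those of \<open>frame_adjust\<close> for gradients of length at
  least \<open>\<mu> / 2\<close>: \<open>5 * \<rho>\<close> for the normal error,
  \<open>32 / (\<mu> / 2) = 64 / \<mu>\<close> for the rotation, and \<open>\<mu> / 16\<close> for
  the closeness condition.\<close>

lemma corrector_parameters: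
 assumes \<eta>: "\<eta> > 0" and \<mu>: "\<mu> > 0" and Lam: "Lam >= 0"
 obtains \<alpha> \<rho> where "0 < \<alpha>" "\<alpha> <= 1" "0 < \<rho>" "\<rho> <= 1" "\<rho> <= \<mu> / 16"
  "\<alpha> * (4 * L * Lam\<^sup>2 + 4 * L\<^sup>2 * Lam\<^sup>2) <= \<eta>"
  "!!tau. 0 <= tau ==> 5 * \<rho> * tau + \<rho> * (tau * F + (stepC * sqrt tau)\<^sup>2) + (64 * \<rho> / \<mu> * (stepC * sqrt tau))\<^sup>2 / \<alpha> <= \<eta> * tau"
proof -
 define A where "A = 4 * L * Lam\<^sup>2 + 4 * L\<^sup>2 * Lam\<^sup>2"
 have A: "A >= 0" using L_nonneg by (simp add: A_def)
 obtain \<alpha> where \<alpha>: "\<alpha> > 0" "\<alpha> <= 1" "A * \<alpha> <= \<eta>" using small_factor[OF A \<eta>] by blast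
 define k where "k = (64 / \<mu>)\<^sup>2 * stepC\<^sup>2 / \<alpha>"
 have k: "k >= 0" using \<alpha> by (simp add: k_def)
 define B where "B = 5 + F + stepC\<^sup>2 + k"
 have B: "B >= 0" using F_nonneg k by (simp add: B_def)
 obtain \<rho>1 where \<rho>1: "\<rho>1 > 0" "\<rho>1 <= 1" "B * \<rho>1 <= \<eta>" using small_factor[OF B \<eta>] by blast
 define \<rho> where "\<rho> = min \<rho>1 (\<mu> / 16)"
 have \<rho>: "0 < \<rho>" "\<rho> <= 1" "\<rho> <= \<mu> / 16" using \<rho>1 \<mu> by (auto simp: \<rho>_def)
 have "B * \<rho> <= B * \<rho>1" using B by (intro mult_left_mono) (auto simp: \<rho>_def)
 hence B\<rho>: "B * \<rho> <= \<eta>" using \<rho>1 by linarith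
 have err: "5 * \<rho> * tau + \<rho> * (tau * F + (stepC * sqrt tau)\<^sup>2) + (64 * \<rho> / \<mu> * (stepC * sqrt tau))\<^sup>2 / \<alpha> <= \<eta> * tau" if tau: "tau >= 0" for tau
 proof -
  have sq: "(stepC * sqrt tau)\<^sup>2 = stepC\<^sup>2 * tau" using tau by (simp add: power_mult_distrib)
  have "(64 * \<rho> / \<mu> * (stepC * sqrt tau))\<^sup>2 / \<alpha> = \<rho>\<^sup>2 * (k * tau)"
   unfolding power_mult_distrib[of "64 * \<rho> / \<mu>"] sq by (simp add: k_def power_divide power_mult_distrib)
  also have "\<dots> <= \<rho> * (k * tau)"
   using \<rho> k tau by (intro mult_right_mono) (auto simp: power2_eq_square mult_left_le)
  finally have e: "(64 * \<rho> / \<mu> * (stepC * sqrt tau))\<^sup>2 / \<alpha> <= \<rho> * (k * tau)" .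
  have "(B * \<rho>) * tau = 5 * \<rho> * tau + \<rho> * (tau * F + stepC\<^sup>2 * tau) + \<rho> * (k * tau)" by (simp add: B_def algebra_simps)
  hence "5 * \<rho> * tau + \<rho> * (tau * F + (stepC * sqrt tau)\<^sup>2) + (64 * \<rho> / \<mu> * (stepC * sqrt tau))\<^sup>2 / \<alpha> <= (B * \<rho>) * tau"
   using e unfolding sq by linarith
  also have "\<dots> <= \<eta> * tau" using B\<rho> tau by (intro mult_right_mono)
  finally show ?thesis .
 qed
 show thesis by (rule that[OF \<alpha>(1,2) \<rho> _ err]) (use \<alpha>(3) in \<open>simp_all add: A_def mult.commute\<close>)
qed

text \<open>\<open>W\<close> is the inf-convolution of the lifted eigenfunction minus its affine
  part. For given \<open>x\<close>, a control that is nearly optimal at the contact point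
  \<open>y\<close> for the unperturbed function is rotated into a control at \<open>x\<close> for
  the perturbed one. As \<open>T\<close> is an infimum, a single good control gives the upper
  bound.\<close>

lemma super_corrector_tilted:
 assumes P: "snd P \<noteq> 0" and cell: "cell_value P H"
 shows "super_corrector P H"
 unfolding super_corrector_def
proof (intro allI impI)
 fix \<eta>0 :: real assume \<eta>0: "\<eta>0 > 0"
 \<comment> \<open>Four portions are spent: two on the residual and on near-optimality at
   \<open>y\<close>, two on comparing the steps at \<open>x\<close> and \<open>y\<close>.\<close>
 define \<eta> where "\<eta> = \<eta>0 / 5"
 have \<eta>: "\<eta> > 0" using \<eta>0 by (simp add: \<eta>_def)
 define \<mu> where "\<mu> = \<bar>snd P\<bar>"
 have \<mu>: "\<mu> > 0" using P by (simp add: \<mu>_def)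
 obtain Lamv M tau1 where Lamv: "Lamv >= 0" and tau1: "tau1 > 0" and app: "!!tau. 0 < tau ==> tau < tau1 ==> \<exists>w. approx_cell (T 1 tau) P H tau \<eta> Lamv M w"
  using cell \<eta> unfolding cell_value_def by blast
 define Lam where "Lam = norm P + Lamv"
 have Lam: "Lam >= 0" using Lamv by (simp add: Lam_def)
 obtain \<alpha> \<rho> where \<alpha>: "0 < \<alpha>" "\<alpha> <= 1" and \<rho>: "0 < \<rho>" "\<rho> <= 1" "\<rho> <= \<mu> / 16"
  and c\<alpha>: "\<alpha> * (4 * L * Lam\<^sup>2 + 4 * L\<^sup>2 * Lam\<^sup>2) <= \<eta>"
  and c\<rho>: "!!tau. 0 <= tau ==> 5 * \<rho> * tau + \<rho> * (tau * F + (stepC * sqrt tau)\<^sup>2) + (64 * \<rho> / \<mu> * (stepC * sqrt tau))\<^sup>2 / \<alpha> <= \<eta> * tau"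
  using corrector_parameters[OF \<eta> \<mu> Lam] by blast
 define D where "D = sqrt (2 * CARD('n) * d) / CARD('n)"
 have D: "D > 0" using d_pos by (simp add: D_def)
 define c3 where "c3 = \<bar>H\<bar> + 2 * \<eta> + (2 * Lam) * (F + 1) + (1 / (2 * \<alpha>)) * stepC\<^sup>2"
 have c3: "c3 >= 0" using \<eta> Lam F_nonneg \<alpha> by (simp add: c3_def)
 obtain tau2 where tau2: "tau2 > 0" "tau2 <= 1" "!!tau. 0 <= tau ==> tau < tau2 ==> stepC * sqrt tau <= 1"
  using small_sqrt[of stepC 1] stepC_ge by auto
 obtain tau3 where tau3: "tau3 > 0" "!!tau. 0 <= tau ==> tau < tau3 ==> c3 * sqrt tau <= D * (\<mu> / 2)"
  using small_sqrt[OF c3, of "D * (\<mu> / 2)"] D \<mu> by auto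
 define tau0 where "tau0 = min tau1 (min tau2 tau3)"
 define M' where "M' = M + \<alpha> * Lam\<^sup>2 / 2"
 have main: "\<exists>W. (\<forall>x. \<bar>W x\<bar> <= M') \<and> (\<forall>\<psi> x p. locally_bdd \<psi> --> norm p <= \<rho> -->
    (\<forall>\<delta>. norm \<delta> <= 1 --> \<psi> (x + \<delta>) <= \<psi> x + p \<bullet> \<delta> + \<rho> * (norm \<delta>)\<^sup>2) -->
    T 1 tau (%y. P \<bullet> y + W y + \<psi> y) x <= P \<bullet> x + W x + \<psi> x - tau * (H - \<eta>0))" if tau: "0 < tau" "tau < tau0" for tau
 proof -
  have t: "0 <= tau" "tau <= 1" "tau < tau1" "tau < tau3" using tau tau2 by (auto simp: tau0_def)
  have small: "stepC * sqrt tau <= 1" using tau2(3)[of tau] tau by (simp add: tau0_def)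
  obtain v where v: "!!x y. v x <= v y + Lamv * dist x y" "!!x. \<bar>v x\<bar> <= M"
   and Tv: "!!x. \<bar>T 1 tau (lift P v) x - (lift P v x - tau * H)\<bar> <= \<eta> * tau"
   using app[OF tau(1) t(3)] unfolding approx_cell_def by blast
  define w where "w = lift P v"
  have w: "w x <= w y + Lam * dist x y" for x y
   unfolding w_def Lam_def by (rule lift_lipschitz[OF v(1) Lamv])
  have lbw: "locally_bdd w" unfolding w_def using v(1) by (rule locally_bdd_lift)
  define W where "W x = infconv \<alpha> w x - P \<bullet> x" for x
  have WM: "\<bar>W x\<bar> <= M'" for x
  proof -
   have "w x = P \<bullet> x + v (fst x)" by (simp add: w_def lift_def)
   moreover have "0 <= \<alpha> * Lam\<^sup>2 / 2" using \<alpha> by simp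
   ultimately show ?thesis
    using infconv_facts(2,3)[OF w \<alpha>(1) Lam, of x] v(2)[of "fst x"] unfolding W_def M'_def by linarith
  qed
  have "T 1 tau (%y. P \<bullet> y + W y + \<psi> y) x <= P \<bullet> x + W x + \<psi> x - tau * (H - \<eta>0)"
   if lb: "locally_bdd \<psi>" and p: "norm p <= \<rho>" and \<psi>: "\<forall>\<delta>. norm \<delta> <= 1 --> \<psi> (x + \<delta>) <= \<psi> x + p \<bullet> \<delta> + \<rho> * (norm \<delta>)\<^sup>2" for \<psi> x p
  proof -
   have lbu: "locally_bdd (%y. infconv \<alpha> w y + \<psi> y)"
   proof -
    have "locally_bdd (%y. (P \<bullet> y + W y) + \<psi> y)"
     by (intro locally_bdd_add lb locally_bdd_bounded[OF WM]) (intro locally_bdd_continuous continuous_intros)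
    thus ?thesis by (simp add: W_def)
   qed
   obtain y where y: "infconv \<alpha> w x = w y + (dist x y)\<^sup>2 / (2 * \<alpha>)" "dist x y <= 2 * \<alpha> * Lam"
    using infconv_facts(4)[OF w \<alpha>(1) Lam] by blast
   define G where "G = (1/\<alpha>) *\<^sub>R (x - y)"
   have ymin: "w y + (dist x y)\<^sup>2 / (2 * \<alpha>) <= w z + (dist x z)\<^sup>2 / (2 * \<alpha>)" for z
    using infconv_facts(1)[OF w \<alpha>(1) Lam, of x z] y(1) by simp
   have sG: "snd G = snd P"
    unfolding G_def by (rule infconv_snd[OF ymin \<alpha>(1)]) (simp add: w_def lift_shift)
   have nG: "norm G <= 2 * Lam" 
   proof -
    have "norm G = norm (x - y) / \<alpha>" using \<alpha> by (simp only: G_def norm_scaleR) simp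
    thus ?thesis using y(2) \<alpha> by (simp add: dist_norm divide_le_eq mult_ac)
   qed
   have nG2: "norm G >= \<mu>" using dist_snd_le[of G 0] sG by (simp add: \<mu>_def)
   have G0: "G \<noteq> 0" using nG2 \<mu> by auto
   \<comment> \<open>Minimality of \<open>y\<close> means that a paraboloid with gradient
     \<open>G\<close> touches \<open>w\<close> from below at \<open>y\<close>, although
     \<open>w\<close> itself is only Lipschitz.\<close>
   have below: "w (y + \<delta>) >= w y + G \<bullet> \<delta> - (1 / (2 * \<alpha>)) * (norm \<delta>)\<^sup>2" for \<delta>
   proof -
    have "dist x (y + \<delta>) = norm ((x - y) - \<delta>)" by (simp add: dist_norm algebra_simps)
    hence "(dist x (y + \<delta>))\<^sup>2 = (dist x y)\<^sup>2 - 2 * ((x - y) \<bullet> \<delta>) + (norm \<delta>)\<^sup>2"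
     by (simp only: norm_diff_square dist_norm[of x y])
    moreover have "G \<bullet> \<delta> = ((x - y) \<bullet> \<delta>) / \<alpha>" by (simp only: G_def inner_scaleR_left) simp
    ultimately have "(dist x (y + \<delta>))\<^sup>2 / (2 * \<alpha>) = (dist x y)\<^sup>2 / (2 * \<alpha>) - G \<bullet> \<delta> + (1 / (2 * \<alpha>)) * (norm \<delta>)\<^sup>2"
     using \<alpha> by (simp add: field_simps)
    thus ?thesis using ymin[of "y + \<delta>"] by simp
   qed
   have "T 1 tau w y < w y - tau * H + 2 * \<eta> * tau"
   proof -
    have "\<eta> * tau > 0" using \<eta> tau by simp
    thus ?thesis using Tv[of y] unfolding w_def[symmetric] by linarith
   qed
   then obtain E where Ec: "E \<in> controls" and pay: "payoff (side 1 tau) tau w (drift 1 tau y) E < w y - tau * H + 2 * \<eta> * tau"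
    by (rule T_approx)
   have step: "infconv \<alpha> w (drift 1 tau x + m') + \<psi> (drift 1 tau x + m') <= w (drift 1 tau y + m) + ((infconv \<alpha> w x - w y) + \<psi> x + 2 * (\<eta> * tau))"
    if "(G + p) \<bullet> m' - G \<bullet> m <= 5 * \<rho> * tau" "norm (m' - m) <= 64 * \<rho> / \<mu> * (stepC * sqrt tau)" "norm (m' - tau *\<^sub>R Vfield f (1 *\<^sub>R x)) <= stepC * sqrt tau" for m m'
   proof -
    have "infconv \<alpha> w (drift 1 tau x + m') + \<psi> (drift 1 tau x + m') <= w (drift 1 tau y + m) + (infconv \<alpha> w x - w y) + \<psi> x
     + 5 * \<rho> * tau + tau * (\<alpha> * (4 * L * Lam\<^sup>2 + 4 * L\<^sup>2 * Lam\<^sup>2)) + \<rho> * (tau * F + (stepC * sqrt tau)\<^sup>2) + (64 * \<rho> / \<mu> * (stepC * sqrt tau))\<^sup>2 / \<alpha>"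
     by (rule infconv_step[OF w \<alpha> Lam t(1,2) y _ p that(1)[unfolded G_def] that(2,3) small]) (use \<psi> in blast)
    moreover have "tau * (\<alpha> * (4 * L * Lam\<^sup>2 + 4 * L\<^sup>2 * Lam\<^sup>2)) <= tau * \<eta>" using c\<alpha> t by (intro mult_left_mono)
    ultimately show ?thesis using c\<rho>[OF t(1)] by (simp add: mult.commute[of tau \<eta>])
   qed
   have "\<exists>E'\<in>controls. payoff (side 1 tau) tau (%y. infconv \<alpha> w y + \<psi> y) (drift 1 tau x) E'
     <= payoff (side 1 tau) tau w (drift 1 tau y) E + ((infconv \<alpha> w x - w y) + \<psi> x + 2 * (\<eta> * tau))"
   proof (cases "orthogonal_transformation E")
    case False
    hence E0: "E = (%_. 0)" using Ec by (auto simp: controls_def)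
    have "payoff (side 1 tau) tau (%y. infconv \<alpha> w y + \<psi> y) (drift 1 tau x) E
     <= payoff (side 1 tau) tau w (drift 1 tau y) E + ((infconv \<alpha> w x - w y) + \<psi> x + 2 * (\<eta> * tau))"
    proof (rule payoff_mono)
     fix i :: 'n and sig :: real assume sig: "\<bar>sig\<bar> = 1"
     show "infconv \<alpha> w (drift 1 tau x + E (move (side 1 tau) tau i sig)) + \<psi> (drift 1 tau x + E (move (side 1 tau) tau i sig))
      <= w (drift 1 tau y + E (move (side 1 tau) tau i sig)) + ((infconv \<alpha> w x - w y) + \<psi> x + 2 * (\<eta> * tau))"
     proof (rule step)
      show "norm (E (move (side 1 tau) tau i sig) - tau *\<^sub>R Vfield f (1 *\<^sub>R x)) <= stepC * sqrt tau"
       by (rule move_bounds(2)[OF Ec sig t(1,2)])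
     qed (use \<rho> \<mu> t stepC_ge in \<open>simp_all add: E0\<close>)
    qed
    thus ?thesis using Ec by blast
   next
    case E: True
    have "surj E" using E orthogonal_transformation_surj by blast
    then obtain a where a: "G = E a" by (metis surjD)
    have na: "norm a = norm G" using E a by (simp add: orthogonal_transformation_norm)
    have "payoff (side 1 tau) tau w (drift 1 tau y) E >= w y + sqrt tau * (D * norm (fst a)) - tau * ((2 * Lam) * (F + 1) + (1 / (2 * \<alpha>)) * stepC\<^sup>2)"
     unfolding D_def by (rule payoff_lower_quadratic[OF E t(1,2) small below _ nG a]) (use \<alpha> in auto)
    \<comment> \<open>Near-optimality caps the payoff at \<open>w y\<close> up to order
      \<open>tau\<close>, so the tangential gain, which carries the weight \<open>sqrt tau\<close>,
      is itself of order \<open>tau\<close>.\<close>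
    hence "sqrt tau * (D * norm (fst a)) <= tau * c3"
    proof -
     assume lo: "payoff (side 1 tau) tau w (drift 1 tau y) E >= w y + sqrt tau * (D * norm (fst a)) - tau * ((2 * Lam) * (F + 1) + (1 / (2 * \<alpha>)) * stepC\<^sup>2)"
     have "tau * (- H) <= tau * \<bar>H\<bar>" using t by (intro mult_left_mono) auto
     moreover have "tau * c3 = tau * \<bar>H\<bar> + 2 * \<eta> * tau + tau * ((2 * Lam) * (F + 1) + (1 / (2 * \<alpha>)) * stepC\<^sup>2)"
      by (simp add: c3_def algebra_simps)
     moreover have "tau * (- H) = - (tau * H)" by simp
     ultimately show ?thesis using lo pay by linarith
    qed
    also have "tau * c3 = sqrt tau * (c3 * sqrt tau)" using t by (simp add: algebra_simps flip: power2_eq_square)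
    finally have "D * norm (fst a) <= c3 * sqrt tau" using tau(1) by simp
    also have "\<dots> <= D * (\<mu> / 2)" using tau3(2) t by blast
    finally have "norm (fst a) <= \<mu> / 2" using D by simp
    hence tang: "norm (fst a) <= norm a / 2" using nG2 na by linarith
    have close: "norm ((G + p) - E a) <= norm a / 8" using p \<rho>(3) nG2 na \<mu> by (simp add: a)
    have a0: "a \<noteq> 0" using na nG2 \<mu> by auto
    obtain R c where R: "orthogonal_transformation R" and Rc: "!!z. (G + p) \<bullet> R (E z) - E a \<bullet> E z = c * snd z"
     and c: "\<bar>c\<bar> <= 5 * norm ((G + p) - E a)" and Rz: "!!z. norm (R z - z) <= 32 * norm ((G + p) - E a) / norm a * norm z"
     by (rule frame_adjust[OF E tang close a0]) blast
    have diff: "norm ((G + p) - E a) = norm p" by (simp add: a)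
    have RE: "(%z. R (E z)) \<in> controls"
     using orthogonal_transformation_compose[OF R E] by (simp add: controls_def o_def)
    have "payoff (side 1 tau) tau (%y. infconv \<alpha> w y + \<psi> y) (drift 1 tau x) (%z. R (E z))
     <= payoff (side 1 tau) tau w (drift 1 tau y) E + ((infconv \<alpha> w x - w y) + \<psi> x + 2 * (\<eta> * tau))"
    proof (rule payoff_mono)
     fix i :: 'n and sig :: real assume sig: "\<bar>sig\<bar> = 1"
     define z where "z = move (side 1 tau) tau i sig"
     have nz: "norm (E z) <= stepC * sqrt tau" unfolding z_def by (rule move_bounds(1)[OF Ec sig t(1,2)])
     show "infconv \<alpha> w (drift 1 tau x + R (E (move (side 1 tau) tau i sig))) + \<psi> (drift 1 tau x + R (E (move (side 1 tau) tau i sig)))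
      <= w (drift 1 tau y + E (move (side 1 tau) tau i sig)) + ((infconv \<alpha> w x - w y) + \<psi> x + 2 * (\<eta> * tau))"
      unfolding z_def[symmetric]
     proof (rule step)
      have "(G + p) \<bullet> R (E z) - G \<bullet> E z = c * (- tau)" using Rc[of z] by (simp add: a z_def move_def)
      also have "\<dots> <= \<bar>c\<bar> * tau" using t mult_right_mono[of "- c" "\<bar>c\<bar>" tau] by simp
      also have "\<dots> <= 5 * \<rho> * tau" using c p t unfolding diff by (intro mult_right_mono) auto
      finally show "(G + p) \<bullet> R (E z) - G \<bullet> E z <= 5 * \<rho> * tau" .
      have "norm (R (E z) - E z) <= 32 * norm p / norm a * norm (E z)" using Rz[of "E z"] unfolding diff .
      also have "\<dots> <= 64 * \<rho> / \<mu> * (stepC * sqrt tau)"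
      proof (rule mult_mono[OF _ nz])
       show "32 * norm p / norm a <= 64 * \<rho> / \<mu>"
        by (rule frac_le) (use p norm_ge_zero[of p] na nG2 \<mu> in linarith)+
      qed (use \<rho> \<mu> in auto)
      finally show "norm (R (E z) - E z) <= 64 * \<rho> / \<mu> * (stepC * sqrt tau)" .
      show "norm (R (E z) - tau *\<^sub>R Vfield f (1 *\<^sub>R x)) <= stepC * sqrt tau"
       unfolding z_def by (rule move_bounds(2)[OF RE sig t(1,2)])
     qed
    qed
    thus ?thesis using RE by blast
   qed
   then obtain E' where E': "E' \<in> controls" and pay': "payoff (side 1 tau) tau (%y. infconv \<alpha> w y + \<psi> y) (drift 1 tau x) E'
     <= payoff (side 1 tau) tau w (drift 1 tau y) E + ((infconv \<alpha> w x - w y) + \<psi> x + 2 * (\<eta> * tau))" by blast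
   have "T 1 tau (%y. infconv \<alpha> w y + \<psi> y) x <= infconv \<alpha> w x + \<psi> x - tau * H + 4 * (\<eta> * tau)"
    using T_le[OF lbu _ t(1) E', of 1 x] pay' pay by simp
   also have "4 * (\<eta> * tau) <= \<eta>0 * tau" using \<eta>0 t by (simp add: \<eta>_def)
   finally have "T 1 tau (%y. infconv \<alpha> w y + \<psi> y) x <= infconv \<alpha> w x + \<psi> x - tau * (H - \<eta>0)"
    by (simp add: algebra_simps)
   thus ?thesis by (simp add: W_def)
  qed
  thus ?thesis using WM by blast
 qed
 have "tau0 > 0" using tau1 tau2 tau3 by (simp add: tau0_def)
 thus "\<exists>\<rho>>0. \<exists>M tau0. tau0 > 0 \<and> (\<forall>tau. 0 < tau --> tau < tau0 -->
  (\<exists>W. (\<forall>x. \<bar>W x\<bar> <= M) \<and> (\<forall>\<psi> x p. locally_bdd \<psi> --> norm p <= \<rho> -->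
    (\<forall>\<delta>. norm \<delta> <= 1 --> \<psi> (x + \<delta>) <= \<psi> x + p \<bullet> \<delta> + \<rho> * (norm \<delta>)\<^sup>2) -->
    T 1 tau (%y. P \<bullet> y + W y + \<psi> y) x <= P \<bullet> x + W x + \<psi> x - tau * (H - \<eta>0))))"
  using main \<rho>(1) by blast
qed

text \<open>The sup-convolution replaces the inf-convolution, but a lower bound must hold against
  every control \<open>E'\<close> at \<open>x\<close>. If \<open>E'\<close> has a large tangential
  component, its payoff is large enough by itself. Otherwise \<open>E'\<close> is rotated into a
  control at \<open>y\<close>, where the residual of the eigenfunction applies. Controls are thus
  transferred from \<open>x\<close> to \<open>y\<close>, opposite to the upper bound.\<close>

lemma sub_corrector_tilted:
 assumes P: "snd P \<noteq> 0" and cell: "cell_value P H"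
 shows "sub_corrector P H"
 unfolding sub_corrector_def
proof (intro allI impI)
 fix \<eta>0 :: real assume \<eta>0: "\<eta>0 > 0"
 define \<eta> where "\<eta> = \<eta>0 / 5"
 have \<eta>: "\<eta> > 0" using \<eta>0 by (simp add: \<eta>_def)
 define \<mu> where "\<mu> = \<bar>snd P\<bar>"
 have \<mu>: "\<mu> > 0" using P by (simp add: \<mu>_def)
 obtain Lamv M tau1 where Lamv: "Lamv >= 0" and tau1: "tau1 > 0" and app: "!!tau. 0 < tau ==> tau < tau1 ==> \<exists>w. approx_cell (T 1 tau) P H tau \<eta> Lamv M w"
  using cell \<eta> unfolding cell_value_def by blast
 define Lam where "Lam = norm P + Lamv"
 have Lam: "Lam >= 0" using Lamv by (simp add: Lam_def)
 obtain \<alpha> \<rho> where \<alpha>: "0 < \<alpha>" "\<alpha> <= 1" and \<rho>: "0 < \<rho>" "\<rho> <= 1" "\<rho> <= \<mu> / 16"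
  and c\<alpha>: "\<alpha> * (4 * L * Lam\<^sup>2 + 4 * L\<^sup>2 * Lam\<^sup>2) <= \<eta>"
  and c\<rho>: "!!tau. 0 <= tau ==> 5 * \<rho> * tau + \<rho> * (tau * F + (stepC * sqrt tau)\<^sup>2) + (64 * \<rho> / \<mu> * (stepC * sqrt tau))\<^sup>2 / \<alpha> <= \<eta> * tau"
  using corrector_parameters[OF \<eta> \<mu> Lam] by blast
 define D where "D = sqrt (2 * CARD('n) * d) / CARD('n)"
 have D: "D > 0" using d_pos by (simp add: D_def)
 define c3 where "c3 = \<bar>H\<bar> + (2 * Lam + 1) * (F + 1) + (1 / (2 * \<alpha>) + 1) * stepC\<^sup>2"
 have c3: "c3 >= 0" using \<eta> Lam F_nonneg \<alpha> by (simp add: c3_def)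
 obtain tau2 where tau2: "tau2 > 0" "tau2 <= 1" "!!tau. 0 <= tau ==> tau < tau2 ==> stepC * sqrt tau <= 1"
  using small_sqrt[of stepC 1] stepC_ge by auto
 obtain tau3 where tau3: "tau3 > 0" "!!tau. 0 <= tau ==> tau < tau3 ==> c3 * sqrt tau <= D * (\<mu> / 4)"
  using small_sqrt[OF c3, of "D * (\<mu> / 4)"] D \<mu> by auto
 define tau0 where "tau0 = min tau1 (min tau2 tau3)"
 define M' where "M' = M + \<alpha> * Lam\<^sup>2 / 2"
 have main: "\<exists>W. (\<forall>x. \<bar>W x\<bar> <= M') \<and> (\<forall>\<psi> x p. locally_bdd \<psi> --> norm p <= \<rho> -->
    (\<forall>\<delta>. norm \<delta> <= 1 --> \<psi> (x + \<delta>) >= \<psi> x + p \<bullet> \<delta> - \<rho> * (norm \<delta>)\<^sup>2) -->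
    T 1 tau (%y. P \<bullet> y + W y + \<psi> y) x >= P \<bullet> x + W x + \<psi> x - tau * (H + \<eta>0))" if tau: "0 < tau" "tau < tau0" for tau
 proof -
  have t: "0 <= tau" "tau <= 1" "tau < tau1" "tau < tau3" using tau tau2 by (auto simp: tau0_def)
  have small: "stepC * sqrt tau <= 1" using tau2(3)[of tau] tau by (simp add: tau0_def)
  obtain v where v: "!!x y. v x <= v y + Lamv * dist x y" "!!x. \<bar>v x\<bar> <= M"
   and Tv: "!!x. \<bar>T 1 tau (lift P v) x - (lift P v x - tau * H)\<bar> <= \<eta> * tau"
   using app[OF tau(1) t(3)] unfolding approx_cell_def by blast
  define w where "w x = - lift P v x" for x
  have w: "w x <= w y + Lam * dist x y" for x y
   using lift_lipschitz[OF v(1) Lamv, of P y x] by (simp add: w_def Lam_def dist_commute)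
  have lbl: "locally_bdd (lift P v)" using v(1) by (rule locally_bdd_lift)
  define S where "S x = - infconv \<alpha> w x" for x
  define W where "W x = S x - P \<bullet> x" for x
  have WM: "\<bar>W x\<bar> <= M'" for x
  proof -
   have "w x = - (P \<bullet> x + v (fst x))" by (simp add: w_def lift_def)
   moreover have "0 <= \<alpha> * Lam\<^sup>2 / 2" using \<alpha> by simp
   ultimately show ?thesis
    using infconv_facts(2,3)[OF w \<alpha>(1) Lam, of x] v(2)[of "fst x"] unfolding W_def S_def M'_def by linarith
  qed
  have "T 1 tau (%y. P \<bullet> y + W y + \<psi> y) x >= P \<bullet> x + W x + \<psi> x - tau * (H + \<eta>0)"
   if p: "norm p <= \<rho>" and \<psi>: "\<forall>\<delta>. norm \<delta> <= 1 --> \<psi> (x + \<delta>) >= \<psi> x + p \<bullet> \<delta> - \<rho> * (norm \<delta>)\<^sup>2" for \<psi> x p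
  proof -
   obtain y where y: "infconv \<alpha> w x = w y + (dist x y)\<^sup>2 / (2 * \<alpha>)" "dist x y <= 2 * \<alpha> * Lam"
    using infconv_facts(4)[OF w \<alpha>(1) Lam] by blast
   define G where "G = (1/\<alpha>) *\<^sub>R (y - x)"
   have Gm: "(1/\<alpha>) *\<^sub>R (x - y) = - G" by (simp add: G_def scaleR_diff_right)
   have ymin: "w y + (dist x y)\<^sup>2 / (2 * \<alpha>) <= w z + (dist x z)\<^sup>2 / (2 * \<alpha>)" for z
    using infconv_facts(1)[OF w \<alpha>(1) Lam, of x z] y(1) by simp
   have "snd ((1/\<alpha>) *\<^sub>R (x - y)) = - snd P"
    by (rule infconv_snd[OF ymin \<alpha>(1)]) (simp add: w_def lift_shift)
   hence sG: "snd G = snd P" unfolding Gm by simp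
   have nG: "norm G <= 2 * Lam" 
   proof -
    have "norm G = norm (x - y) / \<alpha>" using \<alpha> by (simp only: G_def norm_scaleR norm_minus_commute[of y]) simp
    thus ?thesis using y(2) \<alpha> by (simp add: dist_norm divide_le_eq mult_ac)
   qed
   have nG2: "norm G >= \<mu>" using dist_snd_le[of G 0] sG by (simp add: \<mu>_def)
   have below: "S (x + \<delta>) >= S x + G \<bullet> \<delta> - (1 / (2 * \<alpha>)) * (norm \<delta>)\<^sup>2" for \<delta>
   proof -
    have "dist (x + \<delta>) y = norm ((y - x) - \<delta>)" "dist x y = norm (y - x)"
     by (simp_all add: dist_norm norm_minus_commute algebra_simps)
    hence "(dist (x + \<delta>) y)\<^sup>2 = (dist x y)\<^sup>2 - 2 * ((y - x) \<bullet> \<delta>) + (norm \<delta>)\<^sup>2"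
     by (simp only: norm_diff_square)
    moreover have "G \<bullet> \<delta> = ((y - x) \<bullet> \<delta>) / \<alpha>" by (simp only: G_def inner_scaleR_left) simp
    ultimately have "(dist (x + \<delta>) y)\<^sup>2 / (2 * \<alpha>) = (dist x y)\<^sup>2 / (2 * \<alpha>) - G \<bullet> \<delta> + (1 / (2 * \<alpha>)) * (norm \<delta>)\<^sup>2"
     using \<alpha> by (simp add: field_simps)
    thus ?thesis using infconv_facts(1)[OF w \<alpha>(1) Lam, of "x + \<delta>" y] y(1) by (simp add: S_def)
   qed
   have Ty: "T 1 tau (lift P v) y >= - w y - tau * H - \<eta> * tau"
    using Tv[of y] by (simp add: w_def abs_le_iff)
   have step: "lift P v (drift 1 tau y + m) <= S (drift 1 tau x + m') + \<psi> (drift 1 tau x + m') + (- w y - S x - \<psi> x + 2 * (\<eta> * tau))"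
    if "G \<bullet> m - (G + p) \<bullet> m' <= 5 * \<rho> * tau" "norm (m' - m) <= 64 * \<rho> / \<mu> * (stepC * sqrt tau)" "norm (m' - tau *\<^sub>R Vfield f (1 *\<^sub>R x)) <= stepC * sqrt tau" for m m'
   proof -
    have first: "((1/\<alpha>) *\<^sub>R (x - y) + - p) \<bullet> m' - ((1/\<alpha>) *\<^sub>R (x - y)) \<bullet> m <= 5 * \<rho> * tau"
     unfolding Gm using that(1) by (simp add: inner_diff_left inner_add_left)
    have "infconv \<alpha> w (drift 1 tau x + m') + - \<psi> (drift 1 tau x + m') <= w (drift 1 tau y + m) + (infconv \<alpha> w x - w y) + - \<psi> x
     + 5 * \<rho> * tau + tau * (\<alpha> * (4 * L * Lam\<^sup>2 + 4 * L\<^sup>2 * Lam\<^sup>2)) + \<rho> * (tau * F + (stepC * sqrt tau)\<^sup>2) + (64 * \<rho> / \<mu> * (stepC * sqrt tau))\<^sup>2 / \<alpha>"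
    proof (rule infconv_step[OF w \<alpha> Lam t(1,2) y _ _ first that(2,3) small])
     fix \<delta> :: "(real^'n) \<times> real" assume "norm \<delta> <= 1"
     hence "\<psi> (x + \<delta>) >= \<psi> x + p \<bullet> \<delta> - \<rho> * (norm \<delta>)\<^sup>2" using \<psi> by blast
     thus "- \<psi> (x + \<delta>) <= - \<psi> x + - p \<bullet> \<delta> + \<rho> * (norm \<delta>)\<^sup>2" by simp
    qed (use p in simp)
    moreover have "tau * (\<alpha> * (4 * L * Lam\<^sup>2 + 4 * L\<^sup>2 * Lam\<^sup>2)) <= tau * \<eta>" using c\<alpha> t by (intro mult_left_mono)
    ultimately show ?thesis using c\<rho>[OF t(1)] by (simp add: S_def w_def mult.commute[of tau \<eta>])
   qed
   have "S x + \<psi> x - tau * H - 3 * (\<eta> * tau) <= T 1 tau (%y. S y + \<psi> y) x"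
   proof (rule T_ge)
    fix E' :: "(real^'n) \<times> real => (real^'n) \<times> real" assume Ec: "E' \<in> controls"
    \<comment> \<open>\<open>T\<close> at \<open>y\<close> is below the payoff of every control
      there; it suffices to exhibit one whose payoff at \<open>y\<close> is dominated by that of
      \<open>E'\<close> at \<open>x\<close>.\<close>
    have via: "S x + \<psi> x - tau * H - 3 * (\<eta> * tau) <= payoff (side 1 tau) tau (%y. S y + \<psi> y) (drift 1 tau x) E'"
     if E: "E \<in> controls" and le: "payoff (side 1 tau) tau (lift P v) (drift 1 tau y) E
      <= payoff (side 1 tau) tau (%y. S y + \<psi> y) (drift 1 tau x) E' + (- w y - S x - \<psi> x + 2 * (\<eta> * tau))" for E
     using T_le[OF lbl _ t(1) E, of 1 y] Ty le by simp
    show "S x + \<psi> x - tau * H - 3 * (\<eta> * tau) <= payoff (side 1 tau) tau (%y. S y + \<psi> y) (drift 1 tau x) E'"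
    proof (cases "orthogonal_transformation E'")
     case False
     hence E0: "E' = (%_. 0)" using Ec by (auto simp: controls_def)
     show ?thesis
     proof (rule via[OF Ec], rule payoff_mono)
      fix i :: 'n and sig :: real assume sig: "\<bar>sig\<bar> = 1"
      show "lift P v (drift 1 tau y + E' (move (side 1 tau) tau i sig)) <= S (drift 1 tau x + E' (move (side 1 tau) tau i sig))
       + \<psi> (drift 1 tau x + E' (move (side 1 tau) tau i sig)) + (- w y - S x - \<psi> x + 2 * (\<eta> * tau))"
      proof (rule step)
       show "norm (E' (move (side 1 tau) tau i sig) - tau *\<^sub>R Vfield f (1 *\<^sub>R x)) <= stepC * sqrt tau"
        by (rule move_bounds(2)[OF Ec sig t(1,2)])
      qed (use \<rho> \<mu> t stepC_ge in \<open>simp_all add: E0\<close>)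
     qed
    next
     case E': True
     have "surj E'" using E' orthogonal_transformation_surj by blast
     then obtain b where b: "G + p = E' b" by (metis surjD)
     have nb: "norm b = norm (G + p)" using E' b by (simp add: orthogonal_transformation_norm)
     have nGp: "norm (G + p) >= \<mu> / 2" "norm (G + p) <= 2 * Lam + 1"
      using norm_triangle_ineq2[of G "- p"] norm_triangle_ineq[of G p] p \<rho> nG2 nG \<mu> by simp_all
     show ?thesis
     proof (cases "norm (fst b) <= norm b / 2")
      case False
      define u where "u z = S z + \<psi> z" for z
      have ul: "u (x + \<delta>) >= u x + (G + p) \<bullet> \<delta> - (1 / (2 * \<alpha>) + 1) * (norm \<delta>)\<^sup>2" if "norm \<delta> <= 1" for \<delta>
      proof -
       have "\<psi> (x + \<delta>) >= \<psi> x + p \<bullet> \<delta> - \<rho> * (norm \<delta>)\<^sup>2" using \<psi> that by blast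
       moreover have "\<rho> * (norm \<delta>)\<^sup>2 <= 1 * (norm \<delta>)\<^sup>2" using \<rho> by (intro mult_right_mono) auto
       moreover have "(1 / (2 * \<alpha>) + 1) * (norm \<delta>)\<^sup>2 = (1 / (2 * \<alpha>)) * (norm \<delta>)\<^sup>2 + 1 * (norm \<delta>)\<^sup>2" by (simp add: distrib_right)
       ultimately show ?thesis using below[of \<delta>] unfolding u_def inner_add_left by linarith
      qed
      \<comment> \<open>In this case the tangential gain is at least \<open>tau * c3\<close> by the
        choice of \<open>tau3\<close>, and \<open>c3\<close> was defined to cover
        \<open>abs H\<close> together with the drift and curvature errors. The \<open>+ 1\<close> in
        its coefficients accounts for the perturbation, whose slope and curvature are at most
        \<open>1\<close>.\<close>
      have lo: "payoff (side 1 tau) tau u (drift 1 tau x) E' >= u x + sqrt tau * (D * norm (fst b)) - tau * ((2 * Lam + 1) * (F + 1) + (1 / (2 * \<alpha>) + 1) * stepC\<^sup>2)"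
       unfolding D_def by (rule payoff_lower_quadratic[OF E' t(1,2) small ul _ nGp(2) b]) (use \<alpha> in auto)
      have "c3 * sqrt tau <= D * (\<mu> / 4)" using tau3(2) t by blast
      also have "\<dots> <= D * norm (fst b)" using False nb nGp D by (intro mult_left_mono) auto
      finally have "sqrt tau * (c3 * sqrt tau) <= sqrt tau * (D * norm (fst b))" using t by (intro mult_left_mono) auto
      moreover have "sqrt tau * (c3 * sqrt tau) = tau * c3" using t by (simp add: algebra_simps flip: power2_eq_square)
      moreover have "tau * c3 = tau * \<bar>H\<bar> + tau * ((2 * Lam + 1) * (F + 1) + (1 / (2 * \<alpha>) + 1) * stepC\<^sup>2)"
       by (simp add: c3_def algebra_simps)
      moreover have "tau * (- H) <= tau * \<bar>H\<bar>" using t by (intro mult_left_mono) auto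
      moreover have "\<eta> * tau >= 0" using \<eta> t by simp
      moreover have "tau * (- H) = - (tau * H)" by simp
      ultimately have "S x + \<psi> x - tau * H - 3 * (\<eta> * tau) <= payoff (side 1 tau) tau u (drift 1 tau x) E'"
       using lo unfolding u_def[of x] by linarith
      thus ?thesis by (simp add: u_def[abs_def])
     next
      case tang: True
      have eqp: "norm (G - E' b) = norm p" unfolding b[symmetric] by simp
      have close: "norm (G - E' b) <= norm b / 8" using p \<rho>(3) nGp nb unfolding eqp by linarith
      have b0: "b \<noteq> 0" using nb nGp \<mu> by auto
      obtain R c where R: "orthogonal_transformation R" and Rc: "!!z. G \<bullet> R (E' z) - E' b \<bullet> E' z = c * snd z"
       and c: "\<bar>c\<bar> <= 5 * norm (G - E' b)" and Rz: "!!z. norm (R z - z) <= 32 * norm (G - E' b) / norm b * norm z"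
       by (rule frame_adjust[OF E' tang close b0]) blast
      have RE: "(%z. R (E' z)) \<in> controls"
       using orthogonal_transformation_compose[OF R E'] by (simp add: controls_def o_def)
      show ?thesis
      proof (rule via[OF RE], rule payoff_mono)
       fix i :: 'n and sig :: real assume sig: "\<bar>sig\<bar> = 1"
       define z where "z = move (side 1 tau) tau i sig"
       have nz: "norm (E' z) <= stepC * sqrt tau" unfolding z_def by (rule move_bounds(1)[OF Ec sig t(1,2)])
       show "lift P v (drift 1 tau y + R (E' (move (side 1 tau) tau i sig))) <= S (drift 1 tau x + E' (move (side 1 tau) tau i sig))
        + \<psi> (drift 1 tau x + E' (move (side 1 tau) tau i sig)) + (- w y - S x - \<psi> x + 2 * (\<eta> * tau))"
        unfolding z_def[symmetric]
       proof (rule step)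
        have "G \<bullet> R (E' z) - (G + p) \<bullet> E' z = c * (- tau)" using Rc[of z] by (simp add: b[symmetric] z_def move_def)
        also have "\<dots> <= \<bar>c\<bar> * tau" using t mult_right_mono[of "- c" "\<bar>c\<bar>" tau] by simp
        also have "\<dots> <= 5 * \<rho> * tau" using c p t unfolding eqp by (intro mult_right_mono) auto
        finally show "G \<bullet> R (E' z) - (G + p) \<bullet> E' z <= 5 * \<rho> * tau" .
        have "norm (E' z - R (E' z)) <= 32 * norm p / norm b * norm (E' z)"
         using Rz[of "E' z"] unfolding eqp by (simp add: norm_minus_commute)
        also have "\<dots> <= 64 * \<rho> / \<mu> * (stepC * sqrt tau)"
        proof (rule mult_mono[OF _ nz])
         have "32 * norm p / norm b <= 32 * \<rho> / (\<mu> / 2)"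
          by (rule frac_le) (use p norm_ge_zero[of p] nb nGp \<mu> in linarith)+
         thus "32 * norm p / norm b <= 64 * \<rho> / \<mu>" by simp
        qed (use \<rho> \<mu> in auto)
        finally show "norm (E' z - R (E' z)) <= 64 * \<rho> / \<mu> * (stepC * sqrt tau)" .
        show "norm (E' z - tau *\<^sub>R Vfield f (1 *\<^sub>R x)) <= stepC * sqrt tau"
         unfolding z_def by (rule move_bounds(2)[OF Ec sig t(1,2)])
       qed
      qed
     qed
    qed
   qed
   moreover have "3 * (\<eta> * tau) <= \<eta>0 * tau" using \<eta>0 t by (simp add: \<eta>_def)
   moreover have "tau * (H + \<eta>0) = tau * H + \<eta>0 * tau" by (simp add: algebra_simps)
   ultimately have "S x + \<psi> x - tau * (H + \<eta>0) <= T 1 tau (%y. S y + \<psi> y) x" by linarith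
   thus ?thesis by (simp add: W_def)
  qed
  thus ?thesis using WM by blast
 qed
 have "tau0 > 0" using tau1 tau2 tau3 by (simp add: tau0_def)
 thus "\<exists>\<rho>>0. \<exists>M tau0. tau0 > 0 \<and> (\<forall>tau. 0 < tau --> tau < tau0 -->
  (\<exists>W. (\<forall>x. \<bar>W x\<bar> <= M) \<and> (\<forall>\<psi> x p. locally_bdd \<psi> --> norm p <= \<rho> -->
    (\<forall>\<delta>. norm \<delta> <= 1 --> \<psi> (x + \<delta>) >= \<psi> x + p \<bullet> \<delta> - \<rho> * (norm \<delta>)\<^sup>2) -->
    T 1 tau (%y. P \<bullet> y + W y + \<psi> y) x >= P \<bullet> x + W x + \<psi> x - tau * (H + \<eta>0))))"
  using main \<rho>(1) by blast
qed

end

section \<open>Continuity and homogeneity of the effective Hamiltonian\<close>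

lemma linear_growth_nonpos:
 fixes a b :: real
 assumes "!!k :: nat. real k * a <= b"
 shows "a <= 0"
proof (rule ccontr)
 assume "\<not> a <= 0"
 hence "a > 0" by simp
 then obtain k :: nat where "b < real k * a" using reals_Archimedean3 by blast
 thus False using assms[of k] by simp
qed

text \<open>The inner clause of the corrector definition with the corrector merged into
  \<open>G\<close>, named so that correctors can be chosen for a whole sequence of steps before a
  test is applied.\<close>

definition robust_super :: "(('a::real_inner => real) => 'a => real) => real => ('a => real) => real => bool" where
 "robust_super S \<rho> G c \<longleftrightarrow> (\<forall>\<psi> x p. locally_bdd \<psi> --> norm p <= \<rho> -->
  (\<forall>\<delta>. norm \<delta> <= 1 --> \<psi> (x + \<delta>) <= \<psi> x + p \<bullet> \<delta> + \<rho> * (norm \<delta>)\<^sup>2) -->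
  S (%y. G y + \<psi> y) x <= G x + \<psi> x - c)"

definition robust_sub :: "(('a::real_inner => real) => 'a => real) => real => ('a => real) => real => bool" where
 "robust_sub S \<rho> G c \<longleftrightarrow> (\<forall>\<psi> x p. locally_bdd \<psi> --> norm p <= \<rho> -->
  (\<forall>\<delta>. norm \<delta> <= 1 --> \<psi> (x + \<delta>) >= \<psi> x + p \<bullet> \<delta> - \<rho> * (norm \<delta>)\<^sup>2) -->
  S (%y. G y + \<psi> y) x >= G x + \<psi> x - c)"

lemma robust_superD:
 assumes "robust_super S \<rho> G c" "locally_bdd \<psi>" "norm p <= \<rho>"
  and "!!\<delta>. norm \<delta> <= 1 ==> \<psi> (x + \<delta>) <= \<psi> x + p \<bullet> \<delta> + \<rho> * (norm \<delta>)\<^sup>2"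
 shows "S (%y. G y + \<psi> y) x <= G x + \<psi> x - c"
 using assms(1)[unfolded robust_super_def, rule_format, OF assms(2,3), of x] assms(4) by simp

lemma robust_subD:
 assumes "robust_sub S \<rho> G c" "locally_bdd \<psi>" "norm p <= \<rho>"
  and "!!\<delta>. norm \<delta> <= 1 ==> \<psi> (x + \<delta>) >= \<psi> x + p \<bullet> \<delta> - \<rho> * (norm \<delta>)\<^sup>2"
 shows "S (%y. G y + \<psi> y) x >= G x + \<psi> x - c"
 using assms(1)[unfolded robust_sub_def, rule_format, OF assms(2,3), of x] assms(4) by simp

context shear_game
begin

lemma super_correctorE:
 assumes "super_corrector P H" "\<eta> > 0"
 obtains \<rho> M tau0 where "\<rho> > 0" "tau0 > 0" "!!tau. 0 < tau ==> tau < tau0 ==>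
  \<exists>W. (\<forall>x. \<bar>W x\<bar> <= M) \<and> robust_super (T 1 tau) \<rho> (%y. P \<bullet> y + W y) (tau * (H - \<eta>))"
 using mp[OF spec[OF assms(1)[unfolded super_corrector_def], of \<eta>] assms(2)]
 by (elim exE conjE) (rule that, assumption, assumption, unfold robust_super_def, drule spec, drule mp, assumption, drule mp, assumption, assumption)

lemma sub_correctorE:
 assumes "sub_corrector P H" "\<eta> > 0"
 obtains \<rho> M tau0 where "\<rho> > 0" "tau0 > 0" "!!tau. 0 < tau ==> tau < tau0 ==>
  \<exists>W. (\<forall>x. \<bar>W x\<bar> <= M) \<and> robust_sub (T 1 tau) \<rho> (%y. P \<bullet> y + W y) (tau * (H + \<eta>))"
 using mp[OF spec[OF assms(1)[unfolded sub_corrector_def], of \<eta>] assms(2)]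
 by (elim exE conjE) (rule that, assumption, assumption, unfold robust_sub_def, drule spec, drule mp, assumption, drule mp, assumption, assumption)

text \<open>The linear function with slope \<open>P' - P\<close> is an admissible perturbation, so
  one corrector for \<open>P\<close> controls the long-time behaviour of the game for all slopes
  within \<rho>.\<close>

lemma super_corrector_iterate:
 assumes "super_corrector P H" and \<eta>: "\<eta> > 0"
 shows "\<exists>\<rho>>0. \<exists>M tau0. tau0 > 0 \<and> (\<forall>tau P' k. 0 < tau --> tau < tau0 --> norm (P' - P) <= \<rho> -->
  (T 1 tau ^^ k) (%x. P' \<bullet> x) 0 <= 2 * M - k * tau * (H - \<eta>))"
proof -
 obtain \<rho> M tau0 where \<rho>: "\<rho> > 0" and tau0: "tau0 > 0" and cor: "!!tau. 0 < tau ==> tau < tau0 ==>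
  \<exists>W. (\<forall>x. \<bar>W x\<bar> <= M) \<and> robust_super (T 1 tau) \<rho> (%y. P \<bullet> y + W y) (tau * (H - \<eta>))"
  by (rule super_correctorE[OF assms]) blast
 have "(T 1 tau ^^ k) (%x. P' \<bullet> x) 0 <= 2 * M - k * tau * (H - \<eta>)"
  if tau: "0 < tau" "tau < tau0" and P': "norm (P' - P) <= \<rho>" for tau P' k
 proof -
  obtain W where W: "!!x. \<bar>W x\<bar> <= M" and cor: "robust_super (T 1 tau) \<rho> (%y. P \<bullet> y + W y) (tau * (H - \<eta>))"
   using cor[OF tau] by blast
  define G where "G x = P' \<bullet> x + W x" for x
  have lbP: "locally_bdd (%x. P' \<bullet> x)" by (intro locally_bdd_continuous continuous_intros)
  have lbG: "locally_bdd G" unfolding G_def by (intro locally_bdd_add lbP locally_bdd_bounded[OF W])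
  have TG: "T 1 tau G x <= G x - tau * (H - \<eta>)" for x
  proof -
   have "T 1 tau (%y. P \<bullet> y + W y + (P' - P) \<bullet> y) x <= P \<bullet> x + W x + (P' - P) \<bullet> x - tau * (H - \<eta>)"
    using \<rho> by (intro robust_superD[OF cor _ P'] locally_bdd_continuous continuous_intros) (simp add: inner_add_right)
   moreover have "P \<bullet> y + W y + (P' - P) \<bullet> y = G y" for y by (simp add: G_def inner_diff_left)
   ultimately show ?thesis by simp
  qed
  have "(T 1 tau ^^ k) (%x. P' \<bullet> x) x <= G x + (M - k * tau * (H - \<eta>))" for x
  proof (induction k arbitrary: x)
   case 0
   thus ?case using W[of x] by (simp add: G_def abs_le_iff)
  next
   case (Suc k)
   have "(T 1 tau ^^ Suc k) (%x. P' \<bullet> x) x <= T 1 tau G x + (M - k * tau * (H - \<eta>))"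
    using T_mono[OF _ _ iterate_locally_bdd[OF _ _ lbP] lbG Suc] tau by simp
   also have "\<dots> <= G x - tau * (H - \<eta>) + (M - k * tau * (H - \<eta>))" using TG[of x] by simp
   finally show ?case by (simp add: algebra_simps)
  qed
  from this[of 0] show ?thesis using W[of 0] by (simp add: G_def abs_le_iff)
 qed
 thus ?thesis using \<rho> tau0 by blast
qed

lemma sub_corrector_iterate:
 assumes "sub_corrector P H" and \<eta>: "\<eta> > 0"
 shows "\<exists>\<rho>>0. \<exists>M tau0. tau0 > 0 \<and> (\<forall>tau P' k. 0 < tau --> tau < tau0 --> norm (P' - P) <= \<rho> -->
  (T 1 tau ^^ k) (%x. P' \<bullet> x) 0 >= - 2 * M - k * tau * (H + \<eta>))"
proof -
 obtain \<rho> M tau0 where \<rho>: "\<rho> > 0" and tau0: "tau0 > 0" and cor: "!!tau. 0 < tau ==> tau < tau0 ==>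
  \<exists>W. (\<forall>x. \<bar>W x\<bar> <= M) \<and> robust_sub (T 1 tau) \<rho> (%y. P \<bullet> y + W y) (tau * (H + \<eta>))"
  by (rule sub_correctorE[OF assms]) blast
 have "(T 1 tau ^^ k) (%x. P' \<bullet> x) 0 >= - 2 * M - k * tau * (H + \<eta>)"
  if tau: "0 < tau" "tau < tau0" and P': "norm (P' - P) <= \<rho>" for tau P' k
 proof -
  obtain W where W: "!!x. \<bar>W x\<bar> <= M" and cor: "robust_sub (T 1 tau) \<rho> (%y. P \<bullet> y + W y) (tau * (H + \<eta>))"
   using cor[OF tau] by blast
  define G where "G x = P' \<bullet> x + W x" for x
  have lbP: "locally_bdd (%x. P' \<bullet> x)" by (intro locally_bdd_continuous continuous_intros)
  have lbG: "locally_bdd G" unfolding G_def by (intro locally_bdd_add lbP locally_bdd_bounded[OF W])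
  have TG: "T 1 tau G x >= G x - tau * (H + \<eta>)" for x
  proof -
   have "T 1 tau (%y. P \<bullet> y + W y + (P' - P) \<bullet> y) x >= P \<bullet> x + W x + (P' - P) \<bullet> x - tau * (H + \<eta>)"
    using \<rho> by (intro robust_subD[OF cor _ P'] locally_bdd_continuous continuous_intros) (simp add: inner_add_right)
   moreover have "P \<bullet> y + W y + (P' - P) \<bullet> y = G y" for y by (simp add: G_def inner_diff_left)
   ultimately show ?thesis by simp
  qed
  have "G x <= (T 1 tau ^^ k) (%x. P' \<bullet> x) x + (M + k * tau * (H + \<eta>))" for x
  proof (induction k arbitrary: x)
   case 0
   thus ?case using W[of x] by (simp add: G_def abs_le_iff)
  next
   case (Suc k)
   have "T 1 tau G x <= (T 1 tau ^^ Suc k) (%x. P' \<bullet> x) x + (M + k * tau * (H + \<eta>))"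
    using T_mono[OF _ _ lbG iterate_locally_bdd[OF _ _ lbP] Suc] tau by simp
   thus ?case using TG[of x] by (simp add: algebra_simps)
  qed
  from this[of 0] show ?thesis using W[of 0] by (simp add: G_def abs_le_iff)
 qed
 thus ?thesis using \<rho> tau0 by blast
qed

lemma T_cmult:
 assumes "c > 0" "eps >= 0" "h >= 0" "locally_bdd u"
 shows "T eps h (%x. c * u x) x = c * T eps h u x"
proof -
 have pc: "payoff s h (%x. c * u x) z E = c * payoff s h u z E" for s z and E :: "(real^'n) \<times> real => (real^'n) \<times> real"
 proof -
  have "max (c * p) (c * q) = c * max p q" for p q using assms(1) by (simp add: max_def)
  thus ?thesis by (simp add: payoff_def sum_distrib_left)
 qed
 have lb: "locally_bdd (%x. c * u x)"
  unfolding locally_bdd_def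
 proof
  fix R
  obtain B where B: "!!x. norm x <= R ==> \<bar>u x\<bar> <= B" using locally_bddE[OF assms(4)] by metis
  have "\<bar>c * u x\<bar> <= c * B" if "norm x <= R" for x using B[OF that] assms(1) by (simp add: abs_mult)
  thus "\<exists>B. \<forall>x. norm x <= R --> \<bar>c * u x\<bar> <= B" by blast
 qed
 have "c * T eps h u x <= T eps h (%x. c * u x) x"
 proof (rule T_ge)
  fix E :: "(real^'n) \<times> real => (real^'n) \<times> real" assume "E \<in> controls"
  thus "c * T eps h u x <= payoff (side eps h) h (%x. c * u x) (drift eps h x) E"
   unfolding pc using T_le assms by (intro mult_left_mono) auto
 qed
 moreover have "T eps h (%x. c * u x) x / c <= T eps h u x"
 proof (rule T_ge)
  fix E :: "(real^'n) \<times> real => (real^'n) \<times> real" assume "E \<in> controls"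
  hence "T eps h (%x. c * u x) x <= c * payoff (side eps h) h u (drift eps h x) E"
   unfolding pc[symmetric] using T_le[OF lb] assms by auto
  thus "T eps h (%x. c * u x) x / c <= payoff (side eps h) h u (drift eps h x) E"
   using assms(1) by (simp add: divide_le_eq mult.commute)
 qed
 ultimately show ?thesis using assms(1) by (simp add: divide_le_eq mult.commute)
qed

lemma iterate_cmult:
 assumes "c > 0" "eps >= 0" "h >= 0" "locally_bdd u"
 shows "(T eps h ^^ k) (%x. c * u x) = (%x. c * (T eps h ^^ k) u x)"
proof (induction k)
 case (Suc k)
 thus ?case
  using T_cmult[OF assms(1-3) iterate_locally_bdd[OF assms(2-4)]] by auto
qed simp

text \<open>Iterates from the same linear datum are squeezed between both correctors; letting the
  number of steps grow compares \<open>H\<close> with \<open>H'\<close>. The radius \<rho> is fixed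
  by \<open>P\<close> before \<open>P'\<close> is known, as continuity requires.\<close>

lemma corrector_compare:
 assumes "super_corrector P H" and \<eta>: "\<eta> > 0"
 shows "\<exists>\<rho>>0. \<forall>P' H'. norm (P' - P) <= \<rho> --> sub_corrector P' H' --> H <= H' + \<eta>"
proof -
 have \<eta>2: "\<eta> / 2 > 0" using \<eta> by simp
 obtain \<rho> M tau0 where \<rho>: "\<rho> > 0" "tau0 > 0" and up: "!!tau P' k. 0 < tau ==> tau < tau0 ==> norm (P' - P) <= \<rho> ==>
  (T 1 tau ^^ k) (%x. P' \<bullet> x) 0 <= 2 * M - k * tau * (H - \<eta> / 2)"
  using super_corrector_iterate[OF assms(1) \<eta>2] by blast
 have "H <= H' + \<eta>" if P': "norm (P' - P) <= \<rho>" and sc: "sub_corrector P' H'" for P' H'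
 proof -
  obtain \<rho>' M' tau0' where \<rho>': "\<rho>' > 0" "tau0' > 0" and lo: "!!tau P'' k. 0 < tau ==> tau < tau0' ==> norm (P'' - P') <= \<rho>' ==>
   (T 1 tau ^^ k) (%x. P'' \<bullet> x) 0 >= - 2 * M' - k * tau * (H' + \<eta> / 2)"
   using sub_corrector_iterate[OF sc \<eta>2] by blast
  define tau where "tau = min tau0 tau0' / 2"
  have tau: "0 < tau" "tau < tau0" "tau < tau0'" using \<rho> \<rho>' by (auto simp: tau_def min_def)
  have "real k * (tau * (H - H' - \<eta>)) <= 2 * M + 2 * M'" for k
  proof -
   have "- 2 * M' - k * tau * (H' + \<eta> / 2) <= 2 * M - k * tau * (H - \<eta> / 2)"
    using up[OF tau(1,2) P', of k] lo[OF tau(1,3), of P' k] \<rho>' by simp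
   thus ?thesis by (simp add: algebra_simps)
  qed
  hence "tau * (H - H' - \<eta>) <= 0" by (rule linear_growth_nonpos)
  thus ?thesis using tau by (simp add: mult_le_0_iff)
 qed
 thus ?thesis using \<rho> by blast
qed

lemma corrector_compare':
 assumes "sub_corrector P H" and \<eta>: "\<eta> > 0"
 shows "\<exists>\<rho>>0. \<forall>P' H'. norm (P' - P) <= \<rho> --> super_corrector P' H' --> H' <= H + \<eta>"
proof -
 have \<eta>2: "\<eta> / 2 > 0" using \<eta> by simp
 obtain \<rho> M tau0 where \<rho>: "\<rho> > 0" "tau0 > 0" and lo: "!!tau P' k. 0 < tau ==> tau < tau0 ==> norm (P' - P) <= \<rho> ==>
  (T 1 tau ^^ k) (%x. P' \<bullet> x) 0 >= - 2 * M - k * tau * (H + \<eta> / 2)"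
  using sub_corrector_iterate[OF assms(1) \<eta>2] by blast
 have "H' <= H + \<eta>" if P': "norm (P' - P) <= \<rho>" and sc: "super_corrector P' H'" for P' H'
 proof -
  obtain \<rho>' M' tau0' where \<rho>': "\<rho>' > 0" "tau0' > 0" and up: "!!tau P'' k. 0 < tau ==> tau < tau0' ==> norm (P'' - P') <= \<rho>' ==>
   (T 1 tau ^^ k) (%x. P'' \<bullet> x) 0 <= 2 * M' - k * tau * (H' - \<eta> / 2)"
   using super_corrector_iterate[OF sc \<eta>2] by blast
  define tau where "tau = min tau0 tau0' / 2"
  have tau: "0 < tau" "tau < tau0" "tau < tau0'" using \<rho> \<rho>' by (auto simp: tau_def min_def)
  have "real k * (tau * (H' - H - \<eta>)) <= 2 * M + 2 * M'" for k
  proof -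
   have "- 2 * M - k * tau * (H + \<eta> / 2) <= 2 * M' - k * tau * (H' - \<eta> / 2)"
    using lo[OF tau(1,2) P', of k] up[OF tau(1,3), of P' k] \<rho>' by simp
   thus ?thesis by (simp add: algebra_simps)
  qed
  hence "tau * (H' - H - \<eta>) <= 0" by (rule linear_growth_nonpos)
  thus ?thesis using tau by (simp add: mult_le_0_iff)
 qed
 thus ?thesis using \<rho> by blast
qed

text \<open>The game commutes with positive multiples, so the iterates for slopes \<open>P\<close>
  and \<open>c *\<^sub>R P\<close> are proportional, and so are their linear rates.\<close>

lemma corrector_homogeneous_le:
 assumes "super_corrector P H" "sub_corrector (c *\<^sub>R P) H'" and c: "c > 0"
 shows "c * H <= H'"
proof (rule field_le_epsilon)
 fix e :: real assume e: "e > 0"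
 define \<eta> where "\<eta> = e / (c + 1)"
 have \<eta>: "\<eta> > 0" "(c + 1) * \<eta> = e" using e c by (simp_all add: \<eta>_def)
 obtain \<rho> M tau0 where \<rho>: "\<rho> > 0" "tau0 > 0" and up: "!!tau P' k. 0 < tau ==> tau < tau0 ==> norm (P' - P) <= \<rho> ==>
  (T 1 tau ^^ k) (%x. P' \<bullet> x) 0 <= 2 * M - k * tau * (H - \<eta>)"
  using super_corrector_iterate[OF assms(1) \<eta>(1)] by blast
 obtain \<rho>' M' tau0' where \<rho>': "\<rho>' > 0" "tau0' > 0" and lo: "!!tau P'' k. 0 < tau ==> tau < tau0' ==> norm (P'' - c *\<^sub>R P) <= \<rho>' ==>
  (T 1 tau ^^ k) (%x. P'' \<bullet> x) 0 >= - 2 * M' - k * tau * (H' + \<eta>)"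
  using sub_corrector_iterate[OF assms(2) \<eta>(1)] by blast
 define tau where "tau = min tau0 tau0' / 2"
 have tau: "0 < tau" "tau < tau0" "tau < tau0'" using \<rho> \<rho>' by (auto simp: tau_def min_def)
 have lbP: "locally_bdd (%x. P \<bullet> x)" by (intro locally_bdd_continuous continuous_intros)
 have "real k * (tau * (c * H - H' - e)) <= c * (2 * M) + 2 * M'" for k
 proof -
  have "(T 1 tau ^^ k) (%x. (c *\<^sub>R P) \<bullet> x) 0 = c * (T 1 tau ^^ k) (%x. P \<bullet> x) 0"
   using iterate_cmult[OF c _ _ lbP, of 1 tau k] tau by simp
  also have "\<dots> <= c * (2 * M - k * tau * (H - \<eta>))"
   using up[OF tau(1,2), of P k] \<rho> c by (intro mult_left_mono) auto
  finally have "- 2 * M' - k * tau * (H' + \<eta>) <= c * (2 * M - k * tau * (H - \<eta>))"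
   using lo[OF tau(1,3), of "c *\<^sub>R P" k] \<rho>' by simp
  thus ?thesis by (simp add: algebra_simps flip: \<eta>(2))
 qed
 hence "tau * (c * H - H' - e) <= 0" by (rule linear_growth_nonpos)
 thus "c * H <= H' + e" using tau by (simp add: mult_le_0_iff)
qed

lemma effective_continuous:
 assumes "!!P. super_corrector P (Hb P)" "!!P. sub_corrector P (Hb P)"
 shows "continuous_on UNIV Hb"
 unfolding continuous_on_iff
proof (intro ballI allI impI)
 fix P :: "(real^'n) \<times> real" and e :: real assume e: "e > 0"
 hence e2: "e / 2 > 0" by simp
 obtain \<rho> where \<rho>: "\<rho> > 0" "!!P' H'. norm (P' - P) <= \<rho> ==> sub_corrector P' H' ==> Hb P <= H' + e / 2"
  using corrector_compare[OF assms(1) e2] by blast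
 obtain \<rho>' where \<rho>': "\<rho>' > 0" "!!P' H'. norm (P' - P) <= \<rho>' ==> super_corrector P' H' ==> H' <= Hb P + e / 2"
  using corrector_compare'[OF assms(2) e2] by blast
 have "dist (Hb P') (Hb P) < e" if "dist P' P < min \<rho> \<rho>'" for P'
 proof -
  have "Hb P <= Hb P' + e / 2" "Hb P' <= Hb P + e / 2" using \<rho>(2)[OF _ assms(2)] \<rho>'(2)[OF _ assms(1)] that by (auto simp: dist_norm)
  thus ?thesis using e by (simp add: dist_real_def abs_less_iff)
 qed
 thus "\<exists>d>0. \<forall>x'\<in>UNIV. dist x' P < d --> dist (Hb x') (Hb P) < e"
  using \<rho>(1) \<rho>'(1) by (intro exI[of _ "min \<rho> \<rho>'"] conjI ballI impI) auto
qed

lemma effective_homogeneous: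
 assumes "!!P. super_corrector P (Hb P)" "!!P. sub_corrector P (Hb P)" and c: "c > 0"
 shows "Hb (c *\<^sub>R P) = c * Hb P"
proof (rule antisym)
 show "c * Hb P <= Hb (c *\<^sub>R P)" using corrector_homogeneous_le[OF assms(1) assms(2) c] .
 have "(1 / c) * Hb (c *\<^sub>R P) <= Hb P"
  by (rule corrector_homogeneous_le[OF assms(1)]) (use c assms(2)[of P] in auto)
 thus "Hb (c *\<^sub>R P) <= c * Hb P" using c by (simp add: divide_le_eq mult.commute)
qed

end

section \<open>Sub- and supersolutions of the effective equation\<close>

context shear_game
begin

text \<open>After the blow-up \<open>y = eps *\<^sub>R z\<close> the scaled corrector becomes
  \<open>W\<close> and the quadratic part becomes \<xi>, whose slope \<open>p\<close> is small near
  \<open>x0\<close> and whose curvature is of order \<open>eps\<close>. So \<xi> is an admissible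
  perturbation for a robust corrector; the constant \<open>P . x0\<close> is absorbed in it.\<close>

lemma rescaled_test:
 fixes P x0 y :: "(real^'n) \<times> real" and X :: "((real^'n) \<times> real) \<Rightarrow>\<^sub>L ((real^'n) \<times> real)" and c :: real
 assumes sym: "symmetric_op X" and eps: "eps > 0" "h >= 0" and W: "!!z. \<bar>W z\<bar> <= M"
 defines "\<phi> \<equiv> %y. 1/2 * (blinfun_apply X (y - x0) \<bullet> (y - x0)) + c * (norm (y - x0))\<^sup>2"
 defines "\<xi> \<equiv> %z. (\<phi> (eps *\<^sub>R z) - P \<bullet> x0) / eps"
 defines "\<psi> \<equiv> %y. P \<bullet> (y - x0) + \<phi> y + eps * W ((1/eps) *\<^sub>R y)"
 defines "p \<equiv> blinfun_apply X (y - x0) + (2 * c) *\<^sub>R (y - x0)"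
 shows "T eps h \<psi> y = eps * T 1 (h / eps) (%z. P \<bullet> z + W z + \<xi> z) ((1/eps) *\<^sub>R y)"
  and "locally_bdd \<xi>"
  and "norm p <= (norm X + 2 * \<bar>c\<bar>) * norm (y - x0)"
  and "\<bar>\<xi> ((1/eps) *\<^sub>R y + \<delta>) - \<xi> ((1/eps) *\<^sub>R y) - p \<bullet> \<delta>\<bar> <= eps * (norm X + 2 * \<bar>c\<bar>) * (norm \<delta>)\<^sup>2"
  and "\<psi> y = eps * (P \<bullet> ((1/eps) *\<^sub>R y) + W ((1/eps) *\<^sub>R y) + \<xi> ((1/eps) *\<^sub>R y))"
proof -
 have eq: "\<psi> (eps *\<^sub>R z) / eps = P \<bullet> z + W z + \<xi> z" for z
  using eps by (simp add: \<psi>_def \<xi>_def inner_diff_right field_simps)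
 have \<phi>c: "continuous_on UNIV \<phi>" unfolding \<phi>_def by (intro continuous_intros)
 show "locally_bdd \<xi>"
  unfolding \<xi>_def by (intro locally_bdd_continuous continuous_intros continuous_on_compose2[OF \<phi>c]) (use eps in auto)
 have "locally_bdd (%y. P \<bullet> (y - x0) + \<phi> y)" by (intro locally_bdd_continuous continuous_intros \<phi>c)
 hence lb: "locally_bdd \<psi>"
  unfolding locally_bdd_def
 proof (intro allI)
  fix R
  assume "\<forall>R. \<exists>B. \<forall>y. norm y <= R --> \<bar>P \<bullet> (y - x0) + \<phi> y\<bar> <= B"
  then obtain B where B: "!!y. norm y <= R ==> \<bar>P \<bullet> (y - x0) + \<phi> y\<bar> <= B" by blast
  have "\<bar>\<psi> y\<bar> <= B + eps * M" if "norm y <= R" for y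
  proof -
   have "\<bar>eps * W ((1/eps) *\<^sub>R y)\<bar> <= eps * M" using W eps by (simp add: abs_mult)
   thus ?thesis using B[OF that] unfolding \<psi>_def by linarith
  qed
  thus "\<exists>B. \<forall>y. norm y <= R --> \<bar>\<psi> y\<bar> <= B" by blast
 qed
 show "T eps h \<psi> y = eps * T 1 (h / eps) (%z. P \<bullet> z + W z + \<xi> z) ((1/eps) *\<^sub>R y)"
  using T_scale[OF eps lb, of y] unfolding eq .
 show "\<psi> y = eps * (P \<bullet> ((1/eps) *\<^sub>R y) + W ((1/eps) *\<^sub>R y) + \<xi> ((1/eps) *\<^sub>R y))"
  using eq[of "(1/eps) *\<^sub>R y"] eps by (simp add: field_simps)
 have "norm p <= norm (blinfun_apply X (y - x0)) + \<bar>2 * c\<bar> * norm (y - x0)"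
  unfolding p_def using norm_triangle_ineq norm_scaleR by metis
 also have "\<dots> <= norm X * norm (y - x0) + \<bar>2 * c\<bar> * norm (y - x0)" by (intro add_right_mono norm_blinfun)
 finally show "norm p <= (norm X + 2 * \<bar>c\<bar>) * norm (y - x0)" by (simp add: distrib_right abs_mult)
 have ex: "\<phi> (y + eps *\<^sub>R \<delta>) = \<phi> y + p \<bullet> (eps *\<^sub>R \<delta>) + 1/2 * (blinfun_apply (X + (2 * c) *\<^sub>R id_blinfun) (eps *\<^sub>R \<delta>) \<bullet> (eps *\<^sub>R \<delta>))"
  using quadratic_expansion[OF sym, where P = 0] by (simp only: \<phi>_def p_def) simp
 have "\<xi> ((1/eps) *\<^sub>R y + \<delta>) - \<xi> ((1/eps) *\<^sub>R y) = (\<phi> (y + eps *\<^sub>R \<delta>) - \<phi> y) / eps"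
  using eps by (simp add: \<xi>_def scaleR_add_right diff_divide_distrib)
 also have "\<dots> = p \<bullet> \<delta> + eps * (1/2 * (blinfun_apply (X + (2 * c) *\<^sub>R id_blinfun) \<delta> \<bullet> \<delta>))"
  unfolding ex using eps by (simp add: blinfun.scaleR_right field_simps)
 finally have d: "\<xi> ((1/eps) *\<^sub>R y + \<delta>) - \<xi> ((1/eps) *\<^sub>R y) - p \<bullet> \<delta> = eps * (1/2 * (blinfun_apply (X + (2 * c) *\<^sub>R id_blinfun) \<delta> \<bullet> \<delta>))"
  by simp
 have "\<bar>blinfun_apply (X + (2 * c) *\<^sub>R id_blinfun) \<delta> \<bullet> \<delta>\<bar> <= (norm X + 2 * \<bar>c\<bar>) * (norm \<delta>)\<^sup>2"
 proof -
  have "\<bar>blinfun_apply X \<delta> \<bullet> \<delta>\<bar> <= norm (blinfun_apply X \<delta>) * norm \<delta>" by (rule Cauchy_Schwarz_ineq2)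
  also have "\<dots> <= norm X * norm \<delta> * norm \<delta>" by (intro mult_right_mono norm_blinfun) simp
  finally have 1: "\<bar>blinfun_apply X \<delta> \<bullet> \<delta>\<bar> <= norm X * (norm \<delta>)\<^sup>2" by (simp add: power2_eq_square)
  have "blinfun_apply (X + (2 * c) *\<^sub>R id_blinfun) \<delta> \<bullet> \<delta> = blinfun_apply X \<delta> \<bullet> \<delta> + 2 * c * (norm \<delta>)\<^sup>2"
   by (simp add: blinfun.add_left blinfun.scaleR_left inner_add_left power2_norm_eq_inner)
  moreover have "\<bar>2 * c * (norm \<delta>)\<^sup>2\<bar> = 2 * \<bar>c\<bar> * (norm \<delta>)\<^sup>2" by (simp add: abs_mult)
  ultimately show ?thesis using 1 by (simp add: distrib_right) 
 qed
 hence "\<bar>1/2 * (blinfun_apply (X + (2 * c) *\<^sub>R id_blinfun) \<delta> \<bullet> \<delta>)\<bar> <= (norm X + 2 * \<bar>c\<bar>) * (norm \<delta>)\<^sup>2" by simp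
 hence "eps * \<bar>1/2 * (blinfun_apply (X + (2 * c) *\<^sub>R id_blinfun) \<delta> \<bullet> \<delta>)\<bar> <= eps * ((norm X + 2 * \<bar>c\<bar>) * (norm \<delta>)\<^sup>2)"
  using eps by (intro mult_left_mono) auto
 thus "\<bar>\<xi> ((1/eps) *\<^sub>R y + \<delta>) - \<xi> ((1/eps) *\<^sub>R y) - p \<bullet> \<delta>\<bar> <= eps * (norm X + 2 * \<bar>c\<bar>) * (norm \<delta>)\<^sup>2"
  unfolding d using eps by (simp add: abs_mult mult.assoc)
qed

lemma homogenization_scales:
 assumes eps: "!!j. 0 < \<epsilon> j" "\<epsilon> \<longlonglongrightarrow> 0" and h: "!!j. 0 < h j" "!!j. h j <= (\<epsilon> j)\<^sup>2"
 shows "h \<longlonglongrightarrow> 0" "(%j. reach (\<epsilon> j) (h j)) \<longlonglongrightarrow> 0" "h j / \<epsilon> j <= \<epsilon> j"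
proof -
 have "(%j. (\<epsilon> j)\<^sup>2) \<longlonglongrightarrow> 0" using tendsto_power[OF eps(2), of 2] by simp
 thus h0: "h \<longlonglongrightarrow> 0"
  by (intro tendsto_sandwich[OF _ _ tendsto_const \<open>(%j. (\<epsilon> j)\<^sup>2) \<longlonglongrightarrow> 0\<close>]) (use h in \<open>auto intro!: always_eventually less_imp_le\<close>)
 have "(%j. h j * F + sqrt (2 * CARD('n) * d * \<epsilon> j * h j) + h j) \<longlonglongrightarrow> 0 * F + sqrt (2 * CARD('n) * d * 0 * 0) + 0"
  by (intro tendsto_intros eps h0)
 thus "(%j. reach (\<epsilon> j) (h j)) \<longlonglongrightarrow> 0" by (simp add: reach_def side_def)
 show "h j / \<epsilon> j <= \<epsilon> j" using h(2)[of j] eps(1)[of j] by (simp add: divide_le_eq power2_eq_square)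
qed

text \<open>The scaled corrector is used as the perturbation of the test function. The test then
  bounds the decrease over one step from above, robustness bounds it from below by
  \<open>h * (H - \<eta>)\<close>, and division by \<open>h\<close> leaves the effective
  inequality.\<close>

lemma homogenization_sub:
 assumes eps: "!!j. 0 < eps j" "!!j. eps j <= 1" "eps \<longlonglongrightarrow> 0" and h: "!!j. 0 < h j" "!!j. h j <= (eps j)\<^sup>2"
  and g: "uniformly_continuous_on UNIV g"
  and upper: "!!x t e. t > 0 ==> e > 0 ==>
   \<exists>r>0. \<exists>J. \<forall>j\<ge>J. \<forall>y s. dist y x < r --> \<bar>s - t\<bar> < r --> flow (eps j) (h j) g y s < ubar x t + e"
  and attained: "!!e r J. e > 0 ==> r > 0 ==>
   \<exists>j\<ge>J. \<exists>y s. dist y x0 < r \<and> \<bar>s - t0\<bar> < r \<and> flow (eps j) (h j) g y s > ubar x0 t0 - e"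
  and jet: "(a, P, X) \<in> par_superjet ubar x0 t0" and t0: "t0 > 0" and cor: "super_corrector P H"
 shows "a + H <= 0"
proof (rule field_le_epsilon)
 fix e' :: real assume e': "e' > 0"
 define \<eta> where "\<eta> = min 1 (e' / 4)"
 have \<eta>: "\<eta> > 0" "\<eta> <= 1" "4 * \<eta> <= e'" using e' by (auto simp: \<eta>_def)
 have sym: "symmetric_op X" using jet by (simp add: par_superjet_def)
 note scales = homogenization_scales[OF eps(1,3) h]
 obtain \<rho> M tau0 where \<rho>: "\<rho> > 0" and tau0: "tau0 > 0" and cor': "!!tau. 0 < tau ==> tau < tau0 ==>
  \<exists>W. (\<forall>x. \<bar>W x\<bar> <= M) \<and> robust_super (T 1 tau) \<rho> (%y. P \<bullet> y + W y) (tau * (H - \<eta>))"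
  by (rule super_correctorE[OF cor \<eta>(1)]) blast
 define tau where "tau j = h j / eps j" for j
 have tau: "tau j > 0" "tau j <= eps j" for j using scales(3)[of j] h eps by (auto simp: tau_def)
 \<comment> \<open>A corrector is available only for \<open>tau j < tau0\<close>. Elsewhere zero is
   a placeholder, so that the perturbation is bounded for every index, as the test demands.\<close>
 have "\<exists>W. (\<forall>x. \<bar>W x\<bar> <= \<bar>M\<bar>) \<and> (tau j < tau0 --> robust_super (T 1 (tau j)) \<rho> (%y. P \<bullet> y + W y) (tau j * (H - \<eta>)))" for j
 proof (cases "tau j < tau0")
  case True
  thus ?thesis using cor'[OF tau(1) True] abs_ge_self[of M] order_trans by blast
 next
  case False
  thus ?thesis by (intro exI[of _ "%_. 0"]) simp
 qed
 hence "\<exists>W. \<forall>j. (\<forall>x. \<bar>W j x\<bar> <= \<bar>M\<bar>) \<and> (tau j < tau0 --> robust_super (T 1 (tau j)) \<rho> (%y. P \<bullet> y + W j y) (tau j * (H - \<eta>)))"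
  by (intro choice allI)
 then obtain W where W: "!!j x. \<bar>W j x\<bar> <= \<bar>M\<bar>"
  and Wc: "!!j. tau j < tau0 ==> robust_super (T 1 (tau j)) \<rho> (%y. P \<bullet> y + W j y) (tau j * (H - \<eta>))"
  by blast
 define N where "N = norm X + 4"
 have N: "N > 0" by (simp add: N_def add_nonneg_pos)
 have cN: "norm X + 2 * \<bar>2 * \<eta>\<bar> <= N" using \<eta> by (simp add: N_def)
 \<comment> \<open>Below \<open>b\<close> an index is admissible:
   \<open>tau j <= eps j < tau0\<close>, the leftover \<open>h j\<close> is less than \<eta>, and
   the curvature \<open>eps j * N\<close> of the blown-up test function is at most \<rho>.\<close>
 define b where "b = min tau0 (min \<eta> (\<rho> / N))"
 have b: "b > 0" using tau0 \<eta> \<rho> N by (simp add: b_def)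
 obtain J where J: "!!j. j >= J ==> eps j < b"
  using order_tendstoD(2)[OF eps(3) b] by (auto simp: eventually_sequentially)
 have r: "\<rho> / N > 0" using \<rho> N by simp
 have kap: "(%j. eps j * \<bar>M\<bar>) \<longlonglongrightarrow> 0" using tendsto_mult_left_zero[OF eps(3)] .
 have "\<exists>j\<ge>J. \<exists>y. dist y x0 < \<rho> / N \<and>
  P \<bullet> (y - x0) + 1/2 * (blinfun_apply X (y - x0) \<bullet> (y - x0)) + 2 * \<eta> * (norm (y - x0))\<^sup>2 + eps j * W j ((1/eps j) *\<^sub>R y)
   + h j * (a - 2 * \<eta>) - (h j)\<^sup>2
  <= T (eps j) (h j) (%y. P \<bullet> (y - x0) + 1/2 * (blinfun_apply X (y - x0) \<bullet> (y - x0)) + 2 * \<eta> * (norm (y - x0))\<^sup>2 + eps j * W j ((1/eps j) *\<^sub>R y)) y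
   + h j * 0"
 proof (rule discrete_test_sub[where u = "%j. flow (eps j) (h j) g" and S = "%j. T (eps j) (h j)" and c = "%j y. 0"
    and W = "%j y. eps j * W j ((1/eps j) *\<^sub>R y)", OF _ scales(2) h(1) scales(1) _ _ upper attained jet t0 \<eta>(1) _ kap r])
  show "local_mono (T (eps j) (h j)) (reach (eps j) (h j))" for j
   by (rule T_local_mono) (use eps(1) h(1) less_imp_le in blast)+
  show "\<exists>B. \<forall>x t. norm x <= R --> 0 <= t --> t <= R --> \<bar>flow (eps j) (h j) g x t\<bar> <= B" for j R
  proof -
   have "h j <= 1" using h(2)[of j] power_le_one[of "eps j" 2] eps(1,2)[of j] by linarith
   thus ?thesis using flow_bounded[OF eps(1,2) g, of R j] h(1) by blast
  qed
  show "flow (eps j) (h j) g x t <= T (eps j) (h j) (%y. flow (eps j) (h j) g y (t - h j)) x + h j * 0" if "t >= h j" for j x t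
   using flow_step[OF h(1) that] by simp
  show "\<bar>eps j * W j ((1/eps j) *\<^sub>R y)\<bar> <= eps j * \<bar>M\<bar>" for j y using W eps(1)[of j] by (simp add: abs_mult)
 qed
 then obtain j y where j: "j >= J" and y: "dist y x0 < \<rho> / N"
  and le: "P \<bullet> (y - x0) + 1/2 * (blinfun_apply X (y - x0) \<bullet> (y - x0)) + 2 * \<eta> * (norm (y - x0))\<^sup>2 + eps j * W j ((1/eps j) *\<^sub>R y)
   + h j * (a - 2 * \<eta>) - (h j)\<^sup>2
  <= T (eps j) (h j) (%y. P \<bullet> (y - x0) + 1/2 * (blinfun_apply X (y - x0) \<bullet> (y - x0)) + 2 * \<eta> * (norm (y - x0))\<^sup>2 + eps j * W j ((1/eps j) *\<^sub>R y)) y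
   + h j * 0"
  by blast
 have ej: "eps j < tau0" "eps j < \<eta>" "eps j * N <= \<rho>" using J[OF j] N by (auto simp: b_def field_simps)
 define \<phi> where "\<phi> y = 1/2 * (blinfun_apply X (y - x0) \<bullet> (y - x0)) + 2 * \<eta> * (norm (y - x0))\<^sup>2" for y
 define \<xi> where "\<xi> z = (\<phi> (eps j *\<^sub>R z) - P \<bullet> x0) / eps j" for z
 define \<psi> where "\<psi> y = P \<bullet> (y - x0) + \<phi> y + eps j * W j ((1/eps j) *\<^sub>R y)" for y
 define p where "p = blinfun_apply X (y - x0) + (2 * (2 * \<eta>)) *\<^sub>R (y - x0)"
 note pre = sym eps(1)[of j] less_imp_le[OF h(1)[of j]] W
 have rt1: "T (eps j) (h j) \<psi> y = eps j * T 1 (tau j) (%z. P \<bullet> z + W j z + \<xi> z) ((1/eps j) *\<^sub>R y)"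
  unfolding \<psi>_def \<xi>_def \<phi>_def tau_def by (rule rescaled_test(1)[OF pre])
 have rt2: "locally_bdd \<xi>" unfolding \<xi>_def \<phi>_def by (rule rescaled_test(2)[OF pre])
 have rt3: "norm p <= (norm X + 2 * \<bar>2 * \<eta>\<bar>) * norm (y - x0)"
  unfolding p_def by (rule rescaled_test(3)[OF pre])
 have rt4: "\<bar>\<xi> ((1/eps j) *\<^sub>R y + \<delta>) - \<xi> ((1/eps j) *\<^sub>R y) - p \<bullet> \<delta>\<bar> <= eps j * (norm X + 2 * \<bar>2 * \<eta>\<bar>) * (norm \<delta>)\<^sup>2" for \<delta>
  unfolding \<xi>_def \<phi>_def p_def by (rule rescaled_test(4)[OF pre])
 have rt5: "\<psi> y = eps j * (P \<bullet> ((1/eps j) *\<^sub>R y) + W j ((1/eps j) *\<^sub>R y) + \<xi> ((1/eps j) *\<^sub>R y))"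
  unfolding \<psi>_def \<xi>_def \<phi>_def by (rule rescaled_test(5)[OF pre])
 have le': "\<psi> y + h j * (a - 2 * \<eta>) - (h j)\<^sup>2 <= T (eps j) (h j) \<psi> y"
  using le by (simp only: \<psi>_def[abs_def] \<phi>_def add.assoc mult_zero_right add_0_right)
 have np: "norm p <= \<rho>"
 proof -
  have "norm p <= (norm X + 2 * \<bar>2 * \<eta>\<bar>) * norm (y - x0)" by (rule rt3)
  also have "\<dots> <= N * norm (y - x0)" using cN by (intro mult_right_mono) auto
  also have "\<dots> <= N * (\<rho> / N)" using y N by (intro mult_left_mono) (auto simp: dist_norm)
  finally show ?thesis using N by simp
 qed
 have "T 1 (tau j) (%z. P \<bullet> z + W j z + \<xi> z) ((1/eps j) *\<^sub>R y)
  <= P \<bullet> ((1/eps j) *\<^sub>R y) + W j ((1/eps j) *\<^sub>R y) + \<xi> ((1/eps j) *\<^sub>R y) - tau j * (H - \<eta>)"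
 proof (rule robust_superD[OF Wc rt2 np])
  show "tau j < tau0" using tau(2)[of j] ej(1) by simp
  show "\<xi> ((1/eps j) *\<^sub>R y + \<delta>) <= \<xi> ((1/eps j) *\<^sub>R y) + p \<bullet> \<delta> + \<rho> * (norm \<delta>)\<^sup>2" for \<delta>
  proof -
   have "eps j * (norm X + 2 * \<bar>2 * \<eta>\<bar>) <= eps j * N" using cN eps(1)[of j] by (intro mult_left_mono) auto
   hence "eps j * (norm X + 2 * \<bar>2 * \<eta>\<bar>) * (norm \<delta>)\<^sup>2 <= \<rho> * (norm \<delta>)\<^sup>2" using ej(3) by (intro mult_right_mono) auto
   thus ?thesis
    using rt4[of \<delta>] unfolding abs_le_iff by linarith
  qed
 qed
 hence "eps j * T 1 (tau j) (%z. P \<bullet> z + W j z + \<xi> z) ((1/eps j) *\<^sub>R y)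
  <= eps j * (P \<bullet> ((1/eps j) *\<^sub>R y) + W j ((1/eps j) *\<^sub>R y) + \<xi> ((1/eps j) *\<^sub>R y) - tau j * (H - \<eta>))"
  using eps(1)[of j] by (intro mult_left_mono) auto
 also have "\<dots> = \<psi> y - h j * (H - \<eta>)"
  unfolding rt5 right_diff_distrib[of "eps j"] using eps(1)[of j] by (simp add: tau_def)
 finally have "T (eps j) (h j) \<psi> y <= \<psi> y - h j * (H - \<eta>)" by (simp only: rt1)
 hence "h j * (a + H - 3 * \<eta> - h j) <= 0" using le' by (simp add: algebra_simps power2_eq_square)
 hence "a + H - 3 * \<eta> - h j <= 0" using h(1)[of j] by (simp add: mult_le_0_iff)
 moreover have "h j <= eps j"
 proof -
  have "eps j * eps j <= eps j * 1" using eps(1,2)[of j] by (intro mult_left_mono) auto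
  thus ?thesis using h(2)[of j] by (simp add: power2_eq_square)
 qed
 ultimately show "a + H <= 0 + e'" using ej(2) \<eta> by linarith
qed

lemma homogenization_super:
 assumes eps: "!!j. 0 < eps j" "!!j. eps j <= 1" "eps \<longlonglongrightarrow> 0" and h: "!!j. 0 < h j" "!!j. h j <= (eps j)\<^sup>2"
  and g: "uniformly_continuous_on UNIV g"
  and lower: "!!x t e. t > 0 ==> e > 0 ==>
   \<exists>r>0. \<exists>J. \<forall>j\<ge>J. \<forall>y s. dist y x < r --> \<bar>s - t\<bar> < r --> flow (eps j) (h j) g y s > ubar x t - e"
  and attained: "!!e r J. e > 0 ==> r > 0 ==>
   \<exists>j\<ge>J. \<exists>y s. dist y x0 < r \<and> \<bar>s - t0\<bar> < r \<and> flow (eps j) (h j) g y s < ubar x0 t0 + e"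
  and jet: "(a, P, X) \<in> par_subjet ubar x0 t0" and t0: "t0 > 0" and cor: "sub_corrector P H"
 shows "0 <= a + H"
proof (rule field_le_epsilon)
 fix e' :: real assume e': "e' > 0"
 define \<eta> where "\<eta> = min 1 (e' / 4)"
 have \<eta>: "\<eta> > 0" "\<eta> <= 1" "4 * \<eta> <= e'" using e' by (auto simp: \<eta>_def)
 have sym: "symmetric_op X" using jet by (simp add: par_subjet_def)
 note scales = homogenization_scales[OF eps(1,3) h]
 obtain \<rho> M tau0 where \<rho>: "\<rho> > 0" and tau0: "tau0 > 0" and cor': "!!tau. 0 < tau ==> tau < tau0 ==>
  \<exists>W. (\<forall>x. \<bar>W x\<bar> <= M) \<and> robust_sub (T 1 tau) \<rho> (%y. P \<bullet> y + W y) (tau * (H + \<eta>))"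
  by (rule sub_correctorE[OF cor \<eta>(1)]) blast
 define tau where "tau j = h j / eps j" for j
 have tau: "tau j > 0" "tau j <= eps j" for j using scales(3)[of j] h eps by (auto simp: tau_def)
 have "\<exists>W. (\<forall>x. \<bar>W x\<bar> <= \<bar>M\<bar>) \<and> (tau j < tau0 --> robust_sub (T 1 (tau j)) \<rho> (%y. P \<bullet> y + W y) (tau j * (H + \<eta>)))" for j
 proof (cases "tau j < tau0")
  case True
  thus ?thesis using cor'[OF tau(1) True] abs_ge_self[of M] order_trans by blast
 next
  case False
  thus ?thesis by (intro exI[of _ "%_. 0"]) simp
 qed
 hence "\<exists>W. \<forall>j. (\<forall>x. \<bar>W j x\<bar> <= \<bar>M\<bar>) \<and> (tau j < tau0 --> robust_sub (T 1 (tau j)) \<rho> (%y. P \<bullet> y + W j y) (tau j * (H + \<eta>)))"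
  by (intro choice allI)
 then obtain W where W: "!!j x. \<bar>W j x\<bar> <= \<bar>M\<bar>"
  and Wc: "!!j. tau j < tau0 ==> robust_sub (T 1 (tau j)) \<rho> (%y. P \<bullet> y + W j y) (tau j * (H + \<eta>))"
  by blast
 define N where "N = norm X + 4"
 have N: "N > 0" by (simp add: N_def add_nonneg_pos)
 have cN: "norm X + 2 * \<bar>- 2 * \<eta>\<bar> <= N" using \<eta> by (simp add: N_def)
 define b where "b = min tau0 (min \<eta> (\<rho> / N))"
 have b: "b > 0" using tau0 \<eta> \<rho> N by (simp add: b_def)
 obtain J where J: "!!j. j >= J ==> eps j < b"
  using order_tendstoD(2)[OF eps(3) b] by (auto simp: eventually_sequentially)
 have r: "\<rho> / N > 0" using \<rho> N by simp
 have kap: "(%j. eps j * \<bar>M\<bar>) \<longlonglongrightarrow> 0" using tendsto_mult_left_zero[OF eps(3)] .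
 have "\<exists>j\<ge>J. \<exists>y. dist y x0 < \<rho> / N \<and>
  P \<bullet> (y - x0) + 1/2 * (blinfun_apply X (y - x0) \<bullet> (y - x0)) - 2 * \<eta> * (norm (y - x0))\<^sup>2 + eps j * W j ((1/eps j) *\<^sub>R y)
   + h j * (a + 2 * \<eta>) + (h j)\<^sup>2
  >= T (eps j) (h j) (%y. P \<bullet> (y - x0) + 1/2 * (blinfun_apply X (y - x0) \<bullet> (y - x0)) - 2 * \<eta> * (norm (y - x0))\<^sup>2 + eps j * W j ((1/eps j) *\<^sub>R y)) y
   - h j * 0"
 proof (rule discrete_test_super[where u = "%j. flow (eps j) (h j) g" and S = "%j. T (eps j) (h j)" and c = "%j y. 0"
    and W = "%j y. eps j * W j ((1/eps j) *\<^sub>R y)", OF _ scales(2) h(1) scales(1) _ _ lower attained jet t0 \<eta>(1) _ kap r])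
  show "local_mono (T (eps j) (h j)) (reach (eps j) (h j))" for j
   by (rule T_local_mono) (use eps(1) h(1) less_imp_le in blast)+
  show "\<exists>B. \<forall>x t. norm x <= R --> 0 <= t --> t <= R --> \<bar>flow (eps j) (h j) g x t\<bar> <= B" for j R
  proof -
   have "h j <= 1" using h(2)[of j] power_le_one[of "eps j" 2] eps(1,2)[of j] by linarith
   thus ?thesis using flow_bounded[OF eps(1,2) g, of R j] h(1) by blast
  qed
  show "flow (eps j) (h j) g x t >= T (eps j) (h j) (%y. flow (eps j) (h j) g y (t - h j)) x - h j * 0" if "t >= h j" for j x t
   using flow_step[OF h(1) that] by simp
  show "\<bar>eps j * W j ((1/eps j) *\<^sub>R y)\<bar> <= eps j * \<bar>M\<bar>" for j y using W eps(1)[of j] by (simp add: abs_mult)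
 qed
 then obtain j y where j: "j >= J" and y: "dist y x0 < \<rho> / N"
  and le: "P \<bullet> (y - x0) + 1/2 * (blinfun_apply X (y - x0) \<bullet> (y - x0)) - 2 * \<eta> * (norm (y - x0))\<^sup>2 + eps j * W j ((1/eps j) *\<^sub>R y)
   + h j * (a + 2 * \<eta>) + (h j)\<^sup>2
  >= T (eps j) (h j) (%y. P \<bullet> (y - x0) + 1/2 * (blinfun_apply X (y - x0) \<bullet> (y - x0)) - 2 * \<eta> * (norm (y - x0))\<^sup>2 + eps j * W j ((1/eps j) *\<^sub>R y)) y
   - h j * 0"
  by blast
 have ej: "eps j < tau0" "eps j < \<eta>" "eps j * N <= \<rho>" using J[OF j] N by (auto simp: b_def field_simps)
 define \<phi> where "\<phi> y = 1/2 * (blinfun_apply X (y - x0) \<bullet> (y - x0)) + - 2 * \<eta> * (norm (y - x0))\<^sup>2" for y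
 define \<xi> where "\<xi> z = (\<phi> (eps j *\<^sub>R z) - P \<bullet> x0) / eps j" for z
 define \<psi> where "\<psi> y = P \<bullet> (y - x0) + \<phi> y + eps j * W j ((1/eps j) *\<^sub>R y)" for y
 define p where "p = blinfun_apply X (y - x0) + (2 * (- 2 * \<eta>)) *\<^sub>R (y - x0)"
 note pre = sym eps(1)[of j] less_imp_le[OF h(1)[of j]] W
 have rt1: "T (eps j) (h j) \<psi> y = eps j * T 1 (tau j) (%z. P \<bullet> z + W j z + \<xi> z) ((1/eps j) *\<^sub>R y)"
  unfolding \<psi>_def \<xi>_def \<phi>_def tau_def by (rule rescaled_test(1)[OF pre])
 have rt2: "locally_bdd \<xi>" unfolding \<xi>_def \<phi>_def by (rule rescaled_test(2)[OF pre])
 have rt3: "norm p <= (norm X + 2 * \<bar>- 2 * \<eta>\<bar>) * norm (y - x0)"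
  unfolding p_def by (rule rescaled_test(3)[OF pre])
 have rt4: "\<bar>\<xi> ((1/eps j) *\<^sub>R y + \<delta>) - \<xi> ((1/eps j) *\<^sub>R y) - p \<bullet> \<delta>\<bar> <= eps j * (norm X + 2 * \<bar>- 2 * \<eta>\<bar>) * (norm \<delta>)\<^sup>2" for \<delta>
  unfolding \<xi>_def \<phi>_def p_def by (rule rescaled_test(4)[OF pre])
 have rt5: "\<psi> y = eps j * (P \<bullet> ((1/eps j) *\<^sub>R y) + W j ((1/eps j) *\<^sub>R y) + \<xi> ((1/eps j) *\<^sub>R y))"
  unfolding \<psi>_def \<xi>_def \<phi>_def by (rule rescaled_test(5)[OF pre])
 have le': "\<psi> y + h j * (a + 2 * \<eta>) + (h j)\<^sup>2 >= T (eps j) (h j) \<psi> y"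
  using le by (simp add: \<psi>_def[abs_def] \<phi>_def add.assoc algebra_simps)
 have np: "norm p <= \<rho>"
 proof -
  have "norm p <= (norm X + 2 * \<bar>- 2 * \<eta>\<bar>) * norm (y - x0)" by (rule rt3)
  also have "\<dots> <= N * norm (y - x0)" using cN by (intro mult_right_mono) auto
  also have "\<dots> <= N * (\<rho> / N)" using y N by (intro mult_left_mono) (auto simp: dist_norm)
  finally show ?thesis using N by simp
 qed
 have "T 1 (tau j) (%z. P \<bullet> z + W j z + \<xi> z) ((1/eps j) *\<^sub>R y)
  >= P \<bullet> ((1/eps j) *\<^sub>R y) + W j ((1/eps j) *\<^sub>R y) + \<xi> ((1/eps j) *\<^sub>R y) - tau j * (H + \<eta>)"
 proof (rule robust_subD[OF Wc rt2 np])
  show "tau j < tau0" using tau(2)[of j] ej(1) by simp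
  show "\<xi> ((1/eps j) *\<^sub>R y + \<delta>) >= \<xi> ((1/eps j) *\<^sub>R y) + p \<bullet> \<delta> - \<rho> * (norm \<delta>)\<^sup>2" for \<delta>
  proof -
   have "eps j * (norm X + 2 * \<bar>- 2 * \<eta>\<bar>) <= eps j * N" using cN eps(1)[of j] by (intro mult_left_mono) auto
   hence "eps j * (norm X + 2 * \<bar>- 2 * \<eta>\<bar>) * (norm \<delta>)\<^sup>2 <= \<rho> * (norm \<delta>)\<^sup>2" using ej(3) by (intro mult_right_mono) auto
   thus ?thesis
    using rt4[of \<delta>] unfolding abs_le_iff by linarith
  qed
 qed
 hence "eps j * T 1 (tau j) (%z. P \<bullet> z + W j z + \<xi> z) ((1/eps j) *\<^sub>R y)
  >= eps j * (P \<bullet> ((1/eps j) *\<^sub>R y) + W j ((1/eps j) *\<^sub>R y) + \<xi> ((1/eps j) *\<^sub>R y) - tau j * (H + \<eta>))"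
  using eps(1)[of j] by (intro mult_left_mono) auto
 moreover have "eps j * (P \<bullet> ((1/eps j) *\<^sub>R y) + W j ((1/eps j) *\<^sub>R y) + \<xi> ((1/eps j) *\<^sub>R y) - tau j * (H + \<eta>)) = \<psi> y - h j * (H + \<eta>)"
  unfolding rt5 right_diff_distrib[of "eps j"] using eps(1)[of j] by (simp add: tau_def)
 ultimately have "\<psi> y - h j * (H + \<eta>) <= T (eps j) (h j) \<psi> y" by (simp only: rt1)
 hence "0 <= h j * (a + H + 3 * \<eta> + h j)" using le' by (simp add: algebra_simps power2_eq_square)
 hence "0 <= a + H + 3 * \<eta> + h j" using h(1)[of j] by (simp add: zero_le_mult_iff)
 moreover have "h j <= eps j"
 proof -
  have "eps j * eps j <= eps j * 1" using eps(1,2)[of j] by (intro mult_left_mono) auto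
  thus ?thesis using h(2)[of j] by (simp add: power2_eq_square)
 qed
 ultimately show "0 <= a + H + e'" using ej(2) \<eta> by linarith
qed

end

section \<open>Upper semicontinuous functions and their maxima\<close>

definition usc :: "('a::topological_space => real) => bool" where
 "usc f \<longleftrightarrow> (\<forall>z e. e > 0 --> (\<forall>\<^sub>F y in nhds z. f y < f z + e))"

lemma usc_add:
 assumes "usc f" "usc g"
 shows "usc (%z. f z + g z)"
 unfolding usc_def
proof (intro allI impI)
 fix z and e :: real assume "e > 0"
 hence "e / 2 > 0" by simp
 hence "\<forall>\<^sub>F y in nhds z. f y < f z + e / 2" "\<forall>\<^sub>F y in nhds z. g y < g z + e / 2" using assms unfolding usc_def by blast+
 thus "\<forall>\<^sub>F y in nhds z. f y + g y < f z + g z + e" by eventually_elim simp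
qed

lemma usc_continuous:
 assumes "continuous_on UNIV f"
 shows "usc f"
 unfolding usc_def
proof (intro allI impI)
 fix z and e :: real assume "e > 0"
 have "(f \<longlongrightarrow> f z) (nhds z)" using assms unfolding continuous_on_def tendsto_at_iff_tendsto_nhds by blast
 thus "\<forall>\<^sub>F y in nhds z. f y < f z + e" by (rule order_tendstoD) (use \<open>e > 0\<close> in simp)
qed

lemma usc_compose:
 assumes "usc f" "continuous_on UNIV p"
 shows "usc (%z. f (p z))"
 unfolding usc_def
proof (intro allI impI)
 fix z and e :: real assume "e > 0"
 have "filterlim p (nhds (p z)) (nhds z)" using assms(2) unfolding continuous_on_def tendsto_at_iff_tendsto_nhds by blast
 moreover have "\<forall>\<^sub>F y in nhds (p z). f y < f (p z) + e" using assms(1) \<open>e > 0\<close> unfolding usc_def by blast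
 ultimately show "\<forall>\<^sub>F y in nhds z. f (p y) < f (p z) + e" by (rule eventually_compose_filterlim[rotated])
qed

lemma usc_increasing:
 assumes f: "usc f" and \<theta>: "mono \<theta>" "continuous_on UNIV \<theta>"
 shows "usc (%z. \<theta> (f z) :: real)"
 unfolding usc_def
proof (intro allI impI)
 fix z and e :: real assume "e > 0"
 have "isCont \<theta> (f z)" using \<theta>(2) by (simp add: continuous_on_eq_continuous_at)
 then obtain r where r: "r > 0" "!!x. dist x (f z) < r ==> dist (\<theta> x) (\<theta> (f z)) < e"
  unfolding continuous_at_eps_delta using \<open>e > 0\<close> by blast
 have "\<forall>\<^sub>F y in nhds z. f y < f z + r / 2" using f r(1) unfolding usc_def by (meson half_gt_zero)
 thus "\<forall>\<^sub>F y in nhds z. \<theta> (f y) < \<theta> (f z) + e"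
 proof eventually_elim
  case (elim y)
  have "\<theta> (f y) <= \<theta> (f z + r / 2)" using elim by (intro monoD[OF \<theta>(1)]) simp
  also have "\<dots> < \<theta> (f z) + e" using r(2)[of "f z + r / 2"] r(1) by (simp add: dist_real_def abs_less_iff)
  finally show ?case .
 qed
qed

text \<open>If every \<open>f x\<close> were exceeded by some \<open>f (b x)\<close>, finitely many
  neighbourhoods would cover \<open>K\<close>, and the largest of the corresponding values
  \<open>f (b x)\<close> would be exceeded once more.\<close>

lemma usc_attains_max:
 fixes f :: "'a::topological_space => real"
 assumes K: "compact K" "K \<noteq> {}" and f: "usc f"
 shows "\<exists>x\<in>K. \<forall>y\<in>K. f y <= f x"
proof (rule ccontr)
 assume "\<not> ?thesis"
 hence "\<forall>x\<in>K. \<exists>y. y \<in> K \<and> f y > f x" by (meson not_le)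
 then obtain b where b: "!!x. x \<in> K ==> b x \<in> K" "!!x. x \<in> K ==> f (b x) > f x" by metis
 have "\<exists>N. open N \<and> x \<in> N \<and> (\<forall>y\<in>N. f y < f (b x))" if "x \<in> K" for x
 proof -
  have "\<forall>\<^sub>F y in nhds x. f y < f x + (f (b x) - f x)" using f b(2)[OF that] unfolding usc_def by (meson diff_gt_0_iff_gt)
  thus ?thesis unfolding eventually_nhds by simp
 qed
 then obtain N where N: "!!x. x \<in> K ==> open (N x)" "!!x. x \<in> K ==> x \<in> N x" "!!x y. x \<in> K ==> y \<in> N x ==> f y < f (b x)"
  by metis
 have "K \<subseteq> (\<Union>x\<in>K. N x)" using N(2) by blast
 from compactE_image[OF K(1) N(1) this] obtain C where C: "C \<subseteq> K" "finite C" "K \<subseteq> (\<Union>x\<in>C. N x)" by blast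
 hence "C \<noteq> {}" using K(2) by auto
 hence fin: "finite ((%x. f (b x)) ` C)" "(%x. f (b x)) ` C \<noteq> {}" using C(2) by auto
 from Max_in[OF this] obtain c where c: "c \<in> C" "f (b c) = Max ((%x. f (b x)) ` C)" by auto
 hence "b c \<in> K" using b C by blast
 then obtain c' where c': "c' \<in> C" "b c \<in> N c'" using C(3) by blast
 hence "f (b c) < f (b c')" using N(3) C(1) by blast
 moreover have "f (b c') <= f (b c)" unfolding c(2) using c'(1) fin by (intro Max_ge) auto
 ultimately show False by simp
qed

text \<open>Penalised functions are nonpositive far away; a single positive value then reduces
  maximisation over a closed set to its compact part.\<close>

lemma usc_confined_max:
 fixes f :: "'a::{heine_borel,real_normed_vector} => real"
 assumes S: "closed S" and f: "usc f" and z0: "z0 \<in> S" "f z0 > 0" and R: "!!z. z \<in> S ==> f z > 0 ==> norm z <= R"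
 obtains z where "z \<in> S" "f z0 <= f z" "!!z'. z' \<in> S ==> f z' <= f z"
proof -
 have K: "compact (S \<inter> cball 0 R)" using S by (intro closed_Int_compact compact_cball)
 have z0': "z0 \<in> S \<inter> cball 0 R" using z0 R by simp
 hence "S \<inter> cball 0 R \<noteq> {}" by blast
 from usc_attains_max[OF K this f] obtain z where z: "z \<in> S \<inter> cball 0 R" "\<forall>y\<in>S \<inter> cball 0 R. f y <= f z" by blast
 have "f z' <= f z" if "z' \<in> S" for z'
 proof (cases "f z' > 0")
  case True
  thus ?thesis using z(2) R[OF that True] that by simp
 next
  case False
  thus ?thesis using bspec[OF z(2) z0'] z0(2) by simp
 qed
 thus thesis using that[of z] z(1) bspec[OF z(2) z0'] by blast
qed

section \<open>Comparison for the first-order effective equation\<close>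

text \<open>Subsolutions tested by quadratic upper bounds. The constant \<open>C\<close> is
  arbitrary and does not enter the conclusion, so the class is stable under smooth increasing
  changes of the unknown, where only first-order coefficients have to be tracked.\<close>

definition c11_sub :: "('a::real_inner => real) => ('a \<times> real => real) => bool" where
 "c11_sub H U \<longleftrightarrow> (\<forall>x t a P C r. t > 0 --> r > 0 -->
  (\<forall>y s. dist y x < r --> \<bar>s - t\<bar> < r -->
    U (y, s) <= U (x, t) + a * (s - t) + P \<bullet> (y - x) + C * ((norm (y - x))\<^sup>2 + (s - t)\<^sup>2)) --> a + H P <= 0)"

lemma c11_subD:
 assumes "c11_sub H U" "t > 0" "r > 0"
  and "!!y s. dist y x < r ==> \<bar>s - t\<bar> < r ==>
    U (y, s) <= U (x, t) + a * (s - t) + P \<bullet> (y - x) + C * ((norm (y - x))\<^sup>2 + (s - t)\<^sup>2)"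
 shows "a + H P <= 0"
 using assms(1)[unfolded c11_sub_def, rule_format, OF assms(2,3), of x a P C] assms(4) by blast

text \<open>Parabolic jets are of first order in time, so the square of the time increment
  disappears in \<open>e * abs (s - t)\<close> on a small ball.\<close>

lemma par_superjet_of_test:
 assumes r: "r > 0" and le: "!!y s. dist y x < r ==> \<bar>s - t\<bar> < r ==>
    u y s <= u x t + a * (s - t) + P \<bullet> (y - x) + C * ((norm (y - x))\<^sup>2 + (s - t)\<^sup>2)"
 shows "(a, P, (2 * C) *\<^sub>R id_blinfun) \<in> par_superjet u x t"
proof -
 have "\<exists>r'>0. \<forall>y s. s > 0 --> dist y x < r' --> \<bar>s - t\<bar> < r' -->
    u y s <= u x t + a * (s - t) + P \<bullet> (y - x)
       + (1/2) * (blinfun_apply ((2 * C) *\<^sub>R id_blinfun) (y - x) \<bullet> (y - x))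
       + e * (\<bar>s - t\<bar> + (norm (y - x))\<^sup>2)" if e: "e > 0" for e
 proof (intro exI conjI allI impI)
  show "min r (e / (\<bar>C\<bar> + 1)) > 0" using r e by simp
  fix y s assume y: "dist y x < min r (e / (\<bar>C\<bar> + 1))" and s: "\<bar>s - t\<bar> < min r (e / (\<bar>C\<bar> + 1))"
  have "C * (s - t)\<^sup>2 <= \<bar>C\<bar> * \<bar>s - t\<bar> * \<bar>s - t\<bar>"
   using mult_right_mono[OF abs_ge_self[of C], of "(s - t)\<^sup>2"] by (simp add: power2_eq_square abs_mult_self_eq mult.assoc)
  also have "\<dots> <= e * \<bar>s - t\<bar>"
  proof (rule mult_right_mono)
   have "\<bar>C\<bar> * \<bar>s - t\<bar> <= (\<bar>C\<bar> + 1) * (e / (\<bar>C\<bar> + 1))" using s by (intro mult_mono) auto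
   moreover have "(\<bar>C\<bar> + 1) * (e / (\<bar>C\<bar> + 1)) = e" using abs_ge_zero[of C] by simp
   ultimately show "\<bar>C\<bar> * \<bar>s - t\<bar> <= e" by linarith
  qed simp
  finally have "C * (s - t)\<^sup>2 <= e * \<bar>s - t\<bar>" .
  moreover have "e * (norm (y - x))\<^sup>2 >= 0" using e by simp
  moreover have "u y s <= u x t + a * (s - t) + P \<bullet> (y - x) + C * (norm (y - x))\<^sup>2 + C * (s - t)\<^sup>2"
   using le[of y s] y s by (simp add: algebra_simps)
  moreover have "(1/2) * (blinfun_apply ((2 * C) *\<^sub>R id_blinfun) (y - x) \<bullet> (y - x)) = C * (norm (y - x))\<^sup>2"
   by (simp add: blinfun.scaleR_left power2_norm_eq_inner)
  ultimately show "u y s <= u x t + a * (s - t) + P \<bullet> (y - x)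
       + (1/2) * (blinfun_apply ((2 * C) *\<^sub>R id_blinfun) (y - x) \<bullet> (y - x))
       + e * (\<bar>s - t\<bar> + (norm (y - x))\<^sup>2)" unfolding distrib_left by linarith
 qed
 thus ?thesis by (simp add: par_superjet_def symmetric_op_def blinfun.scaleR_left)
qed

lemma tan_expansion:
 assumes b: "- (pi/2) < b" "b < pi/2"
 obtains K \<delta> where "K >= 0" "\<delta> > 0" "!!x. \<bar>x\<bar> < \<delta> ==> - (pi/2) < b + x \<and> b + x < pi/2 \<and> tan (b + x) <= tan b + (1 + (tan b)\<^sup>2) * x + K * x\<^sup>2"
proof -
 define m where "m = min (pi/2 - b) (pi/2 + b) / 2"
 have m: "m > 0" "- (pi/2) < b - m" "b + m < pi/2" using b by (auto simp: m_def min_def field_simps)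
 have cz: "cos x \<noteq> 0" if "b - m <= x" "x <= b + m" for x
  using cos_gt_zero_pi[of x] that m by simp
 define D where "D k = (if k = 0 then (tan :: real => real) else if k = 1 then (%x. 1 + (tan x)\<^sup>2) else (%x. 2 * tan x * (1 + (tan x)\<^sup>2)))" for k :: nat
 have dtan: "(tan has_real_derivative 1 + (tan x)\<^sup>2) (at x)" if "b - m <= x" "x <= b + m" for x
 proof -
  have "inverse ((cos x)\<^sup>2) = 1 + (tan x)\<^sup>2" using tan_sec[OF cz[OF that]] by (simp add: power_inverse)
  thus ?thesis using DERIV_tan[OF cz[OF that]] by simp
 qed
 have "continuous_on {b - m..b + m} (D 2)"
  unfolding D_def by (auto intro!: continuous_intros dest: cz)
 hence "compact (D 2 ` {b - m..b + m})" by (intro compact_continuous_image compact_Icc)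
 then obtain B where B: "!!x. x \<in> {b - m..b + m} ==> \<bar>D 2 x\<bar> <= B"
  using compact_imp_bounded bounded_iff by (metis image_eqI real_norm_def)
 have B0: "B >= 0" using B[of b] m abs_ge_zero[of "D 2 b"] by simp
 have "tan (b + x) <= tan b + (1 + (tan b)\<^sup>2) * x + B * x\<^sup>2" if x: "\<bar>x\<bar> < m" for x
 proof (cases "x = 0")
  case False
  have "\<exists>t. (if b + x < b then b + x < t \<and> t < b else b < t \<and> t < b + x) \<and>
   tan (b + x) = (\<Sum>k<2. D k b / fact k * (b + x - b) ^ k) + D 2 t / fact 2 * (b + x - b) ^ 2"
  proof (rule Taylor[where a = "b - m" and b = "b + m"])
   show "\<forall>k t. k < 2 \<and> b - m <= t \<and> t <= b + m --> (D k has_real_derivative D (Suc k) t) (at t)"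
   proof (intro allI impI)
    fix k :: nat and t assume k: "k < 2 \<and> b - m <= t \<and> t <= b + m"
    hence "k = 0 \<or> k = 1" by auto
    thus "(D k has_real_derivative D (Suc k) t) (at t)"
    proof
     assume "k = 0"
     thus ?thesis using dtan k by (simp add: D_def)
    next
     assume k1: "k = 1"
     have "((%x. 1 + (tan x)\<^sup>2) has_real_derivative (2 * tan t * (1 + (tan t)\<^sup>2))) (at t)"
      using DERIV_add[OF DERIV_const[of 1] DERIV_power[OF dtan, of t 2]] k by (simp add: mult_ac)
     thus ?thesis by (simp add: D_def k1)
    qed
   qed
  qed (use x m False in \<open>auto simp: D_def\<close>)
  then obtain t where t: "if b + x < b then b + x < t \<and> t < b else b < t \<and> t < b + x"
   and eq: "tan (b + x) = (\<Sum>k<2. D k b / fact k * (b + x - b) ^ k) + D 2 t / fact 2 * (b + x - b) ^ 2" by blast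
  have "t \<in> {b - m..b + m}" using t x by (auto split: if_splits)
  hence "D 2 t / 2 <= B" using B[of t] B0 by (simp add: abs_le_iff)
  hence "D 2 t / 2 * x\<^sup>2 <= B * x\<^sup>2" by (intro mult_right_mono) auto
  moreover have "tan (b + x) = tan b + (1 + (tan b)\<^sup>2) * x + D 2 t / 2 * x\<^sup>2"
   using eq by (simp add: numeral_2_eq_2 D_def)
  ultimately show ?thesis by linarith
 qed simp
 thus thesis using that[of B m] B0 m by fastforce
qed

text \<open>A bound for \<open>arctan u\<close> is pushed through \<open>tan\<close>, whose
  derivative multiplies \<open>a\<close> and \<open>P\<close> by the common factor
  \<open>c = 1 + u^2\<close>. Positive homogeneity of \<open>H\<close> cancels this factor, so the
  equation is unchanged although the unknown has become bounded.\<close>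

lemma c11_sub_arctan:
 fixes u :: "'a::euclidean_space => real => real"
 assumes u: "!!x t a P X. t > 0 ==> (a, P, X) \<in> par_superjet u x t ==> a + H P <= 0"
  and hom: "!!c P. c > 0 ==> H (c *\<^sub>R P) = c * H P"
 shows "c11_sub H (%(x, t). arctan (u x t))"
 unfolding c11_sub_def prod.case
proof (intro allI impI)
 fix x t a P C r
 assume t: "t > (0::real)" and r: "r > (0::real)" and le: "\<forall>y s. dist y x < r --> \<bar>s - t\<bar> < r -->
  arctan (u y s) <= arctan (u x t) + a * (s - t) + P \<bullet> (y - x) + C * ((norm (y - x))\<^sup>2 + (s - t)\<^sup>2)"
 define b where "b = arctan (u x t)"
 have b: "- (pi/2) < b" "b < pi/2" using arctan by (auto simp: b_def)
 obtain K \<delta> where K: "K >= 0" and \<delta>: "\<delta> > 0" and tanb: "!!x. \<bar>x\<bar> < \<delta> ==> - (pi/2) < b + x \<and> b + x < pi/2 \<and> tan (b + x) <= tan b + (1 + (tan b)\<^sup>2) * x + K * x\<^sup>2"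
  using tan_expansion[OF b] by blast
 define c where "c = 1 + (u x t)\<^sup>2"
 have c: "c > 0" by (simp add: c_def add_pos_nonneg)
 \<comment> \<open>Within distance \<open>1\<close> the quadratic part is at most twice the
   increment \<open>n\<close>, hence \<open>N * n\<close> bounds the whole test increment, and
   \<open>r'\<close> keeps it in the range of the expansion of \<open>tan\<close>.\<close>
 define N where "N = \<bar>a\<bar> + norm P + 2 * \<bar>C\<bar>"
 define r' where "r' = min (min r 1) (\<delta> / (2 * N + 1))"
 have N: "N >= 0" by (simp add: N_def)
 have r': "r' > 0" using r \<delta> N by (simp add: r'_def)
 have "(c * a, c *\<^sub>R P, (2 * (c * \<bar>C\<bar> + K * (2 * N\<^sup>2))) *\<^sub>R id_blinfun) \<in> par_superjet u x t"
 proof (rule par_superjet_of_test[OF r'])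
  fix y s assume y: "dist y x < r'" and s: "\<bar>s - t\<bar> < r'"
  define Q where "Q = (norm (y - x))\<^sup>2 + (s - t)\<^sup>2"
  define l where "l = a * (s - t) + P \<bullet> (y - x)"
  define x' where "x' = l + C * Q"
  define n where "n = norm (y - x) + \<bar>s - t\<bar>"
  have n: "0 <= n" "n < 2 * r'" using y s by (auto simp: n_def dist_norm)
  have y1: "norm (y - x) <= 1" "\<bar>s - t\<bar> <= 1" using y s by (auto simp: r'_def dist_norm)
  have Qn: "Q <= 2 * n"
  proof -
   have "(norm (y - x))\<^sup>2 <= norm (y - x)" using y1(1) by (simp add: power2_eq_square mult_left_le)
   moreover have "(s - t)\<^sup>2 <= \<bar>s - t\<bar>" using y1(2) mult_left_le[of "\<bar>s - t\<bar>" "\<bar>s - t\<bar>"] by (simp add: power2_eq_square abs_mult_self_eq)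
   moreover have "A + B <= 2 * (b + c)" if "A <= b" "B <= c" "0 <= b" "0 <= c" for A B b c :: real using that by simp
   ultimately show ?thesis unfolding Q_def n_def using norm_ge_zero abs_ge_zero by blast
  qed
  have Q0: "0 <= Q" by (simp add: Q_def)
  have xl: "\<bar>x'\<bar> <= N * n"
  proof -
   have "\<bar>a * (s - t)\<bar> <= \<bar>a\<bar> * n" unfolding abs_mult by (intro mult_left_mono) (auto simp: n_def)
   moreover have "\<bar>P \<bullet> (y - x)\<bar> <= norm P * n"
    using Cauchy_Schwarz_ineq2[of P "y - x"] mult_left_mono[of "norm (y - x)" n "norm P"] by (simp add: n_def)
   moreover have "\<bar>C * Q\<bar> <= 2 * \<bar>C\<bar> * n" using mult_left_mono[OF Qn, of "\<bar>C\<bar>"] Q0 by (simp add: abs_mult)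
   ultimately have "\<bar>x'\<bar> <= \<bar>a\<bar> * n + norm P * n + 2 * \<bar>C\<bar> * n" unfolding x'_def l_def by linarith
   thus ?thesis by (simp add: N_def algebra_simps)
  qed
  have xd: "\<bar>x'\<bar> < \<delta>"
  proof -
   have "N * n <= N * (2 * (\<delta> / (2 * N + 1)))" using n N by (intro mult_left_mono) (auto simp: r'_def)
   also have "\<dots> < \<delta>" using N \<delta> by (simp add: field_simps)
   finally show ?thesis using xl by simp
  qed
  have x2: "x'\<^sup>2 <= 2 * N\<^sup>2 * Q"
  proof -
   have "x'\<^sup>2 <= (N * n)\<^sup>2" using power_mono[OF xl abs_ge_zero, of 2] by simp
   also have "\<dots> = N\<^sup>2 * n\<^sup>2" by (simp add: power_mult_distrib)
   also have "\<dots> <= N\<^sup>2 * (2 * Q)"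
   proof (rule mult_left_mono)
    show "n\<^sup>2 <= 2 * Q" using sum_squares_bound[of "norm (y - x)" "\<bar>s - t\<bar>"] by (simp add: n_def Q_def power2_sum)
   qed simp
   finally show ?thesis by (simp add: mult_ac)
  qed
  have "arctan (u y s) <= b + x'"
   using le[rule_format, of y s] y s unfolding b_def x'_def l_def Q_def by (simp add: r'_def add.assoc)
  hence "tan (arctan (u y s)) <= tan (b + x')"
   using tanb[OF xd] arctan_lbound[of "u y s"] by (intro tan_mono_le) auto
  hence "u y s <= u x t + c * x' + K * x'\<^sup>2"
   using tanb[OF xd] by (simp add: b_def c_def tan_arctan)
  moreover have "K * x'\<^sup>2 <= K * (2 * N\<^sup>2 * Q)" using x2 K by (intro mult_left_mono)
  moreover have "c * (C * Q) <= c * (\<bar>C\<bar> * Q)" using c Q0 by (intro mult_left_mono mult_right_mono) auto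
  ultimately have "u y s <= u x t + c * l + (c * (\<bar>C\<bar> * Q) + K * (2 * N\<^sup>2 * Q))"
   by (simp add: x'_def distrib_left)
  thus "u y s <= u x t + c * a * (s - t) + (c *\<^sub>R P) \<bullet> (y - x)
    + (c * \<bar>C\<bar> + K * (2 * N\<^sup>2)) * ((norm (y - x))\<^sup>2 + (s - t)\<^sup>2)"
   unfolding Q_def[symmetric] by (simp add: l_def algebra_simps)
 qed
 from u[OF t this] have "c * (a + H P) <= 0" using hom[OF c] by (simp add: distrib_left)
 thus "a + H P <= 0" using c by (simp add: mult_le_0_iff)
qed

lemma c11_sub_touching:
 fixes U :: "'a::real_inner \<times> real => real"
 assumes U: "c11_sub H U" and t: "t > 0"
  and max: "!!y s. s >= 0 ==> U (y, s) <= U (x, t) + a * (s - t) + P \<bullet> (y - x) + C * ((norm (y - x))\<^sup>2 + (s - t)\<^sup>2)"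
 shows "a + H P <= 0"
proof (rule c11_subD[OF U t t])
 fix y s assume "\<bar>s - t\<bar> < t"
 hence "s >= 0" by linarith
 thus "U (y, s) <= U (x, t) + a * (s - t) + P \<bullet> (y - x) + C * ((norm (y - x))\<^sup>2 + (s - t)\<^sup>2)" by (rule max)
qed

lemma square_le_imp_le:
 fixes p c :: real
 assumes "p\<^sup>2 <= c"
 shows "p <= c + 1"
proof -
 have "0 <= (p - 1/2)\<^sup>2" by simp
 thus ?thesis using assms by (simp add: power2_eq_square algebra_simps)
qed

lemma norm_sq_shift:
 fixes y x :: "'a::real_inner"
 shows "(norm (y - c))\<^sup>2 = (norm (x - c))\<^sup>2 + 2 * ((x - c) \<bullet> (y - x)) + (norm (y - x))\<^sup>2"
proof -
 have "y - c = (x - c) + (y - x)" by simp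
 thus ?thesis by (simp only: power2_norm_eq_inner inner_add_left inner_add_right) (simp add: inner_commute)
qed

lemma norm_le_fst_snd: "norm z <= norm (fst z) + norm (snd z)"
 by (metis norm_Pair_le prod.collapse)

text \<open>A paraboloid rising with speed \<open>K\<close> cannot be touched by a subsolution once
  \<open>K\<close> exceeds \<open>abs (H P)\<close> for every gradient possible at a contact
  point.\<close>

lemma initial_estimate:
 fixes U :: "'a::euclidean_space \<times> real => real"
 assumes U: "usc U" "!!z. \<bar>U z\<bar> <= 2" and H: "c11_sub H U" "continuous_on UNIV H"
  and init: "!!x. U (x, 0) <= \<gamma> x" and \<gamma>: "!!x. \<bar>\<gamma> x\<bar> <= 2" "uniformly_continuous_on UNIV \<gamma>" and e: "e > 0"
 shows "\<exists>B K. B >= 0 \<and> K >= 0 \<and> (\<forall>x x0 t. t >= 0 --> U (x, t) <= \<gamma> x0 + e + B * (norm (x - x0))\<^sup>2 + K * t)"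
proof -
 obtain \<delta> where \<delta>: "\<delta> > 0" "!!x y. dist x y < \<delta> ==> dist (\<gamma> x) (\<gamma> y) < e"
  using \<gamma>(2) e unfolding uniformly_continuous_on_def by (metis UNIV_I dist_commute)
 \<comment> \<open>Beyond distance \<delta> the quadratic is at least \<open>4\<close>, the maximal
   oscillation of \<gamma>.\<close>
 define B where "B = 4 / \<delta>\<^sup>2"
 have B: "B > 0" using \<delta> by (simp add: B_def)
 have mod: "\<gamma> x <= \<gamma> x0 + e + B * (norm (x - x0))\<^sup>2" for x x0
 proof (cases "dist x x0 < \<delta>")
  case True
  hence "\<gamma> x <= \<gamma> x0 + e" using \<delta>(2)[OF True] by (simp add: dist_real_def)
  thus ?thesis using B by (simp add: add_increasing2)
 next
  case False
  hence "\<delta>\<^sup>2 <= (norm (x - x0))\<^sup>2" using \<delta>(1) by (intro power_mono) (auto simp: dist_norm)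
  hence "B * \<delta>\<^sup>2 <= B * (norm (x - x0))\<^sup>2" using B by (intro mult_left_mono) auto
  hence "4 <= B * (norm (x - x0))\<^sup>2" using \<delta>(1) by (simp add: B_def)
  thus ?thesis using \<gamma>(1)[of x] \<gamma>(1)[of x0] e unfolding abs_le_iff by linarith
 qed
 \<comment> \<open>At a contact point \<open>B * norm (x - x0)^2 <= 4\<close>, so the gradient has
   squared norm at most \<open>16 * B\<close>, and therefore norm at most
   \<open>16 * B + 1\<close>.\<close>
 have "bounded (H ` cball 0 (16 * B + 1))"
  by (intro compact_imp_bounded compact_continuous_image continuous_on_subset[OF H(2)] compact_cball subset_UNIV)
 then obtain K0 where "\<forall>x\<in>H ` cball 0 (16 * B + 1). norm x <= K0" unfolding bounded_iff by blast
 hence K0: "!!P. norm P <= 16 * B + 1 ==> \<bar>H P\<bar> <= K0" by simp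
 define K where "K = \<bar>K0\<bar> + 1"
 have K: "K > 0" by (simp add: K_def)
 have "U (x1, t1) <= \<gamma> x0 + e + B * (norm (x1 - x0))\<^sup>2 + K * t1" if t1: "t1 >= 0" for x1 x0 t1
 proof (rule ccontr)
  assume "\<not> ?thesis"
  hence pos: "U (x1, t1) > \<gamma> x0 + e + B * (norm (x1 - x0))\<^sup>2 + K * t1" by simp
  define \<phi> where "\<phi> z = \<gamma> x0 + e + B * (norm (fst z - x0))\<^sup>2 + K * snd z" for z :: "'a \<times> real"
  define f where "f z = U z + - \<phi> z" for z
  have "continuous_on UNIV (%z. - \<phi> z)" unfolding \<phi>_def by (intro continuous_intros)
  hence f: "usc f" unfolding f_def by (intro usc_add U usc_continuous)
  have S: "closed {z :: 'a \<times> real. snd z >= 0}" by (intro closed_Collect_le continuous_intros)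
  have small: "B * (norm (fst z - x0))\<^sup>2 + K * snd z <= 4" if "f z > 0" for z
   using that U(2)[of z] \<gamma>(1)[of x0] e unfolding f_def \<phi>_def abs_le_iff by linarith
  have xs: "B * (norm (fst z - x0))\<^sup>2 <= 4" if "f z > 0" "snd z >= 0" for z
   using small[OF that(1)] mult_nonneg_nonneg[OF less_imp_le[OF K] that(2)] by linarith
  have "norm z <= norm x0 + (4 / B + 1) + 4 / K" if z: "z \<in> {z. snd z >= 0}" "f z > 0" for z
  proof -
   have s: "snd z >= 0" using z by simp
   have "(norm (fst z - x0))\<^sup>2 <= 4 / B" using xs[OF z(2) s] B by (simp add: le_divide_eq mult.commute)
   hence 1: "norm (fst z - x0) <= 4 / B + 1" by (rule square_le_imp_le)
   have "B * (norm (fst z - x0))\<^sup>2 >= 0" using B by simp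
   hence "K * snd z <= 4" using small[OF z(2)] by linarith
   hence 2: "snd z <= 4 / K" using K by (simp add: le_divide_eq mult.commute)
   have "norm (fst z) <= norm x0 + norm (fst z - x0)" by (rule norm_triangle_sub)
   thus ?thesis using 1 2 norm_le_fst_snd[of z] s by simp
  qed
  from usc_confined_max[OF S f _ _ this, of "(x1, t1)"]
  obtain z where z: "z \<in> {z. snd z >= 0}" "f (x1, t1) <= f z" "!!z'. z' \<in> {z. snd z >= 0} ==> f z' <= f z"
   using t1 pos by (auto simp: f_def \<phi>_def)
  obtain x t where xt: "z = (x, t)" by (cases z)
  have fz: "f z > 0" using z(2) pos by (simp add: f_def \<phi>_def)
  have "t \<noteq> 0"
  proof
   assume "t = 0"
   hence "f z <= 0" using init[of x] mod[of x x0] by (simp add: f_def \<phi>_def xt)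
   thus False using fz by simp
  qed
  hence t: "t > 0" using z(1) by (simp add: xt)
  have "K + H ((2 * B) *\<^sub>R (x - x0)) <= 0"
  proof (rule c11_sub_touching[OF H(1) t, where x = x and C = B])
   fix y s assume "s >= (0::real)"
   hence "f (y, s) <= f (x, t)" using z(3) xt by simp
   moreover have "B * (norm (y - x0))\<^sup>2 = B * (norm (x - x0))\<^sup>2 + ((2 * B) *\<^sub>R (x - x0)) \<bullet> (y - x) + B * (norm (y - x))\<^sup>2"
    unfolding norm_sq_shift[of y x0 x] by (simp add: algebra_simps)
   ultimately have "U (y, s) <= U (x, t) + K * (s - t) + ((2 * B) *\<^sub>R (x - x0)) \<bullet> (y - x) + B * (norm (y - x))\<^sup>2"
    by (simp add: f_def \<phi>_def right_diff_distrib)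
   moreover have "B * (s - t)\<^sup>2 >= 0" using B by simp
   ultimately show "U (y, s) <= U (x, t) + K * (s - t) + ((2 * B) *\<^sub>R (x - x0)) \<bullet> (y - x) + B * ((norm (y - x))\<^sup>2 + (s - t)\<^sup>2)"
    unfolding distrib_left by linarith
  qed
  moreover have "norm ((2 * B) *\<^sub>R (x - x0)) <= 16 * B + 1"
  proof (rule square_le_imp_le)
   have "(norm ((2 * B) *\<^sub>R (x - x0)))\<^sup>2 = 4 * B * (B * (norm (x - x0))\<^sup>2)" by (simp add: power2_eq_square)
   also have "\<dots> <= 4 * B * 4" using xs[OF fz] t B by (intro mult_left_mono) (auto simp: xt)
   finally show "(norm ((2 * B) *\<^sub>R (x - x0)))\<^sup>2 <= 16 * B" by simp
  qed
  ultimately show False using K0[of "(2 * B) *\<^sub>R (x - x0)"] by (simp add: K_def)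
 qed
 thus ?thesis using B K less_imp_le by blast
qed

text \<open>\<open>W\<close> stands for minus a supersolution, so both functions are upper
  semicontinuous and share one test class, with the reflected Hamiltonian for \<open>W\<close>. In
  the doubled problem \<open>kp * t\<close> makes the inequality strict and the \<eta> term confines
  the maximum. Since \<open>H\<close> depends on the gradient alone, the two gradients differ only
  by the slope \<open>Q\<close> of the confining term.\<close>

lemma c11_comparison:
 fixes U W :: "'a::euclidean_space \<times> real => real"
 assumes U: "usc U" "!!z. \<bar>U z\<bar> <= 2" "c11_sub H U" and W: "usc W" "!!z. \<bar>W z\<bar> <= 2" "c11_sub (%P. - H (- P)) W"
  and H: "continuous_on UNIV H" and initU: "!!x. U (x, 0) <= \<gamma> x" and initW: "!!x. W (x, 0) <= - \<gamma> x"
  and \<gamma>: "!!x. \<bar>\<gamma> x\<bar> <= 2" "uniformly_continuous_on UNIV \<gamma>" and t1: "t1 >= 0"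
 shows "U (x1, t1) + W (x1, t1) <= 0"
proof (rule ccontr)
 assume "\<not> ?thesis"
 hence pos: "U (x1, t1) + W (x1, t1) > 0" by simp
 \<comment> \<open>The penalties at \<open>((x1, t1), (x1, t1))\<close> cost at most one
   \<open>sig\<close> each and leave \<open>3 * sig\<close>, whereas at most \<open>2 * sig\<close>
   is possible if one of the two times is zero.\<close>
 define sig where "sig = (U (x1, t1) + W (x1, t1)) / 5"
 have sig: "sig > 0" "sig / 2 > 0" using pos by (auto simp: sig_def)
 have H': "continuous_on UNIV (%P. - H (- P))"
  by (intro continuous_intros continuous_on_compose2[OF H]) auto
 have \<gamma>': "uniformly_continuous_on UNIV (%x. - \<gamma> x)" using uniformly_continuous_on_minus[OF \<gamma>(2)] .
 obtain B1 K1 where 1: "B1 >= 0" "K1 >= 0" "!!x x0 t. t >= 0 ==> U (x, t) <= \<gamma> x0 + sig / 2 + B1 * (norm (x - x0))\<^sup>2 + K1 * t"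
  using initial_estimate[OF U H initU \<gamma> sig(2)] by blast
 obtain B2 K2 where 2: "B2 >= 0" "K2 >= 0" "!!x x0 t. t >= 0 ==> W (x, t) <= - \<gamma> x0 + sig / 2 + B2 * (norm (x - x0))\<^sup>2 + K2 * t"
  using initial_estimate[OF W H' initW _ \<gamma>' sig(2)] \<gamma>(1) by auto
 define N where "N = B1 + B2 + K1 + K2 + 1"
 have N: "N > 0" using 1 2 by (simp add: N_def)
 define m where "m = min 1 (sig / N)"
 have m: "m > 0" "m <= 1" "m * N <= sig" using sig N by (auto simp: m_def min_def le_divide_eq)
 have est: "sig / 2 + B * b\<^sup>2 + K * c <= 2 * sig" if B: "0 <= B" "0 <= K" "B + K <= N" and b: "0 <= b" "b <= m" "c <= m" for B K b c
 proof -
  have "b\<^sup>2 <= m\<^sup>2" using b by (intro power_mono)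
  also have "m\<^sup>2 <= m" using m mult_left_le[of m m] by (simp add: power2_eq_square)
  finally have "b\<^sup>2 <= m" .
  hence "B * b\<^sup>2 + K * c <= B * m + K * m" using B b by (intro add_mono mult_left_mono) auto
  also have "\<dots> <= N * m" using mult_right_mono[OF B(3), of m] m(1) by (simp add: distrib_right)
  finally show ?thesis using m(3) sig by (simp add: mult.commute)
 qed
 \<comment> \<open>The sum of \<open>U\<close> and \<open>W\<close> is at most \<open>4\<close>, so
   with this \<open>A\<close> a positive value of the doubled function forces the two points within
   \<open>m\<close> of each other.\<close>
 define A where "A = 4 / m\<^sup>2"
 have A: "A > 0" "A * m\<^sup>2 = 4" using m by (auto simp: A_def)
 define kp where "kp = sig / (t1 + 1)"
 have kp: "kp > 0" "kp * t1 <= sig" using sig t1 by (auto simp: kp_def field_simps)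
 have "uniformly_continuous_on (cball 0 (2 * A * m + 1)) H"
  by (intro compact_uniformly_continuous continuous_on_subset[OF H] compact_cball subset_UNIV)
 then obtain \<delta>0 where \<delta>0: "\<delta>0 > 0" "!!P Q. P \<in> cball 0 (2 * A * m + 1) ==> Q \<in> cball 0 (2 * A * m + 1) ==> dist P Q < \<delta>0 ==> dist (H P) (H Q) < kp"
  using kp(1) unfolding uniformly_continuous_on_def by (metis dist_commute)
 define \<delta> where "\<delta> = min \<delta>0 1"
 have \<delta>: "\<delta> > 0" "\<delta> <= 1" "\<delta> <= \<delta>0" using \<delta>0 by (auto simp: \<delta>_def)
 \<comment> \<open>The confining slope satisfies
   \<open>norm Q^2 = 4 * \<eta> * (\<eta> * norm x^2) <= 16 * \<eta>\<close>; the \<open>17\<close>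
   makes \<open>norm Q < \<delta>\<close> strict.\<close>
 define \<eta> where "\<eta> = min (\<delta>\<^sup>2 / 17) (sig / ((norm x1)\<^sup>2 + 1))"
 have \<eta>: "\<eta> > 0" "16 * \<eta> < \<delta>\<^sup>2" "\<eta> * (norm x1)\<^sup>2 <= sig"
 proof -
  have n: "(norm x1)\<^sup>2 + 1 > 0" by (simp add: add_nonneg_pos)
  show "\<eta> > 0" using \<delta>(1) sig n by (simp add: \<eta>_def)
  have "\<delta>\<^sup>2 > 0" using \<delta>(1) by simp
  moreover have "\<eta> <= \<delta>\<^sup>2 / 17" unfolding \<eta>_def by (rule min.cobounded1)
  ultimately show "16 * \<eta> < \<delta>\<^sup>2" by linarith
  have "\<eta> * (norm x1)\<^sup>2 <= sig / ((norm x1)\<^sup>2 + 1) * (norm x1)\<^sup>2" by (intro mult_right_mono) (auto simp: \<eta>_def)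
  also have "\<dots> <= sig" using n sig by (simp add: field_simps)
  finally show "\<eta> * (norm x1)\<^sup>2 <= sig" .
 qed
 define pen where "pen z = A * ((norm (fst (fst z) - fst (snd z)))\<^sup>2 + (snd (fst z) - snd (snd z))\<^sup>2)
  + kp * snd (fst z) + \<eta> * (norm (fst (fst z)))\<^sup>2" for z :: "('a \<times> real) \<times> ('a \<times> real)"
 define f where "f z = U (fst z) + W (snd z) + - pen z" for z
 have penc: "continuous_on UNIV pen" unfolding pen_def by (intro continuous_intros)
 have f: "usc f" unfolding f_def
  by (intro usc_add usc_compose[OF U(1)] usc_compose[OF W(1)] usc_continuous continuous_intros penc)
 define S where "S = {z :: ('a \<times> real) \<times> ('a \<times> real). 0 <= snd (fst z)} \<inter> {z. 0 <= snd (snd z)}"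
 have S: "closed S" unfolding S_def by (intro closed_Int closed_Collect_le continuous_intros)
 have small: "A * (norm (x - y))\<^sup>2 <= 4 \<and> A * (t - s)\<^sup>2 <= 4 \<and> kp * t <= 4 \<and> \<eta> * (norm x)\<^sup>2 <= 4"
  if "f ((x, t), (y, s)) > 0" "t >= 0" for x t y s
 proof -
  have "pen ((x, t), (y, s)) <= 4" using that(1) U(2)[of "(x, t)"] W(2)[of "(y, s)"] unfolding f_def abs_le_iff by simp
  hence "A * (norm (x - y))\<^sup>2 + A * (t - s)\<^sup>2 + kp * t + \<eta> * (norm x)\<^sup>2 <= 4" by (simp add: pen_def distrib_left)
  moreover have "0 <= A * (norm (x - y))\<^sup>2" "0 <= A * (t - s)\<^sup>2" "0 <= kp * t" "0 <= \<eta> * (norm x)\<^sup>2" using A kp \<eta> that(2) by auto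
  ultimately show ?thesis by linarith
 qed
 have near: "b <= m" if "A * b\<^sup>2 <= 4" "0 <= b" for b
 proof -
  have "A * b\<^sup>2 <= A * m\<^sup>2" unfolding A(2) by (rule that(1))
  hence "b\<^sup>2 <= m\<^sup>2" by (rule mult_left_le_imp_le[OF _ A(1)])
  thus ?thesis by (rule power2_le_imp_le[OF _ less_imp_le[OF m(1)]])
 qed
 have close: "norm (x - y) <= m \<and> \<bar>t - s\<bar> <= m" if "f ((x, t), (y, s)) > 0" "t >= 0" for x t y s
  using small[OF that] near[of "norm (x - y)"] near[of "\<bar>t - s\<bar>"] by (simp only: norm_ge_zero abs_ge_zero power2_abs simp_thms)
 have f0: "f ((x1, t1), (x1, t1)) >= 3 * sig" using kp(2) \<eta>(3) by (simp add: f_def pen_def sig_def)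
 have "norm z <= (4 / \<eta> + 1) + 4 / kp + ((4 / \<eta> + 1) + 1) + (4 / kp + 1)" if z: "z \<in> S" "f z > 0" for z
 proof -
  obtain x t y s where zz: "z = ((x, t), (y, s))" by (metis prod.collapse)
  have ts: "t >= 0" "s >= 0" using z(1) by (auto simp: S_def zz)
  note sm = small[OF z(2)[unfolded zz] ts(1)] and cl = close[OF z(2)[unfolded zz] ts(1)]
  have "(norm x)\<^sup>2 <= 4 / \<eta>" using sm \<eta>(1) by (simp add: le_divide_eq mult.commute)
  hence nx: "norm x <= 4 / \<eta> + 1" by (rule square_le_imp_le)
  have nt: "t <= 4 / kp" using sm kp(1) by (simp add: le_divide_eq mult.commute)
  have ny: "norm y <= norm x + 1" using cl m(2) norm_triangle_sub[of y x] by (simp add: norm_minus_commute)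
  have ns: "s <= t + 1" using cl m(2) by linarith
  have "norm z <= norm (x, t) + norm (y, s)" using norm_le_fst_snd[of z] by (simp add: zz)
  also have "\<dots> <= (norm x + t) + (norm y + s)"
   using norm_le_fst_snd[of "(x, t)"] norm_le_fst_snd[of "(y, s)"] ts by simp
  finally show ?thesis using nx nt ny ns by linarith
 qed
 note bnd = this
 have "((x1, t1), (x1, t1)) \<in> S" using t1 by (simp add: S_def)
 moreover have "f ((x1, t1), (x1, t1)) > 0" using f0 sig by linarith
 ultimately obtain z where z: "z \<in> S" "f ((x1, t1), (x1, t1)) <= f z" "!!z'. z' \<in> S ==> f z' <= f z"
  using usc_confined_max[OF S f _ _ bnd] by blast
 obtain x t y s where zz: "z = ((x, t), (y, s))" by (metis prod.collapse)
 have ts: "t >= 0" "s >= 0" using z(1) by (auto simp: S_def zz)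
 have f3: "f ((x, t), (y, s)) >= 3 * sig" using z(2) f0 by (simp add: zz)
 hence fpos: "f ((x, t), (y, s)) > 0" using sig by simp
 note sm = small[OF fpos ts(1)] and cl = close[OF fpos ts(1)]
 have max: "f ((x', t'), (y', s')) <= f ((x, t), (y, s))" if "t' >= 0" "s' >= 0" for x' t' y' s'
  using z(3)[of "((x', t'), (y', s'))"] that by (simp add: S_def zz)
 have UW: "U (x, t) + W (y, s) >= 3 * sig"
 proof -
  have "pen ((x, t), (y, s)) >= 0" using A kp \<eta> ts by (simp add: pen_def)
  thus ?thesis using f3 by (simp add: f_def)
 qed
 have t: "t > 0"
 proof (rule ccontr)
  assume "\<not> t > 0"
  hence t0: "t = 0" using ts by simp
  have "U (x, t) + W (y, s) <= sig / 2 + B2 * (norm (y - x))\<^sup>2 + K2 * s"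
   using initU[of x] 2(3)[OF ts(2), of y x] by (simp add: t0)
  also have "\<dots> <= 2 * sig"
   using cl t0 1 2 by (intro est) (auto simp: N_def norm_minus_commute)
  finally show False using UW sig by simp
 qed
 have s: "s > 0"
 proof (rule ccontr)
  assume "\<not> s > 0"
  hence s0: "s = 0" using ts by simp
  have "U (x, t) + W (y, s) <= sig / 2 + B1 * (norm (x - y))\<^sup>2 + K1 * t"
   using initW[of y] 1(3)[OF ts(1), of x y] by (simp add: s0)
  also have "\<dots> <= 2 * sig"
   using cl s0 1 2 by (intro est) (auto simp: N_def)
  finally show False using UW sig by simp
 qed
 define P where "P = (2 * A) *\<^sub>R (x - y)"
 define Q where "Q = (2 * \<eta>) *\<^sub>R x"
 have tq: "(b - c)\<^sup>2 = (a - c)\<^sup>2 + 2 * (a - c) * (b - a) + (b - a)\<^sup>2" for a b c :: real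
  by (simp add: power2_eq_square algebra_simps)
 have "(2 * A * (t - s) + kp) + H (P + Q) <= 0"
 proof (rule c11_sub_touching[OF U(3) t, where x = x and C = "A + \<eta>"])
  fix x' t' assume t': "t' >= (0::real)"
  have e1: "A * (norm (x' - y))\<^sup>2 = A * (norm (x - y))\<^sup>2 + P \<bullet> (x' - x) + A * (norm (x' - x))\<^sup>2"
   unfolding norm_sq_shift[of x' y x] by (simp add: P_def algebra_simps)
  have e2: "\<eta> * (norm x')\<^sup>2 = \<eta> * (norm x)\<^sup>2 + Q \<bullet> (x' - x) + \<eta> * (norm (x' - x))\<^sup>2"
   using norm_sq_shift[of x' 0 x] unfolding diff_zero by (simp only: Q_def inner_scaleR_left) (simp only: distrib_left mult_ac)
  have e3: "A * (t' - s)\<^sup>2 = A * (t - s)\<^sup>2 + 2 * A * (t - s) * (t' - t) + A * (t' - t)\<^sup>2"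
   unfolding tq[of t' s t] by (simp add: algebra_simps)
  have e4: "\<eta> * (t' - t)\<^sup>2 >= 0" using \<eta>(1) by simp
  have "U (x', t') <= U (x, t) + (A * (norm (x' - y))\<^sup>2 - A * (norm (x - y))\<^sup>2) + (A * (t' - s)\<^sup>2 - A * (t - s)\<^sup>2)
   + kp * (t' - t) + (\<eta> * (norm x')\<^sup>2 - \<eta> * (norm x)\<^sup>2)"
   using max[OF t' ts(2), of x' y] by (simp add: f_def pen_def algebra_simps)
  thus "U (x', t') <= U (x, t) + (2 * A * (t - s) + kp) * (t' - t) + (P + Q) \<bullet> (x' - x) + (A + \<eta>) * ((norm (x' - x))\<^sup>2 + (t' - t)\<^sup>2)"
   using e1 e2 e3 e4 unfolding inner_add_left distrib_left distrib_right by linarith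
 qed
 moreover have "2 * A * (s - t) + - H (- (- P)) <= 0"
 proof (rule c11_sub_touching[OF W(3) s, where x = y and C = A])
  fix y' s' assume s': "s' >= (0::real)"
  have e1: "A * (norm (x - y'))\<^sup>2 = A * (norm (x - y))\<^sup>2 + (- P) \<bullet> (y' - y) + A * (norm (y' - y))\<^sup>2"
   unfolding norm_minus_commute[of x] norm_sq_shift[of y' x y] by (simp add: P_def algebra_simps)
  have e3: "A * (t - s')\<^sup>2 = A * (t - s)\<^sup>2 + 2 * A * (s - t) * (s' - s) + A * (s' - s)\<^sup>2"
   unfolding power2_commute[of t] tq[of s' t s] by (simp add: algebra_simps)
  have "W (y', s') <= W (y, s) + (A * (norm (x - y'))\<^sup>2 - A * (norm (x - y))\<^sup>2) + (A * (t - s')\<^sup>2 - A * (t - s)\<^sup>2)"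
   using max[OF ts(1) s', of x y'] by (simp add: f_def pen_def algebra_simps)
  thus "W (y', s') <= W (y, s) + 2 * A * (s - t) * (s' - s) + (- P) \<bullet> (y' - y) + A * ((norm (y' - y))\<^sup>2 + (s' - s)\<^sup>2)"
   using e1 e3 unfolding distrib_left by linarith
 qed
 ultimately have le: "kp + H (P + Q) - H P <= 0" by (simp add: algebra_simps)
 have nP: "norm P <= 2 * A * m" using cl A by (simp add: P_def)
 have nQ: "norm Q < \<delta>"
 proof -
  have "(norm Q)\<^sup>2 = 4 * \<eta> * (\<eta> * (norm x)\<^sup>2)" by (simp add: Q_def power2_eq_square)
  also have "\<dots> <= 4 * \<eta> * 4" using sm \<eta>(1) by (intro mult_left_mono) (blast, linarith)
  also have "\<dots> < \<delta>\<^sup>2" using \<eta>(2) by linarith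
  finally show ?thesis by (rule power2_less_imp_less[OF _ less_imp_le[OF \<delta>(1)]])
 qed
 have "dist (H (P + Q)) (H P) < kp"
 proof (rule \<delta>0(2))
  show "P + Q \<in> cball 0 (2 * A * m + 1)" using norm_triangle_ineq[of P Q] nP nQ \<delta>(2) by (simp only: mem_cball_0)
  show "P \<in> cball 0 (2 * A * m + 1)" using nP by (simp only: mem_cball_0)
  show "dist (P + Q) P < \<delta>0" using nQ \<delta>(3) by (simp add: dist_norm)
 qed
 thus False using le by (simp add: dist_real_def abs_less_iff)
qed

text \<open>Nothing is known about the size of \<open>u\<close> and \<open>v\<close> at infinity.
  Passing to \<open>arctan\<close> bounds both by \<open>2\<close>, keeps the datum uniformly
  continuous because \<open>arctan\<close> is 1-Lipschitz, and is compatible with the equation by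
  homogeneity.\<close>

lemma first_order_comparison:
 fixes u v :: "'a::euclidean_space => real => real"
 assumes H: "continuous_on UNIV H" "!!c P. c > 0 ==> H (c *\<^sub>R P) = c * H P"
  and u: "usc (%(x, t). u x t)" "!!x t a P X. t > 0 ==> (a, P, X) \<in> par_superjet u x t ==> a + H P <= 0"
  and v: "usc (%(x, t). - v x t)" "!!x t a P X. t > 0 ==> (a, P, X) \<in> par_subjet v x t ==> a + H P >= 0"
  and init: "!!x. u x 0 <= g x" "!!x. g x <= v x 0" and g: "uniformly_continuous_on UNIV g" and t: "t >= 0"
 shows "u x t <= v x t"
proof -
 have arc: "mono arctan" "continuous_on UNIV arctan" by (auto intro!: monoI arctan_monotone' continuous_intros)
 have arc2: "\<bar>arctan a\<bar> <= 2" for a using arctan_lbound[of a] arctan_ubound[of a] pi_less_4 by (simp add: abs_le_iff)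
 have lip: "dist (arctan a) (arctan b) <= dist a b" for a b :: real
 proof -
  have le: "\<bar>arctan a - arctan b\<bar> <= \<bar>a - b\<bar>" if ab: "a < b" for a b :: real
  proof -
   obtain z where "arctan b - arctan a = (b - a) * inverse (1 + z\<^sup>2)"
    using MVT2[OF ab, of arctan "%z. inverse (1 + z\<^sup>2)"] DERIV_arctan by blast
   moreover have "inverse (1 + z\<^sup>2) <= 1" "inverse (1 + z\<^sup>2) >= 0" by (auto simp: inverse_le_1_iff)
   ultimately have "0 <= arctan b - arctan a" "arctan b - arctan a <= b - a" using ab by (auto simp: mult_left_le)
   thus ?thesis by simp
  qed
  show ?thesis
   using le[of a b] le[of b a] by (cases a b rule: linorder_cases) (auto simp: dist_real_def abs_minus_commute)
 qed
 have \<gamma>: "uniformly_continuous_on UNIV (%x. arctan (g x))"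
  using g lip order.strict_trans1 unfolding uniformly_continuous_on_def by meson
 have "arctan (u x t) + arctan (- v x t) <= 0"
 proof (rule c11_comparison[of "%(x, t). arctan (u x t)" H "%(x, t). arctan (- v x t)" "%x. arctan (g x)" t x, simplified prod.case, OF _ _ _ _ _ _ H(1) _ _ _ \<gamma> t])
  show "usc (%(x, t). arctan (u x t))" using usc_increasing[OF u(1) arc] by (simp add: case_prod_beta')
  show "usc (%(x, t). arctan (- v x t))" using usc_increasing[OF v(1) arc] by (simp add: case_prod_beta')
  show "c11_sub H (%(x, t). arctan (u x t))" by (rule c11_sub_arctan[OF u(2) H(2)])
  show "c11_sub (%P. - H (- P)) (%(x, t). arctan (- v x t))"
  proof (rule c11_sub_arctan[where u = "%x t. - v x t"])
   fix x t a P X assume t: "t > (0::real)" and "(a, P, X) \<in> par_superjet (%x t. - v x t) x t"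
   hence "(- a, - P, - X) \<in> par_subjet v x t" by (simp add: par_subjet_minus)
   from v(2)[OF t this] show "a + - H (- P) <= 0" by simp
  next
   fix c and P :: 'a assume "c > (0::real)"
   thus "- H (- (c *\<^sub>R P)) = c * - H (- P)" using H(2)[of c "- P"] by simp
  qed
 qed (use arc2 init in \<open>auto simp: case_prod_beta arctan_monotone' arctan_minus\<close>)
 thus ?thesis by (simp add: arctan_minus arctan_le_iff)
qed

section \<open>Half-relaxed limits and the effective Cauchy problem\<close>

lemma usc_both_continuous:
 assumes "usc f" "usc (%z. - f z)"
 shows "continuous_on UNIV f"
 unfolding continuous_on_def tendsto_at_iff_tendsto_nhds
proof (intro ballI tendstoI)
 fix z and e :: real assume e: "e > 0"
 have "\<forall>\<^sub>F y in nhds z. f y < f z + e" "\<forall>\<^sub>F y in nhds z. - f y < - f z + e" using assms e unfolding usc_def by blast+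
 thus "\<forall>\<^sub>F y in nhds z. dist (f y) (f z) < e" by eventually_elim (simp add: dist_real_def abs_less_iff)
qed

text \<open>The upper half-relaxed limit, taken as the infimum of all eventual local upper bounds.
  The last property, near-attainment by late indices close to \<open>z\<close>, supplies the contact
  points for tests.\<close>

lemma upper_limit_exists:
 fixes u :: "nat => 'b::metric_space => real"
 assumes bd: "!!z. \<exists>r>0. \<exists>B. \<forall>j y. dist y z < r --> \<bar>u j y\<bar> <= B"
 obtains U where "usc U"
  "!!z e. e > 0 ==> \<exists>r>0. \<exists>J. \<forall>j\<ge>J. \<forall>y. dist y z < r --> u j y < U z + e"
  "!!z e r J. e > 0 ==> r > 0 ==> \<exists>j\<ge>J. \<exists>y. dist y z < r \<and> u j y > U z - e"
proof
 define C where "C z = {c. \<exists>r>0. \<exists>J. \<forall>j\<ge>J. \<forall>y. dist y z < r --> u j y <= c}" for z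
 define U where "U z = Inf (C z)" for z
 have CI: "c \<in> C z" if "r > 0" "!!j y. j >= J ==> dist y z < r ==> u j y <= c" for c z r J
  unfolding C_def mem_Collect_eq by (intro exI[of _ r] exI[of _ J] conjI allI impI that)
 have bb: "bdd_below (C z) \<and> C z \<noteq> {}" for z
 proof -
  obtain r B where r: "r > 0" and B: "!!j y. dist y z < r ==> \<bar>u j y\<bar> <= B" using bd[of z] by blast
  have lower: "- B <= c" if c: "c \<in> C z" for c
  proof -
   obtain r' J where J: "r' > 0" "\<forall>j\<ge>J. \<forall>y. dist y z < r' --> u j y <= c"
    using c unfolding C_def mem_Collect_eq by (elim exE conjE) (rule that)
   hence "u J z <= c" by simp
   thus ?thesis using B[of z J] r unfolding abs_le_iff by simp
  qed
  have "B \<in> C z"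
  proof (rule CI[OF r, of 0])
   fix j y assume "dist y z < r"
   from B[OF this, of j] show "u j y <= B" by (rule abs_le_D1)
  qed
  hence "C z \<noteq> {}" by (rule ex_in_conv[THEN iffD1, OF exI])
  moreover have "bdd_below (C z)" using lower by (rule bdd_belowI)
  ultimately show ?thesis by (intro conjI)
 qed
 show a: "\<exists>r>0. \<exists>J. \<forall>j\<ge>J. \<forall>y. dist y z < r --> u j y < U z + e" if e: "e > 0" for z e
 proof -
  have "Inf (C z) < U z + e" using e by (simp add: U_def)
  from cInf_lessD[OF conjunct2[OF bb] this] obtain c where c: "c \<in> C z" "c < U z + e" by blast
  from c(1) obtain r J where r: "r > 0" "\<forall>j\<ge>J. \<forall>y. dist y z < r --> u j y <= c"
   unfolding C_def mem_Collect_eq by (elim exE conjE) (rule that)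
  thus ?thesis by (intro exI[of _ r] exI[of _ J] conjI allI impI le_less_trans[OF _ c(2)]) blast+
 qed
 show "\<exists>j\<ge>J. \<exists>y. dist y z < r \<and> u j y > U z - e" if e: "e > 0" "r > 0" for z e r J
 proof (rule ccontr)
  assume "\<not> ?thesis"
  hence "U z - e \<in> C z" by (intro CI[OF e(2), of J] leI) blast
  hence "U z <= U z - e" unfolding U_def by (rule cInf_lower[OF _ conjunct1[OF bb]])
  thus False using e by simp
 qed
 show "usc U"
  unfolding usc_def
 proof (intro allI impI)
  fix z and e :: real assume "e > 0"
  hence e2: "e / 2 > 0" by simp
  obtain r J where r: "r > 0" and J: "!!j y. j >= J ==> dist y z < r ==> u j y < U z + e / 2" using a[OF e2] by blast
  have "U y < U z + e" if y: "dist y z < r / 2" for y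
  proof -
   have "U z + e / 2 \<in> C y"
   proof (rule CI)
    show "r / 2 > 0" using r by simp
    fix j w assume "j >= J" "dist w y < r / 2"
    thus "u j w <= U z + e / 2" using J[of j w] y dist_triangle_half_l[of y z r w] dist_triangle[of w z y] by simp
   qed
   hence "U y <= U z + e / 2" unfolding U_def[of y] by (rule cInf_lower[OF _ conjunct1[OF bb]])
   thus ?thesis using \<open>e > 0\<close> by simp
  qed
  thus "\<forall>\<^sub>F y in nhds z. U y < U z + e" unfolding eventually_nhds_metric using r half_gt_zero by blast
 qed
qed

text \<open>For a continuous Hamiltonian without Hessian the semicontinuous envelopes collapse to
  the value at the jet.\<close>

lemma par_visc_first_order:
 fixes H :: "'a::euclidean_space => real"
 assumes H: "continuous_on UNIV H"
 shows "par_visc_solution (%P. True) (%x P X. H P) g u \<longleftrightarrow>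
  continuous_on (UNIV \<times> {0..}) (%(x, t). u x t) \<and> (\<forall>x. u x 0 = g x) \<and>
  (\<forall>x t a P X. t > 0 --> (a, P, X) \<in> par_superjet u x t --> a + H P <= 0) \<and>
  (\<forall>x t a P X. t > 0 --> (a, P, X) \<in> par_subjet u x t --> a + H P >= 0)"
proof -
 have near: "\<exists>r>0. \<forall>Q. dist Q P < r --> \<bar>H Q - H P\<bar> < e" if "e > 0" for P e
  using H that unfolding continuous_on_iff dist_real_def by (metis UNIV_I)
 have sub: "(\<forall>\<delta>>0. \<forall>r>0. \<exists>y Q Y. dist y x < r \<and> dist Q P < r \<and> dist Y X < r \<and> symmetric_op Y \<and> True \<and> a + H Q < \<delta>) \<longleftrightarrow> a + H P <= 0"
  if "symmetric_op X" for x :: 'a and a P and X :: "'a \<Rightarrow>\<^sub>L 'a"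
 proof
  assume l: "\<forall>\<delta>>0. \<forall>r>0. \<exists>y Q Y. dist y x < r \<and> dist Q P < r \<and> dist Y X < r \<and> symmetric_op Y \<and> True \<and> a + H Q < \<delta>"
  show "a + H P <= 0"
  proof (rule ccontr)
   assume "\<not> ?thesis"
   hence e: "(a + H P) / 2 > 0" by simp
   obtain r where r: "r > 0" "!!Q. dist Q P < r ==> \<bar>H Q - H P\<bar> < (a + H P) / 2" using near[OF e] by blast
   obtain Q where Q: "dist Q P < r" "a + H Q < (a + H P) / 2" using l e r(1) by blast
   show False using r(2)[OF Q(1)] Q(2) abs_ge_self[of "H Q - H P"] abs_ge_minus_self[of "H Q - H P"] by argo
  qed
 next
  assume le: "a + H P <= 0"
  show "\<forall>\<delta>>0. \<forall>r>0. \<exists>y Q Y. dist y x < r \<and> dist Q P < r \<and> dist Y X < r \<and> symmetric_op Y \<and> True \<and> a + H Q < \<delta>"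
   using le that by (intro allI impI exI[of _ x] exI[of _ P] exI[of _ X]) auto
 qed
 have super: "(\<forall>\<delta>>0. \<forall>r>0. \<exists>y Q Y. dist y x < r \<and> dist Q P < r \<and> dist Y X < r \<and> symmetric_op Y \<and> True \<and> a + H Q > - \<delta>) \<longleftrightarrow> a + H P >= 0"
  if "symmetric_op X" for x :: 'a and a P and X :: "'a \<Rightarrow>\<^sub>L 'a"
 proof
  assume l: "\<forall>\<delta>>0. \<forall>r>0. \<exists>y Q Y. dist y x < r \<and> dist Q P < r \<and> dist Y X < r \<and> symmetric_op Y \<and> True \<and> a + H Q > - \<delta>"
  show "a + H P >= 0"
  proof (rule ccontr)
   assume "\<not> ?thesis"
   hence e: "- (a + H P) / 2 > 0" by simp
   obtain r where r: "r > 0" "!!Q. dist Q P < r ==> \<bar>H Q - H P\<bar> < - (a + H P) / 2" using near[OF e] by blast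
   obtain Q where Q: "dist Q P < r" "a + H Q > - (- (a + H P) / 2)" using l e r(1) by blast
   show False using r(2)[OF Q(1)] Q(2) abs_ge_self[of "H Q - H P"] abs_ge_minus_self[of "H Q - H P"] by argo
  qed
 next
  assume le: "a + H P >= 0"
  show "\<forall>\<delta>>0. \<forall>r>0. \<exists>y Q Y. dist y x < r \<and> dist Q P < r \<and> dist Y X < r \<and> symmetric_op Y \<and> True \<and> a + H Q > - \<delta>"
   using le that by (intro allI impI exI[of _ x] exI[of _ P] exI[of _ X]) auto
 qed
 have S1: "visc_sub_par (%P. True) (%x P X. H P) u \<longleftrightarrow> (\<forall>x t a P X. t > 0 --> (a, P, X) \<in> par_superjet u x t --> a + H P <= 0)"
 proof -
  have sym: "symmetric_op X" if "(a, P, X) \<in> par_superjet u x t" for a P X x t using that by (simp add: par_superjet_def)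
  show ?thesis
  proof (intro iffI allI impI)
   fix x t a P X assume v: "visc_sub_par (%P. True) (%x P X. H P) u" and t: "t > 0" and jet: "(a, P, X) \<in> par_superjet u x t"
   show "a + H P <= 0"
    using mp[OF spec[OF spec[OF v[unfolded visc_sub_par_def]]] t, THEN bspec, OF jet, unfolded prod.case]
    by (rule iffD1[OF sub[OF sym[OF jet]]])
  next
   assume v: "\<forall>x t a P X. t > 0 --> (a, P, X) \<in> par_superjet u x t --> a + H P <= 0"
   show "visc_sub_par (%P. True) (%x P X. H P) u"
    unfolding visc_sub_par_def
   proof (intro allI impI ballI)
    fix x t z assume t: "t > 0" and z: "z \<in> par_superjet u x t"
    obtain a P X where zz: "z = (a, P, X)" by (rule prod_cases3)
    have "a + H P <= 0" using v t z unfolding zz by blast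
    from iffD2[OF sub[OF sym[OF z[unfolded zz]]] this]
    show "case z of (a, P, X) => \<forall>\<delta>>0. \<forall>r>0. \<exists>y Q Y. dist y x < r \<and> dist Q P < r \<and> dist Y X < r \<and> symmetric_op Y \<and> True \<and> a + H Q < \<delta>"
     unfolding zz prod.case .
   qed
  qed
 qed
 have S2: "visc_super_par (%P. True) (%x P X. H P) u \<longleftrightarrow> (\<forall>x t a P X. t > 0 --> (a, P, X) \<in> par_subjet u x t --> a + H P >= 0)"
 proof -
  have sym: "symmetric_op X" if "(a, P, X) \<in> par_subjet u x t" for a P X x t using that by (simp add: par_subjet_def)
  show ?thesis
  proof (intro iffI allI impI)
   fix x t a P X assume v: "visc_super_par (%P. True) (%x P X. H P) u" and t: "t > 0" and jet: "(a, P, X) \<in> par_subjet u x t"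
   show "a + H P >= 0"
    using mp[OF spec[OF spec[OF v[unfolded visc_super_par_def]]] t, THEN bspec, OF jet, unfolded prod.case]
    by (rule iffD1[OF super[OF sym[OF jet]]])
  next
   assume v: "\<forall>x t a P X. t > 0 --> (a, P, X) \<in> par_subjet u x t --> a + H P >= 0"
   show "visc_super_par (%P. True) (%x P X. H P) u"
    unfolding visc_super_par_def
   proof (intro allI impI ballI)
    fix x t z assume t: "t > 0" and z: "z \<in> par_subjet u x t"
    obtain a P X where zz: "z = (a, P, X)" by (rule prod_cases3)
    have "a + H P >= 0" using v t z unfolding zz by blast
    from iffD2[OF super[OF sym[OF z[unfolded zz]]] this]
    show "case z of (a, P, X) => \<forall>\<delta>>0. \<forall>r>0. \<exists>y Q Y. dist y x < r \<and> dist Q P < r \<and> dist Y X < r \<and> symmetric_op Y \<and> True \<and> a + H Q > - \<delta>"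
     unfolding zz prod.case .
   qed
  qed
 qed
 show ?thesis unfolding par_visc_solution_def S1 S2 by (rule refl)
qed

text \<open>Jets compare only with positive times, so extending a function constantly to negative
  times leaves them unchanged and provides a function continuous on the whole space.\<close>

lemma par_jets_extension:
 assumes "t > 0"
 shows "par_superjet (%x s. u x (max s 0)) x t = par_superjet u x t"
  and "par_subjet (%x s. u x (max s 0)) x t = par_subjet u x t"
proof -
 have m: "max s 0 = s" if "s > 0" for s :: real using that by simp
 show "par_superjet (%x s. u x (max s 0)) x t = par_superjet u x t"
  "par_subjet (%x s. u x (max s 0)) x t = par_subjet u x t"
  unfolding par_superjet_def par_subjet_def m[OF assms] by (simp_all only: m cong: imp_cong)
qed

lemma first_order_le:
 fixes H :: "'a::euclidean_space => real"
 assumes H: "continuous_on UNIV H" "!!c P. c > 0 ==> H (c *\<^sub>R P) = c * H P" and g: "uniformly_continuous_on UNIV g"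
  and u: "par_visc_solution (%P. True) (%x P X. H P) g u" and v: "par_visc_solution (%P. True) (%x P X. H P) g v" and t: "t >= 0"
 shows "u x t <= v x t"
proof -
 have ext: "continuous_on UNIV (%(x, t). w x (max t 0))" if "continuous_on (UNIV \<times> {0..}) (%(x, t). w x t)" for w :: "'a => real => real"
 proof -
  have "continuous_on UNIV (%z. (%(x, t). w x t) (fst z, max (snd z) 0))"
   by (rule continuous_on_compose2[OF that]) (auto intro!: continuous_intros)
  thus ?thesis by (simp add: case_prod_beta')
 qed
 note u' = u[unfolded par_visc_first_order[OF H(1)]] and v' = v[unfolded par_visc_first_order[OF H(1)]]
 have "u x (max t 0) <= v x (max t 0)"
 proof (rule first_order_comparison[OF H _ _ _ _ _ _ g t])
  show "usc (%(x, t). u x (max t 0))" using ext u' by (intro usc_continuous) blast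
  have "continuous_on UNIV (%z. - (%(x, t). v x (max t 0)) z)" using ext v' by (intro continuous_on_minus) blast
  thus "usc (%(x, t). - v x (max t 0))" by (intro usc_continuous) (simp add: case_prod_beta')
  show "a + H P <= 0" if "t > 0" "(a, P, X) \<in> par_superjet (%x t. u x (max t 0)) x t" for x t a P X
   using that u' par_jets_extension(1)[OF that(1)] by metis
  show "a + H P >= 0" if "t > 0" "(a, P, X) \<in> par_subjet (%x t. v x (max t 0)) x t" for x t a P X
   using that v' par_jets_extension(2)[OF that(1)] by metis
  show "u x (max 0 0) <= g x" "g x <= v x (max 0 0)" for x using u' v' by simp_all
 qed
 thus ?thesis using t by simp
qed

context shear_game
begin

text \<open>The barriers behind this estimate grow at a rate independent of \<open>eps\<close>. This
  uniformity, absent from the interior equicontinuity, makes the half-relaxed limits attain the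
  initial datum.\<close>

lemma flow_near_initial_value:
 assumes g: "uniformly_continuous_on UNIV g" and e: "e > 0"
 obtains r where "r > 0" "!!eps h x y s. 0 < eps ==> eps <= 1 ==> 0 < h ==> h <= 1 ==> dist y x < r ==> s < r ==> \<bar>flow eps h g y s - g x\<bar> <= 3 * e"
proof -
 have lb: "locally_bdd g" using g by (intro locally_bdd_continuous uniformly_continuous_imp_continuous)
 obtain \<delta> where \<delta>: "\<delta> > 0" "!!x y. dist x y < \<delta> ==> dist (g x) (g y) < e"
  using g e unfolding uniformly_continuous_on_def by (metis UNIV_I dist_commute)
 have mod: "g x <= g y + e" if "dist x y <= \<delta> / 2" for x y
  using \<delta>(2)[of x y] that \<delta>(1) by (simp add: dist_real_def abs_less_iff)
 define B where "B = e / (\<delta> / 2)\<^sup>2 * (\<bar>growthC\<bar> * exp 1)"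
 have "B >= 0" using e by (simp add: B_def)
 then obtain tau where tau: "tau > 0" "tau <= 1" "B * tau <= e" using small_factor[OF _ e] by blast
 have "e / (\<delta> / 2)\<^sup>2 * (growthC * tau * exp tau) <= e / (\<delta> / 2)\<^sup>2 * (\<bar>growthC\<bar> * tau * exp 1)"
  using e tau by (intro mult_left_mono mult_mono) auto
 also have "\<dots> = B * tau" by (simp add: B_def)
 finally have small: "e / (\<delta> / 2)\<^sup>2 * (growthC * tau * exp tau) <= e" using tau(3) by linarith
 have "\<bar>flow eps h g y s - g x\<bar> <= 3 * e" if eh: "0 < eps" "eps <= 1" "0 < h" "h <= 1" and y: "dist y x < min tau \<delta>" "s < min tau \<delta>" for eps h x y s
 proof -
  have "\<bar>flow eps h g y s - g y\<bar> <= e + e / (\<delta> / 2)\<^sup>2 * (growthC * tau * exp tau)"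
   by (rule flow_near_initial[OF _ eh(2-4) lb _ _ mod]) (use eh \<delta> e y tau in auto)
  moreover have "dist (g y) (g x) < e" using \<delta>(2) y by simp
  ultimately show ?thesis using small by (simp add: dist_real_def abs_le_iff abs_less_iff)
 qed
 thus thesis using that[of "min tau \<delta>"] tau(1) \<delta>(1) by simp
qed

text \<open>The half-relaxed limits \<open>U\<close> and \<open>- W\<close> are a sub- and a
  supersolution with the same datum. Comparison closes the gap between them, which turns the
  semilimits into continuous convergence and yields existence for the effective problem.\<close>

lemma homogenized_limit:
 assumes eps: "!!j. 0 < eps j" "!!j. eps j <= 1" "eps \<longlonglongrightarrow> 0" and h: "!!j. 0 < h j" "!!j. h j <= (eps j)\<^sup>2"
  and g: "uniformly_continuous_on UNIV g"
  and cor: "!!P. super_corrector P (Hb P)" "!!P. sub_corrector P (Hb P)"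
 obtains l where "par_visc_solution (%P. True) (%x P X. Hb P) g (%x t. l (x, t))"
  "!!z e. e > 0 ==> \<exists>r>0. \<exists>J. \<forall>j\<ge>J. \<forall>y. dist y z < r --> \<bar>flow (eps j) (h j) g (fst y) (snd y) - l z\<bar> < e"
proof -
 have H: "continuous_on UNIV Hb" "!!c P. c > 0 ==> Hb (c *\<^sub>R P) = c * Hb P"
  using effective_continuous[OF cor] effective_homogeneous[OF cor] by blast+
 have h1: "h j <= 1" for j using h(2)[of j] power_le_one[of "eps j" 2] eps(1,2)[of j] by linarith
 define u where "u j z = flow (eps j) (h j) g (fst z) (snd z)" for j z
 have bd: "\<exists>r>0. \<exists>B. \<forall>j y. dist y z < r --> \<bar>u j y\<bar> <= B" for z
 proof -
  obtain B where B: "!!eps h x t. 0 < eps ==> eps <= 1 ==> 0 < h ==> h <= 1 ==> norm x <= norm z + 1 ==> t <= norm z + 1 ==> \<bar>flow eps h g x t\<bar> <= B"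
   using flow_bounded_uniformly[OF g, of "norm z + 1"] by blast
  have "\<bar>u j y\<bar> <= B" if "dist y z < 1" for j y
  proof -
   have ny: "norm y <= norm z + 1" using that norm_triangle_sub[of y z] by (simp add: dist_norm)
   have "norm (fst y) <= norm y" "\<bar>snd y\<bar> <= norm y" using dist_fst_le[of y 0] dist_snd_le[of y 0] by simp_all
   thus ?thesis unfolding u_def using ny by (intro B eps h h1) auto
  qed
  thus ?thesis using zero_less_one by blast
 qed
 have bd': "\<exists>r>0. \<exists>B. \<forall>j y. dist y z < r --> \<bar>- u j y\<bar> <= B" for z using bd[of z] by simp
 obtain U where U: "usc U" "!!z e. e > 0 ==> \<exists>r>0. \<exists>J. \<forall>j\<ge>J. \<forall>y. dist y z < r --> u j y < U z + e"
  "!!z e r J. e > 0 ==> r > 0 ==> \<exists>j\<ge>J. \<exists>y. dist y z < r \<and> u j y > U z - e"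
  using upper_limit_exists[of u, OF bd] by blast
 obtain W where W: "usc W" "!!z e. e > 0 ==> \<exists>r>0. \<exists>J. \<forall>j\<ge>J. \<forall>y. dist y z < r --> - u j y < W z + e"
  "!!z e r J. e > 0 ==> r > 0 ==> \<exists>j\<ge>J. \<exists>y. dist y z < r \<and> - u j y > W z - e"
  using upper_limit_exists[of "%j y. - u j y", OF bd'] by blast
 have split: "dist (y, s) (x, t) < r" if "dist y x < r / 2" "\<bar>s - t\<bar> < r / 2" for y x :: "(real^'n) \<times> real" and s t r
  using that sqrt_sum_squares_le_sum_abs[of "dist y x" "dist s t"] by (simp add: dist_Pair_Pair dist_real_def)
 \<comment> \<open>The estimate near the initial time is one-sided in \<open>s\<close>, and the flow
   equals \<open>g\<close> for negative times, so the whole half-line \<open>t <= 0\<close> is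
   settled at once.\<close>
 have initU: "U (x, t) <= g x \<and> W (x, t) <= - g x" if t: "t <= 0" for x t
 proof -
  have "U (x, t) <= g x + e \<and> W (x, t) <= - g x + e" if e: "e > 0" for e
  proof -
   have e6: "e / 6 > 0" using e by simp
   obtain r where r: "r > 0" "!!eps h x y s. 0 < eps ==> eps <= 1 ==> 0 < h ==> h <= 1 ==> dist y x < r ==> s < r ==> \<bar>flow eps h g y s - g x\<bar> <= 3 * (e / 6)"
    using flow_near_initial_value[OF g e6] by blast
   have nb: "\<bar>u j y - g x\<bar> <= e / 2" if "dist y (x, t) < r" for j y
   proof -
    have "dist (fst y) x < r" "snd y < r"
     using that t dist_fst_le[of y "(x, t)"] dist_snd_le[of y "(x, t)"] by (auto simp: dist_real_def)
    from r(2)[OF eps(1,2) h(1) h1 this] show ?thesis by (simp add: u_def)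
   qed
   have e2: "e / 2 > 0" using e by simp
   obtain j y where "dist y (x, t) < r" "u j y > U (x, t) - e / 2" using U(3)[OF e2 r(1)] by blast
   hence "U (x, t) <= g x + e" using nb[of y j] unfolding abs_le_iff by linarith
   moreover obtain j' y' where "dist y' (x, t) < r" "- u j' y' > W (x, t) - e / 2" using W(3)[OF e2 r(1)] by blast
   hence "W (x, t) <= - g x + e" using nb[of y' j'] unfolding abs_le_iff by linarith
   ultimately show ?thesis by simp
  qed
  thus ?thesis using field_le_epsilon by blast
 qed
 have sub: "a + Hb P <= 0" if "t > 0" and jet: "(a, P, X) \<in> par_superjet (%x t. U (x, t)) x t" for x t a P X
 proof (rule homogenization_sub[OF eps h g _ _ jet \<open>t > 0\<close> cor(1)])
  fix x t and e :: real assume "e > 0"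
  from U(2)[OF this, of "(x, t)"] obtain r J where r: "r > 0" "!!j y. j >= J ==> dist y (x, t) < r ==> u j y < U (x, t) + e" by blast
  have "flow (eps j) (h j) g y s < U (x, t) + e" if "j >= J" "dist y x < r / 2" "\<bar>s - t\<bar> < r / 2" for j y s
   using r(2)[OF that(1) split[OF that(2,3)]] by (simp add: u_def)
  thus "\<exists>r>0. \<exists>J. \<forall>j\<ge>J. \<forall>y s. dist y x < r --> \<bar>s - t\<bar> < r --> flow (eps j) (h j) g y s < U (x, t) + e"
   using half_gt_zero[OF r(1)] by blast
 next
  fix e r :: real and J assume "e > 0" "r > 0"
  from U(3)[OF this, of J "(x, t)"] obtain j y where "j >= J" "dist y (x, t) < r" "u j y > U (x, t) - e" by blast
  thus "\<exists>j\<ge>J. \<exists>y s. dist y x < r \<and> \<bar>s - t\<bar> < r \<and> flow (eps j) (h j) g y s > U (x, t) - e"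
   using dist_fst_le[of y "(x, t)"] dist_snd_le[of y "(x, t)"]
   by (intro exI[of _ j] conjI exI[of _ "fst y"] exI[of _ "snd y"]) (auto simp: u_def dist_real_def)
 qed
 have super: "a + Hb P >= 0" if "t > 0" and jet: "(a, P, X) \<in> par_subjet (%x t. - W (x, t)) x t" for x t a P X
 proof (rule homogenization_super[OF eps h g _ _ jet \<open>t > 0\<close> cor(2)])
  fix x t and e :: real assume "e > 0"
  from W(2)[OF this, of "(x, t)"] obtain r J where r: "r > 0" "!!j y. j >= J ==> dist y (x, t) < r ==> - u j y < W (x, t) + e" by blast
  have "flow (eps j) (h j) g y s > - W (x, t) - e" if "j >= J" "dist y x < r / 2" "\<bar>s - t\<bar> < r / 2" for j y s
   using r(2)[OF that(1) split[OF that(2,3)]] by (simp add: u_def)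
  thus "\<exists>r>0. \<exists>J. \<forall>j\<ge>J. \<forall>y s. dist y x < r --> \<bar>s - t\<bar> < r --> flow (eps j) (h j) g y s > - W (x, t) - e"
   using half_gt_zero[OF r(1)] by blast
 next
  fix e r :: real and J assume "e > 0" "r > 0"
  from W(3)[OF this, of J "(x, t)"] obtain j y where "j >= J" "dist y (x, t) < r" "- u j y > W (x, t) - e" by blast
  thus "\<exists>j\<ge>J. \<exists>y s. dist y x < r \<and> \<bar>s - t\<bar> < r \<and> flow (eps j) (h j) g y s < - W (x, t) + e"
   using dist_fst_le[of y "(x, t)"] dist_snd_le[of y "(x, t)"]
   by (intro exI[of _ j] conjI exI[of _ "fst y"] exI[of _ "snd y"]) (auto simp: u_def dist_real_def)
 qed
 have le: "U (x, t) <= - W (x, t)" for x t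
 proof (cases "t >= 0")
  case True
  show ?thesis
  proof (rule first_order_comparison[OF H _ _ _ _ _ _ g True, where u = "%x t. U (x, t)" and v = "%x t. - W (x, t)"])
   show "usc (%(x, t). U (x, t))" "usc (%(x, t). - (- W (x, t)))" using U(1) W(1) by simp_all
   show "U (x, 0) <= g x" "g x <= - W (x, 0)" for x using initU[of 0 x] by auto
   show "a + Hb P <= 0" if "t > 0" "(a, P, X) \<in> par_superjet (%x t. U (x, t)) x t" for x t a P X
    using sub[OF that] .
   show "a + Hb P >= 0" if "t > 0" "(a, P, X) \<in> par_subjet (%x t. - W (x, t)) x t" for x t a P X
    using super[OF that] .
  qed
 next
  case False
  thus ?thesis using initU[of t x] by linarith
 qed
 have ccv: "\<exists>r>0. \<exists>J. \<forall>j\<ge>J. \<forall>y. dist y z < r --> \<bar>u j y - U z\<bar> < e" if e: "e > 0" for z e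
 proof -
  obtain r J where r: "r > 0" "!!j y. j >= J ==> dist y z < r ==> u j y < U z + e" using U(2)[OF e] by blast
  obtain r' J' where r': "r' > 0" "!!j y. j >= J' ==> dist y z < r' ==> - u j y < W z + e" using W(2)[OF e] by blast
  have "U z <= - W z" using le[of "fst z" "snd z"] by simp
  hence "\<bar>u j y - U z\<bar> < e" if "j >= max J J'" "dist y z < min r r'" for j y
   using r(2)[of j y] r'(2)[of j y] that by (simp add: abs_less_iff)
  thus ?thesis using r(1) r'(1) by (intro exI[of _ "min r r'"] conjI exI[of _ "max J J'"]) auto
 qed
 have eq: "W z = - U z" for z
 proof (rule antisym)
  show "W z <= - U z" using le[of "fst z" "snd z"] by simp
  show "- U z <= W z"
  proof (rule field_le_epsilon)
   fix e :: real assume e: "e > 0"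
   hence e2: "e / 2 > 0" by simp
   obtain r J where r: "r > 0" "!!j y. j >= J ==> dist y z < r ==> u j y < U z + e / 2" using U(2)[OF e2] by blast
   obtain r' J' where r': "r' > 0" "!!j y. j >= J' ==> dist y z < r' ==> - u j y < W z + e / 2" using W(2)[OF e2] by blast
   show "- U z <= W z + e" using r(2)[of "max J J'" z] r'(2)[of "max J J'" z] r(1) r'(1) by simp
  qed
 qed
 show thesis
 proof (rule that[of U])
  show "\<exists>r>0. \<exists>J. \<forall>j\<ge>J. \<forall>y. dist y z < r --> \<bar>flow (eps j) (h j) g (fst y) (snd y) - U z\<bar> < e" if "e > 0" for z e
   using ccv[OF that] by (simp add: u_def)
  show "par_visc_solution (%P. True) (%x P X. Hb P) g (%x t. U (x, t))"
   unfolding par_visc_first_order[OF H(1)]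
  proof (intro conjI allI impI)
   show "continuous_on (UNIV \<times> {0..}) (%(x, t). U (x, t))"
   proof -
    have "W = (%z. - U z)" by (rule ext) (rule eq)
    hence "continuous_on UNIV U" using usc_both_continuous[OF U(1)] W(1) by simp
    thus ?thesis using continuous_on_subset by fastforce
   qed
   show "U (x, 0) = g x" for x using initU[of 0 x] by (simp add: eq)
   show "a + Hb P <= 0" if "t > 0" "(a, P, X) \<in> par_superjet (%x t. U (x, t)) x t" for x t a P X
    using sub[OF that] .
   show "a + Hb P >= 0" if "t > 0" "(a, P, X) \<in> par_subjet (%x t. U (x, t)) x t" for x t a P X
    using super[OF that(1)] that(2) by (simp add: eq)
  qed
 qed
qed

text \<open>For \<open>snd P = 0\<close> uniqueness identifies \<open>v lam\<close> with the
  explicit constant, which forces \<open>H = norm P\<close>. Otherwise the vanishing discount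
  provides the approximate eigenfunctions.\<close>

lemma effective_correctors:
 assumes per: "zn_periodic f"
  and sol: "!!lam. lam > 0 ==> cell_solution d f P lam (v lam)"
  and uniq: "!!lam w. lam > 0 ==> cell_solution d f P lam w ==> w = v lam"
  and lim: "!!x. ((%lam. lam * v lam x) \<longlongrightarrow> - H) (at_right 0)"
 shows "super_corrector P H \<and> sub_corrector P H"
proof (cases "snd P = 0")
 case True
 have "\<forall>\<^sub>F lam in at_right 0. lam * v lam 0 = - norm P"
  using eventually_at_right_less[of 0]
 proof eventually_elim
  case (elim lam)
  have "v lam = (%_. - norm P / lam)" using uniq[OF elim cell_constant[OF elim True d_pos]] by simp
  thus ?case using elim by simp
 qed
 hence "((%lam. lam * v lam 0) \<longlongrightarrow> - norm P) (at_right 0)" by (rule tendsto_eventually)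
 from tendsto_unique[OF _ this lim[of 0]] have "H = norm P" by simp
 thus ?thesis using super_corrector_flat[OF True] sub_corrector_flat[OF True] by simp
next
 case False
 have "cell_value P H" unfolding cell_value_def
  using approx_cell_exists[OF per False sol uniq lim] by blast
 thus ?thesis using super_corrector_tilted[OF False] sub_corrector_tilted[OF False] by blast
qed

end

lemma periodic_bounded:
 fixes f :: "real^'n => real"
 assumes "zn_periodic f" "continuous_on UNIV f"
 obtains F where "!!x. \<bar>f x\<bar> <= F"
proof -
 have "bounded (f ` cbox 0 (\<chi> i. 1))"
  by (intro compact_imp_bounded compact_continuous_image continuous_on_subset[OF assms(2)] compact_cbox subset_UNIV)
 then obtain F where F: "\<forall>x\<in>f ` cbox 0 (\<chi> i. 1). norm x <= F" unfolding bounded_iff by blast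
 have "\<bar>f x\<bar> <= F" for x
 proof -
  obtain k y where k: "\<forall>i. k $ i \<in> \<int>" "x = y + k" and y: "y \<in> cbox 0 (\<chi> i. 1)" by (rule periodic_reduce)
  hence "f x = f y" using assms(1) unfolding zn_periodic_def by simp
  thus ?thesis using F y by simp
 qed
 thus thesis by (rule that)
qed

theorem theorem4p2:
  fixes f :: "real^'n \<Rightarrow> real" and d :: real
    and g :: "(real^'n) \<times> real \<Rightarrow> real"
    and G :: "real \<Rightarrow> (real^'n) \<times> real \<Rightarrow> real \<Rightarrow> real"
    and Hbar :: "(real^'n) \<times> real \<Rightarrow> real"
    and v :: "(real^'n) \<times> real \<Rightarrow> real \<Rightarrow> real^'n \<Rightarrow> real"
  assumes "CARD('n) \<ge> 2"
    and "d > 0"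
    and "zn_periodic f"
    and "\<exists>L. L-lipschitz_on UNIV f"
    and "uniformly_continuous_on UNIV g"
    and "\<forall>eps\<in>{0<..1}. par_visc_solution (\<lambda>P. P \<noteq> 0) (FG eps d f) g (G eps) \<and>
           (\<forall>H. par_visc_solution (\<lambda>P. P \<noteq> 0) (FG eps d f) g H \<longrightarrow>
                 (\<forall>x t. t \<ge> 0 \<longrightarrow> H x t = G eps x t))"
    and "\<forall>P lam. lam > 0 \<longrightarrow> cell_solution d f P lam (v P lam) \<and>
           (\<forall>w. cell_solution d f P lam w \<longrightarrow> w = v P lam)"
    and "\<forall>P x'. ((\<lambda>lam. lam * v P lam x') \<longlongrightarrow> - Hbar P) (at_right 0)"
  shows "\<exists>G0. par_visc_solution (\<lambda>P. True) (\<lambda>x P X. Hbar P) g G0 \<and>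
           (\<forall>H. par_visc_solution (\<lambda>P. True) (\<lambda>x P X. Hbar P) g H \<longrightarrow>
                 (\<forall>x t. t \<ge> 0 \<longrightarrow> H x t = G0 x t)) \<and>
           (\<forall>K. compact K \<longrightarrow> K \<subseteq> UNIV \<times> {0..} \<longrightarrow>
              uniform_limit K (\<lambda>eps (x, t). G eps x t) (\<lambda>(x, t). G0 x t) (at_right 0))"
proof -
 note per = assms(3) and ucg = assms(5)
 have G: "par_visc_solution (%P. P \<noteq> 0) (FG eps d f) g H ==> t >= 0 ==> H x t = G eps x t" if "0 < eps" "eps <= 1" for eps H x t
  using bspec[OF assms(6), of eps] that unfolding greaterThanAtMost_iff by blast
 have cell: "cell_solution d f P lam (v P lam)" "cell_solution d f P lam w ==> w = v P lam" if "lam > 0" for P lam w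
  using assms(7) that by blast+
 obtain L where L: "L-lipschitz_on UNIV f" using assms(4) by blast
 obtain F where F: "!!x. \<bar>f x\<bar> <= F" using periodic_bounded[OF per lipschitz_on_continuous_on[OF L]] by blast
 interpret shear_game f d F L
  by unfold_locales (use assms(2) F lipschitz_onD[OF L] in \<open>auto simp: dist_real_def\<close>)
 have cor: "super_corrector P (Hbar P)" "sub_corrector P (Hbar P)" for P
  using effective_correctors[OF per cell, of P "Hbar P"] assms(8) by blast+
 have H: "continuous_on UNIV Hbar" "!!c P. c > 0 ==> Hbar (c *\<^sub>R P) = c * Hbar P"
  using effective_continuous[OF cor] effective_homogeneous[OF cor] by blast+
 have inv: "0 < inverse (real (Suc j))" "inverse (real (Suc j)) <= 1" for j by (auto simp: inverse_le_1_iff)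
 \<comment> \<open>An arbitrary admissible sequence fixes the candidate limit, independently of the
   compact set and of the sequences below.\<close>
 obtain l0 where l0: "par_visc_solution (%P. True) (%x P X. Hbar P) g (%x t. l0 (x, t))"
  by (rule homogenized_limit[OF inv LIMSEQ_inverse_real_of_nat, of "%j. (inverse (real (Suc j)))\<^sup>2" g Hbar])
   (use inv ucg cor in auto)
 have uniq: "H1 x t = H2 x t" if "par_visc_solution (%P. True) (%x P X. Hbar P) g H1"
  "par_visc_solution (%P. True) (%x P X. Hbar P) g H2" "t >= 0" for H1 H2 x t
  using first_order_le[OF H ucg that(1,2,3), of x] first_order_le[OF H ucg that(2,1,3), of x] by simp
 have "uniform_limit K (%eps (x, t). G eps x t) (%(x, t). l0 (x, t)) (at_right 0)" if K: "compact K" "K \<subseteq> UNIV \<times> {0..}" for K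
  unfolding uniform_limit_iff
 proof (intro allI impI)
  fix e :: real assume e: "e > 0"
  define good where "good eps \<longleftrightarrow> (\<forall>z\<in>K. dist ((%(x, t). G eps x t) z) ((%(x, t). l0 (x, t)) z) < e)" for eps
  have "\<forall>\<^sub>F eps in at_right 0. good eps"
  proof (rule ccontr)
   assume "\<not> ?thesis"
   \<comment> \<open>Failure arbitrarily close to zero is turned into a sequence of parameters,
     along which step sizes can be chosen one at a time.\<close>
   hence "\<exists>eps. 0 < eps \<and> eps < inverse (real (Suc n)) \<and> \<not> good eps" for n
    unfolding eventually_at_right_field using inv(1)[of n] by blast
   then obtain \<epsilon> where \<epsilon>: "!!n. 0 < \<epsilon> n" "!!n. \<epsilon> n < inverse (real (Suc n))" "!!n. \<not> good (\<epsilon> n)" by metis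
   have \<epsilon>1: "\<epsilon> n <= 1" for n using \<epsilon>(2)[of n] inv(2)[of n] by linarith
   have \<epsilon>0: "\<epsilon> \<longlonglongrightarrow> 0"
    by (rule tendsto_sandwich[OF _ _ tendsto_const LIMSEQ_inverse_real_of_nat]) (use \<epsilon>(1,2) in \<open>auto intro!: always_eventually less_imp_le\<close>)
   obtain R where R: "!!z. z \<in> K ==> norm z <= R" using compact_imp_bounded[OF K(1)] unfolding bounded_iff by blast
   have e2: "e / 2 > 0" using e by simp
   \<comment> \<open>For each fixed parameter the step is taken so small that the flow is close to
     \<open>G\<close> on the ball containing \<open>K\<close>, and below the square of the
     parameter, as the homogenized limit requires. This diagonal choice replaces any rate of
     convergence in \<open>h\<close>.\<close>
   have "\<exists>h. 0 < h \<and> h < (\<epsilon> n)\<^sup>2 \<and> (\<forall>x t. norm x <= R --> 0 <= t --> t <= R --> \<bar>flow (\<epsilon> n) h g x t - G (\<epsilon> n) x t\<bar> < e / 2)" for n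
   proof (rule flow_approximates[OF \<epsilon>(1) \<epsilon>1 ucg _ _ e2])
    show "(\<epsilon> n)\<^sup>2 > 0" using \<epsilon>(1)[of n] by simp
   qed (use G[OF \<epsilon>(1) \<epsilon>1] in blast)
   then obtain h where h: "!!n. 0 < h n" "!!n. h n < (\<epsilon> n)\<^sup>2"
    "!!n x t. norm x <= R ==> 0 <= t ==> t <= R ==> \<bar>flow (\<epsilon> n) (h n) g x t - G (\<epsilon> n) x t\<bar> < e / 2" by metis
   obtain l where l: "par_visc_solution (%P. True) (%x P X. Hbar P) g (%x t. l (x, t))"
    "!!z e. e > 0 ==> \<exists>r>0. \<exists>J. \<forall>j\<ge>J. \<forall>y. dist y z < r --> \<bar>flow (\<epsilon> j) (h j) g (fst y) (snd y) - l z\<bar> < e"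
    by (rule homogenized_limit[OF \<epsilon>(1) \<epsilon>1 \<epsilon>0 h(1) less_imp_le[OF h(2)] ucg cor]) blast
   obtain J where J: "!!z. z \<in> K ==> \<bar>flow (\<epsilon> J) (h J) g (fst z) (snd z) - l z\<bar> < e / 2"
    using continuous_convergence_uniform[OF l(2) K(1) e2] by blast
   have "good (\<epsilon> J)"
    unfolding good_def
   proof
    fix z assume z: "z \<in> K"
    have s: "snd z >= 0" using K(2) z by auto
    have "norm (fst z) <= R" "snd z <= R"
     using R[OF z] dist_fst_le[of z 0] dist_snd_le[of z 0] by auto
    hence "\<bar>flow (\<epsilon> J) (h J) g (fst z) (snd z) - G (\<epsilon> J) (fst z) (snd z)\<bar> < e / 2" using h(3) s by blast
    \<comment> \<open>Uniqueness for the effective equation makes the limit independent of the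
      chosen sequence.\<close>
    moreover have "l z = l0 z" using uniq[OF l(1) l0 s, of "fst z"] by simp
    ultimately have "\<bar>G (\<epsilon> J) (fst z) (snd z) - l0 z\<bar> < e" using J[OF z] by linarith
    thus "dist ((%(x, t). G (\<epsilon> J) x t) z) ((%(x, t). l0 (x, t)) z) < e"
     by (simp add: case_prod_beta dist_real_def)
   qed
   thus False using \<epsilon>(3) by blast
  qed
  thus "\<forall>\<^sub>F eps in at_right 0. \<forall>z\<in>K. dist ((%(x, t). G eps x t) z) ((%(x, t). l0 (x, t)) z) < e"
   by (simp only: good_def)
 qed
 thus ?thesis using l0 uniq[OF _ l0] by (intro exI[of _ "%x t. l0 (x, t)"]) blast
qed

end
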